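(* Let $\mathcal{A}(\tau_n)$ be the normalized Laurent phenomenon algebra generated by the initial seed $\tau_n$, which has cluster variables $X_1,\dots,X_n$ and exchange polynomials $F_i=A_i+\prod_{j\in[n],\,j\ne i}X_j$ for $i\in[n]$. The seeds in $\mathcal{A}(\tau_n)$ are in bijection with activation sequences $\vec s\subset[n]$ (ordered subsets of $[n]$, including the empty one). Specifically, there are exactly $2^n+n-1$ cluster variables in $\mathcal{A}(\tau_n)$, and there are exactly $\sum_{k=0}^{n}n!/k!$ seeds in $\mathcal{A}(\tau_n)$.
   Context: Setting. $n$ is a positive integer and $[n]=\{1,\dots,n\}$; $R$ is a coefficient ring with unique factorization over $\mathbb{Z}$; $A_1,\dots,A_n\in R$ are the coefficients appearing in the exchange polynomials of $\tau_n$; $\mathcal{F}$ is the field of rational functions in $n$ independent variables over $\mathrm{Frac}(R)$. Seeds. A seed of rank $n$ in $\mathcal{F}$ is a pair $(\mathbf{X},\mathbf{F})$ with $\mathbf{X}=\{X_1,\dots,X_n\}$ a transcendence basis of $\mathcal{F}$ (the cluster; its elements are the cluster variables) and $\mathbf{F}=\{F_1,\dots,F_n\}\subset R[X_1,\dots,X_n]$ (the exchange polynomials, $F_i$ attached to $X_i$) such that each $F_i$ is irreducible in $R[X_1,\dots,X_n]$, is not divisible by any $X_j$, and does not involve $X_i$. These sets are regarded as unordered; the indexing is only for convenience. For a seed, $\hat F_i$ denotes the unique Laurent polynomial $\hat F_i=\big(\prod_{j\ne i}X_j^{a_j}\big)F_i$ with integers $a_j\le 0$ such that for every $j\neq i$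 the expression $\hat F_i|_{X_j\leftarrow F_j/X}$ lies in $R[X_1^{\pm1},\dots,X_{j-1}^{\pm1},X^{\pm1},X_{j+1}^{\pm1},\dots,X_n^{\pm1}]$ and is not divisible by $F_j$ in that ring. Mutation. The mutation $\mu_i$ of $(\mathbf{X},\mathbf{F})$ at $i$ is the seed $(\mathbf{X}',\mathbf{F}')$ with $X'_j=X_j$ for $j\ne i$, $X'_i=\hat F_i/X_i$, and: $F'_j=F_j$ if $F_j$ does not depend on $X_i$; otherwise put $G_j=F_j|_{X_i\leftarrow (\hat F_i|_{X_j\leftarrow 0})/X'_i}$, let $H_j$ be $G_j$ with all common factors in $R[X_1,\dots,\widehat{X_i},\dots,\widehat{X_j},\dots,X_n]$ (hats mean omission) with $\hat F_i|_{X_j\leftarrow 0}$ divided out, and $F'_j=MH_j$, where $M$ is the Laurent monomial in the new cluster variables other than $X_j'$ making $F'_j$ a polynomial not divisible by any cluster variable. This defines $F'_j$ up to a unit of $R$. Algebra. Two seeds $(\mathbf X,\mathbf F)$ and $(\mathbf X',\mathbf F')$ are equivalent if $X_i/X'_i$ and $F_i/F'_i$ are units in $R$ for each $i\in[n]$ (the exchange polynomials being viewed in $\mathcal F$). The Laurent phenomenon algebra $\mathcal{A}(\tau_n)$ consists of the collection of all seeds obtainable from $\tau_n$ by finite sequences of mutations, together with the subring of $\mathcal{F}$ generated over $R$ by all their cluster variables; it is normalized if equivalent seeds are equal. An activation sequence $\vec s=(s_1,\dots,s_k)$, $0\le k\le n$, is an ordered subset of $[n]$ (its entries are distinct). *)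

theory Defs
  imports
    "HOL-Library.Cardinality"
    "HOL-Library.Poly_Mapping"
    "HOL-Computational_Algebra.Computational_Algebra"
begin

text \<open>
  The index set \<open>[n]\<close> is a finite type \<open>'n\<close>, so \<open>n = CARD('n)\<close>. Its linear order plays no
  mathematical role; the library needs it to see that a polynomial ring over a domain is a domain.
\<close>

type_synonym ('n, 'r) mpoly = "('n \<Rightarrow>\<^sub>0 nat) \<Rightarrow>\<^sub>0 'r"

type_synonym ('n, 'r) ratfun = "('n, 'r) mpoly fract"

definition mconst :: "'r::zero \<Rightarrow> ('n, 'r) mpoly" where
  "mconst c = Poly_Mapping.single 0 c"

definition mvar :: "'n \<Rightarrow> ('n, 'r::zero_neq_one) mpoly" where
  "mvar i = Poly_Mapping.single (Poly_Mapping.single i 1) 1"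

definition mvars :: "('n, 'r::zero) mpoly \<Rightarrow> 'n set" where
  "mvars p = (\<Union>m\<in>Poly_Mapping.keys p. Poly_Mapping.keys m)"

definition emb :: "'r::idom \<Rightarrow> ('n::{finite,linorder}, 'r) ratfun" where
  "emb c = Fract (mconst c) 1"

text \<open>The substitution \<open>x\<^sub>i \<mapsto> X i\<close>, with values in the ambient field.\<close>

definition peval ::
  "('n::{finite,linorder} \<Rightarrow> ('n, 'r::idom) ratfun) \<Rightarrow> ('n, 'r) mpoly \<Rightarrow> ('n, 'r) ratfun" where
  "peval X p = (\<Sum>m\<in>Poly_Mapping.keys p.
     emb (Poly_Mapping.lookup p m) * (\<Prod>i\<in>UNIV. X i ^ Poly_Mapping.lookup m i))"

definition lmonom ::
  "('n::{finite,linorder} \<Rightarrow> ('n, 'r::idom) ratfun) \<Rightarrow> 'n set \<Rightarrow> ('n \<Rightarrow> int) \<Rightarrow> ('n, 'r) ratfun" where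
  "lmonom X K a = (\<Prod>k\<in>K. X k powi a k)"

definition poly_ring ::
  "('n::{finite,linorder} \<Rightarrow> ('n, 'r::idom) ratfun) \<Rightarrow> 'n set \<Rightarrow> ('n, 'r) ratfun set" where
  "poly_ring X K = {peval X p | p. mvars p \<subseteq> K}"

definition laurent_ring ::
  "('n::{finite,linorder} \<Rightarrow> ('n, 'r::idom) ratfun) \<Rightarrow> ('n, 'r) ratfun set" where
  "laurent_ring X = {lmonom X UNIV a * peval X p | a p. True}"

definition dvd_in :: "'a::comm_ring_1 set \<Rightarrow> 'a \<Rightarrow> 'a \<Rightarrow> bool" where
  "dvd_in S a b \<longleftrightarrow> (\<exists>c\<in>S. b = a * c)"

text \<open>
  Clearing denominators, algebraic independence over \<open>Frac R\<close> is algebraic independence over \<open>R\<close>.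
  A transcendence basis need not generate the field: the field only has to be
  algebraic over \<open>Frac(R)(X)\<close>.
\<close>

definition transcendence_basis ::
  "('n::{finite,linorder} \<Rightarrow> ('n, 'r::idom) ratfun) \<Rightarrow> bool" where
  "transcendence_basis X \<longleftrightarrow>
     (\<forall>p. peval X p = 0 \<longrightarrow> p = 0) \<and>
     (\<forall>f. \<exists>q. q \<noteq> 0 \<and> poly q f = 0 \<and>
        (\<forall>k. coeff q k \<in> {a / b | a b. a \<in> poly_ring X UNIV \<and> b \<in> poly_ring X UNIV \<and> b \<noteq> 0}))"

text \<open>
  In a labelled seed the exchange polynomials are formal, the variable \<open>mvar i\<close> standing for the
  \<open>i\<close>-th cluster variable. Forgetting the labels leaves the set of pairs (cluster variable,
  attached exchange polynomial) in the ambient field.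
\<close>

type_synonym ('n, 'r) labelled_seed = "('n \<Rightarrow> ('n, 'r) ratfun) \<times> ('n \<Rightarrow> ('n, 'r) mpoly)"

type_synonym ('n, 'r) seed = "(('n, 'r) ratfun \<times> ('n, 'r) ratfun) set"

definition is_seed :: "('n::{finite,linorder}, 'r::idom) labelled_seed \<Rightarrow> bool" where
  "is_seed t \<longleftrightarrow> (case t of (X, F) \<Rightarrow> transcendence_basis X \<and>
     (\<forall>i. irreducible (F i) \<and> (\<forall>j. \<not> mvar j dvd F i) \<and> i \<notin> mvars (F i)))"

definition unlabel ::
  "('n::{finite,linorder}, 'r::idom) labelled_seed \<Rightarrow> ('n, 'r) seed" where
  "unlabel t = (case t of (X, F) \<Rightarrow> {(X i, peval X (F i)) | i. True})"

text \<open>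
  The Laurent polynomial \<open>(\<Prod>j\<noteq>i. x\<^sub>j\<^bsup>a j\<^esup>) * F i\<close>, evaluated at \<open>Y\<close>. Substitutions into
  \<open>F i\<close>-hat are evaluations at a modified family \<open>Y\<close>.
\<close>

definition hat_at ::
  "('n::{finite,linorder} \<Rightarrow> ('n, 'r::idom) mpoly) \<Rightarrow> 'n \<Rightarrow> ('n \<Rightarrow> int) \<Rightarrow>
     ('n \<Rightarrow> ('n, 'r) ratfun) \<Rightarrow> ('n, 'r) ratfun" where
  "hat_at F i a Y = lmonom Y (UNIV - {i}) a * peval Y (F i)"

text \<open>
  In the substitution \<open>X\<^sub>j \<leftarrow> F\<^sub>j / X\<close> the new variable \<open>X\<close> takes the place of \<open>X\<^sub>j\<close>, which does not
  occur in \<open>F\<^sub>j\<close>; it is again written \<open>X j\<close> below.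
\<close>

definition is_hat_exponent ::
  "('n::{finite,linorder}, 'r::idom) labelled_seed \<Rightarrow> 'n \<Rightarrow> ('n \<Rightarrow> int) \<Rightarrow> bool" where
  "is_hat_exponent t i a \<longleftrightarrow> (case t of (X, F) \<Rightarrow>
     \<forall>j. j \<noteq> i \<longrightarrow> a j \<le> 0 \<and>
       (let E = hat_at F i a (X(j := peval X (F j) / X j)) in
          E \<in> laurent_ring X \<and> \<not> dvd_in (laurent_ring X) (peval X (F j)) E))"

text \<open>
  \<open>H\<close> is \<open>G\<close> with all common factors with \<open>P\<close> divided out: the quotient \<open>D = G / H\<close> is built from
  factors of \<open>P\<close> (it divides a power of \<open>P\<close>), and \<open>H\<close> and \<open>P\<close> have no common factor left. Factors
  are taken in the polynomial ring in the \<open>X k\<close> with \<open>k \<noteq> i, j\<close>; \<open>P\<close> and \<open>G\<close> are Laurent, so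
  divisibility is tested in the Laurent polynomial ring, where monomials are units. The
  resulting monomial ambiguity of \<open>H\<close> is removed by the monomial \<open>M\<close> in
  \<open>is_mutation\<close> below. The family \<open>X'\<close> is the new cluster, which agrees with the old one
  away from \<open>i\<close>.
\<close>

definition common_factors_removed ::
  "('n::{finite,linorder} \<Rightarrow> ('n, 'r::idom) ratfun) \<Rightarrow> 'n \<Rightarrow> 'n \<Rightarrow>
     ('n, 'r) ratfun \<Rightarrow> ('n, 'r) ratfun \<Rightarrow> ('n, 'r) ratfun \<Rightarrow> bool" where
  "common_factors_removed X' i j P G H \<longleftrightarrow> H \<in> laurent_ring X' \<and>
     (\<exists>D\<in>poly_ring X' (UNIV - {i, j}). G = D * H \<and> (\<exists>m. dvd_in (laurent_ring X') D (P ^ m))) \<and>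
     (\<forall>Q\<in>poly_ring X' (UNIV - {i, j}).
        dvd_in (laurent_ring X') Q H \<and> dvd_in (laurent_ring X') Q P \<longrightarrow>
        dvd_in (laurent_ring X') Q 1)"

text \<open>
  If \<open>F j\<close> involves \<open>X i\<close> then the exponent \<open>a j\<close> is \<open>0\<close>, so that evaluating at \<open>X(j := 0)\<close>
  is the substitution \<open>X\<^sub>j \<leftarrow> 0\<close>. The polynomial \<open>F' j\<close> is only determined up to a unit of \<open>R\<close>,
  so mutation is a relation.
\<close>

definition is_mutation ::
  "'n \<Rightarrow> ('n::{finite,linorder}, 'r::idom) labelled_seed \<Rightarrow> ('n, 'r) labelled_seed \<Rightarrow> bool" where
  "is_mutation i t t' \<longleftrightarrow> is_seed t \<and> is_seed t' \<and> (case (t, t') of ((X, F), (X', F')) \<Rightarrow>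
     (\<exists>a. is_hat_exponent (X, F) i a \<and>
        X' = X(i := hat_at F i a X / X i) \<and>
        (\<forall>j. if i \<notin> mvars (F j) then F' j = F j
             else (let P = hat_at F i a (X(j := 0));
                       G = peval (X(i := P / X' i)) (F j)
                   in \<exists>H b. common_factors_removed X' i j P G H \<and>
                        peval X' (F' j) = lmonom X' (UNIV - {j}) b * H \<and>
                        (\<forall>k. \<not> mvar k dvd F' j)))))"

definition mutates_to ::
  "('n::{finite,linorder}, 'r::idom) seed \<Rightarrow> ('n, 'r) seed \<Rightarrow> bool" where
  "mutates_to s s' \<longleftrightarrow> (\<exists>i t t'. is_mutation i t t' \<and> s = unlabel t \<and> s' = unlabel t')"

text \<open>Clusters being unordered, equivalence of seeds is taken up to a matching of the indices.\<close>

definition unit_multiple ::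
  "('n::{finite,linorder}, 'r::idom) ratfun \<Rightarrow> ('n, 'r) ratfun \<Rightarrow> bool" where
  "unit_multiple f g \<longleftrightarrow> (\<exists>u. u dvd 1 \<and> f / g = emb u)"

definition seed_equiv ::
  "('n::{finite,linorder}, 'r::idom) seed \<Rightarrow> ('n, 'r) seed \<Rightarrow> bool" where
  "seed_equiv s s' \<longleftrightarrow> (\<exists>\<phi>. bij_betw \<phi> s s' \<and>
     (\<forall>v\<in>s. unit_multiple (fst v) (fst (\<phi> v)) \<and> unit_multiple (snd v) (snd (\<phi> v))))"

definition cluster_variables ::
  "('n::{finite,linorder}, 'r::idom) seed set \<Rightarrow> ('n, 'r) ratfun set" where
  "cluster_variables \<S> = (\<Union>s\<in>\<S>. fst ` s)"

inductive_set generated_subring ::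
  "('n::{finite,linorder}, 'r::idom) ratfun set \<Rightarrow> ('n, 'r) ratfun set" for V where
  const: "emb c \<in> generated_subring V"
| gen: "v \<in> V \<Longrightarrow> v \<in> generated_subring V"
| add: "f \<in> generated_subring V \<Longrightarrow> g \<in> generated_subring V \<Longrightarrow> f + g \<in> generated_subring V"
| mult: "f \<in> generated_subring V \<Longrightarrow> g \<in> generated_subring V \<Longrightarrow> f * g \<in> generated_subring V"

text \<open>
  As mutation involves a choice of units, the seeds of a Laurent phenomenon algebra generated by
  \<open>\<tau>\<close> are a collection \<open>\<S>\<close> that contains a mutation of each of its members at each
  index, and all of whose members are reached from \<open>\<tau>\<close> by mutations within \<open>\<S>\<close>.
\<close>

definition lp_algebra ::
  "('n::{finite,linorder}, 'r::idom) labelled_seed \<Rightarrow> ('n, 'r) seed set \<Rightarrow>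
     ('n, 'r) ratfun set \<Rightarrow> bool" where
  "lp_algebra \<tau> \<S> \<A> \<longleftrightarrow> is_seed \<tau> \<and> unlabel \<tau> \<in> \<S> \<and>
     (\<forall>t i. is_seed t \<and> unlabel t \<in> \<S> \<longrightarrow> (\<exists>t'. is_mutation i t t' \<and> unlabel t' \<in> \<S>)) \<and>
     (\<forall>s\<in>\<S>. (\<lambda>s s'. s' \<in> \<S> \<and> mutates_to s s')\<^sup>*\<^sup>* (unlabel \<tau>) s) \<and>
     \<A> = generated_subring (cluster_variables \<S>)"

definition normalized_lp_algebra ::
  "('n::{finite,linorder}, 'r::idom) labelled_seed \<Rightarrow> ('n, 'r) seed set \<Rightarrow>
     ('n, 'r) ratfun set \<Rightarrow> bool" where
  "normalized_lp_algebra \<tau> \<S> \<A> \<longleftrightarrow> lp_algebra \<tau> \<S> \<A> \<and>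
     (\<forall>s\<in>\<S>. \<forall>s'\<in>\<S>. seed_equiv s s' \<longrightarrow> s = s')"

definition tau_poly :: "('n::finite \<Rightarrow> 'r::comm_ring_1) \<Rightarrow> 'n \<Rightarrow> ('n, 'r) mpoly" where
  "tau_poly A i = mconst (A i) + (\<Prod>j\<in>UNIV - {i}. mvar j)"

definition activation_sequences :: "'n list set" where
  "activation_sequences = {s. distinct s}"

end

theory Submission
  imports Defs "HOL-Combinatorics.Transposition"
begin

text \<open>
  For \<open>S \<subseteq> [n]\<close> let \<open>Y\<^sub>S\<close> be the Laurent polynomial obtained from \<open>1\<close> by adjoining the elements of \<open>S\<close>
  one at a time with \<open>x\<^sub>k Y\<^bsub>S + k\<^esub> = A\<^sub>k Y\<^sub>S + (\<Prod>i\<in>S. A\<^sub>i) (\<Prod>j\<notin>S + k. x\<^sub>j)\<close>; it does not depend on the order.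
  Up to constants, the cluster of an activation sequence \<open>(s\<^sub>1, \<dots>, s\<^sub>k)\<close> consists of the initial
  variables \<open>x\<^sub>q\<close> with \<open>q\<close> not active and of the \<open>Y\<^sub>S\<close> for the nonempty initial segments \<open>S\<close>.
  Mutation at an inactive index appends it, mutation at the last active index removes it, and
  mutation at \<open>s\<^sub>l\<close> with \<open>l < k\<close> interchanges \<open>s\<^sub>l\<close> and \<open>s\<^bsub>l+1\<^esub>\<close> by the exchange relation
  \<open>Y\<^bsub>S + a\<^esub> Y\<^bsub>S + b\<^esub> = Y\<^sub>S Y\<^bsub>S + a + b\<^esub> + (\<Prod>i\<in>S. A\<^sub>i)\<^sup>2 (\<Prod>j\<notin>S + a + b. x\<^sub>j)\<^sup>2\<close>.

  The constants need not be computed: all cluster variables are quotients of primitive polynomials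
  in the initial ones, and a constant of this kind is a unit of \<open>R\<close>, so the seed of a given sequence
  is unique in a normalized algebra. Every seed is reached from the initial one by activations, for
  which the exponents of the exchange Laurent polynomials vanish. For the other mutations, the new
  exchange polynomials are identified with those of a seed reached by activations, which are prime
  and divide the expression they are extracted from.

  A mutation keeps all other variables unchanged, and the seeds with a variable proportional to
  \<open>Y\<^sub>S\<close> are connected by mutations at other indices, so proportional cluster variables are equal.
  For \<open>n = 1\<close> the exchange polynomial is a constant and the two seeds are found directly.
\<close>

section \<open>Multivariate polynomials\<close>

text \<open>Two obstacles shape the proof. Mutation fixes its exponents and removed factors only by
  divisibility conditions, so it cannot simply be computed. For an activation it can: whatever is
  removed divides a monomial up to a constant, so the primality of no new polynomial has to be
  known. Closure of the algebra under mutation then supplies one seed for every activation sequence,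
  and these serve as references. In any other mutation a reference seed is moved onto the new
  cluster; its exchange polynomials are irreducible because it is a seed, hence prime, and each must
  divide the new one. The exponents can be nonzero only at active indices at least two places behind
  the mutated one; there they are read off in the adjacent seed, again a reference seed.

  The second obstacle is labels. Mutation leaves them in place, so a new variable sits at the old
  index. Interchanging two neighbours is therefore expressed by keeping the list and permuting the
  initial variables and constants, which is why these are parameters throughout.\<close>

lemma mconst_0 [simp]: "mconst 0 = 0"
  and mconst_1 [simp]: "mconst 1 = 1"
  and mconst_add: "mconst (a + b) = mconst a + mconst b"
  and mconst_mult: "mconst (c * d) = mconst c * mconst (d::'r::semiring_0)"
  by (simp_all add: mconst_def single_add mult_single)

lemma mconst_eq_iff [simp]: "mconst a = mconst b \<longleftrightarrow> a = b"
  unfolding mconst_def by (metis lookup_single_eq)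

lemma mconst_eq_0_iff [simp]: "mconst a = 0 \<longleftrightarrow> a = 0"
  by (metis mconst_eq_iff mconst_0)

lemma mvars_0 [simp]: "mvars 0 = {}"
  and mvars_mconst [simp]: "mvars (mconst c) = {}"
  and mvars_mvar [simp]: "mvars (mvar i :: ('n, 'r::zero_neq_one) mpoly) = {i}"
  by (auto simp: mvars_def mconst_def mvar_def)

lemma mvars_1 [simp]: "mvars (1 :: ('n, 'r::semiring_1) mpoly) = {}"
  by (metis mconst_1 mvars_mconst)

lemma mvars_add: "mvars (p + q) \<subseteq> mvars p \<union> mvars q"
  unfolding mvars_def using keys_add by fastforce

lemma mvars_mult_subset:
  fixes p q :: "('n, 'r::comm_semiring_1) mpoly"
  shows "mvars (p * q) \<subseteq> mvars p \<union> mvars q"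
proof
  fix i assume "i \<in> mvars (p * q)"
  then obtain a b where ab: "a \<in> Poly_Mapping.keys p" "b \<in> Poly_Mapping.keys q" "i \<in> Poly_Mapping.keys (a + b)"
    unfolding mvars_def using keys_mult[of p q] by blast
  then have "i \<in> Poly_Mapping.keys a \<union> Poly_Mapping.keys b" using keys_add[of a b] by blast
  with ab show "i \<in> mvars p \<union> mvars q" by (auto simp: mvars_def)
qed

lemma mvars_uminus [simp]: "mvars (- p :: ('n, 'r::ab_group_add) mpoly) = mvars p"
  by (auto simp: mvars_def in_keys_iff)

lemma mvars_diff: "mvars (p - q :: ('n, 'r::ab_group_add) mpoly) \<subseteq> mvars p \<union> mvars q"
  using mvars_add[of p "- q"] by simp

lemma mvars_subsetI:
  fixes p q :: "('n, 'r::comm_ring_1) mpoly"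
  assumes "mvars p \<subseteq> K" "mvars q \<subseteq> K"
  shows "mvars (p + q) \<subseteq> K" "mvars (p - q) \<subseteq> K" "mvars (p * q) \<subseteq> K"
  using mvars_add[of p q] mvars_diff[of p q] mvars_mult_subset[of p q] assms by blast+

lemma mpoly_single_induct [case_names zero add]:
  fixes p :: "('n, 'r::comm_semiring_1) mpoly"
  assumes "P 0" "\<And>m c q. c \<noteq> 0 \<Longrightarrow> m \<notin> Poly_Mapping.keys q \<Longrightarrow> P q \<Longrightarrow> P (Poly_Mapping.single m c + q)"
  shows "P p"
proof (induction p rule: update_induct)
  case const
  show ?case using assms(1) by simp
next
  case (update q m c)
  have "Poly_Mapping.update m c q = Poly_Mapping.single m c + q"
    using update(1) by (auto intro!: poly_mapping_eqI simp: lookup_update lookup_add lookup_single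
        when_def in_keys_iff)
  then show ?case using assms(2)[OF _ update(1)] update by simp
qed

lemma single_monom_induct:
  fixes m :: "'n \<Rightarrow>\<^sub>0 nat"
  assumes "P 0" "\<And>m i. i \<in> K \<Longrightarrow> P m \<Longrightarrow> P (Poly_Mapping.single i 1 + m)" "Poly_Mapping.keys m \<subseteq> K"
  shows "P m"
  using assms(3)
proof (induction "\<Sum>i\<in>Poly_Mapping.keys m. Poly_Mapping.lookup m i" arbitrary: m)
  case 0
  then have "m = 0" by (auto intro!: poly_mapping_eqI simp: in_keys_iff)
  with assms(1) show ?case by simp
next
  case (Suc n)
  then have "Poly_Mapping.keys m \<noteq> {}" by auto
  then obtain i where i: "i \<in> Poly_Mapping.keys m" by blast
  define m' where "m' = m - Poly_Mapping.single i 1"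
  have m: "m = Poly_Mapping.single i 1 + m'"
    using i by (auto intro!: poly_mapping_eqI
        simp: m'_def lookup_add lookup_minus lookup_single when_def in_keys_iff)
  have k: "Poly_Mapping.keys m' \<subseteq> Poly_Mapping.keys m"
    by (auto simp: m'_def in_keys_iff lookup_minus)
  have "(\<Sum>j\<in>Poly_Mapping.keys m. Poly_Mapping.lookup m j) = Suc (\<Sum>j\<in>Poly_Mapping.keys m. Poly_Mapping.lookup m' j)"
    using i by (subst (1) m) (simp add: lookup_add sum.distrib lookup_single when_def sum.delta)
  moreover have "(\<Sum>j\<in>Poly_Mapping.keys m. Poly_Mapping.lookup m' j) = (\<Sum>j\<in>Poly_Mapping.keys m'. Poly_Mapping.lookup m' j)"
    by (rule sum.mono_neutral_right) (use k in \<open>auto simp: in_keys_iff\<close>)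
  ultimately have "P m'" using Suc k by auto
  then show ?case using m assms(2)[of i m'] i Suc.prems by auto
qed

text \<open>Tracking a variable set \<open>K\<close> lets one rule serve the full ring and the
  subrings of polynomials in fewer variables, down to the constants at
  \<open>K = {}\<close>.\<close>

lemma mpoly_induct [case_names const add var]:
  fixes p :: "('n, 'r::comm_semiring_1) mpoly"
  assumes "mvars p \<subseteq> K"
    and const: "\<And>c. P (mconst c)"
    and add: "\<And>p q. P p \<Longrightarrow> P q \<Longrightarrow> P (p + q)"
    and var: "\<And>p i. i \<in> K \<Longrightarrow> P p \<Longrightarrow> P (mvar i * p)"
  shows "P p"
  using assms(1)
proof (induction p rule: mpoly_single_induct)
  case zero
  then show ?case using const[of 0] by simp
next
  case (add m c q)
  have "Poly_Mapping.keys (Poly_Mapping.single m c + q) = insert m (Poly_Mapping.keys q)"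
    using add by (auto simp: in_keys_iff lookup_add lookup_single when_def split: if_splits)
  then have m: "Poly_Mapping.keys m \<subseteq> K" and q: "mvars q \<subseteq> K"
    using add(4) by (auto simp: mvars_def)
  have "P (Poly_Mapping.single m c)"
  proof (rule single_monom_induct[where m = m and K = K])
    show "P (Poly_Mapping.single 0 c)" using const[of c] by (simp add: mconst_def)
  next
    fix m i assume "i \<in> K" "P (Poly_Mapping.single m c)"
    from var[OF this] show "P (Poly_Mapping.single (Poly_Mapping.single i 1 + m) c)"
      by (simp add: mvar_def mult_single)
  qed (rule m)
  then show ?case using assms(3) add(3) q by blast
qed

section \<open>Evaluation along a homomorphism of coefficients\<close>

locale coeff_hom =
  fixes e :: "'r::comm_semiring_1 \<Rightarrow> 'c::comm_semiring_1"
  assumes hom_0 [simp]: "e 0 = 0" and hom_1 [simp]: "e 1 = 1"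
    and hom_add: "e (a + b) = e a + e b" and hom_mult: "e (a * b) = e a * e b"
begin

definition mev :: "('n::finite \<Rightarrow> 'c) \<Rightarrow> ('n, 'r) mpoly \<Rightarrow> 'c" where
  "mev X p = (\<Sum>m\<in>Poly_Mapping.keys p. e (Poly_Mapping.lookup p m) * (\<Prod>i\<in>UNIV. X i ^ Poly_Mapping.lookup m i))"

lemma mev_superset:
  "finite S \<Longrightarrow> Poly_Mapping.keys p \<subseteq> S \<Longrightarrow> mev X p = (\<Sum>m\<in>S. e (Poly_Mapping.lookup p m) * (\<Prod>i\<in>UNIV. X i ^ Poly_Mapping.lookup m i))"
  unfolding mev_def by (rule sum.mono_neutral_left) (auto simp: in_keys_iff)

lemma mev_add: "mev X (p + q) = mev X p + mev X q"
proof -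
  let ?S = "Poly_Mapping.keys p \<union> Poly_Mapping.keys q"
  show ?thesis
    using keys_add[of p q]
    by (simp add: mev_superset[of ?S] lookup_add hom_add distrib_right sum.distrib)
qed

lemma mev_single: "mev X (Poly_Mapping.single m c) = e c * (\<Prod>i\<in>UNIV. X i ^ Poly_Mapping.lookup m i)"
  by (subst mev_superset[of "{m}"]) auto

lemma mev_0 [simp]: "mev X 0 = 0"
  by (simp add: mev_def)

lemma mev_mconst [simp]: "mev X (mconst c) = e c"
  by (simp add: mconst_def mev_single)

lemma mev_1 [simp]: "mev X 1 = 1"
  using mev_mconst[of X 1] by simp

lemma mev_mvar [simp]: "mev X (mvar i) = X i"
proof -
  have "(\<Prod>j\<in>UNIV. X j ^ (if i = j then Suc 0 else 0)) = X i"
    by (simp add: if_distrib[of "\<lambda>n. _ ^ n"] prod.delta' cong: if_cong)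
  then show ?thesis by (simp add: mvar_def mev_single lookup_single when_def)
qed

lemma mev_mult: "mev X (p * q) = mev X p * mev X q"
proof (induction p rule: mpoly_single_induct)
  case (add m c p)
  have "mev X (Poly_Mapping.single m c * q) = mev X (Poly_Mapping.single m c) * mev X q"
  proof (induction q rule: mpoly_single_induct)
    case (add m' c' q)
    then show ?case
      by (simp add: distrib_left mev_add mult_single mev_single lookup_add power_add prod.distrib
          hom_mult mult_ac)
  qed simp
  with add show ?case by (simp add: distrib_right mev_add)
qed simp

lemma mev_power: "mev X (p ^ k) = mev X p ^ k"
  by (induction k) (simp_all add: mev_mult)

lemma mev_prod: "mev X (\<Prod>a\<in>S. f a) = (\<Prod>a\<in>S. mev X (f a))"
  by (induction S rule: infinite_finite_induct) (simp_all add: mev_mult)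

lemma mev_sum: "mev X (\<Sum>a\<in>S. f a) = (\<Sum>a\<in>S. mev X (f a))"
  by (induction S rule: infinite_finite_induct) (simp_all add: mev_add)

lemma mev_cong:
  assumes "\<And>i. i \<in> mvars p \<Longrightarrow> X i = Y i"
  shows "mev X p = mev Y p"
proof -
  have "(\<Prod>i\<in>UNIV. X i ^ Poly_Mapping.lookup m i) = (\<Prod>i\<in>UNIV. Y i ^ Poly_Mapping.lookup m i)" if "m \<in> Poly_Mapping.keys p" for m
  proof (rule prod.cong[OF refl])
    fix i show "X i ^ Poly_Mapping.lookup m i = Y i ^ Poly_Mapping.lookup m i"
    proof (cases "i \<in> Poly_Mapping.keys m")
      case True
      then have "i \<in> mvars p" using that unfolding mvars_def by blast
      then show ?thesis using assms by simp
    qed (simp add: in_keys_iff)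
  qed
  then show ?thesis by (simp add: mev_def)
qed

end

text \<open>Evaluation is used with two targets: here univariate polynomials, which isolate one
  variable, and later, as \<open>ev\<close>, the ambient field.\<close>

global_interpretation univ: coeff_hom "\<lambda>c :: 'r::comm_ring_1. [:mconst c :: ('n, 'r) mpoly:]"
  by unfold_locales (simp_all add: mconst_add mconst_mult mult.commute)

text \<open>The expansion in powers of the variable \<open>z\<close>. The coefficients stay in the
  full polynomial ring; that they do not contain \<open>z\<close> is
  \<open>mvars_coeff_in_var\<close>.\<close>

definition in_var :: "'n::finite \<Rightarrow> ('n, 'r::comm_ring_1) mpoly \<Rightarrow> ('n, 'r) mpoly poly" where
  "in_var z = univ.mev (\<lambda>k. if k = z then [:0, 1:] else [:mvar k:])"

lemma in_var_simps [simp]: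
  "in_var z 0 = 0" "in_var z 1 = 1" "in_var z (mconst c) = [:mconst c:]"
  "in_var z (mvar k) = (if k = z then [:0, 1:] else [:mvar k:])"
  "in_var z (p + q) = in_var z p + in_var z q" "in_var z (p * q) = in_var z p * in_var z q"
  by (simp_all add: in_var_def univ.mev_add univ.mev_mult)

lemma in_var_uminus [simp]: "in_var z (- p) = - in_var z p"
  using in_var_simps(5)[of z p "- p"] by (simp add: eq_neg_iff_add_eq_0 add.commute)

lemma in_var_diff [simp]: "in_var z (p - q) = in_var z p - in_var z q"
  using in_var_simps(5)[of z p "- q"] by simp

lemma poly_in_var [simp]: "poly (in_var z p) (mvar z) = p"
  by (rule mpoly_induct[of p UNIV]) auto

lemma in_var_inject: "in_var z p = in_var z q \<Longrightarrow> p = q"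
  by (metis poly_in_var)

lemma in_var_eq_0_iff [simp]: "in_var z p = 0 \<longleftrightarrow> p = 0"
  using in_var_inject[of z p 0] by auto

lemma mvars_coeff_in_var:
  fixes p :: "('n::finite, 'r::comm_ring_1) mpoly"
  shows "mvars (coeff (in_var z p) n) \<subseteq> mvars p - {z}"
proof -
  define V where "V = mvars p"
  have "\<forall>n. mvars (coeff (in_var z p) n) \<subseteq> V - {z}"
  proof (rule mpoly_induct[of p V])
    fix f g :: "('n, 'r) mpoly"
    assume "\<forall>n. mvars (coeff (in_var z f) n) \<subseteq> V - {z}"
      "\<forall>n. mvars (coeff (in_var z g) n) \<subseteq> V - {z}"
    then show "\<forall>n. mvars (coeff (in_var z (f + g)) n) \<subseteq> V - {z}"
      using mvars_add[of "coeff (in_var z f) _" "coeff (in_var z g) _"]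
      unfolding in_var_simps coeff_add by (meson Un_least order_trans)
  next
    fix f :: "('n, 'r) mpoly" and i
    assume i: "i \<in> V" and IH: "\<forall>n. mvars (coeff (in_var z f) n) \<subseteq> V - {z}"
    show "\<forall>n. mvars (coeff (in_var z (mvar i * f)) n) \<subseteq> V - {z}"
    proof
      fix n
      show "mvars (coeff (in_var z (mvar i * f)) n) \<subseteq> V - {z}"
      proof (cases "i = z")
        case True
        then show ?thesis using IH by (cases n) auto
      next
        case False
        then show ?thesis
          using i IH[rule_format, of n] mvars_mult_subset[of "mvar i" "coeff (in_var z f) n"]
          by auto
      qed
    qed
  qed (auto simp: V_def coeff_pCons split: nat.splits)
  then show ?thesis by (simp add: V_def)
qed

lemma in_var_free:
  fixes p :: "('n::finite, 'r::comm_ring_1) mpoly"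
  assumes z: "z \<notin> mvars p"
  shows "in_var z p = [:p:]"
proof -
  have "degree (in_var z p) = 0"
  proof (rule mpoly_induct[of p "mvars p"])
    fix f g :: "('n, 'r) mpoly"
    assume "degree (in_var z f) = 0" "degree (in_var z g) = 0"
    then show "degree (in_var z (f + g)) = 0"
      using degree_add_le[of "in_var z f" 0 "in_var z g"] by simp
  next
    fix f :: "('n, 'r) mpoly" and i
    assume "i \<in> mvars p" "degree (in_var z f) = 0"
    then show "degree (in_var z (mvar i * f)) = 0"
      using z degree_smult_le[of "mvar i" "in_var z f"] by (cases "i = z") auto
  qed simp_all
  then obtain c where c: "in_var z p = [:c:]" by (auto elim: degree_eq_zeroE)
  then have "p = c" using poly_in_var[of z p] by simp
  with c show ?thesis by simp
qed

lemma degree_in_var_eq_0_iff: "degree (in_var z p) = 0 \<longleftrightarrow> z \<notin> mvars p"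
proof
  assume "degree (in_var z p) = 0"
  then obtain c where c: "in_var z p = [:c:]" by (auto elim: degree_eq_zeroE)
  then have "p = c" using poly_in_var[of z p] by simp
  with c mvars_coeff_in_var[of z p 0] show "z \<notin> mvars p" by auto
qed (simp add: in_var_free)

text \<open>Over a domain the degree in each single variable is additive, so no variable can cancel
  from a product.\<close>

lemma mvars_mult:
  fixes p q :: "('n::{finite,linorder}, 'r::idom) mpoly"
  assumes "p \<noteq> 0" "q \<noteq> 0"
  shows "mvars (p * q) = mvars p \<union> mvars q"
proof -
  have "z \<in> mvars (p * q) \<longleftrightarrow> z \<in> mvars p \<or> z \<in> mvars q" for z
    using assms degree_in_var_eq_0_iff[of z p] degree_in_var_eq_0_iff[of z q]
      degree_in_var_eq_0_iff[of z "p * q"] by (auto simp: degree_mult_eq)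
  then show ?thesis by blast
qed

lemma mvars_dvd:
  fixes p q :: "('n::{finite,linorder}, 'r::idom) mpoly"
  shows "p dvd q \<Longrightarrow> q \<noteq> 0 \<Longrightarrow> mvars p \<subseteq> mvars q"
  by (elim dvdE) (auto simp: mvars_mult)

lemma mvars_empty:
  fixes p :: "('n::finite, 'r::comm_ring_1) mpoly"
  shows "mvars p = {} \<Longrightarrow> \<exists>c. p = mconst c"
  by (rule mpoly_induct[of p "{}"]) (auto simp flip: mconst_add)

text \<open>\<open>p0\<close> is the constant coefficient of \<open>p\<close> in \<open>z\<close>,
  that is \<open>p\<close> with \<open>z\<close> set to 0; \<open>p1\<close> may still contain
  \<open>z\<close>.\<close>

lemma split_off_var:
  fixes p :: "('n::finite, 'r::comm_ring_1) mpoly"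
  shows "\<exists>p0 p1. p = p0 + mvar z * p1 \<and> mvars p0 \<subseteq> mvars p - {z}"
proof -
  let ?q = "in_var z p"
  obtain a r where r: "?q = pCons a r" by (cases ?q)
  have "p = a + mvar z * poly r (mvar z)"
    using poly_in_var[of z p] by (simp add: r)
  moreover have "mvars a \<subseteq> mvars p - {z}"
    using mvars_coeff_in_var[of z p 0] by (simp add: r)
  ultimately show ?thesis by blast
qed

section \<open>Units and divisibility of constants\<close>

lemma is_unit_mconst_iff [simp]:
  fixes c :: "'r::idom"
  shows "(mconst c :: ('n::{finite,linorder}, 'r) mpoly) dvd 1 \<longleftrightarrow> c dvd 1"
proof
  assume "(mconst c :: ('n, 'r) mpoly) dvd 1"
  then obtain q :: "('n, 'r) mpoly" where q: "1 = mconst c * q" by (elim dvdE)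
  then have "q dvd 1" by (metis dvd_triv_right)
  then have "mvars q = {}" using mvars_dvd[of q 1] by auto
  then obtain d where "q = mconst d" using mvars_empty by blast
  with q show "c dvd 1" by (metis dvd_def mconst_1 mconst_eq_iff mconst_mult)
next
  assume "c dvd 1"
  then show "(mconst c :: ('n, 'r) mpoly) dvd 1" by (metis dvd_def mconst_1 mconst_mult)
qed

lemma is_unit_mpolyE:
  fixes p :: "('n::{finite,linorder}, 'r::idom) mpoly"
  assumes "p dvd 1"
  obtains u where "p = mconst u" "u dvd 1"
  using assms mvars_dvd[of p 1] mvars_empty[of p] by auto

lemma mconst_dvd_mconst_iff [simp]:
  fixes c d :: "'r::idom"
  shows "(mconst c :: ('n::{finite,linorder}, 'r) mpoly) dvd mconst d \<longleftrightarrow> c dvd d"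
proof
  assume *: "(mconst c :: ('n, 'r) mpoly) dvd mconst d"
  show "c dvd d"
  proof (cases "d = 0")
    case False
    from * obtain q :: "('n, 'r) mpoly" where q: "mconst d = mconst c * q" by (elim dvdE)
    then have "q dvd mconst d" by simp
    then have "mvars q = {}" using mvars_dvd[of q "mconst d"] False by auto
    then obtain e where "q = mconst e" using mvars_empty by blast
    with q show ?thesis by (metis dvd_def mconst_eq_iff mconst_mult)
  qed simp
next
  assume "c dvd d"
  then show "(mconst c :: ('n, 'r) mpoly) dvd mconst d" by (auto simp: mconst_mult)
qed

section \<open>Unique factorization\<close>

text \<open>\<open>prime_on K p\<close> is primality in the subring of polynomials in the variables \<open>K\<close>; it
  is passed from \<open>K\<close> to \<open>insert z K\<close> by Gauss' argument.\<close>

definition prime_on :: "'n set \<Rightarrow> ('n, 'r::idom) mpoly \<Rightarrow> bool" where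
  "prime_on K p \<longleftrightarrow> (\<forall>a b. mvars a \<subseteq> K \<longrightarrow> mvars b \<subseteq> K \<longrightarrow> p dvd a * b \<longrightarrow> p dvd a \<or> p dvd b)"

lemma dvd_iff_dvd_coeffs:
  fixes p :: "('n::{finite,linorder}, 'r::idom) mpoly"
  assumes "z \<notin> mvars p"
  shows "p dvd a \<longleftrightarrow> (\<forall>n. p dvd coeff (in_var z a) n)"
proof
  assume "p dvd a"
  then obtain q where "a = p * q" by (elim dvdE)
  then have "in_var z a = [:p:] * in_var z q" by (simp add: in_var_free[OF assms])
  then have "[:p:] dvd in_var z a" by (metis dvd_triv_left)
  then show "\<forall>n. p dvd coeff (in_var z a) n" by (rule const_poly_dvd_iff[THEN iffD1])
next
  assume "\<forall>n. p dvd coeff (in_var z a) n"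
  then have "[:p:] dvd in_var z a" by (simp add: const_poly_dvd_iff)
  then obtain q where "in_var z a = [:p:] * q" by (elim dvdE)
  from arg_cong[OF this, of "\<lambda>r. poly r (mvar z)"] show "p dvd a" by simp
qed

lemma prime_on_insert:
  fixes p :: "('n::{finite,linorder}, 'r::idom) mpoly"
  assumes p: "prime_on K p" "mvars p \<subseteq> K" and z: "z \<notin> K"
  shows "prime_on (insert z K) p"
  unfolding prime_on_def
proof (intro allI impI)
  fix a b :: "('n, 'r) mpoly"
  assume ab: "mvars a \<subseteq> insert z K" "mvars b \<subseteq> insert z K" and dvd: "p dvd a * b"
  have zp: "z \<notin> mvars p" using p z by blast
  have K: "mvars (coeff (in_var z a) i) \<subseteq> K" "mvars (coeff (in_var z b) i) \<subseteq> K" for i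
    using mvars_coeff_in_var[of z a i] mvars_coeff_in_var[of z b i] ab by blast+
  show "p dvd a \<or> p dvd b"
  proof (rule ccontr)
    assume "\<not> (p dvd a \<or> p dvd b)"
    then have ex: "\<exists>i. \<not> p dvd coeff (in_var z a) i" "\<exists>i. \<not> p dvd coeff (in_var z b) i"
      using dvd_iff_dvd_coeffs[OF zp] by blast+
    define i where "i = (LEAST i. \<not> p dvd coeff (in_var z a) i)"
    define j where "j = (LEAST i. \<not> p dvd coeff (in_var z b) i)"
    have i: "\<not> p dvd coeff (in_var z a) i" "\<And>k. k < i \<Longrightarrow> p dvd coeff (in_var z a) k"
      using LeastI_ex[OF ex(1)] not_less_Least unfolding i_def by blast+
    have j: "\<not> p dvd coeff (in_var z b) j" "\<And>k. k < j \<Longrightarrow> p dvd coeff (in_var z b) k"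
      using LeastI_ex[OF ex(2)] not_less_Least unfolding j_def by blast+
    let ?f = "\<lambda>k. coeff (in_var z a) k * coeff (in_var z b) (i + j - k)"
    have "p dvd coeff (in_var z (a * b)) (i + j)"
      using dvd dvd_iff_dvd_coeffs[OF zp] by blast
    moreover have "coeff (in_var z (a * b)) (i + j) = ?f i + (\<Sum>k\<in>{..i + j} - {i}. ?f k)"
      by (simp add: coeff_mult sum.remove[of "{..i + j}" i])
    moreover have "p dvd (\<Sum>k\<in>{..i + j} - {i}. ?f k)"
    proof (rule dvd_sum)
      fix k assume "k \<in> {..i + j} - {i}"
      then have "k < i \<or> i + j - k < j" by auto
      with i(2) j(2) show "p dvd ?f k" by auto
    qed
    ultimately have "p dvd coeff (in_var z a) i * coeff (in_var z b) j"
      by (simp add: dvd_add_left_iff)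
    with p(1) K i(1) j(1) show False unfolding prime_on_def by blast
  qed
qed

text \<open>A measure for descending to factors: all it has to be is additive and positive on
  nonunits. On constants it is the number of prime factors in \<open>R\<close>.\<close>

lemma exists_factor_count:
  fixes K :: "'n::{finite,linorder} set"
  shows "\<exists>\<nu> :: ('n, 'r::{factorial_semiring,idom}) mpoly \<Rightarrow> nat.
    (\<forall>a b. a \<noteq> 0 \<longrightarrow> b \<noteq> 0 \<longrightarrow> mvars a \<subseteq> K \<longrightarrow> mvars b \<subseteq> K \<longrightarrow> \<nu> (a * b) = \<nu> a + \<nu> b) \<and>
    (\<forall>a. a \<noteq> 0 \<longrightarrow> mvars a \<subseteq> K \<longrightarrow> \<nu> a = 0 \<longrightarrow> a dvd 1)"
  using finite[of K]
proof induction
  case empty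
  let ?\<nu> = "\<lambda>p :: ('n, 'r) mpoly. size (prime_factorization (Poly_Mapping.lookup p 0))"
  have A: "?\<nu> (a * b) = ?\<nu> a + ?\<nu> b"
    if nz: "a \<noteq> 0" "b \<noteq> 0" and ab: "mvars a \<subseteq> {}" "mvars b \<subseteq> {}" for a b :: "('n, 'r) mpoly"
  proof -
    obtain c d where "a = mconst c" "b = mconst d"
      using ab mvars_empty[of a] mvars_empty[of b] unfolding subset_empty by blast
    with nz show ?thesis
      by (simp flip: mconst_mult) (simp add: mconst_def prime_factorization_mult)
  qed
  have B: "a dvd 1" if "a \<noteq> 0" "mvars a \<subseteq> {}" "?\<nu> a = 0" for a :: "('n, 'r) mpoly"
  proof -
    from \<open>mvars a \<subseteq> {}\<close> obtain c where c: "a = mconst c"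
      using mvars_empty[of a] unfolding subset_empty by blast
    with that have "prime_factorization c = {#}" by (simp add: mconst_def)
    moreover have "c \<noteq> 0" using \<open>a \<noteq> 0\<close> c by simp
    ultimately have "c dvd 1" by (simp add: prime_factorization_empty_iff)
    then show ?thesis by (simp add: c)
  qed
  show ?case
    by (rule exI[of _ ?\<nu>], intro conjI allI impI) (erule (3) A, erule (2) B)
next
  case (insert z K)
  then obtain \<nu> :: "('n, 'r) mpoly \<Rightarrow> nat" where \<nu>:
    "\<And>a b. a \<noteq> 0 \<Longrightarrow> b \<noteq> 0 \<Longrightarrow> mvars a \<subseteq> K \<Longrightarrow> mvars b \<subseteq> K \<Longrightarrow> \<nu> (a * b) = \<nu> a + \<nu> b"
    "\<And>a. a \<noteq> 0 \<Longrightarrow> mvars a \<subseteq> K \<Longrightarrow> \<nu> a = 0 \<Longrightarrow> a dvd 1" by blast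
  \<comment> \<open>Degree in the new variable plus the count of the leading coefficient: both are
    additive, and the value 0 forces a polynomial free of \<open>z\<close>.\<close>
  let ?\<mu> = "\<lambda>p. degree (in_var z p) + \<nu> (lead_coeff (in_var z p))"
  have K: "mvars (coeff (in_var z a) i) \<subseteq> K" if "mvars a \<subseteq> insert z K" for a :: "('n, 'r) mpoly" and i
    using mvars_coeff_in_var[of z a i] that by blast
  have A: "?\<mu> (a * b) = ?\<mu> a + ?\<mu> b"
    if "a \<noteq> 0" "b \<noteq> 0" "mvars a \<subseteq> insert z K" "mvars b \<subseteq> insert z K" for a b :: "('n, 'r) mpoly"
  proof -
    have "lead_coeff (in_var z (a * b)) = lead_coeff (in_var z a) * lead_coeff (in_var z b)"
      by (simp only: in_var_simps lead_coeff_mult)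
    moreover have "degree (in_var z (a * b)) = degree (in_var z a) + degree (in_var z b)"
      using that by (simp add: degree_mult_eq)
    moreover have "\<nu> (lead_coeff (in_var z a) * lead_coeff (in_var z b)) =
        \<nu> (lead_coeff (in_var z a)) + \<nu> (lead_coeff (in_var z b))"
      using that K[of a] K[of b] by (intro \<nu>(1)) auto
    ultimately show ?thesis by simp
  qed
  have B: "a dvd 1" if "a \<noteq> 0" "mvars a \<subseteq> insert z K" "?\<mu> a = 0" for a :: "('n, 'r) mpoly"
  proof -
    from that have "z \<notin> mvars a" by (simp add: degree_in_var_eq_0_iff)
    with that \<nu>(2)[of a] show ?thesis by (auto simp: in_var_free)
  qed
  show ?case
    by (rule exI[of _ ?\<mu>], intro conjI allI impI) (erule (3) A, erule (2) B)
qed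

text \<open>Euclidean division in \<open>z\<close> over coefficients that do not form a field:
  \<open>c\<close> collects the leading coefficients of \<open>d\<close> by which the dividend has
  to be multiplied.\<close>

lemma pseudo_division:
  fixes d :: "('n::{finite,linorder}, 'r::idom) mpoly"
  assumes d: "d \<noteq> 0" "mvars d \<subseteq> insert z K" and z: "z \<notin> K" and f: "mvars f \<subseteq> insert z K"
  shows "\<exists>c q r. c \<noteq> 0 \<and> mvars c \<subseteq> K \<and> mvars q \<subseteq> insert z K \<and> mvars r \<subseteq> insert z K \<and>
    c * f = q * d + r \<and> (r = 0 \<or> degree (in_var z r) < degree (in_var z d))"
  using f
proof (induction "degree (in_var z f)" arbitrary: f rule: less_induct)
  case less
  let ?n = "degree (in_var z f)" and ?m = "degree (in_var z d)"
  show ?case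
  proof (cases "f = 0 \<or> ?n < ?m")
    case True
    with less.prems show ?thesis
      by (intro exI[of _ 1] exI[of _ 0] exI[of _ f]) auto
  next
    case False
    then have nm: "?m \<le> ?n" "f \<noteq> 0" by auto
    define a where "a = lead_coeff (in_var z d)"
    define b where "b = lead_coeff (in_var z f)"
    have a: "a \<noteq> 0" "mvars a \<subseteq> K" and b: "mvars b \<subseteq> K" "b \<noteq> 0"
      using d nm less.prems mvars_coeff_in_var[of z d ?m] mvars_coeff_in_var[of z f ?n]
      by (auto simp: a_def b_def)
    have iv: "in_var z a = [:a:]" "in_var z b = [:b:]"
      using a b z by (auto intro!: in_var_free)
    have pw: "in_var z (mvar z ^ k) = monom 1 k" for k
      by (induction k) (simp_all add: monom_Suc)
    have pv: "mvars (mvar z ^ k :: ('n, 'r) mpoly) \<subseteq> {z}" for k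
    proof (induction k)
      case (Suc k)
      then show ?case using mvars_mult_subset[of "mvar z" "mvar z ^ k"] by auto
    qed simp
    define s where "s = b * mvar z ^ (?n - ?m)"
    have s: "mvars s \<subseteq> insert z K"
      using mvars_mult_subset[of b "mvar z ^ (?n - ?m)"] pv b by (auto simp: s_def)
    have s0: "s \<noteq> 0"
    proof
      assume "s = 0"
      then have "in_var z s = 0" by simp
      then show False using b by (simp add: s_def pw iv smult_monom)
    qed
    have ivs: "in_var z s = monom b (?n - ?m)"
      by (simp add: s_def pw iv smult_monom)
    \<comment> \<open>Cross multiplication with the two leading coefficients cancels the top
      terms.\<close>
    define g where "g = a * f - s * d"
    have g: "mvars g \<subseteq> insert z K"
      using mvars_diff[of "a * f" "s * d"] mvars_mult_subset[of a f] mvars_mult_subset[of s d]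
        a(2) s d(2) less.prems unfolding g_def by blast
    have eq: "in_var z g = smult a (in_var z f) - monom b (?n - ?m) * in_var z d"
      by (simp add: g_def iv ivs)
    have top: "coeff (in_var z g) ?n = 0"
      using nm by (simp add: eq coeff_monom_mult a_def b_def)
    have le: "degree (in_var z g) \<le> ?n"
    proof -
      have "degree (monom b (?n - ?m) * in_var z d) \<le> ?n"
        using degree_mult_le[of "monom b (?n - ?m)" "in_var z d"] degree_monom_le[of b "?n - ?m"] nm
        by linarith
      then show ?thesis unfolding eq by (intro degree_diff_le) (use degree_smult_le in auto)
    qed
    show ?thesis
    proof (cases "g = 0 \<or> degree (in_var z g) < ?m")
      case True
      then show ?thesis
        by (intro exI[of _ a] exI[of _ s] exI[of _ g]) (use a s g in \<open>auto simp: g_def\<close>)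
    next
      case False
      have "degree (in_var z g) < ?n"
      proof (rule ccontr)
        assume "\<not> degree (in_var z g) < ?n"
        with le have "degree (in_var z g) = ?n" by simp
        with top False show False by (metis in_var_eq_0_iff leading_coeff_0_iff)
      qed
      from less.hyps[OF this g] obtain c q r where cqr: "c \<noteq> 0" "mvars c \<subseteq> K"
        "mvars q \<subseteq> insert z K" "mvars r \<subseteq> insert z K" "c * g = q * d + r"
        "r = 0 \<or> degree (in_var z r) < ?m" by blast
      have e1: "c * a * f = (q + c * s) * d + r"
        using cqr(5) by (simp add: g_def algebra_simps)
      have e2: "mvars (c * a) \<subseteq> K" using cqr a mvars_mult_subset[of c a] by auto
      have e3: "mvars (q + c * s) \<subseteq> insert z K"
        using mvars_add[of q "c * s"] mvars_mult_subset[of c s] cqr(2,3) s by blast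
      show ?thesis
        by (intro exI[of _ "c * a"] exI[of _ "q + c * s"] exI[of _ r])
          (use a cqr e1 e2 e3 in auto)
    qed
  qed
qed

lemma irreducible_dvd_cases:
  assumes "irreducible f" "p dvd f"
  shows "p dvd 1 \<or> f dvd p"
proof -
  from assms obtain q where q: "f = p * q" by (elim dvdE)
  with assms(1) have "p dvd 1 \<or> q dvd 1" by (rule irreducibleD)
  then show ?thesis
  proof
    assume "q dvd 1"
    then obtain r where "1 = q * r" by (elim dvdE)
    then have "p = f * r" using q by (simp add: mult.assoc)
    then show ?thesis by simp
  qed simp
qed

text \<open>By descent on the factor count every nonzero nonunit has an irreducible factor, and
  splitting it off lowers the count again; so a polynomial can be peeled factor by factor inside the
  subring of \<open>K\<close>.\<close>

lemma factor_in_subring: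
  fixes c :: "('n::{finite,linorder}, 'r::{factorial_semiring,idom}) mpoly"
  assumes c: "c \<noteq> 0" "mvars c \<subseteq> K"
    and step: "\<And>p c. irreducible p \<Longrightarrow> mvars p \<subseteq> K \<Longrightarrow> c \<noteq> 0 \<Longrightarrow> mvars c \<subseteq> K \<Longrightarrow> P c \<Longrightarrow> P (p * c)"
    and unit: "\<And>c. c dvd 1 \<Longrightarrow> P c"
  shows "P c"
proof -
  obtain \<nu> :: "('n, 'r) mpoly \<Rightarrow> nat" where \<nu>:
    "\<And>a b. a \<noteq> 0 \<Longrightarrow> b \<noteq> 0 \<Longrightarrow> mvars a \<subseteq> K \<Longrightarrow> mvars b \<subseteq> K \<Longrightarrow> \<nu> (a * b) = \<nu> a + \<nu> b"
    "\<And>a. a \<noteq> 0 \<Longrightarrow> mvars a \<subseteq> K \<Longrightarrow> \<nu> a = 0 \<Longrightarrow> a dvd 1"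
    using exists_factor_count[of K] by blast
  have pos: "\<nu> a > 0" if "a \<noteq> 0" "mvars a \<subseteq> K" "\<not> a dvd 1" for a :: "('n, 'r) mpoly"
    using \<nu>(2) that by blast
  have irr: "\<exists>p q. c = p * q \<and> irreducible p" if "c \<noteq> 0" "mvars c \<subseteq> K" "\<not> c dvd 1" for c :: "('n, 'r) mpoly"
    using that
  proof (induction "\<nu> c" arbitrary: c rule: less_induct)
    case less
    show ?case
    proof (cases "irreducible c")
      case True
      then show ?thesis by (intro exI[of _ c] exI[of _ 1]) simp
    next
      case False
      with less.prems obtain a b where ab: "c = a * b" "\<not> a dvd 1" "\<not> b dvd 1"
        unfolding irreducible_def by blast
      with less.prems have nz: "a \<noteq> 0" "b \<noteq> 0" "mvars a \<subseteq> K" "mvars b \<subseteq> K"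
        by (auto simp: mvars_mult)
      then have "\<nu> a < \<nu> c" using ab \<nu>(1)[of a b] pos[of b] by simp
      from less.hyps[OF this] nz ab obtain p q where "a = p * q" "irreducible p" by blast
      with ab show ?thesis by (metis mult.assoc)
    qed
  qed
  show ?thesis using c
  proof (induction "\<nu> c" arbitrary: c rule: less_induct)
    case less
    show ?case
    proof (cases "c dvd 1")
      case False
      with irr less.prems obtain p q where pq: "c = p * q" "irreducible p" by blast
      with less.prems have nz: "p \<noteq> 0" "q \<noteq> 0" "mvars p \<subseteq> K" "mvars q \<subseteq> K"
        by (auto simp: mvars_mult)
      then have "\<nu> q < \<nu> c" using pq \<nu>(1)[of p q] pos[of p] irreducible_not_unit[of p] by simp
      from less.hyps[OF this] nz have "P q" by blast
      with step[OF pq(2) nz(3,2,4)] pq(1) show ?thesis by simp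
    qed (rule unit)
  qed
qed

text \<open>Induction on the variables. If \<open>f\<close> involves the new variable
  \<open>z\<close>, an element \<open>d\<close> of least \<open>z\<close>-degree in the ideal
  generated by \<open>f\<close> and \<open>g\<close> takes the place of a gcd over the fraction
  field. The factors free of \<open>z\<close> that the divisions introduce are removed one
  irreducible at a time; these are prime by the induction hypothesis.\<close>

lemma irreducible_imp_prime_on:
  fixes f :: "('n::{finite,linorder}, 'r::{factorial_semiring,idom}) mpoly"
  assumes "irreducible f" "mvars f \<subseteq> K"
  shows "prime_on K f"
  using finite[of K] assms
proof (induction K arbitrary: f)
  case empty
  then obtain c where c: "f = mconst c" using mvars_empty[of f] by auto
  have "irreducible c"
  proof (rule irreducibleI)
    fix a b assume "c = a * b"
    with irreducibleD[OF empty(1), of "mconst a" "mconst b"] c show "a dvd 1 \<or> b dvd 1"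
      by (simp add: mconst_mult)
  qed (use empty(1) c in \<open>auto simp: irreducible_def\<close>)
  then have pr: "prime_elem c" by (rule irreducible_imp_prime_elem)
  show ?case unfolding prime_on_def
  proof (intro allI impI)
    fix a b :: "('n, 'r) mpoly" assume "mvars a \<subseteq> {}" "mvars b \<subseteq> {}" and d: "f dvd a * b"
    then obtain u v where "a = mconst u" "b = mconst v"
      using mvars_empty[of a] mvars_empty[of b] by auto
    with d c pr show "f dvd a \<or> f dvd b"
      by (simp flip: mconst_mult add: prime_elem_dvd_mult_iff)
  qed
next
  case (insert z K)
  show ?case
  proof (cases "z \<in> mvars f")
    case False
    then have "mvars f \<subseteq> K" using insert by auto
    then show ?thesis using insert prime_on_insert by blast
  next
    case z: True
    let ?P = "\<lambda>p :: ('n, 'r) mpoly. mvars p \<subseteq> insert z K"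
    have f0: "f \<noteq> 0" using insert by (simp add: irreducible_def)
    have prime: "prime_on (insert z K) p" if "irreducible p" "mvars p \<subseteq> K" for p :: "('n, 'r) mpoly"
      using insert that prime_on_insert by blast
    \<comment> \<open>An irreducible \<open>p\<close> free of \<open>z\<close> does not divide
      \<open>f\<close>, since otherwise \<open>f\<close> would divide \<open>p\<close>. So it
      divides the cofactor and cancels.\<close>
    have cancel: "f dvd g" if "c \<noteq> 0" "mvars c \<subseteq> K" "f dvd c * g" "?P g" "g \<noteq> 0" for c g
    proof -
      have "f dvd c * g \<longrightarrow> f dvd g"
      proof (rule factor_in_subring[OF that(1,2)])
        fix p c :: "('n, 'r) mpoly"
        assume p: "irreducible p" "mvars p \<subseteq> K" and c: "c \<noteq> 0" "mvars c \<subseteq> K"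
          and IH: "f dvd c * g \<longrightarrow> f dvd g"
        show "f dvd p * c * g \<longrightarrow> f dvd g"
        proof
          assume "f dvd p * c * g"
          then obtain w where w: "p * (c * g) = f * w" by (auto elim!: dvdE simp: mult.assoc)
          have p0: "p \<noteq> 0" using p by auto
          have w0: "w \<noteq> 0" using w p0 c(1) that(5) by auto
          have "f * w \<noteq> 0" using f0 w0 by simp
          moreover have "?P (f * w)"
            unfolding w[symmetric] using p c that p0 by (auto simp: mvars_mult)
          ultimately have "?P w" using f0 w0 by (simp add: mvars_mult)
          moreover have "p dvd f * w" using w by (metis dvd_triv_left)
          ultimately have "p dvd f \<or> p dvd w"
            using prime[OF p] insert.prems unfolding prime_on_def by blast
          moreover have "\<not> p dvd f"
          proof
            assume "p dvd f"
            then have "f dvd p"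
              using irreducible_dvd_cases[OF insert.prems(1)] irreducible_not_unit[OF p(1)] by blast
            then show False using mvars_dvd[of f p] p0 p z insert.hyps by blast
          qed
          ultimately obtain v where "w = p * v" by (auto elim: dvdE)
          with w have "p * (c * g) = p * (f * v)" by (simp add: mult_ac)
          with p0 have "c * g = f * v" by simp
          with IH show "f dvd g" by simp
        qed
      next
        fix c :: "('n, 'r) mpoly" assume "c dvd 1"
        then obtain c' where "1 = c * c'" by (elim dvdE)
        then have "g = c' * (c * g)" by (simp add: mult_ac)
        then show "f dvd c * g \<longrightarrow> f dvd g" by (metis dvd_mult)
      qed
      with that(3) show ?thesis by blast
    qed
    \<comment> \<open>The irreducible factors of \<open>c\<close> are distributed over
      \<open>q\<close> and \<open>d\<close>; what remains is a factorization of \<open>f\<close>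
      itself.\<close>
    have split: "z \<notin> mvars d \<or> f dvd d"
      if "c \<noteq> 0" "mvars c \<subseteq> K" "c * f = q * d" "?P q" "?P d" for c q d
    proof -
      have "\<forall>q d. c * f = q * d \<longrightarrow> ?P q \<longrightarrow> ?P d \<longrightarrow> z \<notin> mvars d \<or> f dvd d"
      proof (rule factor_in_subring[OF that(1,2)])
        fix p c :: "('n, 'r) mpoly"
        assume p: "irreducible p" "mvars p \<subseteq> K" and c: "c \<noteq> 0" "mvars c \<subseteq> K"
          and IH: "\<forall>q d. c * f = q * d \<longrightarrow> ?P q \<longrightarrow> ?P d \<longrightarrow> z \<notin> mvars d \<or> f dvd d"
        have p0: "p \<noteq> 0" using p by auto
        show "\<forall>q d. p * c * f = q * d \<longrightarrow> ?P q \<longrightarrow> ?P d \<longrightarrow> z \<notin> mvars d \<or> f dvd d"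
        proof (intro allI impI)
          fix q d assume eq: "p * c * f = q * d" and qd: "?P q" "?P d"
          then have nz: "q \<noteq> 0" "d \<noteq> 0" using p0 c f0 by auto
          have "p dvd q * d" using eq by (metis dvd_triv_left mult.assoc)
          then have "p dvd q \<or> p dvd d"
            using prime[OF p] qd unfolding prime_on_def by blast
          then show "z \<notin> mvars d \<or> f dvd d"
          proof
            assume "p dvd q"
            then obtain q' where q': "q = p * q'" by (elim dvdE)
            with eq p0 have "c * f = q' * d" by (simp add: mult.assoc)
            moreover have "?P q'" using q' nz qd by (auto simp: mvars_mult)
            ultimately show ?thesis using IH qd by blast
          next
            assume "p dvd d"
            then obtain d' where d': "d = p * d'" by (elim dvdE)
            with eq p0 have "c * f = q * d'" by (simp add: mult_ac)
            moreover have "?P d'" using d' nz qd by (auto simp: mvars_mult)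
            ultimately have "z \<notin> mvars d' \<or> f dvd d'" using IH qd by blast
            then show ?thesis using d' nz p insert.hyps by (auto simp: mvars_mult)
          qed
        qed
      next
        fix c :: "('n, 'r) mpoly" assume c: "c dvd 1"
        show "\<forall>q d. c * f = q * d \<longrightarrow> ?P q \<longrightarrow> ?P d \<longrightarrow> z \<notin> mvars d \<or> f dvd d"
        proof (intro allI impI)
          fix q d assume eq: "c * f = q * d"
          obtain c' where c': "1 = c * c'" using c by (elim dvdE)
          have "f = c' * (c * f)" using c' by (simp add: mult_ac)
          also have "\<dots> = (c' * q) * d" by (simp add: eq mult_ac)
          finally have "d dvd f" by simp
          then have "d dvd 1 \<or> f dvd d" using irreducible_dvd_cases insert.prems by blast
          then show "z \<notin> mvars d \<or> f dvd d" using mvars_dvd[of d 1] by auto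
        qed
      qed
      with that show ?thesis by blast
    qed
    show ?thesis unfolding prime_on_def
    proof (intro allI impI)
      fix g h :: "('n, 'r) mpoly"
      assume g: "?P g" and h: "?P h" and dvd: "f dvd g * h"
      show "f dvd g \<or> f dvd h"
      proof (cases "g = 0 \<or> h = 0")
        case False
        then have gh: "g \<noteq> 0" "h \<noteq> 0" by auto
        \<comment> \<open>The nonzero elements of the ideal generated by \<open>f\<close> and
          \<open>g\<close> in the variables at hand.\<close>
        define I where "I e \<longleftrightarrow> e \<noteq> 0 \<and> (\<exists>a b. e = a * f + b * g \<and> ?P a \<and> ?P b)" for e
        have "\<exists>a b. f = a * f + b * g \<and> ?P a \<and> ?P b"
          by (rule exI[of _ 1], rule exI[of _ 0]) simp
        then have "I f" using f0 by (simp add: I_def)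
        then obtain d where d: "I d"
          and min: "\<And>e. I e \<Longrightarrow> degree (in_var z d) \<le> degree (in_var z e)"
          using ex_has_least_nat[of I f "\<lambda>x. degree (in_var z x)"] by blast
        from d obtain a b where ab: "d = a * f + b * g" "?P a" "?P b" and d0: "d \<noteq> 0"
          unfolding I_def by blast
        have Pd: "?P d"
          using ab(2,3) g insert.prems(2) unfolding ab(1) by (intro mvars_subsetI)
        have div: "\<exists>c q. c \<noteq> 0 \<and> mvars c \<subseteq> K \<and> ?P q \<and> c * (s * f + t * g) = q * d"
          if st: "?P s" "?P t" for s t
        proof -
          have "?P (s * f + t * g)"
            using st g insert.prems(2) by (intro mvars_subsetI)
          from pseudo_division[OF d0 Pd insert.hyps(2) this]
          obtain c q r where c: "c \<noteq> 0" "mvars c \<subseteq> K" "?P q" "?P r"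
            "c * (s * f + t * g) = q * d + r"
            "r = 0 \<or> degree (in_var z r) < degree (in_var z d)" by blast
          have "r = (c * s - q * a) * f + (c * t - q * b) * g"
          proof -
            have "r = c * (s * f + t * g) - q * d" using c(5) by simp
            then show ?thesis by (simp add: ab(1) algebra_simps)
          qed
          moreover have "?P (c * s - q * a)" "?P (c * t - q * b)"

            by (intro mvars_subsetI; use c(2,3) st ab(2,3) in blast)+
          ultimately have "\<exists>a b. r = a * f + b * g \<and> ?P a \<and> ?P b"
            by blast
          then have "r = 0" using min[of r] c(6) unfolding I_def by fastforce
          with c(1-3,5) show ?thesis by (intro exI[of _ c] exI[of _ q]) simp
        qed
        obtain c1 q1 where c1: "c1 \<noteq> 0" "mvars c1 \<subseteq> K" "?P q1" "c1 * f = q1 * d"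
          using div[of 1 0] by fastforce
        obtain c2 q2 where c2: "c2 \<noteq> 0" "mvars c2 \<subseteq> K" "?P q2" "c2 * g = q2 * d"
          using div[of 0 1] by fastforce
        from split[OF c1(1,2,4,3) Pd] show ?thesis
        proof
          assume "z \<notin> mvars d"
          then have "mvars d \<subseteq> K" using Pd by auto
          \<comment> \<open>Modulo \<open>f\<close> the element \<open>d\<close> is a multiple of
            \<open>g\<close>, and \<open>f\<close> divides \<open>g * h\<close>.\<close>
          moreover have "f dvd d * h"
          proof -
            have "d * h = f * (a * h) + b * (g * h)" by (simp add: ab(1) algebra_simps)
            then show ?thesis using dvd by simp
          qed
          ultimately show ?thesis using cancel[OF d0 _ _ h gh(2)] by blast
        next
          assume "f dvd d"
          then have "f dvd c2 * g" using c2(4) by simp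
          then show ?thesis using cancel[OF c2(1,2) _ g gh(1)] by blast
        qed
      qed auto
    qed
  qed
qed

theorem mpoly_irreducible_imp_prime_elem:
  fixes f :: "('n::{finite,linorder}, 'r::{factorial_semiring,idom}) mpoly"
  assumes "irreducible f"
  shows "prime_elem f"
  using irreducible_imp_prime_on[OF assms, of UNIV] assms
  unfolding prime_on_def prime_elem_def irreducible_def by blast

section \<open>Evaluation in the ambient field\<close>

lemma emb_0 [simp]: "emb 0 = 0"
  and emb_1 [simp]: "emb 1 = 1"
  and emb_add: "emb (a + b) = emb a + emb b"
  and emb_mult: "emb (a * b) = emb a * emb b"
  by (simp_all add: emb_def Zero_fract_def One_fract_def mconst_add mconst_mult)

lemma emb_eq_iff [simp]:
  "(emb a :: ('n::{finite,linorder}, 'r::idom) ratfun) = emb b \<longleftrightarrow> a = b"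
  by (simp add: emb_def eq_fract)

lemma emb_eq_0_iff [simp]:
  "(emb a :: ('n::{finite,linorder}, 'r::idom) ratfun) = 0 \<longleftrightarrow> a = 0"
  by (metis emb_eq_iff emb_0)

global_interpretation ev: coeff_hom "emb :: 'r::idom \<Rightarrow> ('n::{finite,linorder}, 'r) ratfun"
  by unfold_locales (simp_all add: emb_add emb_mult)

lemma peval_mev: "peval X p = ev.mev X p"
  by (simp add: peval_def ev.mev_def)

lemma peval_simps [simp]:
  "peval X 0 = 0" "peval X 1 = 1" "peval X (mconst c) = emb c" "peval X (mvar i) = X i"
  "peval X (p + q) = peval X p + peval X q" "peval X (p * q) = peval X p * peval X q"
  "peval X (p ^ n) = peval X p ^ n"
  by (simp_all add: peval_mev ev.mev_add ev.mev_mult ev.mev_power)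

lemma peval_sum [simp]: "peval X (\<Sum>a\<in>S. f a) = (\<Sum>a\<in>S. peval X (f a))"
  and peval_prod [simp]: "peval X (\<Prod>a\<in>S. f a) = (\<Prod>a\<in>S. peval X (f a))"
  by (simp_all add: peval_mev ev.mev_sum ev.mev_prod)

lemma peval_uminus [simp]: "peval X (- p) = - peval X p"
proof -
  have "peval X (- p) + peval X p = peval X (- p + p)" by (simp only: peval_simps)
  then show ?thesis by (simp add: eq_neg_iff_add_eq_0)
qed

lemma peval_diff [simp]: "peval X (p - q) = peval X p - peval X q"
  unfolding diff_conv_add_uminus[of p q] by (simp only: peval_simps peval_uminus diff_conv_add_uminus)

lemma peval_cong: "(\<And>i. i \<in> mvars p \<Longrightarrow> X i = Y i) \<Longrightarrow> peval X p = peval Y p"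
  unfolding peval_mev by (rule ev.mev_cong)

lemma peval_upd_free: "z \<notin> mvars p \<Longrightarrow> peval (X(z := v)) p = peval X p"
  by (rule peval_cong) auto

definition alg_ind :: "('n::{finite,linorder} \<Rightarrow> ('n, 'r::idom) ratfun) \<Rightarrow> bool" where
  "alg_ind X \<longleftrightarrow> (\<forall>p. peval X p = 0 \<longrightarrow> p = 0)"

lemma alg_ind_eq_0_iff: "alg_ind X \<Longrightarrow> peval X p = 0 \<longleftrightarrow> p = 0"
  by (auto simp: alg_ind_def)

lemma alg_ind_eq_iff: "alg_ind X \<Longrightarrow> peval X p = peval X q \<longleftrightarrow> p = q"
  using alg_ind_eq_0_iff[of X "p - q"] by auto

lemma mvar_neq_0 [simp]: "(mvar k :: ('n, 'r::zero_neq_one) mpoly) \<noteq> 0"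
proof -
  have "mvars (mvar k :: ('n, 'r) mpoly) \<noteq> mvars (0 :: ('n, 'r) mpoly)" by simp
  then show ?thesis by metis
qed

lemma alg_ind_nonzero: "alg_ind X \<Longrightarrow> X k \<noteq> 0"
  using alg_ind_eq_0_iff[of X "mvar k"] by auto

text \<open>The seed condition that no variable divides an exchange polynomial is used in this form:
  no substitution of 0 for a cluster variable makes it vanish.\<close>

lemma mvar_dvd_iff_peval:
  assumes "alg_ind X"
  shows "mvar z dvd p \<longleftrightarrow> peval (X(z := 0)) p = 0"
proof
  assume "peval (X(z := 0)) p = 0"
  moreover obtain p0 p1 where p: "p = p0 + mvar z * p1" "mvars p0 \<subseteq> mvars p - {z}"
    using split_off_var by blast
  ultimately have "peval X p0 = 0"
    using peval_upd_free[of z p0 X 0] by auto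
  then have "p0 = 0" using assms by (simp add: alg_ind_eq_0_iff)
  with p show "mvar z dvd p" by simp
qed auto

lemma prime_elem_mvar: "prime_elem (mvar z :: ('n::{finite,linorder}, 'r::idom) mpoly)"
proof (rule prime_elemI)
  have *: "mvar z dvd p \<longleftrightarrow> coeff (in_var z p) 0 = 0" for p :: "('n, 'r) mpoly"
  proof
    assume "mvar z dvd p"
    then show "coeff (in_var z p) 0 = 0" by (auto elim!: dvdE)
  next
    assume "coeff (in_var z p) 0 = 0"
    then obtain r where "in_var z p = pCons 0 r" by (cases "in_var z p") auto
    then have "p = mvar z * poly r (mvar z)" using poly_in_var[of z p] by simp
    then show "mvar z dvd p" by simp
  qed
  show "mvar z dvd a \<or> mvar z dvd b" if "mvar z dvd a * b" for a b :: "('n, 'r) mpoly"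
    using that by (simp add: * coeff_mult)
  show "\<not> mvar z dvd (1 :: ('n, 'r) mpoly)" by (simp add: *)
qed simp

section \<open>Monomials and their divisors\<close>

definition pmon :: "('n::finite \<Rightarrow> nat) \<Rightarrow> ('n, 'r::comm_semiring_1) mpoly" where
  "pmon m = (\<Prod>k\<in>UNIV. mvar k ^ m k)"

lemma peval_pmon: "peval X (pmon m) = (\<Prod>k\<in>UNIV. X k ^ m k)"
  by (simp add: pmon_def)

lemma pmon_neq_0 [simp]: "(pmon m :: ('n::{finite,linorder}, 'r::idom) mpoly) \<noteq> 0"
  by (simp add: pmon_def)

lemma pmon_0 [simp]: "pmon (\<lambda>_. 0) = 1"
  by (simp add: pmon_def)

lemma pmon_add: "pmon (\<lambda>k. m k + n k) = pmon m * pmon n"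
  by (simp add: pmon_def power_add prod.distrib)

lemma pmon_Suc: "pmon (m(k := Suc (m k))) = mvar k * pmon m"
proof -
  have "(\<Prod>i\<in>UNIV - {k}. mvar i ^ (m(k := Suc (m k))) i) = (\<Prod>i\<in>UNIV - {k}. mvar i ^ m i)"
    by (rule prod.cong) auto
  then show ?thesis
    by (simp add: pmon_def prod.remove[of UNIV k] mult.assoc)
qed

lemma dvd_const_monomial:
  fixes p :: "('n::{finite,linorder}, 'r::idom) mpoly"
  assumes "p dvd mconst c * pmon m" "c \<noteq> 0"
  shows "\<exists>d m'. p = mconst d * pmon m'"
  using assms(1)
proof (induction "\<Sum>k\<in>UNIV. m k" arbitrary: p m)
  case 0
  then have "m = (\<lambda>_. 0)" by auto
  with 0 have "p dvd mconst c" by simp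
  then have "mvars p = {}" using mvars_dvd[of p "mconst c"] assms(2) by auto
  then obtain d where "p = mconst d" using mvars_empty by blast
  then show ?case by (intro exI[of _ d] exI[of _ "\<lambda>_. 0"]) simp
next
  case (Suc n)
  then obtain k where k: "m k \<noteq> 0" by (metis sum.neutral nat.distinct(1))
  define m' where "m' = m(k := m k - 1)"
  have m: "m = m'(k := Suc (m' k))" using k by (auto simp: m'_def)
  have eq: "pmon m = mvar k * (pmon m' :: ('n, 'r) mpoly)" unfolding m by (rule pmon_Suc)
  have n: "n = (\<Sum>k\<in>UNIV. m' k)"
  proof -
    have "(\<Sum>i\<in>UNIV - {k}. m i) = (\<Sum>i\<in>UNIV - {k}. m' i)"
      by (rule sum.cong) (auto simp: m'_def)
    then show ?thesis using Suc(2) k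
      by (simp add: sum.remove[of UNIV k] m'_def)
  qed
  from Suc.prems obtain q where q: "mconst c * pmon m = p * q" by (elim dvdE)
  then have q': "mvar k * (mconst c * pmon m') = p * q" by (simp add: eq mult_ac)
  then have "mvar k dvd p * q" by (metis dvd_triv_left)
  then have "mvar k dvd p \<or> mvar k dvd q" using prime_elem_mvar prime_elem_dvd_multD by blast
  then show ?case
  proof
    assume "mvar k dvd p"
    then obtain p' where p': "p = mvar k * p'" by (elim dvdE)
    with q' have "mconst c * pmon m' = p' * q" by (simp add: mult.assoc)
    then have "p' dvd mconst c * pmon m'" by simp
    from Suc.hyps(1)[OF n this] obtain d m'' where "p' = mconst d * pmon m''" by blast
    with p' have "p = mconst d * pmon (m''(k := Suc (m'' k)))" by (simp add: pmon_Suc mult_ac)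
    then show ?thesis by blast
  next
    assume "mvar k dvd q"
    then obtain q'' where "q = mvar k * q''" by (elim dvdE)
    with q' have "mconst c * pmon m' = p * q''" by (simp add: mult.left_commute)
    then have "p dvd mconst c * pmon m'" by simp
    from Suc.hyps(1)[OF n this] show ?thesis .
  qed
qed

lemma prime_elem_dvd_prodD:
  assumes "prime_elem p" "p dvd (\<Prod>a\<in>S. f a)"
  shows "\<exists>a\<in>S. p dvd f a"
  using assms(2)
proof (induction S rule: infinite_finite_induct)
  case (insert x S)
  then show ?case using prime_elem_dvd_multD[OF assms(1)] by auto
qed (use assms(1) prime_elem_not_unit[of p] in auto)

lemma prime_not_dvd_pmon:
  fixes C :: "('n::{finite,linorder}, 'r::idom) mpoly"
  assumes "prime_elem C" "\<And>k. \<not> mvar k dvd C"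
  shows "\<not> C dvd pmon m"
proof
  assume "C dvd pmon m"
  then obtain k where "C dvd mvar k ^ m k"
    unfolding pmon_def using prime_elem_dvd_prodD[OF assms(1)] by blast
  then have "C dvd mvar k" by (rule prime_elem_dvd_power[OF assms(1)])
  then obtain q where q: "mvar k = C * q" by (elim dvdE)
  then have "mvar k dvd C * q" by simp
  then have "mvar k dvd q"
    using prime_elem_dvd_multD[OF prime_elem_mvar] assms(2) by blast
  then obtain r where "q = mvar k * r" by (elim dvdE)
  with q have "mvar k * 1 = mvar k * (C * r)" by (simp add: mult_ac)
  then have "1 = C * r" unfolding mult_cancel_left by simp
  then have "C dvd 1" by (rule dvdI)
  then show False using assms(1) prime_elem_not_unit by blast
qed

section \<open>Laurent functions\<close>

text \<open>Functions of a family \<open>Y\<close> given by a Laurent polynomial over \<open>Frac R\<close> in which only the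
  variables in \<open>Z\<close> occur in denominators.\<close>

inductive lfun :: "'n set \<Rightarrow> (('n::{finite,linorder} \<Rightarrow> ('n, 'r::idom) ratfun) \<Rightarrow> ('n, 'r) ratfun) \<Rightarrow> bool"
  for Z where
  lfun_emb: "lfun Z (\<lambda>Y. emb c)"
| lfun_inv_emb: "c \<noteq> 0 \<Longrightarrow> lfun Z (\<lambda>Y. inverse (emb c))"
| lfun_var: "lfun Z (\<lambda>Y. Y k)"
| lfun_inv_var: "k \<in> Z \<Longrightarrow> lfun Z (\<lambda>Y. inverse (Y k))"
| lfun_add: "lfun Z S \<Longrightarrow> lfun Z T \<Longrightarrow> lfun Z (\<lambda>Y. S Y + T Y)"
| lfun_mult: "lfun Z S \<Longrightarrow> lfun Z T \<Longrightarrow> lfun Z (\<lambda>Y. S Y * T Y)"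

lemma lfun_mono: "lfun Z T \<Longrightarrow> Z \<subseteq> Z' \<Longrightarrow> lfun Z' T"
  by (induction rule: lfun.induct) (auto intro: lfun.intros)

lemma lfun_1: "lfun Z (\<lambda>Y. 1)"
  using lfun_emb[of Z 1] by simp

lemma lfun_0: "lfun Z (\<lambda>Y. 0)"
  using lfun_emb[of Z 0] by simp

lemma lfun_power: "lfun Z T \<Longrightarrow> lfun Z (\<lambda>Y. T Y ^ n)"
  by (induction n) (auto intro: lfun_1 lfun_mult)

lemma lfun_prod: "(\<And>a. a \<in> S \<Longrightarrow> lfun Z (T a)) \<Longrightarrow> lfun Z (\<lambda>Y. \<Prod>a\<in>S. T a Y)"
  by (induction S rule: infinite_finite_induct) (auto intro: lfun_1 lfun_mult)

lemma lfun_sum: "(\<And>a. a \<in> S \<Longrightarrow> lfun Z (T a)) \<Longrightarrow> lfun Z (\<lambda>Y. \<Sum>a\<in>S. T a Y)"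
  by (induction S rule: infinite_finite_induct) (auto intro: lfun_0 lfun_add)

lemma lfun_peval:
  assumes "\<And>k. lfun Z (\<lambda>Y. f Y k)"
  shows "lfun Z (\<lambda>Y. peval (f Y) p)"
  by (rule mpoly_induct[of p UNIV]) (auto intro!: lfun_emb lfun_add lfun_mult assms)

lemma lfun_powi: "k \<in> Z \<Longrightarrow> lfun Z (\<lambda>Y. Y k powi a)"
  by (cases "a \<ge> 0") (auto simp: power_int_def intro!: lfun_power lfun_var lfun_inv_var)

lemma lfun_powi_nonneg: "a \<ge> 0 \<Longrightarrow> lfun Z (\<lambda>Y. Y k powi a)"
  by (auto simp: power_int_def intro!: lfun_power lfun_var)

lemma lfun_divide: "lfun Z S \<Longrightarrow> k \<in> Z \<Longrightarrow> lfun Z (\<lambda>Y. S Y / Y k)"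
  unfolding divide_inverse by (intro lfun_mult lfun_inv_var)

lemma lfun_lmonom: "(\<And>k. k \<in> K \<Longrightarrow> a k < 0 \<Longrightarrow> k \<in> Z) \<Longrightarrow> lfun Z (\<lambda>Y. lmonom Y K a)"
  unfolding lmonom_def
  by (intro lfun_prod) (metis lfun_powi lfun_powi_nonneg not_less)

text \<open>A single denominator and a single numerator serve all families \<open>Y\<close> at once,
  including those that are not algebraically independent, as long as the variables in
  \<open>Z\<close> do not vanish.\<close>

lemma lfun_rep:
  fixes T :: "('n::{finite,linorder} \<Rightarrow> ('n, 'r::idom) ratfun) \<Rightarrow> ('n, 'r) ratfun"
  assumes "lfun Z T"
  obtains c m p where "c \<noteq> 0" "\<And>k. k \<notin> Z \<Longrightarrow> m k = 0"
    "\<And>Y. (\<forall>k\<in>Z. Y k \<noteq> 0) \<Longrightarrow> emb c * peval Y (pmon m) * T Y = peval Y p"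
proof -
  have "\<exists>c m p. c \<noteq> 0 \<and> (\<forall>k. k \<notin> Z \<longrightarrow> m k = 0) \<and>
    (\<forall>Y. (\<forall>k\<in>Z. Y k \<noteq> 0) \<longrightarrow> emb c * peval Y (pmon m) * T Y = peval Y p)"
    using assms
  proof induction
    case (lfun_emb d)
    show ?case by (rule exI[of _ 1], rule exI[of _ "\<lambda>_. 0"], rule exI[of _ "mconst d"]) simp
  next
    case (lfun_inv_emb d)
    then show ?case by (intro exI[of _ d] exI[of _ "\<lambda>_. 0"] exI[of _ 1]) simp
  next
    case (lfun_var k)
    show ?case by (rule exI[of _ 1], rule exI[of _ "\<lambda>_. 0"], rule exI[of _ "mvar k"]) simp
  next
    case (lfun_inv_var k)
    have "pmon ((\<lambda>_. 0)(k := Suc 0)) = (mvar k :: ('n, 'r) mpoly)"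
      using pmon_Suc[of "\<lambda>_. 0" k] by simp
    then have "emb 1 * peval Y (pmon ((\<lambda>_. 0)(k := Suc 0))) * inverse (Y k) = peval Y 1"
      if "\<forall>k\<in>Z. Y k \<noteq> 0" for Y :: "'n \<Rightarrow> ('n, 'r) ratfun"
      using that lfun_inv_var by simp
    moreover have "((\<lambda>_. 0)(k := Suc 0)) j = 0" if "j \<notin> Z" for j
      using that lfun_inv_var by auto
    ultimately show ?case using one_neq_zero by blast
  next
    case (lfun_add S T)
    then obtain c m p d n q where *: "c \<noteq> 0" "d \<noteq> 0" "\<And>k. k \<notin> Z \<Longrightarrow> m k = 0" "\<And>k. k \<notin> Z \<Longrightarrow> n k = 0"
      "\<And>Y. (\<forall>k\<in>Z. Y k \<noteq> 0) \<Longrightarrow> emb c * peval Y (pmon m) * S Y = peval Y p"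
      "\<And>Y. (\<forall>k\<in>Z. Y k \<noteq> 0) \<Longrightarrow> emb d * peval Y (pmon n) * T Y = peval Y q" by metis
    show ?case
    proof (intro exI conjI allI impI)
      show "c * d \<noteq> 0" using * by simp
      show "m k + n k = 0" if "k \<notin> Z" for k using * that by simp
      fix Y :: "'n \<Rightarrow> ('n, 'r) ratfun" assume Y: "\<forall>k\<in>Z. Y k \<noteq> 0"
      have "emb (c * d) * peval Y (pmon (\<lambda>k. m k + n k)) * (S Y + T Y) =
        emb d * peval Y (pmon n) * (emb c * peval Y (pmon m) * S Y) +
        emb c * peval Y (pmon m) * (emb d * peval Y (pmon n) * T Y)"
        by (simp add: pmon_add emb_mult algebra_simps)
      also have "\<dots> = peval Y (mconst d * pmon n * p + mconst c * pmon m * q)"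
        by (simp add: *(5,6)[OF Y])
      finally show "emb (c * d) * peval Y (pmon (\<lambda>k. m k + n k)) * (S Y + T Y) = \<dots>" .
    qed
  next
    case (lfun_mult S T)
    then obtain c m p d n q where *: "c \<noteq> 0" "d \<noteq> 0" "\<And>k. k \<notin> Z \<Longrightarrow> m k = 0" "\<And>k. k \<notin> Z \<Longrightarrow> n k = 0"
      "\<And>Y. (\<forall>k\<in>Z. Y k \<noteq> 0) \<Longrightarrow> emb c * peval Y (pmon m) * S Y = peval Y p"
      "\<And>Y. (\<forall>k\<in>Z. Y k \<noteq> 0) \<Longrightarrow> emb d * peval Y (pmon n) * T Y = peval Y q" by metis
    show ?case
    proof (intro exI conjI allI impI)
      show "c * d \<noteq> 0" using * by simp
      show "m k + n k = 0" if "k \<notin> Z" for k using * that by simp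
      fix Y :: "'n \<Rightarrow> ('n, 'r) ratfun" assume Y: "\<forall>k\<in>Z. Y k \<noteq> 0"
      have "emb (c * d) * peval Y (pmon (\<lambda>k. m k + n k)) * (S Y * T Y) =
        (emb c * peval Y (pmon m) * S Y) * (emb d * peval Y (pmon n) * T Y)"
        by (simp add: pmon_add emb_mult algebra_simps)
      also have "\<dots> = peval Y (p * q)"
        by (simp add: *(5,6)[OF Y])
      finally show "emb (c * d) * peval Y (pmon (\<lambda>k. m k + n k)) * (S Y * T Y) = \<dots>" .
    qed
  qed
  then show ?thesis using that by blast
qed

lemma peval_pmon_neq_0: "(\<And>k. m k \<noteq> 0 \<Longrightarrow> Y k \<noteq> 0) \<Longrightarrow> peval Y (pmon m) \<noteq> 0"
  by (auto simp: peval_pmon prod_zero_iff)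

text \<open>After clearing denominators, equality at an independent family is equality of
  polynomials and can be specialized. Most uses set one variable to 0 or apply a substitution that
  is an involution.\<close>

lemma lfun_identity:
  assumes X: "alg_ind X" and S: "lfun Z S" and T: "lfun Z T" and eq: "S X = T X"
    and Y: "\<And>k. k \<in> Z \<Longrightarrow> Y k \<noteq> 0"
  shows "S Y = T Y"
proof -
  obtain c m p where p: "c \<noteq> 0" "\<And>k. k \<notin> Z \<Longrightarrow> m k = 0"
    "\<And>Y. (\<forall>k\<in>Z. Y k \<noteq> 0) \<Longrightarrow> emb c * peval Y (pmon m) * S Y = peval Y p"
    using lfun_rep[OF S] by blast
  obtain d n q where q: "d \<noteq> 0" "\<And>k. k \<notin> Z \<Longrightarrow> n k = 0"
    "\<And>Y. (\<forall>k\<in>Z. Y k \<noteq> 0) \<Longrightarrow> emb d * peval Y (pmon n) * T Y = peval Y q"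
    using lfun_rep[OF T] by blast
  have XZ: "\<forall>k\<in>Z. X k \<noteq> 0" using alg_ind_nonzero[OF X] by blast
  have "peval X (mconst d * pmon n * p) = peval X (mconst c * pmon m * q)"
    using p(3)[OF XZ, symmetric] q(3)[OF XZ, symmetric] eq by (simp add: mult_ac)
  then have pq: "mconst d * pmon n * p = mconst c * pmon m * q"
    using X alg_ind_eq_iff by blast
  have YZ: "\<forall>k\<in>Z. Y k \<noteq> 0" using Y by blast
  have "peval Y (mconst d * pmon n * p) = peval Y (mconst c * pmon m * q)" by (simp only: pq)
  then have "(emb c * emb d * peval Y (pmon m) * peval Y (pmon n)) * S Y =
    (emb c * emb d * peval Y (pmon m) * peval Y (pmon n)) * T Y"
    using p(3)[OF YZ, symmetric] q(3)[OF YZ, symmetric] by (simp add: mult_ac)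
  moreover have "peval Y (pmon m) \<noteq> 0" "peval Y (pmon n) \<noteq> 0"
    using p(2) q(2) Y by (metis peval_pmon_neq_0)+
  ultimately show ?thesis using p(1) q(1) by simp
qed

section \<open>Laurent polynomial rings\<close>

lemma lmonom_neq_0: "(\<And>k. k \<in> K \<Longrightarrow> X k \<noteq> 0) \<Longrightarrow> lmonom X K a \<noteq> 0"
  by (auto simp: lmonom_def prod_zero_iff[OF finite] power_int_eq_0_iff)

lemma lmonom_add:
  assumes "\<And>k. k \<in> K \<Longrightarrow> X k \<noteq> 0"
  shows "lmonom X K (\<lambda>k. a k + b k) = lmonom X K a * lmonom X K b"
  unfolding lmonom_def prod.distrib[symmetric]
  by (rule prod.cong) (auto simp: power_int_add assms)

lemma lmonom_uminus: "lmonom X K (\<lambda>k. - a k) = inverse (lmonom X K a)"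
  by (simp add: lmonom_def power_int_minus prod_inversef[symmetric] o_def)

lemma lmonom_pmon: "lmonom X UNIV (\<lambda>k. int (m k)) = peval X (pmon m)"
  by (simp add: lmonom_def peval_pmon)

lemma lmonom_0 [simp]: "lmonom X K (\<lambda>_. 0) = 1"
  by (simp add: lmonom_def)

lemma lmonom_UNIV_remove: "lmonom X UNIV a = X i powi a i * lmonom X (UNIV - {i}) a"
  by (simp add: lmonom_def prod.remove[of UNIV i])

lemma lmonom_extend: "lmonom X K a = lmonom X UNIV (\<lambda>k. if k \<in> K then a k else 0)"
proof -
  have "lmonom X UNIV (\<lambda>k. if k \<in> K then a k else 0) = (\<Prod>k\<in>UNIV. if k \<in> K then X k powi a k else 1)"
    unfolding lmonom_def by (rule prod.cong) auto
  then show ?thesis by (simp add: lmonom_def prod.If_cases)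
qed

lemma lmonom_upd: "i \<notin> K \<Longrightarrow> lmonom (X(i := v)) K a = lmonom X K a"
  unfolding lmonom_def by (rule prod.cong) auto

lemma laurent_ring_iff:
  assumes "\<And>k. X k \<noteq> 0"
  shows "f \<in> laurent_ring X \<longleftrightarrow> (\<exists>m p. f * peval X (pmon m) = peval X p)"
proof
  assume "f \<in> laurent_ring X"
  then obtain a p where f: "f = lmonom X UNIV a * peval X p" by (auto simp: laurent_ring_def)
  define m where "m k = nat (- a k)" for k
  define n where "n k = nat (a k)" for k
  have "lmonom X UNIV a * lmonom X UNIV (\<lambda>k. int (m k)) = lmonom X UNIV (\<lambda>k. int (n k))"
  proof -
    have "(\<lambda>k. a k + int (m k)) = (\<lambda>k. int (n k))" by (auto simp: m_def n_def)
    then show ?thesis using lmonom_add[of UNIV X a "\<lambda>k. int (m k)"] assms by simp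
  qed
  then have "f * peval X (pmon m) = peval X (pmon n * p)"
    by (simp add: f lmonom_pmon mult_ac)
  then show "\<exists>m p. f * peval X (pmon m) = peval X p" by blast
next
  assume "\<exists>m p. f * peval X (pmon m) = peval X p"
  then obtain m p where mp: "f * peval X (pmon m) = peval X p" by blast
  have "peval X (pmon m) \<noteq> 0" using assms peval_pmon_neq_0 by blast
  then have "f = lmonom X UNIV (\<lambda>k. - int (m k)) * peval X p"
    using mp unfolding lmonom_uminus lmonom_pmon by (simp add: field_simps)
  then show "f \<in> laurent_ring X" by (auto simp: laurent_ring_def)
qed

lemma peval_in_laurent [simp]: "peval X p \<in> laurent_ring X"
  unfolding laurent_ring_def by (rule CollectI, intro exI[of _ "\<lambda>_. 0"] exI[of _ p]) simp

lemma lmonom_in_laurent [simp]: "lmonom X K a \<in> laurent_ring X"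
  unfolding laurent_ring_def lmonom_extend[of X K]
  by (rule CollectI, intro exI[of _ "\<lambda>k. if k \<in> K then a k else 0"] exI[of _ 1]) simp

lemma laurent_ring_mult:
  assumes "\<And>k. X k \<noteq> 0" "f \<in> laurent_ring X" "g \<in> laurent_ring X"
  shows "f * g \<in> laurent_ring X"
proof -
  obtain m p n q where "f * peval X (pmon m) = peval X p" "g * peval X (pmon n) = peval X q"
    using assms by (auto simp: laurent_ring_iff)
  then have "(f * peval X (pmon m)) * (g * peval X (pmon n)) = peval X (p * q)" by simp
  then have "f * g * peval X (pmon (\<lambda>k. m k + n k)) = peval X (p * q)"
    by (simp add: pmon_add mult_ac)
  then show ?thesis using assms(1) laurent_ring_iff by blast
qed

lemma laurent_ring_add:
  assumes "\<And>k. X k \<noteq> 0" "f \<in> laurent_ring X" "g \<in> laurent_ring X"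
  shows "f + g \<in> laurent_ring X"
proof -
  obtain m p n q where *: "f * peval X (pmon m) = peval X p" "g * peval X (pmon n) = peval X q"
    using assms by (auto simp: laurent_ring_iff)
  have "(f + g) * peval X (pmon (\<lambda>k. m k + n k)) = 
    f * peval X (pmon m) * peval X (pmon n) + g * peval X (pmon n) * peval X (pmon m)"
    by (simp add: pmon_add algebra_simps)
  also have "\<dots> = peval X (p * pmon n + q * pmon m)" by (simp add: *)
  finally show ?thesis using assms(1) laurent_ring_iff by blast
qed

lemma laurent_ring_power:
  assumes "\<And>k. X k \<noteq> 0" "f \<in> laurent_ring X"
  shows "f ^ n \<in> laurent_ring X"
proof (induction n)
  case (Suc n)
  show ?case unfolding power_Suc by (rule laurent_ring_mult[OF assms(1) assms(2) Suc])
qed (use peval_in_laurent[of X 1] in simp)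

lemma lfun_in_laurent:
  assumes "lfun Z T" "\<And>k. X k \<noteq> 0"
  obtains c where "c \<noteq> 0" "emb c * T X \<in> laurent_ring X"
proof -
  obtain c m p where p: "c \<noteq> 0"
    "\<And>Y. (\<forall>k\<in>Z. Y k \<noteq> 0) \<Longrightarrow> emb c * peval Y (pmon m) * T Y = peval Y p"
    using lfun_rep[OF assms(1)] by metis
  have "emb c * T X * peval X (pmon m) = peval X p"
    using p(2)[of X] assms(2) by (simp add: mult_ac)
  then show ?thesis using p(1) that laurent_ring_iff[of X] assms(2) by blast
qed

text \<open>A prime that no variable divides does not divide a monomial, so the monomial denominator
  of a Laurent quotient can be cancelled.\<close>

lemma dvd_in_laurent_iff:
  assumes X: "alg_ind X" and C: "prime_elem C" "\<And>k. \<not> mvar k dvd C"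
  shows "dvd_in (laurent_ring X) (peval X C) (peval X p) \<longleftrightarrow> C dvd p"
proof
  assume "dvd_in (laurent_ring X) (peval X C) (peval X p)"
  then obtain g where g: "g \<in> laurent_ring X" "peval X p = peval X C * g"
    by (auto simp: dvd_in_def)
  then obtain m q where "g * peval X (pmon m) = peval X q"
    using laurent_ring_iff alg_ind_nonzero[OF X] by blast
  then have "peval X (p * pmon m) = peval X (C * q)"
    by (simp add: g(2) mult.assoc)
  then have "p * pmon m = C * q" using X alg_ind_eq_iff by blast
  then have "C dvd p * pmon m" by simp
  then show "C dvd p"
    using prime_not_dvd_pmon[OF C] prime_elem_dvd_multD[OF C(1)] by blast
next
  assume "C dvd p"
  then obtain q where "p = C * q" by (elim dvdE)
  then have "peval X p = peval X C * peval X q" by simp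
  then show "dvd_in (laurent_ring X) (peval X C) (peval X p)"
    unfolding dvd_in_def using peval_in_laurent by blast
qed

section \<open>Constants and primitive polynomials\<close>

text \<open>The nonzero elements of \<open>Frac R\<close>. Constants are tracked only up to these;
  \<open>gauss_units_fconst\<close> later turns them into units of \<open>R\<close>.\<close>

definition fconst :: "('n::{finite,linorder}, 'r::idom) ratfun \<Rightarrow> bool" where
  "fconst \<kappa> \<longleftrightarrow> (\<exists>a b. a \<noteq> 0 \<and> b \<noteq> 0 \<and> \<kappa> = emb a / emb b)"

lemma fconst_neq_0: "fconst \<kappa> \<Longrightarrow> \<kappa> \<noteq> 0"
  by (auto simp: fconst_def)

lemma fconst_emb: "c \<noteq> 0 \<Longrightarrow> fconst (emb c)"
  unfolding fconst_def by (intro exI[of _ c] exI[of _ 1]) simp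

lemma fconst_1 [simp]: "fconst 1"
  using fconst_emb[of 1] by simp

lemma fconst_mult: "fconst \<kappa> \<Longrightarrow> fconst \<mu> \<Longrightarrow> fconst (\<kappa> * \<mu>)"
  unfolding fconst_def
  by (elim exE conjE, rule_tac x = "a * aa" in exI, rule_tac x = "b * ba" in exI)
    (simp add: emb_mult)

lemma fconst_inverse: "fconst \<kappa> \<Longrightarrow> fconst (inverse \<kappa>)"
  unfolding fconst_def by (elim exE conjE, rule_tac x = b in exI, rule_tac x = a in exI) simp

lemma fconst_divide: "fconst \<kappa> \<Longrightarrow> fconst \<mu> \<Longrightarrow> fconst (\<kappa> / \<mu>)"
  unfolding divide_inverse by (intro fconst_mult fconst_inverse)

lemma fconst_prod: "(\<And>a. a \<in> S \<Longrightarrow> fconst (f a)) \<Longrightarrow> fconst (\<Prod>a\<in>S. f a)"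
  by (induction S rule: infinite_finite_induct) (auto intro: fconst_mult)

lemma fconst_power: "fconst \<kappa> \<Longrightarrow> fconst (\<kappa> ^ n)"
  by (induction n) (auto intro: fconst_mult)

lemma fconst_powi: "fconst \<kappa> \<Longrightarrow> fconst (\<kappa> powi n)"
  by (auto simp: power_int_def intro: fconst_power fconst_inverse)

lemma lfun_fconst: "fconst \<kappa> \<Longrightarrow> lfun Z (\<lambda>Y. \<kappa>)"
  unfolding fconst_def divide_inverse by (auto intro!: lfun_mult lfun_emb lfun_inv_emb)

definition primitive :: "('n::{finite,linorder}, 'r::idom) mpoly \<Rightarrow> bool" where
  "primitive p \<longleftrightarrow> (\<forall>c. mconst c dvd p \<longrightarrow> c dvd 1)"

lemma primitive_neq_0: "primitive p \<Longrightarrow> p \<noteq> 0"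
  unfolding primitive_def by (metis dvd_0_right mconst_0 dvd_0_left zero_neq_one)

lemma irreducible_mconst:
  fixes c :: "'r::idom"
  assumes "irreducible c"
  shows "irreducible (mconst c :: ('n::{finite,linorder}, 'r) mpoly)"
proof (rule irreducibleI)
  fix a b :: "('n, 'r) mpoly" assume ab: "mconst c = a * b"
  have c0: "c \<noteq> 0" using assms by auto
  then have "a * b \<noteq> 0" using ab[symmetric] by simp
  then have "a \<noteq> 0" "b \<noteq> 0" by auto
  then have "mvars a \<union> mvars b = {}" using mvars_mult[of a b] ab by (metis mvars_mconst)
  then obtain d e where "a = mconst d" "b = mconst e" using mvars_empty[of a] mvars_empty[of b] by auto
  with ab assms show "a dvd 1 \<or> b dvd 1"
    by (auto simp flip: mconst_mult dest: irreducibleD)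
qed (use assms in \<open>auto simp: irreducible_def\<close>)

lemma not_primitiveE:
  fixes p :: "('n::{finite,linorder}, 'r::{factorial_semiring,idom}) mpoly"
  assumes "\<not> primitive p" "p \<noteq> 0"
  obtains \<pi> where "\<not> \<pi> dvd 1" "prime_elem (mconst \<pi> :: ('n, 'r) mpoly)" "mconst \<pi> dvd p"
proof -
  obtain c where c: "mconst c dvd p" "\<not> c dvd 1" using assms by (auto simp: primitive_def)
  then have "c \<noteq> 0" using assms(2) by auto
  then obtain \<pi> where \<pi>: "\<pi> dvd c" "prime \<pi>" using prime_divisor_exists c(2) by blast
  then have "irreducible \<pi>" by (simp add: prime_elem_imp_irreducible)
  then have "prime_elem (mconst \<pi> :: ('n, 'r) mpoly)"
    using irreducible_mconst mpoly_irreducible_imp_prime_elem by blast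
  moreover have "mconst \<pi> dvd p" using \<pi>(1) c(1) dvd_trans mconst_dvd_mconst_iff by blast
  moreover have "\<not> \<pi> dvd 1" using \<pi>(2) not_prime_unit by blast
  ultimately show ?thesis using that by blast
qed

text \<open>Gauss' lemma: a nonunit constant divisor yields a prime of \<open>R\<close>, and the
  primes of \<open>R\<close> stay prime in the polynomial ring.\<close>

lemma primitive_mult:
  fixes p q :: "('n::{finite,linorder}, 'r::{factorial_semiring,idom}) mpoly"
  assumes "primitive p" "primitive q"
  shows "primitive (p * q)"
proof (rule ccontr)
  assume "\<not> primitive (p * q)"
  then obtain \<pi> where \<pi>: "\<not> \<pi> dvd 1" "prime_elem (mconst \<pi> :: ('n, 'r) mpoly)" "mconst \<pi> dvd p * q"
    using assms[THEN primitive_neq_0] by (elim not_primitiveE) auto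
  then have "mconst \<pi> dvd p \<or> mconst \<pi> dvd q" using prime_elem_dvd_multD by blast
  with assms \<pi>(1) show False unfolding primitive_def by blast
qed

lemma primitive_1 [simp]: "primitive 1"
  by (simp add: primitive_def)

lemma primitive_irreducible:
  assumes "irreducible p" "mvars p \<noteq> {}"
  shows "primitive p"
  unfolding primitive_def
proof (intro allI impI)
  fix c assume c: "mconst c dvd p"
  from irreducible_dvd_cases[OF assms(1) this] show "c dvd 1"
  proof
    assume p: "p dvd mconst c"
    have "c \<noteq> 0" using c assms(1) by auto
    with mvars_dvd[OF p] assms(2) show ?thesis by auto
  qed simp
qed

lemma irreducible_mvar: "irreducible (mvar k :: ('n::{finite,linorder}, 'r::idom) mpoly)"
proof (rule irreducibleI)
  fix a b :: "('n, 'r) mpoly" assume ab: "mvar k = a * b"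
  have unit: "q dvd 1" if p: "mvar k dvd p" and eq: "mvar k = p * q" for p q :: "('n, 'r) mpoly"
  proof -
    obtain r where "p = mvar k * r" using p by (elim dvdE)
    with eq have "mvar k * 1 = mvar k * (q * r)" by (simp add: mult_ac)
    then have "1 = q * r" unfolding mult_cancel_left by simp
    then show ?thesis by (rule dvdI)
  qed
  have "mvar k dvd a * b" using ab by simp
  then have "mvar k dvd a \<or> mvar k dvd b" using prime_elem_dvd_multD[OF prime_elem_mvar] by blast
  then show "a dvd 1 \<or> b dvd 1" using unit[of a b] unit[of b a] ab by (auto simp: mult.commute)
qed (use prime_elem_mvar[of k] in \<open>auto dest: prime_elem_not_unit\<close>)

lemma primitive_mvar: "primitive (mvar k)"
  by (rule primitive_irreducible) (simp_all add: irreducible_mvar)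

lemma primitive_pmon: "primitive (pmon m :: ('n::{finite,linorder}, 'r::{factorial_semiring,idom}) mpoly)"
proof -
  have pw: "primitive (p ^ j)" if "primitive p" for p :: "('n, 'r) mpoly" and j
    using that by (induction j) (auto intro: primitive_mult)
  have "primitive (\<Prod>k\<in>S. mvar k ^ m k :: ('n, 'r) mpoly)" for S
    by (induction S rule: infinite_finite_induct) (auto intro: primitive_mult pw primitive_mvar)
  then show ?thesis by (simp add: pmon_def)
qed

text \<open>The prime factors of \<open>a\<close> are cancelled one at a time: none divides the
  primitive \<open>q\<close>, so each divides what is left of \<open>b\<close>.\<close>

lemma mconst_dvd_mult_primitive:
  fixes q :: "('n::{finite,linorder}, 'r::{factorial_semiring,idom}) mpoly"
  assumes "mconst a dvd mconst b * q" "primitive q" "a \<noteq> 0"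
  shows "a dvd b"
proof -
  obtain M where M: "\<And>x. x \<in># M \<Longrightarrow> prime_elem x" "normalize (prod_mset M) = normalize a"
    using prime_factorization_exists[OF assms(3)] by blast
  have "prod_mset M dvd b" if "mconst (prod_mset M) dvd mconst b * q" for b
    using that M(1)
  proof (induction M arbitrary: b)
    case (add x M)
    have x: "prime_elem x" using add.prems by simp
    then have x0: "x \<noteq> 0" and xu: "\<not> x dvd 1" by (auto simp: prime_elem_not_unit)
    have mx: "prime_elem (mconst x :: ('n, 'r) mpoly)"
      using x irreducible_mconst mpoly_irreducible_imp_prime_elem prime_elem_imp_irreducible by blast
    obtain w where w: "mconst b * q = mconst x * (mconst (prod_mset M) * w)"
      using add.prems(1) unfolding prod_mset.add_mset mconst_mult dvd_def mult.assoc by blast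
    then have "mconst x dvd mconst b * q" by simp
    then have "mconst x dvd (mconst b :: ('n, 'r) mpoly)"
      using prime_elem_dvd_multD[OF mx] assms(2) xu unfolding primitive_def by blast
    then obtain b' where b': "b = x * b'" by (auto elim: dvdE)
    have "mconst b' * q = mconst (prod_mset M) * w"
      using w x0 by (simp add: b' mconst_mult mult.assoc)
    then have "mconst (prod_mset M) dvd mconst b' * q" by simp
    then have "prod_mset M dvd b'" using add by simp
    then show ?case by (simp add: b')
  qed simp
  moreover have "prod_mset M dvd a" "a dvd prod_mset M"
    using M(2) associated_iff_dvd by blast+
  ultimately show ?thesis using assms(1)
    by (meson dvd_trans mconst_dvd_mconst_iff mult_dvd_mono dvd_refl)
qed

text \<open>The elements whose Gauss valuation at every prime of \<open>R\<close> is trivial.\<close>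

definition gauss_units ::
  "('n::{finite,linorder} \<Rightarrow> ('n, 'r::idom) ratfun) \<Rightarrow> ('n, 'r) ratfun set" where
  "gauss_units x = {peval x p / peval x q | p q. primitive p \<and> primitive q}"

lemma gauss_units_mult:
  fixes x :: "'n::{finite,linorder} \<Rightarrow> ('n, 'r::{factorial_semiring,idom}) ratfun"
  assumes "f \<in> gauss_units x" "g \<in> gauss_units x"
  shows "f * g \<in> gauss_units x"
proof -
  obtain p q r s where "primitive p" "primitive q" "primitive r" "primitive s"
    "f = peval x p / peval x q" "g = peval x r / peval x s"
    using assms by (auto simp: gauss_units_def)
  then show ?thesis unfolding gauss_units_def
    by (intro CollectI exI[of _ "p * r"] exI[of _ "q * s"]) (auto intro: primitive_mult)
qed

lemma gauss_units_inverse: "f \<in> gauss_units x \<Longrightarrow> inverse f \<in> gauss_units x"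
  unfolding gauss_units_def by (elim CollectE exE conjE, rule CollectI, rule_tac x = q in exI,
      rule_tac x = p in exI) simp

lemma gauss_units_divide:
  fixes x :: "'n::{finite,linorder} \<Rightarrow> ('n, 'r::{factorial_semiring,idom}) ratfun"
  shows "f \<in> gauss_units x \<Longrightarrow> g \<in> gauss_units x \<Longrightarrow> f / g \<in> gauss_units x"
  unfolding divide_inverse by (intro gauss_units_mult gauss_units_inverse)

lemma gauss_units_peval: "primitive p \<Longrightarrow> peval x p \<in> gauss_units x"
  unfolding gauss_units_def by (intro CollectI exI[of _ p] exI[of _ 1]) simp

text \<open>From \<open>a * q = b * p\<close> with \<open>p\<close> and \<open>q\<close> primitive,
  \<open>a\<close> and \<open>b\<close> divide each other. In this way an untracked constant is
  recognized as a unit.\<close>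

lemma gauss_units_fconst:
  fixes x :: "'n::{finite,linorder} \<Rightarrow> ('n, 'r::{factorial_semiring,idom}) ratfun"
  assumes x: "alg_ind x" and "\<kappa> \<in> gauss_units x" "fconst \<kappa>"
  obtains u where "u dvd 1" "\<kappa> = emb u"
proof -
  obtain p q where pq: "primitive p" "primitive q" "\<kappa> = peval x p / peval x q"
    using assms by (auto simp: gauss_units_def)
  obtain a b where ab: "a \<noteq> 0" "b \<noteq> 0" "\<kappa> = emb a / emb b" using assms by (auto simp: fconst_def)
  have "peval x q \<noteq> 0" using pq primitive_neq_0 x alg_ind_eq_0_iff by blast
  with pq ab have "peval x (mconst a * q) = peval x (mconst b * p)"
    by (simp add: field_simps)
  then have eq: "mconst a * q = mconst b * p" using x alg_ind_eq_iff by blast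
  have "a dvd b" using mconst_dvd_mult_primitive[of a b p] eq pq ab by (metis dvd_triv_left)
  moreover have "b dvd a" using mconst_dvd_mult_primitive[of b a q] eq pq ab by (metis dvd_triv_left)
  then obtain u where u: "a = b * u" by (elim dvdE)
  ultimately have "u dvd 1" using ab(2) by auto
  moreover have "\<kappa> = emb u" using ab u by (simp add: emb_mult)
  ultimately show ?thesis using that by blast
qed

section \<open>Clusters attached to activation sequences\<close>

text \<open>Up to a constant, \<open>Yh \<beta> x S\<close> is the cluster variable common to the seeds whose activation
  sequence has an initial segment with the set of entries \<open>S\<close>; \<open>Vh\<close> below is the cluster of the
  sequence \<open>ps\<close>.\<close>

definition Yh :: "('n \<Rightarrow> 'a) \<Rightarrow> ('n::finite \<Rightarrow> 'a::field) \<Rightarrow> 'n set \<Rightarrow> 'a" where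
  "Yh \<beta> x S = ((\<Prod>i\<in>S. \<beta> i) + (\<Sum>i\<in>S. (\<Prod>j\<in>S - {i}. \<beta> j) * (\<Prod>j\<in>UNIV - {i}. x j))) / (\<Prod>i\<in>S. x i)"

lemma Yh_empty [simp]: "Yh \<beta> x {} = 1"
  by (simp add: Yh_def)

text \<open>\<open>Yh\<close> is defined in closed form, which is visibly independent of any order
  on \<open>S\<close>; this is the recursion that it solves, and at the same time the exchange
  relation for appending \<open>k\<close>.\<close>

lemma Yh_insert:
  fixes x :: "'n::finite \<Rightarrow> 'a::field"
  assumes x: "\<And>k. x k \<noteq> 0" and k: "k \<notin> S"
  shows "x k * Yh \<beta> x (insert k S) = \<beta> k * Yh \<beta> x S + (\<Prod>i\<in>S. \<beta> i) * (\<Prod>j\<in>- insert k S. x j)"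
proof -
  have fin: "finite S" by simp
  let ?s = "\<Sum>i\<in>S. (\<Prod>j\<in>S - {i}. \<beta> j) * (\<Prod>j\<in>UNIV - {i}. x j)"
  have "(\<Sum>i\<in>S. (\<Prod>j\<in>insert k S - {i}. \<beta> j) * (\<Prod>j\<in>UNIV - {i}. x j)) = \<beta> k * ?s"
    unfolding sum_distrib_left
  proof (rule sum.cong[OF refl])
    fix i assume "i \<in> S"
    then have "insert k S - {i} = insert k (S - {i})" using k by auto
    then show "(\<Prod>j\<in>insert k S - {i}. \<beta> j) * (\<Prod>j\<in>UNIV - {i}. x j) =
        \<beta> k * ((\<Prod>j\<in>S - {i}. \<beta> j) * (\<Prod>j\<in>UNIV - {i}. x j))"
      using k by simp
  qed
  moreover have "insert k S - {k} = S" using k by auto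
  moreover have "(\<Prod>j\<in>UNIV - {k}. x j) = (\<Prod>i\<in>S. x i) * (\<Prod>j\<in>- insert k S. x j)"
  proof -
    have "UNIV - {k} = S \<union> - insert k S" using k by auto
    show ?thesis unfolding \<open>UNIV - {k} = _\<close> by (rule prod.union_disjoint) auto
  qed
  moreover have "(\<Prod>i\<in>S. x i) \<noteq> 0" using x by simp
  ultimately show ?thesis
    using x[of k] k by (simp add: Yh_def field_simps)
qed

text \<open>After multiplication by \<open>x a * x b\<close> the left side is expanded by the
  recursion from \<open>S\<close> at \<open>a\<close> and at \<open>b\<close>; the recursion from
  \<open>insert b S\<close> at \<open>a\<close> collects the result.\<close>

lemma Yh_exchange:
  fixes x :: "'n::finite \<Rightarrow> 'a::field"
  assumes x: "\<And>k. x k \<noteq> 0" and ab: "a \<notin> S" "b \<notin> S" "a \<noteq> b"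
  shows "Yh \<beta> x (insert a S) * Yh \<beta> x (insert b S) =
    Yh \<beta> x S * Yh \<beta> x (insert a (insert b S)) +
    (\<Prod>i\<in>S. \<beta> i)\<^sup>2 * (\<Prod>j\<in>- insert a (insert b S). x j)\<^sup>2"
proof -
  let ?m = "\<Prod>j\<in>- insert a (insert b S). x j"
  define A where "A = (\<Prod>i\<in>S. \<beta> i)"
  have "- insert a S = insert b (- insert a (insert b S))" using ab by auto
  then have m1: "(\<Prod>j\<in>- insert a S. x j) = x b * ?m" using ab by simp
  have "- insert b S = insert a (- insert a (insert b S))" using ab by auto
  then have m2: "(\<Prod>j\<in>- insert b S. x j) = x a * ?m" using ab by simp
  have e1: "x a * Yh \<beta> x (insert a S) = \<beta> a * Yh \<beta> x S + A * (x b * ?m)"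
    using Yh_insert[of x a S \<beta>] x ab by (simp add: m1 A_def)
  have e2: "x b * Yh \<beta> x (insert b S) = \<beta> b * Yh \<beta> x S + A * (x a * ?m)"
    using Yh_insert[of x b S \<beta>] x ab by (simp add: m2 A_def)
  have e3: "x a * Yh \<beta> x (insert a (insert b S)) = \<beta> a * Yh \<beta> x (insert b S) + \<beta> b * A * ?m"
    using Yh_insert[of x a "insert b S" \<beta>] x ab by (simp add: A_def)
  have "x a * x b * (Yh \<beta> x (insert a S) * Yh \<beta> x (insert b S)) =
    (x a * Yh \<beta> x (insert a S)) * (x b * Yh \<beta> x (insert b S))" by (simp add: mult_ac)
  also have "\<dots> = x b * (Yh \<beta> x S * (\<beta> a * Yh \<beta> x (insert b S) + \<beta> b * A * ?m) + x a * (A\<^sup>2 * ?m\<^sup>2))"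
    unfolding e1 using e2 by (simp add: power2_eq_square) algebra
  also have "\<dots> = x a * x b * (Yh \<beta> x S * Yh \<beta> x (insert a (insert b S)) + A\<^sup>2 * ?m\<^sup>2)"
    unfolding e3[symmetric] by (simp add: algebra_simps)
  finally show ?thesis using x[of a] x[of b] by (simp add: A_def)
qed

lemma Yh_reindex:
  fixes \<beta> x :: "'n::finite \<Rightarrow> 'a::field" and \<iota> :: "'n \<Rightarrow> 'n"
  assumes "bij \<iota>"
  shows "Yh (\<beta> \<circ> \<iota>) (x \<circ> \<iota>) S = Yh \<beta> x (\<iota> ` S)"
proof -
  have inj: "inj_on \<iota> T" for T using assms by (metis bij_is_inj inj_on_subset subset_UNIV)
  have img: "\<iota> ` (T - {i}) = \<iota> ` T - {\<iota> i}" for T i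
    using assms by (simp add: bij_is_inj image_set_diff)
  have U: "\<iota> ` UNIV = UNIV" using assms by (simp add: bij_is_surj)
  have p: "(\<Prod>i\<in>T. (f \<circ> \<iota>) i) = (\<Prod>i\<in>\<iota> ` T. f i)" for T and f :: "'n \<Rightarrow> 'a"
    by (simp add: prod.reindex[OF inj] o_def)
  show ?thesis unfolding Yh_def p img U
    by (simp add: sum.reindex[OF inj] o_def)
qed

text \<open>An element that does not occur in \<open>ps\<close> gets the value
  \<open>length ps\<close>.\<close>

definition idx :: "'n list \<Rightarrow> 'n \<Rightarrow> nat" where
  "idx ps q = length (takeWhile (\<lambda>p. p \<noteq> q) ps)"

lemma idx_nth: "distinct ps \<Longrightarrow> l < length ps \<Longrightarrow> idx ps (ps ! l) = l"
proof -
  assume ps: "distinct ps" "l < length ps"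
  have "takeWhile (\<lambda>p. p \<noteq> ps ! l) ps = take l ps"
    by (rule takeWhile_eq_take_P_nth) (use ps in \<open>auto simp: nth_eq_iff_index_eq\<close>)
  then show ?thesis using ps by (simp add: idx_def)
qed

lemma idx_map: "inj \<iota> \<Longrightarrow> idx (map \<iota> ps) (\<iota> q) = idx ps q"
  by (simp add: idx_def takeWhile_map o_def inj_eq)

lemma idx_less: "q \<in> set ps \<Longrightarrow> idx ps q < length ps"
  by (induction ps) (auto simp: idx_def)

definition Vh :: "('n \<Rightarrow> 'a) \<Rightarrow> ('n::finite \<Rightarrow> 'a::field) \<Rightarrow> 'n list \<Rightarrow> 'n \<Rightarrow> 'a" where
  "Vh \<beta> x ps q = (if q \<in> set ps then Yh \<beta> x (set (take (Suc (idx ps q)) ps)) else x q)"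

text \<open>The variable that replaces \<open>Vh \<beta> x ps q\<close> under mutation.\<close>

definition Wh :: "('n \<Rightarrow> 'a) \<Rightarrow> ('n::finite \<Rightarrow> 'a::field) \<Rightarrow> 'n list \<Rightarrow> 'n \<Rightarrow> 'a" where
  "Wh \<beta> x ps q = (if q \<notin> set ps then Yh \<beta> x (insert q (set ps))
     else if Suc (idx ps q) = length ps then x q
     else Yh \<beta> x (insert (ps ! Suc (idx ps q)) (set (take (idx ps q) ps))))"

lemma Vh_nth: "distinct ps \<Longrightarrow> l < length ps \<Longrightarrow> Vh \<beta> x ps (ps ! l) = Yh \<beta> x (set (take (Suc l) ps))"
  by (simp add: Vh_def idx_nth)

lemma Wh_last: "distinct ps \<Longrightarrow> Suc l = length ps \<Longrightarrow> Wh \<beta> x ps (ps ! l) = x (ps ! l)"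
  by (simp add: Wh_def idx_nth)

lemma Wh_nth:
  "distinct ps \<Longrightarrow> Suc l < length ps \<Longrightarrow>
    Wh \<beta> x ps (ps ! l) = Yh \<beta> x (insert (ps ! Suc l) (set (take l ps)))"
  by (simp add: Wh_def idx_nth)

lemma Vh_reindex:
  fixes \<beta> x :: "'n::finite \<Rightarrow> 'a::field" and \<iota> :: "'n \<Rightarrow> 'n"
  assumes "bij \<iota>"
  shows "Vh (\<beta> \<circ> \<iota>) (x \<circ> \<iota>) ps q = Vh \<beta> x (map \<iota> ps) (\<iota> q)"
  using assms unfolding Vh_def
  by (simp add: Yh_reindex idx_map bij_is_inj take_map inj_image_mem_iff)

lemma Wh_reindex:
  fixes \<beta> x :: "'n::finite \<Rightarrow> 'a::field" and \<iota> :: "'n \<Rightarrow> 'n"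
  assumes "bij \<iota>"
  shows "Wh (\<beta> \<circ> \<iota>) (x \<circ> \<iota>) ps q = Wh \<beta> x (map \<iota> ps) (\<iota> q)"
proof -
  have "Suc (idx ps q) < length ps" if "q \<in> set ps" "Suc (idx ps q) \<noteq> length ps"
    using that idx_less[of q ps] by simp
  then show ?thesis using assms unfolding Wh_def
    by (simp add: Yh_reindex idx_map bij_is_inj take_map inj_image_mem_iff)
qed

text \<open>The product \<open>Vh q * Wh q\<close> as a function of the cluster \<open>h\<close>: \<open>Mh \<beta> ps h l\<close> is the product of
  the initial variables outside the first \<open>l\<close> positions of \<open>ps\<close>.\<close>

definition yh :: "'n list \<Rightarrow> ('n \<Rightarrow> 'a::field) \<Rightarrow> nat \<Rightarrow> 'a" where
  "yh ps h l = (if l = 0 then 1 else h (ps ! (l - 1)))"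

definition Ah :: "('n \<Rightarrow> 'a::field) \<Rightarrow> 'n list \<Rightarrow> nat \<Rightarrow> 'a" where
  "Ah \<beta> ps l = (\<Prod>q\<in>set (take l ps). \<beta> q)"

text \<open>Recursion on the distance from the end of \<open>ps\<close>, since only the inactive
  initial variables belong to the cluster. The quotient that is multiplied in is the initial
  variable at the next position to the left, solved from the recursion for
  \<open>Yh\<close>.\<close>

primrec Mr :: "('n \<Rightarrow> 'a) \<Rightarrow> 'n list \<Rightarrow> ('n::finite \<Rightarrow> 'a::field) \<Rightarrow> nat \<Rightarrow> 'a" where
  "Mr \<beta> ps h 0 = (\<Prod>p\<in>- set ps. h p)"
| "Mr \<beta> ps h (Suc d) = Mr \<beta> ps h d *
     (\<beta> (ps ! (length ps - Suc d)) * yh ps h (length ps - Suc d) + Ah \<beta> ps (length ps - Suc d) * Mr \<beta> ps h d) /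
     yh ps h (Suc (length ps - Suc d))"

definition Mh :: "('n \<Rightarrow> 'a) \<Rightarrow> 'n list \<Rightarrow> ('n::finite \<Rightarrow> 'a::field) \<Rightarrow> nat \<Rightarrow> 'a" where
  "Mh \<beta> ps h l = Mr \<beta> ps h (length ps - l)"

lemma Mh_length: "Mh \<beta> ps h (length ps) = (\<Prod>p\<in>- set ps. h p)"
  by (simp add: Mh_def)

lemma Mh_rec:
  assumes "l < length ps"
  shows "Mh \<beta> ps h l = Mh \<beta> ps h (Suc l) *
    (\<beta> (ps ! l) * yh ps h l + Ah \<beta> ps l * Mh \<beta> ps h (Suc l)) / yh ps h (Suc l)"
proof -
  have "length ps - l = Suc (length ps - Suc l)" "length ps - Suc (length ps - Suc l) = l"
    using assms by auto
  then show ?thesis unfolding Mh_def by simp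
qed

lemma Mh_induct [consumes 1, case_names length step]:
  assumes "l \<le> length ps" "P (length ps)" "\<And>l. l < length ps \<Longrightarrow> P (Suc l) \<Longrightarrow> P l"
  shows "P l"
  using assms by (induction rule: inc_induct) auto

lemma Mh_cong:
  assumes "l \<le> length ps" "\<And>p. p \<notin> set ps \<Longrightarrow> h p = h' p"
    "\<And>m. m < length ps \<Longrightarrow> l \<le> Suc m \<Longrightarrow> h (ps ! m) = h' (ps ! m)"
    "\<And>m. m < length ps \<Longrightarrow> l \<le> m \<Longrightarrow> \<beta> (ps ! m) = \<beta>' (ps ! m) \<and> Ah \<beta> ps m = Ah \<beta>' ps m"
  shows "Mh \<beta> ps h l = Mh \<beta>' ps h' l"
  using assms
proof (induction rule: Mh_induct)
  case length
  then show ?case by (auto simp: Mh_length intro: prod.cong)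
next
  case (step l)
  have "yh ps h l = yh ps h' l" "yh ps h (Suc l) = yh ps h' (Suc l)"
    using step by (auto simp: yh_def)
  then show ?case using step by (simp add: Mh_rec)
qed

lemma Mh_upd_early:
  assumes "distinct ps" "l \<le> length ps" "Suc m < l"
  shows "Mh \<beta> ps (h(ps ! m := v)) l = Mh \<beta> ps h l"
  by (rule Mh_cong) (use assms nth_mem[of m ps] in \<open>auto simp: nth_eq_iff_index_eq\<close>)

text \<open>All these products keep the product of the inactive variables as a factor.\<close>

lemma Mh_inactive_0:
  assumes "k \<notin> set ps" "h k = 0" "l \<le> length ps"
  shows "Mh \<beta> ps h l = 0"
  using assms(3)
proof (induction rule: Mh_induct)
  case length
  then show ?case using assms(1,2) by (auto simp: Mh_length)
qed (simp add: Mh_rec)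

text \<open>The right sides of the exchange relations for appending \<open>q\<close>, removing it as
  the last entry, and interchanging it with its successor. They are functions of an arbitrary family
  because the definition of mutation evaluates exchange polynomials away from the cluster.\<close>

definition Tfun :: "('n \<Rightarrow> 'a) \<Rightarrow> 'n list \<Rightarrow> 'n \<Rightarrow> ('n::finite \<Rightarrow> 'a::field) \<Rightarrow> 'a" where
  "Tfun \<beta> ps q h = (if q \<notin> set ps then \<beta> q * yh ps h (length ps) + Ah \<beta> ps (length ps) * (\<Prod>p\<in>- insert q (set ps). h p)
     else let l = idx ps q in
       if Suc l = length ps then \<beta> q * yh ps h l + Ah \<beta> ps l * Mh \<beta> ps h (length ps)
       else yh ps h l * yh ps h (l + 2) + (Ah \<beta> ps l)\<^sup>2 * (Mh \<beta> ps h (l + 2))\<^sup>2)"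

text \<open>The variables that \<open>Tfun\<close> may have in its denominator: unfolding
  \<open>Mh\<close> from \<open>l + 2\<close> on divides by the variables at the positions
  \<open>m \<ge> l + 2\<close>.\<close>

definition Zset :: "'n list \<Rightarrow> 'n \<Rightarrow> 'n set" where
  "Zset ps q = (if q \<in> set ps then {ps ! m | m. idx ps q + 2 \<le> m \<and> m < length ps} else {})"

lemma Tfun_inactive:
  "q \<notin> set ps \<Longrightarrow> Tfun \<beta> ps q h =
    \<beta> q * yh ps h (length ps) + Ah \<beta> ps (length ps) * (\<Prod>p\<in>- insert q (set ps). h p)"
  by (simp add: Tfun_def)

lemma Tfun_last:
  "distinct ps \<Longrightarrow> Suc l = length ps \<Longrightarrow> Tfun \<beta> ps (ps ! l) h =
    \<beta> (ps ! l) * yh ps h l + Ah \<beta> ps l * (\<Prod>p\<in>- set ps. h p)"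
  by (simp add: Tfun_def idx_nth Let_def Mh_length)

lemma Tfun_mid:
  "distinct ps \<Longrightarrow> Suc l < length ps \<Longrightarrow> Tfun \<beta> ps (ps ! l) h =
    yh ps h l * yh ps h (l + 2) + (Ah \<beta> ps l)\<^sup>2 * (Mh \<beta> ps h (l + 2))\<^sup>2"
  by (simp add: Tfun_def idx_nth Let_def)

lemma Zset_inactive: "q \<notin> set ps \<Longrightarrow> Zset ps q = {}"
  by (simp add: Zset_def)

lemma Zset_nth: "distinct ps \<Longrightarrow> l < length ps \<Longrightarrow>
    Zset ps (ps ! l) = {ps ! m | m. l + 2 \<le> m \<and> m < length ps}"
  by (simp add: Zset_def idx_nth)

lemma nth_in_Zset_iff:
  "distinct ps \<Longrightarrow> l < length ps \<Longrightarrow> m < length ps \<Longrightarrow> ps ! m \<in> Zset ps (ps ! l) \<longleftrightarrow> l + 2 \<le> m"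
  by (auto simp: Zset_nth nth_eq_iff_index_eq)

lemma Ah_Suc: "distinct ps \<Longrightarrow> l < length ps \<Longrightarrow> Ah \<beta> ps (Suc l) = \<beta> (ps ! l) * Ah \<beta> ps l"
proof -
  assume *: "distinct ps" "l < length ps"
  then have "ps ! l \<notin> set (take l ps)"
    by (auto simp: in_set_conv_nth nth_eq_iff_index_eq)
  then show ?thesis using * by (simp add: Ah_def take_Suc_conv_app_nth)
qed

lemma yh_Suc: "yh ps h (Suc l) = h (ps ! l)"
  by (simp add: yh_def)

lemma yh_upd_nth:
  "distinct ps \<Longrightarrow> l < length ps \<Longrightarrow> m \<le> length ps \<Longrightarrow>
    yh ps (h(ps ! l := v)) m = (if m = Suc l then v else yh ps h m)"
  by (auto simp: yh_def nth_eq_iff_index_eq)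

lemma yh_upd_inactive: "k \<notin> set ps \<Longrightarrow> m \<le> length ps \<Longrightarrow> yh ps (h(k := v)) m = yh ps h m"
  by (auto simp: yh_def)

text \<open>Only nonvanishing is assumed, over an arbitrary field, so that the same facts apply to
  longer and shorter sequences and to permuted initial data.\<close>

locale chain =
  fixes \<beta> x :: "'n::finite \<Rightarrow> 'a::field" and ps :: "'n list"
  assumes dist: "distinct ps" and \<beta>0: "\<beta> q \<noteq> 0" and x0: "x q \<noteq> 0" and Yh0: "Yh \<beta> x S \<noteq> 0"
begin

abbreviation "r \<equiv> length ps"
abbreviation "V \<equiv> Vh \<beta> x ps"
abbreviation "W \<equiv> Wh \<beta> x ps"
abbreviation "y \<equiv> yh ps"
abbreviation "M \<equiv> Mh \<beta> ps"
abbreviation "T \<equiv> Tfun \<beta> ps"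
abbreviation "A \<equiv> Ah \<beta> ps"

lemma V0: "V q \<noteq> 0"
  by (simp add: Vh_def x0 Yh0)

lemma W0: "W q \<noteq> 0"
  by (simp add: Wh_def x0 Yh0)

lemma A0: "A l \<noteq> 0"
  by (simp add: Ah_def \<beta>0)

lemma y_V: "l \<le> r \<Longrightarrow> y V l = Yh \<beta> x (set (take l ps))"
  by (cases l) (simp_all add: yh_def Vh_nth dist)

lemma y_V0: "l \<le> r \<Longrightarrow> y V l \<noteq> 0"
  by (simp add: y_V Yh0)

lemma V_inactive: "q \<notin> set ps \<Longrightarrow> V q = x q"
  by (simp add: Vh_def)

lemma nth_notin_take: "l < r \<Longrightarrow> ps ! l \<notin> set (take l ps)"
  using dist by (auto simp: in_set_conv_nth nth_eq_iff_index_eq)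

lemma nth_in_take:
  assumes "a < r"
  shows "ps ! a \<in> set (take m ps) \<longleftrightarrow> a < m"
proof
  assume "ps ! a \<in> set (take m ps)"
  then obtain b where "b < m" "b < r" "ps ! b = ps ! a" by (auto simp: in_set_conv_nth)
  then show "a < m" using dist assms by (simp add: nth_eq_iff_index_eq)
next
  assume "a < m"
  then have "take m ps ! a \<in> set (take m ps)" using assms by (intro nth_mem) simp
  then show "ps ! a \<in> set (take m ps)" using \<open>a < m\<close> by simp
qed

lemma take_Suc_set: "l < r \<Longrightarrow> set (take (Suc l) ps) = insert (ps ! l) (set (take l ps))"
  by (simp add: take_Suc_conv_app_nth)

lemma M_V: "l \<le> r \<Longrightarrow> M V l = (\<Prod>q\<in>- set (take l ps). x q)"
proof (induction rule: Mh_induct)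
  case length
  show ?case by (simp add: Mh_length V_inactive)
next
  case (step l)
  have "- set (take l ps) = insert (ps ! l) (- set (take (Suc l) ps))"
    using step(1) nth_notin_take by (auto simp: take_Suc_set)
  moreover have "ps ! l \<notin> - set (take (Suc l) ps)" using step(1) by (simp add: take_Suc_set)
  ultimately have "(\<Prod>q\<in>- set (take l ps). x q) = x (ps ! l) * M V (Suc l)"
    using step by simp
  moreover have "x (ps ! l) * y V (Suc l) = \<beta> (ps ! l) * y V l + A l * M V (Suc l)"
    using Yh_insert[of x "ps ! l" "set (take l ps)" \<beta>] x0 step nth_notin_take[of l]
    by (simp add: y_V take_Suc_set Ah_def)
  moreover have "y V (Suc l) \<noteq> 0" using step y_V0 by simp
  ultimately show ?case using step(1) by (simp add: Mh_rec) (metis mult.commute mult.left_commute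
        nonzero_mult_div_cancel_right)
qed

lemma M_V0: "l \<le> r \<Longrightarrow> M V l \<noteq> 0"
  by (simp add: M_V x0)

text \<open>The exchange relations: \<open>Yh_insert\<close> if \<open>q\<close> is inactive or
  last, \<open>Yh_exchange\<close> otherwise.\<close>

lemma T_V: "T q V = V q * W q"
proof (cases "q \<in> set ps")
  case False
  have e: "- insert q (set ps) \<subseteq> - set ps" by auto
  have "(\<Prod>p\<in>- insert q (set ps). V p) = (\<Prod>p\<in>- insert q (set ps). x p)"
    by (rule prod.cong) (auto simp: V_inactive)
  with False show ?thesis using Yh_insert[of x q "set ps" \<beta>] x0
    by (simp add: Tfun_inactive y_V V_inactive Wh_def Ah_def)
next
  case True
  then obtain l where l: "q = ps ! l" "l < r" by (auto simp: in_set_conv_nth)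
  show ?thesis
  proof (cases "Suc l = r")
    case True
    have "(\<Prod>p\<in>- set ps. V p) = (\<Prod>p\<in>- set ps. x p)"
      by (rule prod.cong) (auto simp: V_inactive)
    moreover have s: "set ps = insert q (set (take l ps))"
      using take_Suc_set[of l] l True by simp
    ultimately show ?thesis
      using Yh_insert[of x q "set (take l ps)" \<beta>] x0 l True nth_notin_take[of l] dist
      by (simp add: Tfun_last Vh_nth Wh_last y_V Ah_def mult.commute)
  next
    case False
    with l have l': "Suc l < r" by simp
    have s: "set (take (Suc l) ps) = insert q (set (take l ps))"
      "set (take (Suc (Suc l)) ps) = insert q (insert (ps ! Suc l) (set (take l ps)))"
      using take_Suc_set[of l] take_Suc_set[of "Suc l"] l l' by auto
    have n: "q \<notin> set (take l ps)" "ps ! Suc l \<notin> set (take l ps)" "q \<noteq> ps ! Suc l"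
    proof -
      have "ps ! Suc l \<notin> insert q (set (take l ps))"
        using nth_notin_take[of "Suc l"] l' unfolding s(1)[symmetric] by simp
      moreover have "q \<notin> set (take l ps)" using nth_notin_take[of l] l by simp
      ultimately show "q \<notin> set (take l ps)" "ps ! Suc l \<notin> set (take l ps)" "q \<noteq> ps ! Suc l"
        by blast+
    qed
    show ?thesis
      using Yh_exchange[of x q "set (take l ps)" "ps ! Suc l" \<beta>] x0 n l l' dist
      by (simp add: Tfun_mid Vh_nth Wh_nth y_V M_V s Ah_def)
  qed
qed

text \<open>The variable at position \<open>l\<close> is \<open>y (Suc l)\<close>. It enters
  \<open>M (Suc l)\<close> just once, in the numerator, so the dependence is affine.\<close>

lemma M_upd_next:
  assumes "Suc l < r"
  shows "M (h(ps ! l := v)) (Suc l) = M h (l + 2) * (\<beta> (ps ! Suc l) * v + A (Suc l) * M h (l + 2)) / y h (l + 2)"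
proof -
  have "M (h(ps ! l := v)) (l + 2) = M h (l + 2)"
    using Mh_upd_early[of ps "l + 2" l] assms dist by simp
  then show ?thesis using assms dist
    by (simp del: fun_upd_apply add: Mh_rec[of "Suc l"] yh_upd_nth)
qed

lemma M_upd_next0: "l < r \<Longrightarrow> M (V(ps ! l := 0)) (Suc l) \<noteq> 0"
proof (cases "Suc l = r")
  case True
  have "M (V(ps ! l := 0)) (Suc l) = M V (Suc l)"
    unfolding True Mh_length by (rule prod.cong) (use True in auto)
  then show ?thesis using True M_V0 by simp
next
  case False
  moreover assume "l < r"
  ultimately have l: "Suc l < r" by simp
  then show ?thesis using M_V0[of "l + 2"] y_V0[of "l + 2"] A0[of "Suc l"]
    by (simp add: M_upd_next[OF l])
qed

section \<open>Vanishing of the exchange functions and their dependence on single variables\<close>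

lemma prod_upd_active: "z \<in> set ps \<Longrightarrow> S \<inter> set ps = {} \<Longrightarrow> (\<Prod>p\<in>S. (h(z := v)) p) = (\<Prod>p\<in>S. h p)"
  by (rule prod.cong) auto

lemma prod_upd_0: "z \<in> S \<Longrightarrow> (\<Prod>p\<in>S. (h(z := (0::'a))) p) = 0" for S :: "'n set"
  by (rule prod_zero) auto

text \<open>This prevents a variable outside \<open>Zset ps q\<close> from occurring in the monomial
  that relates the exchange function to the exchange polynomial.\<close>

lemma T_upd_0_neq_0:
  assumes z: "z \<notin> Zset ps q"
  shows "T q (V(z := 0)) \<noteq> 0"
proof (cases "q \<in> set ps")
  case False
  have p0: "(\<Prod>p\<in>- insert q (set ps). V p) \<noteq> 0" by (simp add: V0)
  show ?thesis
  proof (cases "z \<in> set ps")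
    case z: True
    then obtain m where m: "z = ps ! m" "m < r" by (auto simp: in_set_conv_nth)
    have p: "(\<Prod>p\<in>- insert q (set ps). (V(z := 0)) p) = (\<Prod>p\<in>- insert q (set ps). V p)"
      by (rule prod_upd_active[OF z]) auto
    show ?thesis
    proof (cases "Suc m = r")
      case True
      then show ?thesis using False m A0 p0 by (simp del: fun_upd_apply prod_zero_iff add: Tfun_inactive p[unfolded m(1)] yh_upd_nth dist)
    next
      case False': False
      then have "T q (V(z := 0)) = T q V" using False m
        by (simp del: fun_upd_apply prod_zero_iff add: Tfun_inactive p[unfolded m(1)] yh_upd_nth dist)
      then show ?thesis by (simp add: T_V V0 W0)
    qed
  next
    case z: False
    show ?thesis
    proof (cases "z = q")
      case True
      have "(\<Prod>p\<in>- insert q (set ps). (V(z := 0)) p) = (\<Prod>p\<in>- insert q (set ps). V p)"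
        by (rule prod.cong) (use True in auto)
      then have "T q (V(z := 0)) = T q V" using False z by (simp del: fun_upd_apply prod_zero_iff add: Tfun_inactive yh_upd_inactive)
      then show ?thesis by (simp add: T_V V0 W0)
    next
      case zq: False
      have "(\<Prod>p\<in>- insert q (set ps). (V(z := 0)) p) = 0"
        by (rule prod_upd_0) (use zq z in auto)
      then show ?thesis using False z y_V0[of r] \<beta>0 by (simp del: fun_upd_apply prod_zero_iff add: Tfun_inactive yh_upd_inactive)
    qed
  qed
next
  case True
  then obtain l where l: "q = ps ! l" "l < r" by (auto simp: in_set_conv_nth)
  show ?thesis
  proof (cases "Suc l = r")
    case True
    show ?thesis
    proof (cases "z \<in> set ps")
      case z: True
      then obtain m where m: "z = ps ! m" "m < r" by (auto simp: in_set_conv_nth)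
      have p: "(\<Prod>p\<in>- set ps. (V(z := 0)) p) = (\<Prod>p\<in>- set ps. V p)"
        by (rule prod_upd_active[OF z]) auto
      show ?thesis
      proof (cases "Suc m = l")
        case True': True
        have "(\<Prod>p\<in>- set ps. V p) \<noteq> 0" by (simp add: V0)
        with True' show ?thesis using True l m A0 by (simp del: fun_upd_apply prod_zero_iff add: Tfun_last[OF dist True] p[unfolded m(1)] yh_upd_nth dist)
      next
        case False
        then have "T q (V(z := 0)) = T q V" using True l m
          by (simp del: fun_upd_apply prod_zero_iff add: Tfun_last[OF dist True] p[unfolded m(1)] yh_upd_nth dist)
        then show ?thesis by (simp add: T_V V0 W0)
      qed
    next
      case z: False
      have "(\<Prod>p\<in>- set ps. (V(z := 0)) p) = 0" by (rule prod_upd_0) (use z in auto)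
      then show ?thesis using l True z y_V0[of l] \<beta>0
        by (simp del: fun_upd_apply prod_zero_iff add: Tfun_last[OF dist True] yh_upd_inactive)
    qed
  next
    case False
    with l have l': "Suc l < r" by simp
    show ?thesis
    proof (cases "z \<in> set ps")
      case z: True
      then obtain m where m: "z = ps ! m" "m < r" by (auto simp: in_set_conv_nth)
      with assms l have "m < l + 2" by (simp add: nth_in_Zset_iff dist)
      then consider "m = Suc l" | "m < Suc l" by linarith
      then show ?thesis
      proof cases
        case 1
        have "M (V(z := 0)) (l + 2) \<noteq> 0" using M_upd_next0[of "Suc l"] m 1 l' by simp
        then show ?thesis using 1 l l' m A0 by (simp del: fun_upd_apply prod_zero_iff add: Tfun_mid dist yh_upd_nth)
      next
        case 2
        have M: "M (V(z := 0)) (l + 2) = M V (l + 2)"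
          using 2 m l' by (simp add: Mh_upd_early dist)
        show ?thesis
        proof (cases "Suc m = l")
          case True
          then show ?thesis using 2 l l' m A0 M M_V0[of "l + 2"] by (simp del: fun_upd_apply prod_zero_iff add: Tfun_mid dist yh_upd_nth)
        next
          case False
          then have "T q (V(z := 0)) = T q V" using 2 l l' m M by (simp del: fun_upd_apply prod_zero_iff add: Tfun_mid dist yh_upd_nth)
          then show ?thesis by (simp add: T_V V0 W0)
        qed
      qed
    next
      case z: False
      have "M (V(z := 0)) (l + 2) = 0" by (rule Mh_inactive_0[of z]) (use z l' in auto)
      then show ?thesis using l l' z y_V0[of l] y_V0[of "l + 2"]
        by (simp del: fun_upd_apply prod_zero_iff add: Tfun_mid dist yh_upd_inactive)
    qed
  qed
qed

text \<open>A change of value under a substitution in one variable will show that the exchange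
  polynomial contains this variable.\<close>

lemma T_involves_inactive:
  assumes "z \<notin> set ps" "q \<noteq> z"
  shows "T q (V(z := 0)) \<noteq> T q V"
proof (cases "q \<in> set ps")
  case False
  have "(\<Prod>p\<in>- insert q (set ps). (V(z := 0)) p) = 0"
    by (rule prod_upd_0) (use assms in auto)
  moreover have "(\<Prod>p\<in>- insert q (set ps). V p) \<noteq> 0" by (simp add: V0)
  ultimately show ?thesis using False assms A0 by (simp del: fun_upd_apply prod_zero_iff add: Tfun_inactive yh_upd_inactive)
next
  case True
  then obtain l where l: "q = ps ! l" "l < r" by (auto simp: in_set_conv_nth)
  show ?thesis
  proof (cases "Suc l = r")
    case True
    have "(\<Prod>p\<in>- set ps. (V(z := 0)) p) = 0" by (rule prod_upd_0) (use assms in auto)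
    moreover have "(\<Prod>p\<in>- set ps. V p) \<noteq> 0" by (simp add: V0)
    ultimately show ?thesis using True l assms A0
      by (simp del: fun_upd_apply prod_zero_iff add: Tfun_last[OF dist True] yh_upd_inactive)
  next
    case False
    with l have l': "Suc l < r" by simp
    have "M (V(z := 0)) (l + 2) = 0" by (rule Mh_inactive_0[of z]) (use assms l' in auto)
    then show ?thesis using l l' assms A0 M_V0[of "l + 2"]
      by (simp del: fun_upd_apply prod_zero_iff add: Tfun_mid dist yh_upd_inactive)
  qed
qed

lemma T_involves_last:
  assumes "q \<notin> set ps" "Suc l = r"
  shows "T q (V(ps ! l := 0)) \<noteq> T q V"
proof -
  have "(\<Prod>p\<in>- insert q (set ps). (V(ps ! l := 0)) p) = (\<Prod>p\<in>- insert q (set ps). V p)"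
    by (rule prod_upd_active) (use assms in auto)
  then show ?thesis using assms \<beta>0 y_V0[of r]
    by (simp del: fun_upd_apply prod_zero_iff add: Tfun_inactive yh_upd_nth dist)
qed

lemma T_involves_prev:
  assumes "Suc l < r"
  shows "T (ps ! Suc l) (V(ps ! l := 0)) \<noteq> T (ps ! Suc l) V"
proof (cases "Suc (Suc l) = r")
  case True
  have "(\<Prod>p\<in>- set ps. (V(ps ! l := 0)) p) = (\<Prod>p\<in>- set ps. V p)"
    by (rule prod_upd_active) (use assms in auto)
  then show ?thesis using assms \<beta>0 y_V0[of "Suc l"]
    by (simp del: fun_upd_apply prod_zero_iff add: Tfun_last[OF dist True] yh_upd_nth dist)
next
  case False
  with assms have l: "Suc (Suc l) < r" by simp
  have "M (V(ps ! l := 0)) (Suc l + 2) = M V (Suc l + 2)"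
    using l by (intro Mh_upd_early dist) auto
  then show ?thesis using l y_V0[of "Suc l"] y_V0[of "Suc l + 2"]
    by (simp del: fun_upd_apply prod_zero_iff add: Tfun_mid[OF dist l] yh_upd_nth dist)
qed

text \<open>The variable at \<open>Suc l\<close> enters \<open>M (l + 2)\<close> affinely and
  \<open>M (l + 2)\<close> is squared; the other summand contributes to the linear term.\<close>

lemma T_quadratic:
  assumes "l + 2 < r"
  obtains a b c where "a \<noteq> 0" "c \<noteq> 0"
    "\<And>v. T (ps ! l) (V(ps ! Suc l := v)) = a * v\<^sup>2 + b * v + c"
proof -
  let ?m = "M V (l + 3)" and ?y = "y V (l + 3)"
  define \<alpha> where "\<alpha> = ?m * \<beta> (ps ! (l + 2)) / ?y"
  define \<gamma> where "\<gamma> = ?m * (A (l + 2) * ?m) / ?y"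
  have "?m \<noteq> 0" "?y \<noteq> 0" using assms by (auto intro!: M_V0 y_V0)
  then have \<alpha>: "\<alpha> \<noteq> 0" and \<gamma>: "\<gamma> \<noteq> 0" using A0 \<beta>0 by (auto simp: \<alpha>_def \<gamma>_def)
  have M: "M (V(ps ! Suc l := v)) (l + 2) = \<alpha> * v + \<gamma>" for v
    using M_upd_next[of "Suc l" V v] assms
    by (simp add: \<alpha>_def \<gamma>_def numeral_3_eq_3 add_divide_distrib distrib_left mult_ac)
  have eq: "T (ps ! l) (V(ps ! Suc l := v)) =
      ((A l)\<^sup>2 * \<alpha>\<^sup>2) * v\<^sup>2 + (y V l + 2 * (A l)\<^sup>2 * \<alpha> * \<gamma>) * v + (A l)\<^sup>2 * \<gamma>\<^sup>2" for v
    using assms M[of v] by (simp del: fun_upd_apply add: Tfun_mid dist yh_upd_nth power2_eq_square algebra_simps)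
  show ?thesis by (rule that[OF _ _ eq]) (use \<alpha> \<gamma> A0 in simp_all)
qed

text \<open>The variable at \<open>Suc l\<close> is \<open>y (l + 2)\<close>. The exchange function
  at \<open>m\<close> contains it only through \<open>y m\<close>, when
  \<open>m = l + 2\<close>.\<close>

lemma T_linear:
  assumes "l + 2 \<le> m" "m < r"
  obtains b c where "\<And>v. T (ps ! m) (V(ps ! Suc l := v)) = b * v + c"
proof -
  have "\<exists>b c. \<forall>v. T (ps ! m) (V(ps ! Suc l := v)) = b * v + c"
  proof (cases "Suc m = r")
    case True
    have p: "(\<Prod>p\<in>- set ps. (V(ps ! Suc l := v)) p) = (\<Prod>p\<in>- set ps. V p)" for v
      by (rule prod_upd_active) (use assms in auto)
    have "T (ps ! m) (V(ps ! Suc l := v)) =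
        (if m = l + 2 then \<beta> (ps ! m) else 0) * v + ((if m = l + 2 then 0 else \<beta> (ps ! m) * y V m) +
        A m * (\<Prod>p\<in>- set ps. V p))" for v
      using assms by (simp del: fun_upd_apply add: Tfun_last[OF dist True] p yh_upd_nth dist)
    then show ?thesis by blast
  next
    case False
    with assms have m: "Suc m < r" by simp
    have M: "M (V(ps ! Suc l := v)) (m + 2) = M V (m + 2)" for v
      using m assms by (intro Mh_upd_early dist) auto
    have "T (ps ! m) (V(ps ! Suc l := v)) =
        (if m = l + 2 then y V (m + 2) else 0) * v + ((if m = l + 2 then 0 else y V m * y V (m + 2)) +
        (A m)\<^sup>2 * (M V (m + 2))\<^sup>2)" for v
      using assms m M[of v] by (simp del: fun_upd_apply add: Tfun_mid[OF dist m] yh_upd_nth dist)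
    then show ?thesis by blast
  qed
  then show ?thesis using that by blast
qed

text \<open>Three distinct points determine a quadratic. The third point \<open>w\<close> will be a
  cluster variable, so the argument works in every characteristic.\<close>

lemma quadratic_eq_0:
  fixes a b c w :: 'a
  assumes w: "w \<noteq> 0" "w \<noteq> 1" and *: "\<And>v. a * v\<^sup>2 + b * v + c = 0"
  shows "a = 0"
proof -
  have c: "c = 0" using *[of 0] by simp
  have "a + b = 0" using *[of 1] c by simp
  then have b: "b = - a" by (simp add: eq_neg_iff_add_eq_0 add.commute)
  have "a * w\<^sup>2 + b * w = a * w * (w - 1)" by (simp add: b power2_eq_square algebra_simps)
  then have "a * w * (w - 1) = 0" using *[of w] c by simp
  with w show ?thesis by simp
qed

text \<open>Degree two against degree at most one in the variable at \<open>Suc l\<close>. This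
  separates the exchange polynomials of two active indices that are not adjacent.\<close>

lemma T_not_proportional:
  assumes w: "w \<noteq> 0" "w \<noteq> (1::'a)" and lm: "l + 2 \<le> m" "m < r"
  shows "\<exists>v. T (ps ! l) (V(ps ! Suc l := v)) \<noteq> \<kappa> * T (ps ! m) (V(ps ! Suc l := v))"
proof (rule ccontr)
  assume *: "\<not> ?thesis"
  have "l + 2 < r" using lm by simp
  from T_quadratic[OF this] obtain a b c where abc: "a \<noteq> 0"
    "\<And>v. T (ps ! l) (V(ps ! Suc l := v)) = a * v\<^sup>2 + b * v + c" by metis
  obtain b' c' where "\<And>v. T (ps ! m) (V(ps ! Suc l := v)) = b' * v + c'"
    using T_linear[OF lm] by blast
  with * abc(2) have eq: "a * v\<^sup>2 + b * v + c = \<kappa> * (b' * v + c')" for v by metis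
  have "a * v\<^sup>2 + (b - \<kappa> * b') * v + (c - \<kappa> * c') = 0" for v
    using eq[of v] by (simp add: algebra_simps)
  from quadratic_eq_0[OF w this] abc(1) show False by simp
qed

lemma T_involves_next:
  assumes w: "w \<noteq> 0" "w \<noteq> (1::'a)" and l: "Suc l < r"
  shows "\<exists>v. T (ps ! l) (V(ps ! Suc l := v)) \<noteq> T (ps ! l) (V(ps ! Suc l := 0))"
proof (cases "l + 2 = r")
  case True
  have "M (V(ps ! Suc l := 0)) (l + 2) = M V (l + 2)"
    unfolding True Mh_length by (rule prod_upd_active) (use l in auto)
  then have "T (ps ! l) (V(ps ! Suc l := 0)) \<noteq> T (ps ! l) V"
    using l y_V0[of l] y_V0[of "l + 2"] True by (simp del: fun_upd_apply add: Tfun_mid dist yh_upd_nth)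
  then show ?thesis by (intro exI[of _ "V (ps ! Suc l)"]) simp
next
  case False
  with l have "l + 2 < r" by simp
  from T_quadratic[OF this] obtain a b c where abc: "a \<noteq> 0"
    "\<And>v. T (ps ! l) (V(ps ! Suc l := v)) = a * v\<^sup>2 + b * v + c" by metis
  show ?thesis
  proof (rule ccontr)
    assume "\<not> ?thesis"
    then have "a * v\<^sup>2 + b * v + 0 = 0" for v using abc(2)[of v] abc(2)[of 0] by simp
    from quadratic_eq_0[OF w this] abc(1) show False by simp
  qed
qed

subsection \<open>Mutations of clusters\<close>

lemma V_snoc:
  assumes "k \<notin> set ps"
  shows "Vh \<beta> x (ps @ [k]) = V(k := W k)"
proof
  fix q
  consider "q = k" | "q \<in> set ps" | "q \<noteq> k" "q \<notin> set ps" by blast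
  then show "Vh \<beta> x (ps @ [k]) q = (V(k := W k)) q"
  proof cases
    case 1
    have "idx (ps @ [k]) k = r" using idx_nth[of "ps @ [k]" r] assms dist by simp
    then show ?thesis using 1 assms by (simp add: Vh_def Wh_def)
  next
    case 2
    then obtain l where l: "q = ps ! l" "l < r" by (auto simp: in_set_conv_nth)
    have "idx (ps @ [k]) q = l" using idx_nth[of "ps @ [k]" l] assms dist l by (simp add: nth_append)
    then show ?thesis using 2 assms l by (auto simp: Vh_def idx_nth dist)
  qed (simp add: Vh_def)
qed

lemma W_snoc_mid:
  assumes "k \<notin> set ps" "Suc l < r"
  shows "Wh \<beta> x (ps @ [k]) (ps ! l) = W (ps ! l)"
proof -
  have "idx (ps @ [k]) (ps ! l) = l"
    using idx_nth[of "ps @ [k]" l] assms dist by (simp add: nth_append)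
  then show ?thesis using assms by (auto simp: Wh_def idx_nth dist nth_append)
qed

lemma W_snoc_new: "k \<notin> set ps \<Longrightarrow> Wh \<beta> x (ps @ [k]) k = V k"
  using Wh_last[of "ps @ [k]" r \<beta> x] dist by (simp add: V_inactive)

lemma chain_snoc: "k \<notin> set ps \<Longrightarrow> chain \<beta> x (ps @ [k])"
  by unfold_locales (simp_all add: dist \<beta>0 x0 Yh0)

lemma Ah_snoc: "l \<le> r \<Longrightarrow> Ah \<beta> (ps @ [k]) l = A l"
  by (simp add: Ah_def)

lemma yh_snoc: "l \<le> r \<Longrightarrow> yh (ps @ [k]) h l = y h l"
  by (cases l) (simp_all add: yh_def nth_append)

text \<open>The expression \<open>G_j\<close> from the definition of mutation, computed for the
  mutation at \<open>k\<close>. Here and in the next three lemmas it is a multiple of the exchange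
  function of the new sequence, evaluated at the new cluster.\<close>

lemma T_snoc_inactive:
  assumes k: "k \<notin> set ps" and j: "j \<notin> set ps" "j \<noteq> k" and wk: "wk \<noteq> 0"
  shows "T j (h(k := T k (h(j := 0)) / wk)) =
    (y h r / wk) * Tfun \<beta> (ps @ [k]) j (h(k := wk))"
proof -
  let ?m = "\<Prod>p\<in>- insert j (insert k (set ps)). h p"
  have "(\<Prod>p\<in>- insert k (set ps). (h(j := 0)) p) = 0"
    by (rule prod_upd_0) (use j in auto)
  then have 1: "T k (h(j := 0)) = \<beta> k * y h r"
    using k j by (simp del: fun_upd_apply add: Tfun_inactive yh_upd_inactive)
  have e: "- insert j (set ps) = insert k (- insert j (insert k (set ps)))" using j k by auto
  have m: "(\<Prod>p\<in>- insert j (insert k (set ps)). (h(k := v)) p) = ?m" for v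
    by (rule prod.cong) auto
  have 2: "T j (h(k := v)) = \<beta> j * y h r + A r * (v * ?m)" for v
    using k j unfolding Tfun_inactive[OF j(1)] e
    by (subst prod.insert) (simp_all del: fun_upd_apply add: yh_upd_inactive m, simp)
  have 3: "Tfun \<beta> (ps @ [k]) j (h(k := wk)) = \<beta> j * wk + (\<beta> k * A r) * ?m"
    using Ah_Suc[of "ps @ [k]" r \<beta>] dist k j m
    by (simp del: fun_upd_apply add: Tfun_inactive Ah_snoc yh_Suc insert_commute) simp
  show ?thesis unfolding 1 2 3 using wk by (simp add: field_simps)
qed

lemma T_snoc_last:
  assumes k: "k \<notin> set ps" and l: "Suc l = r" and wk: "wk \<noteq> 0"
  shows "T (ps ! l) (h(k := T k (h(ps ! l := 0)) / wk)) =
    (\<beta> (ps ! l) / wk) * Tfun \<beta> (ps @ [k]) (ps ! l) (h(k := wk))"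
proof -
  let ?j = "ps ! l"
  let ?m = "\<Prod>p\<in>- insert k (set ps). h p"
  have j: "?j \<in> set ps" using l by simp
  have "(\<Prod>p\<in>- insert k (set ps). (h(?j := 0)) p) = ?m"
    by (rule prod_upd_active[OF j]) auto
  then have 1: "T k (h(?j := 0)) = \<beta> ?j * A l * ?m"
    using k l Ah_Suc[OF dist, of l \<beta>] by (simp del: fun_upd_apply add: Tfun_inactive yh_upd_nth dist)
  have e: "- set ps = insert k (- insert k (set ps))" using k by auto
  have m: "(\<Prod>p\<in>- insert k (set ps). (h(k := v)) p) = ?m" for v
    by (rule prod.cong) auto
  have 2: "T ?j (h(k := v)) = \<beta> ?j * y h l + A l * (v * ?m)" for v
    using k l unfolding Tfun_last[OF dist l] e
    by (subst prod.insert) (simp_all del: fun_upd_apply add: yh_upd_inactive m, simp)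
  have d: "distinct (ps @ [k])" using dist k by simp
  have M: "Mh \<beta> (ps @ [k]) (h(k := wk)) (Suc r) = ?m"
    using Mh_length[of \<beta> "ps @ [k]" "h(k := wk)"] m by (simp del: fun_upd_apply)
  have "Tfun \<beta> (ps @ [k]) ((ps @ [k]) ! l) (h(k := wk)) = y h l * wk + (A l)\<^sup>2 * ?m\<^sup>2"
    using l M k by (subst Tfun_mid[OF d])
      (simp_all del: fun_upd_apply add: Ah_snoc yh_snoc yh_upd_inactive, simp add: yh_def)
  then have 3: "Tfun \<beta> (ps @ [k]) ?j (h(k := wk)) = y h l * wk + (A l)\<^sup>2 * ?m\<^sup>2"
    using l by (simp add: nth_append)
  show ?thesis unfolding 1 2 3 using wk by (simp add: field_simps power2_eq_square)
qed

lemma T_butlast_inactive: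
  assumes ps: "ps = qs @ [i]" and j: "j \<notin> set ps" and wi: "wi \<noteq> 0"
  shows "T j (h(i := T i (h(j := 0)) / wi)) = (\<beta> i / wi) * Tfun \<beta> qs j (h(i := wi))"
proof -
  let ?s = "length qs"
  have d: "distinct qs" "i \<notin> set qs" "i \<in> set ps" using dist ps by auto
  have l: "Suc ?s = length ps" and i: "i = ps ! ?s" using ps by auto
  let ?m = "\<Prod>p\<in>- insert j (set ps). h p"
  have "(\<Prod>p\<in>- set ps. (h(j := 0)) p) = 0" by (rule prod_upd_0) (use j in auto)
  then have 1: "T i (h(j := 0)) = \<beta> i * y h ?s"
    using j l Tfun_last[OF dist l, of \<beta> "h(j := 0)"] i
    by (simp del: fun_upd_apply add: yh_upd_inactive)
  have m: "(\<Prod>p\<in>- insert j (set ps). (h(i := v)) p) = ?m" for v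
    by (rule prod_upd_active) (use d in auto)
  have 2: "T j (h(i := v)) = \<beta> j * v + \<beta> i * A ?s * ?m" for v
  proof -
    have "y (h(i := v)) r = v" unfolding l[symmetric] yh_Suc using i by simp
    then show ?thesis using j m[of v] Ah_Suc[OF dist, of ?s \<beta>] l i
      by (simp del: fun_upd_apply add: Tfun_inactive)
  qed
  have jq: "j \<notin> set qs" and ij: "i \<noteq> j" using j ps by auto
  have e: "- insert j (set qs) = insert i (- insert j (set ps))" using d ps j by auto
  have "(\<Prod>p\<in>- insert j (set qs). (h(i := wi)) p) = wi * ?m"
    unfolding e using m[of wi] d by (subst prod.insert) (auto simp del: fun_upd_apply, simp)
  moreover have "yh qs (h(i := wi)) ?s = y h ?s"
    using d by (auto simp: yh_def ps nth_append in_set_conv_nth)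
  moreover have "Ah \<beta> qs ?s = A ?s" by (simp add: Ah_def ps)
  ultimately have 3: "Tfun \<beta> qs j (h(i := wi)) = \<beta> j * y h ?s + A ?s * (wi * ?m)"
    using jq by (simp del: fun_upd_apply add: Tfun_inactive)
  show ?thesis unfolding 1 2 3 using wi by (simp add: field_simps)
qed

lemma T_butlast_last:
  assumes ps: "ps = qs @ [i]" and l: "Suc l = length qs" and wi: "wi \<noteq> 0"
  shows "T (qs ! l) (h(i := T i (h(qs ! l := 0)) / wi)) =
    (A l * (\<Prod>p\<in>- set ps. h p) / wi) * Tfun \<beta> qs (qs ! l) (h(i := wi))"
proof -
  let ?j = "qs ! l"
  let ?s = "length qs"
  have d: "distinct qs" "i \<notin> set qs" "i \<in> set ps" "?j \<in> set qs" using dist ps l by auto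
  have r: "Suc ?s = r" and i: "i = ps ! ?s" and j: "?j = ps ! l" using ps l by (auto simp: nth_append)
  let ?m = "\<Prod>p\<in>- set ps. h p"
  have "(\<Prod>p\<in>- set ps. (h(?j := 0)) p) = ?m"
    by (rule prod_upd_active) (use d ps in auto)
  then have 1: "T i (h(?j := 0)) = \<beta> ?j * A l * ?m"
    using l r Tfun_last[OF dist r, of \<beta> "h(?j := 0)"] i j Ah_Suc[OF dist, of l \<beta>]
    by (simp del: fun_upd_apply add: yh_upd_nth dist flip: l)
  have m: "(\<Prod>p\<in>- set ps. (h(i := v)) p) = ?m" for v
    by (rule prod_upd_active) (use d in auto)
  have M: "M (h(i := v)) (Suc (Suc l)) = ?m" for v
    using Mh_length[of \<beta> ps "h(i := v)"] m[of v] l r by simp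
  have y: "y (h(i := v)) l = y h l" "y (h(i := v)) (Suc (Suc l)) = v" for v
    using l r dist i by (simp_all del: fun_upd_apply add: yh_upd_nth)
  have 2: "T ?j (h(i := v)) = y h l * v + (A l)\<^sup>2 * ?m\<^sup>2" for v
    unfolding j using Tfun_mid[OF dist, of l \<beta> "h(i := v)"] l r M y by (simp del: fun_upd_apply)
  have e: "- set qs = insert i (- set ps)" using d ps by auto
  have "(\<Prod>p\<in>- set qs. (h(i := wi)) p) = wi * ?m"
    unfolding e using m[of wi] d by (subst prod.insert) (auto simp del: fun_upd_apply, simp)
  moreover have "yh qs (h(i := wi)) l = y h l"
    using d l by (auto simp: yh_def ps nth_append in_set_conv_nth)
  moreover have "Ah \<beta> qs l = A l" using l by (simp add: Ah_def ps)
  ultimately have 3: "Tfun \<beta> qs ?j (h(i := wi)) = \<beta> ?j * y h l + A l * (wi * ?m)"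
    by (simp del: fun_upd_apply add: Tfun_last[OF d(1) l])
  show ?thesis unfolding 1 2 3 using wi by (simp add: field_simps power2_eq_square)
qed

end

text \<open>Mutation at \<open>i\<close> puts the variable of the segment ending in \<open>j\<close>
  at the index \<open>i\<close>. The swapped sequence is therefore described by the same list
  \<open>ps\<close> with initial data transposed.\<close>

locale chain_swap = chain +
  fixes l :: nat
  assumes l: "Suc l < length ps"
begin

abbreviation "i \<equiv> ps ! l"
abbreviation "j \<equiv> ps ! Suc l"
definition "\<beta>' = \<beta> \<circ> Transposition.transpose i j"
definition "x' = x \<circ> Transposition.transpose i j"

lemma ij: "i \<noteq> j"
  using dist l by (simp add: nth_eq_iff_index_eq)

lemma bij_\<tau>: "bij (Transposition.transpose i j)"
  by (rule bij_transpose)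

text \<open>Only the initial segment that contains \<open>i\<close> but not \<open>j\<close> is
  moved by the transposition.\<close>

lemma \<tau>_image: "Transposition.transpose i j ` set (take m ps) =
    (if m = Suc l then insert j (set (take l ps)) else set (take m ps))"
proof -
  have mem: "i \<in> set (take m ps) \<longleftrightarrow> l < m" "j \<in> set (take m ps) \<longleftrightarrow> Suc l < m"
    using l by (simp_all add: nth_in_take)
  show ?thesis
  proof (cases "m = Suc l")
    case True
    have "i \<notin> set (take l ps)" "j \<notin> set (take l ps)"
      using dist l by (auto simp: in_set_conv_nth nth_eq_iff_index_eq)
    then have "Transposition.transpose i j ` set (take l ps) = set (take l ps)"
      by (simp add: transpose_image_eq)
    then show ?thesis using True take_Suc_set[of l] l by simp
  next
    case False
    then have "i \<in> set (take m ps) \<longleftrightarrow> j \<in> set (take m ps)" using mem by auto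
    then show ?thesis using False by (simp add: transpose_image_eq)
  qed
qed

lemma Yh_swap: "Yh \<beta>' x' S = Yh \<beta> x (Transposition.transpose i j ` S)"
  unfolding \<beta>'_def x'_def by (rule Yh_reindex[OF bij_\<tau>])

lemma chain': "chain \<beta>' x' ps"
  by unfold_locales (simp_all add: dist Yh0 Yh_swap, simp_all add: \<beta>'_def x'_def \<beta>0 x0)

lemma Ah': "Ah \<beta>' ps m = (if m = Suc l then \<beta> j * A l else A m)"
proof -
  have "Ah \<beta>' ps m = (\<Prod>q\<in>Transposition.transpose i j ` set (take m ps). \<beta> q)"
    unfolding Ah_def \<beta>'_def
    by (subst prod.reindex) (auto intro: inj_on_subset[OF bij_is_inj[OF bij_\<tau>]])
  moreover have "j \<notin> set (take l ps)"
    using dist l by (auto simp: in_set_conv_nth nth_eq_iff_index_eq)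
  ultimately show ?thesis by (simp add: \<tau>_image Ah_def)
qed

lemma \<beta>'_nth: "m < r \<Longrightarrow> \<beta>' (ps ! m) = (if m = l then \<beta> j else if m = Suc l then \<beta> i else \<beta> (ps ! m))"
  using l dist by (auto simp: \<beta>'_def Transposition.transpose_def nth_eq_iff_index_eq)

lemma V_swap: "Vh \<beta>' x' ps = V(i := W i)"
proof
  fix q
  show "Vh \<beta>' x' ps q = (V(i := W i)) q"
  proof (cases "q \<in> set ps")
    case True
    then obtain m where m: "q = ps ! m" "m < r" by (auto simp: in_set_conv_nth)
    then show ?thesis using l dist
      by (auto simp: Vh_nth Wh_nth Yh_swap \<tau>_image nth_eq_iff_index_eq)
  next
    case False
    then show ?thesis using l nth_mem[of l ps] nth_mem[of "Suc l" ps]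
      by (auto simp: Vh_def x'_def Transposition.transpose_def)
  qed
qed

lemma W_swap_i: "Wh \<beta>' x' ps i = V i"
proof -
  have "Transposition.transpose i j ` insert j (set (take l ps)) = insert i (set (take l ps))"
    using \<tau>_image[of l] by simp
  then show ?thesis using l dist by (simp add: Wh_nth Vh_nth Yh_swap take_Suc_set)
qed

lemma W_swap_inactive: "q \<notin> set ps \<Longrightarrow> Wh \<beta>' x' ps q = W q"
proof -
  assume q: "q \<notin> set ps"
  then have "Transposition.transpose i j q = q" using l
    by (auto simp: Transposition.transpose_def)
  then show ?thesis using q \<tau>_image[of r] l by (simp add: Wh_def Yh_swap)
qed

lemma W_swap_far:
  assumes m: "m < r" "Suc m < l \<or> Suc l < m"
  shows "Wh \<beta>' x' ps (ps ! m) = W (ps ! m)"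
proof (cases "Suc m = r")
  case True
  then show ?thesis using m l dist
    by (auto simp: Wh_last[OF dist True] x'_def Transposition.transpose_def nth_eq_iff_index_eq)
next
  case False
  with m have m': "Suc m < r" by simp
  have "Transposition.transpose i j (ps ! Suc m) = ps ! Suc m"
    using m m' l dist by (auto simp: Transposition.transpose_def nth_eq_iff_index_eq)
  then show ?thesis using m m' dist \<tau>_image[of m] by (auto simp: Wh_nth Yh_swap)
qed

lemma M_swap_late: "l + 2 \<le> m \<Longrightarrow> m \<le> r \<Longrightarrow> Mh \<beta>' ps h m = M h m"
  by (rule Mh_cong) (auto simp: Ah' \<beta>'_nth)

lemma M_upd_late: "l + 2 \<le> m \<Longrightarrow> m \<le> r \<Longrightarrow> M (h(i := v)) m = M h m"
  by (rule Mh_upd_early) (auto simp: dist)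

text \<open>The counterpart for a swap of the computations for appending and removing. With
  \<open>h j = 0\<close> only the square in the exchange function at \<open>i\<close>
  survives.\<close>

lemma T_swap_next:
  assumes wi: "wi \<noteq> 0" and l2: "l + 2 < r" and h: "h (ps ! (l + 2)) \<noteq> 0"
  shows "T j (h(i := T i (h(j := 0)) / wi)) =
    ((A (Suc l))\<^sup>2 * (M h (l + 3))\<^sup>2 / (h (ps ! (l + 2)) * wi)) * Tfun \<beta>' ps j (h(i := wi))"
proof -
  define m where "m = M h (l + 3)"
  define z where "z = h (ps ! (l + 2))"
  define \<alpha> where "\<alpha> = A l"
  have lr: "Suc (Suc l) < r" using l2 by simp
  have A1: "A (Suc l) = \<beta> i * \<alpha>" and A2: "A (l + 2) = \<beta> j * (\<beta> i * \<alpha>)"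
    using Ah_Suc[OF dist, of l \<beta>] Ah_Suc[OF dist, of "Suc l" \<beta>] l by (simp_all add: \<alpha>_def)
  have M2: "M (h(j := 0)) (l + 2) = m * (A (l + 2) * m) / z"
    using M_upd_next[of "Suc l" h 0] lr by (simp add: m_def z_def yh_def numeral_3_eq_3)
  have "T i (h(j := 0)) = \<alpha>\<^sup>2 * (M (h(j := 0)) (l + 2))\<^sup>2"
    using l by (simp del: fun_upd_apply add: Tfun_mid dist \<alpha>_def yh_upd_nth)
  then have 1: "T i (h(j := 0)) = \<alpha>\<^sup>2 * (m * (A (l + 2) * m) / z)\<^sup>2" by (simp only: M2)
  have M3: "M (h(i := v)) (Suc l + 2) = m" for v
    using M_upd_late[of "Suc l + 2" h v] lr by (simp add: m_def numeral_3_eq_3)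
  have y3: "y (h(i := v)) (Suc l) = v" "y (h(i := v)) (Suc l + 2) = z" for v
    using lr dist ij by (auto simp: yh_def z_def nth_eq_iff_index_eq)
  have 2: "T j (h(i := v)) = v * z + (A (Suc l))\<^sup>2 * m\<^sup>2" for v
    by (simp only: Tfun_mid[OF dist lr] M3 y3)
  have 3: "Tfun \<beta>' ps j (h(i := wi)) = wi * z + (\<beta> j * \<alpha>)\<^sup>2 * m\<^sup>2"
    using M_swap_late[of "Suc l + 2" "h(i := wi)"] lr M3[of wi] y3[of wi]
    by (simp del: fun_upd_apply add: Tfun_mid[OF dist lr] Ah' \<alpha>_def)
  show ?thesis
    unfolding 1 2 3 A1 A2 m_def[symmetric] z_def[symmetric]
    using wi h[folded z_def] by (simp add: field_simps power2_eq_square)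
qed

lemma T_swap_next_last:
  assumes wi: "wi \<noteq> 0" and l2: "Suc (Suc l) = r"
  shows "T j (h(i := T i (h(j := 0)) / wi)) =
    (A l * (\<Prod>p\<in>- set ps. h p) / wi) * Tfun \<beta>' ps j (h(i := wi))"
proof -
  define m where "m = (\<Prod>p\<in>- set ps. h p)"
  define \<alpha> where "\<alpha> = A l"
  have A1: "A (Suc l) = \<beta> i * \<alpha>"
    using Ah_Suc[OF dist, of l \<beta>] l by (simp_all add: \<alpha>_def)
  have p: "(\<Prod>p\<in>- set ps. (h(i := v)) p) = m" "(\<Prod>p\<in>- set ps. (h(j := v)) p) = m" for v
    unfolding m_def by (rule prod_upd_active; use l in auto)+
  have M2: "M (h(j := 0)) (l + 2) = m"
    using Mh_length[of \<beta> ps "h(j := 0)"] p(2) l2 by simp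
  have "T i (h(j := 0)) = \<alpha>\<^sup>2 * (M (h(j := 0)) (l + 2))\<^sup>2"
    using l by (simp del: fun_upd_apply add: Tfun_mid dist \<alpha>_def yh_upd_nth)
  then have 1: "T i (h(j := 0)) = \<alpha>\<^sup>2 * m\<^sup>2" by (simp only: M2)
  have 2: "T j (h(i := v)) = \<beta> j * v + A (Suc l) * m" for v
    by (simp del: fun_upd_apply add: Tfun_last[OF dist l2] p) (simp add: yh_def)
  have 3: "Tfun \<beta>' ps j (h(i := wi)) = \<beta> i * wi + \<beta> j * \<alpha> * m"
    using l ij by (simp del: fun_upd_apply add: Tfun_last[OF dist l2] p Ah' \<beta>'_nth \<alpha>_def)
      (simp add: yh_def)
  show ?thesis
    unfolding 1 2 3 A1 m_def[symmetric] \<alpha>_def[symmetric]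
    using wi by (simp add: field_simps power2_eq_square)
qed

lemma T_swap_prev:
  assumes wi: "wi \<noteq> 0" and n: "l = Suc n"
  shows "T (ps ! n) (h(i := T i (h(ps ! n := 0)) / wi)) =
    (A l * M h (l + 2) / wi)\<^sup>2 * Tfun \<beta>' ps (ps ! n) (h(i := wi))"
proof -
  define m where "m = M h (l + 2)"
  define z where "z = y h (l + 2)"
  define \<alpha> where "\<alpha> = A l"
  have A1: "A (Suc l) = \<beta> i * \<alpha>"
    using Ah_Suc[OF dist, of l \<beta>] l by (simp_all add: \<alpha>_def)
  have M2: "M (h(ps ! n := v)) (l + 2) = m" for v
    unfolding m_def by (rule Mh_upd_early) (use l n dist in auto)
  have "T i (h(ps ! n := 0)) = \<alpha>\<^sup>2 * (M (h(ps ! n := 0)) (l + 2))\<^sup>2"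
    using l n by (simp del: fun_upd_apply add: Tfun_mid dist \<alpha>_def yh_upd_nth)
  then have 1: "T i (h(ps ! n := 0)) = \<alpha>\<^sup>2 * m\<^sup>2" by (simp only: M2)
  have nr: "Suc n < r" using l n by simp
  have M3: "M (h(i := v)) (n + 2) = m * (\<beta> j * v + A (Suc l) * m) / z" for v
    using M_upd_next[of l h v] l n by (simp add: m_def z_def)
  have M4: "Mh \<beta>' ps (h(i := v)) (n + 2) = m * (\<beta> i * v + \<beta> j * \<alpha> * m) / z" for v
  proof -
    have "Mh \<beta>' ps (h(i := v)) (l + 2) = m"
      using M_swap_late[of "l + 2" "h(i := v)"] M_upd_late[of "l + 2" h v] l by (simp add: m_def)
    moreover have "Mh \<beta>' ps (h(i := v)) (Suc l) = Mh \<beta>' ps (h(i := v)) (l + 2) *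
        (\<beta> i * v + \<beta> j * \<alpha> * Mh \<beta>' ps (h(i := v)) (l + 2)) / z"
      using l Mh_rec[of "Suc l" ps \<beta>' "h(i := v)"] dist
      by (simp del: fun_upd_apply add: Ah' \<beta>'_nth \<alpha>_def yh_upd_nth z_def)
    ultimately show ?thesis using n by simp
  qed
  have y3: "y (h(i := v)) n = y h n" "y (h(i := v)) (n + 2) = v" for v
    using n l dist by (simp_all del: fun_upd_apply add: yh_upd_nth)
  have 2: "T (ps ! n) (h(i := v)) = y h n * v + (A n)\<^sup>2 * (m * (\<beta> j * v + A (Suc l) * m) / z)\<^sup>2" for v
    by (simp only: Tfun_mid[OF dist nr] M3 y3)
  have 3: "Tfun \<beta>' ps (ps ! n) (h(i := wi)) =
      y h n * wi + (A n)\<^sup>2 * (m * (\<beta> i * wi + \<beta> j * \<alpha> * m) / z)\<^sup>2"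
  proof -
    have "Ah \<beta>' ps n = A n" using Ah'[of n] n by simp
    then show ?thesis by (simp only: Tfun_mid[OF dist nr] M4 y3)
  qed
  have "y h n * (\<alpha>\<^sup>2 * m\<^sup>2 / wi) + (A n)\<^sup>2 * (m * (\<beta> j * (\<alpha>\<^sup>2 * m\<^sup>2 / wi) + \<beta> i * \<alpha> * m) / z)\<^sup>2 =
    (\<alpha> * m / wi)\<^sup>2 * (y h n * wi + (A n)\<^sup>2 * (m * (\<beta> i * wi + \<beta> j * \<alpha> * m) / z)\<^sup>2)"
  proof -
    \<comment> \<open>The substitution replaces \<open>wi\<close> by
      \<open>(\<alpha> * m)\<^sup>2 / wi\<close>. Up to the factor \<open>\<alpha> * m / wi\<close>
      this interchanges the roles of \<open>\<beta> i\<close> and \<open>\<beta> j\<close> in the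
      affine factor of \<open>M\<close>.\<close>
    have "m * (\<beta> j * (\<alpha>\<^sup>2 * m\<^sup>2 / wi) + \<beta> i * \<alpha> * m) / z =
      (\<alpha> * m / wi) * (m * (\<beta> i * wi + \<beta> j * \<alpha> * m) / z)"
      using wi by (cases "z = 0") (simp_all add: field_simps power2_eq_square)
    moreover have "y h n * (\<alpha>\<^sup>2 * m\<^sup>2 / wi) = (\<alpha> * m / wi)\<^sup>2 * (y h n * wi)"
      using wi by (simp add: field_simps power2_eq_square)
    ultimately show ?thesis by (simp only: power_mult_distrib distrib_left mult_ac)
  qed
  then show ?thesis
    unfolding 1 2 3 A1 m_def[symmetric] \<alpha>_def[symmetric] .
qed

end

section \<open>Mutation of a single exchange polynomial\<close>

lemma lmonom_powi: "lmonom X K c powi d = lmonom X K (\<lambda>k. c k * d)"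
proof -
  have "(\<Prod>k\<in>K. X k powi c k) powi d = (\<Prod>k\<in>K. X k powi (c k * d))"
    by (induction K rule: infinite_finite_induct) (simp_all add: power_int_mult_distrib power_int_mult)
  then show ?thesis by (simp add: lmonom_def)
qed

lemma laurent_ring_const_dvd:
  assumes X: "alg_ind X" and c: "c \<noteq> 0"
    and d: "dvd_in (laurent_ring X) (peval X d) (emb c * lmonom X UNIV e)"
  shows "\<exists>c' m. d = mconst c' * pmon m"
proof -
  have nz: "\<And>k. X k \<noteq> 0" using alg_ind_nonzero[OF X] .
  obtain g where g: "g \<in> laurent_ring X" "emb c * lmonom X UNIV e = peval X d * g"
    using d by (auto simp: dvd_in_def)
  obtain m q where q: "g * peval X (pmon m) = peval X q" using g(1) nz laurent_ring_iff by blast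
  define m1 where "m1 k = nat (e k)" for k
  define m2 where "m2 k = nat (- e k)" for k
  have "lmonom X UNIV e * peval X (pmon m2) = peval X (pmon m1)"
  proof -
    have "(\<lambda>k. e k + int (m2 k)) = (\<lambda>k. int (m1 k))" by (auto simp: m1_def m2_def)
    then show ?thesis using lmonom_add[of UNIV X e "\<lambda>k. int (m2 k)"] nz by (simp add: lmonom_pmon)
  qed
  moreover have "emb c * (lmonom X UNIV e * peval X (pmon m2)) * peval X (pmon m) =
      peval X d * (g * peval X (pmon m)) * peval X (pmon m2)"
    using g(2) by (simp add: mult_ac)
  ultimately have "peval X (mconst c * pmon (\<lambda>k. m1 k + m k)) = peval X (d * (q * pmon m2))"
    using q by (simp add: pmon_add mult_ac)
  then have "mconst c * pmon (\<lambda>k. m1 k + m k) = d * (q * pmon m2)" using X alg_ind_eq_iff by blast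
  then have "d dvd mconst c * pmon (\<lambda>k. m1 k + m k)" by simp
  then show ?thesis using dvd_const_monomial c by blast
qed

lemma prime_dvd_laurent_mult:
  assumes X: "alg_ind X" and C: "prime_elem C" "\<And>k. \<not> mvar k dvd C"
    and f: "f \<in> laurent_ring X" and g: "g \<in> laurent_ring X"
    and d: "dvd_in (laurent_ring X) (peval X C) (f * g)"
  shows "dvd_in (laurent_ring X) (peval X C) f \<or> dvd_in (laurent_ring X) (peval X C) g"
proof -
  have nz: "\<And>k. X k \<noteq> 0" using alg_ind_nonzero[OF X] .
  obtain m p where p: "f * peval X (pmon m) = peval X p" using f nz laurent_ring_iff by blast
  obtain n q where q: "g * peval X (pmon n) = peval X q" using g nz laurent_ring_iff by blast
  obtain s where s: "s \<in> laurent_ring X" "f * g = peval X C * s" using d by (auto simp: dvd_in_def)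
  have "peval X (p * q) = peval X C * (s * peval X (pmon m) * peval X (pmon n))"
    using p[symmetric] q[symmetric] s(2) by (simp add: mult_ac)
  moreover have "s * peval X (pmon m) * peval X (pmon n) \<in> laurent_ring X"
    using s(1) nz by (intro laurent_ring_mult) auto
  ultimately have "dvd_in (laurent_ring X) (peval X C) (peval X (p * q))"
    unfolding dvd_in_def by blast
  then have "C dvd p * q" using dvd_in_laurent_iff[OF X C] by blast
  then have "C dvd p \<or> C dvd q" using prime_elem_dvd_multD[OF C(1)] by blast
  moreover have "dvd_in (laurent_ring X) (peval X C) h"
    if Cr: "C dvd r" and h: "h * peval X (pmon m) = peval X r" for h r m
  proof -
    obtain t where "r = C * t" using Cr by (elim dvdE)
    with h have "h * peval X (pmon m) = peval X C * peval X t" by simp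
    moreover have "peval X (pmon m) \<noteq> 0" by (rule peval_pmon_neq_0) (rule nz)
    ultimately have "h = peval X C * (lmonom X UNIV (\<lambda>k. - int (m k)) * peval X t)"
      unfolding lmonom_uminus lmonom_pmon by (simp add: field_simps)
    then show ?thesis unfolding dvd_in_def
      using laurent_ring_mult[of X, OF nz lmonom_in_laurent peval_in_laurent] by blast
  qed
  ultimately show ?thesis using p q by blast
qed

lemma dvd_in_trans_mult:
  assumes "\<And>k. X k \<noteq> 0" "dvd_in (laurent_ring X) a b" "g \<in> laurent_ring X"
  shows "dvd_in (laurent_ring X) a (b * g)"
proof -
  obtain c where "c \<in> laurent_ring X" "b = a * c" using assms(2) by (auto simp: dvd_in_def)
  then show ?thesis unfolding dvd_in_def using laurent_ring_mult[OF assms(1) _ assms(3)]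
    by (intro bexI[of _ "c * g"]) (auto simp: mult.assoc)
qed

lemma prime_dvd_laurent_power:
  assumes X: "alg_ind X" and C: "prime_elem C" "\<And>k. \<not> mvar k dvd C"
    and f: "f \<in> laurent_ring X"
    and d: "dvd_in (laurent_ring X) (peval X C) (f ^ n)"
  shows "dvd_in (laurent_ring X) (peval X C) f"
  using d
proof (induction n)
  case 0
  have "dvd_in (laurent_ring X) (peval X C) (peval X 1)" using 0 by simp
  then have "C dvd 1" using dvd_in_laurent_iff[OF X C] by blast
  then show ?case using C(1) prime_elem_not_unit by blast
next
  case (Suc n)
  have nz: "\<And>k. X k \<noteq> 0" using alg_ind_nonzero[OF X] .
  show ?case using prime_dvd_laurent_mult[OF X C f laurent_ring_power[OF nz f]] Suc by auto
qed

lemma prime_not_dvd_const: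
  fixes C :: "('n::{finite,linorder}, 'r::idom) mpoly"
  assumes "mvars C \<noteq> {}" "c \<noteq> 0"
  shows "\<not> C dvd mconst c"
  using mvars_dvd[of C "mconst c"] assms by auto

text \<open>For mutations whose outcome is known from a reference polynomial \<open>C\<close>. It
  divides \<open>G\<close> up to a constant but not \<open>P\<close>, hence not the removed factor
  \<open>D\<close>, which divides a power of \<open>P\<close>. So \<open>C\<close> divides
  \<open>F'\<close>, and irreducibility leaves a unit.\<close>

lemma mutated_exchange_poly_unique:
  fixes X' :: "'n::{finite,linorder} \<Rightarrow> ('n, 'r::{factorial_semiring,idom}) ratfun"
  assumes X': "alg_ind X'"
    and C: "irreducible C" "\<And>k. \<not> mvar k dvd C" "mvars C \<noteq> {}"
    and c: "c \<noteq> 0" and G: "emb c * G = N * peval X' C" "N \<in> laurent_ring X'"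
    and P: "P \<in> laurent_ring X'" "\<not> dvd_in (laurent_ring X') (peval X' C) P"
    and H: "common_factors_removed X' i j P G H"
    and F': "peval X' F' = lmonom X' K b * H" "irreducible F'"
  shows "\<exists>u. u dvd 1 \<and> F' = mconst u * C"
proof -
  have nz: "\<And>k. X' k \<noteq> 0" using alg_ind_nonzero[OF X'] .
  have pC: "prime_elem C" using C(1) by (rule mpoly_irreducible_imp_prime_elem)
  note dvd_iff = dvd_in_laurent_iff[OF X' pC C(2)]
  obtain D m where D: "D \<in> poly_ring X' (UNIV - {i, j})" "G = D * H"
    "dvd_in (laurent_ring X') D (P ^ m)" using H by (auto simp: common_factors_removed_def)
  obtain d where d: "D = peval X' d" using D(1) by (auto simp: poly_ring_def)
  have "peval X' (mconst c * d * F') = lmonom X' K b * (emb c * G)"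
    using F'(1) D(2) d by (simp add: mult_ac)
  also have "\<dots> = peval X' C * (lmonom X' K b * N)" by (simp add: G(1))
  finally have "dvd_in (laurent_ring X') (peval X' C) (peval X' (mconst c * d * F'))"
    unfolding dvd_in_def using laurent_ring_mult[OF nz lmonom_in_laurent G(2)] by blast
  then have "C dvd mconst c * d * F'" using dvd_iff by blast
  then have "C dvd mconst c \<or> C dvd d \<or> C dvd F'" using prime_elem_dvd_multD[OF pC] by blast
  moreover have "\<not> C dvd mconst c" using prime_not_dvd_const C(3) c by blast
  moreover have "\<not> C dvd d"
  proof
    assume "C dvd d"
    then have "dvd_in (laurent_ring X') (peval X' C) D" using dvd_iff d by blast
    then obtain s where s: "s \<in> laurent_ring X'" "D = peval X' C * s" by (auto simp: dvd_in_def)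
    obtain t where t: "t \<in> laurent_ring X'" "P ^ m = D * t" using D(3) by (auto simp: dvd_in_def)
    have "P ^ m = peval X' C * (s * t)" using s t by (simp add: mult_ac)
    then have "dvd_in (laurent_ring X') (peval X' C) (P ^ m)"
      unfolding dvd_in_def using laurent_ring_mult[OF nz s(1) t(1)] by blast
    then show False using prime_dvd_laurent_power[OF X' pC C(2) P(1)] P(2) by blast
  qed
  ultimately have CF: "C dvd F'" by blast
  then obtain q where q: "F' = C * q" by (elim dvdE)
  with F'(2) have "C dvd 1 \<or> q dvd 1" by (rule irreducibleD)
  then have "q dvd 1" using C(1) irreducible_not_unit by blast
  then obtain u where "q = mconst u" "u dvd 1" by (elim is_unit_mpolyE)
  then show ?thesis using q by (auto simp: mult.commute)
qed

text \<open>For activations, where no reference polynomial exists yet: if common divisors of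
  \<open>G\<close> and powers of \<open>P\<close> divide a monomial up to a constant, the removed
  factor is itself a monomial up to a constant, and \<open>F'\<close> is known from
  \<open>G\<close>.\<close>

lemma mutated_exchange_poly_monomial:
  fixes X' :: "'n::{finite,linorder} \<Rightarrow> ('n, 'r::idom) ratfun"
  assumes X': "alg_ind X'"
    and H: "common_factors_removed X' i j P G H" and G: "G \<noteq> 0"
    and D: "\<And>D m. dvd_in (laurent_ring X') D (P ^ m) \<Longrightarrow> dvd_in (laurent_ring X') D G \<Longrightarrow>
      \<exists>c e. c \<noteq> 0 \<and> dvd_in (laurent_ring X') D (emb c * lmonom X' UNIV e)"
    and F': "peval X' F' = lmonom X' K b * H"
  shows "\<exists>\<kappa> e. fconst \<kappa> \<and> peval X' F' = \<kappa> * lmonom X' UNIV e * G"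
proof -
  have nz: "\<And>k. X' k \<noteq> 0" using alg_ind_nonzero[OF X'] .
  obtain D m where D': "D \<in> poly_ring X' (UNIV - {i, j})" "G = D * H"
    "dvd_in (laurent_ring X') D (P ^ m)" "H \<in> laurent_ring X'"
    using H by (auto simp: common_factors_removed_def)
  obtain d where d: "D = peval X' d" using D'(1) by (auto simp: poly_ring_def)
  have "dvd_in (laurent_ring X') D G" using D'(2,4) by (auto simp: dvd_in_def)
  from D[OF D'(3) this] obtain c e where "c \<noteq> 0"
    "dvd_in (laurent_ring X') (peval X' d) (emb c * lmonom X' UNIV e)" by (auto simp: d)
  then obtain c' m' where cm: "d = mconst c' * pmon m'" using laurent_ring_const_dvd[OF X'] by blast
  have c': "c' \<noteq> 0" using G D'(2) d cm by auto
  have DD: "D = emb c' * lmonom X' UNIV (\<lambda>k. int (m' k))" by (simp add: d cm lmonom_pmon)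
  have mn: "lmonom X' UNIV (\<lambda>k. int (m' k)) \<noteq> 0" using nz by (intro lmonom_neq_0)
  define bb where "bb k = (if k \<in> K then b k else 0)" for k
  have "H = inverse (emb c') * lmonom X' UNIV (\<lambda>k. - int (m' k)) * G"
    using D'(2) DD c' mn by (simp add: lmonom_uminus field_simps)
  then have "peval X' F' = inverse (emb c') * (lmonom X' UNIV bb * lmonom X' UNIV (\<lambda>k. - int (m' k))) * G"
  proof -
    have "lmonom X' K b = lmonom X' UNIV bb" unfolding bb_def by (rule lmonom_extend)
    then show ?thesis unfolding F' \<open>H = _\<close> by (simp only: mult_ac)
  qed
  also have "\<dots> = inverse (emb c') * lmonom X' UNIV (\<lambda>k. bb k + - int (m' k)) * G"
    by (subst lmonom_add) (use nz in auto)
  finally show ?thesis using fconst_inverse[OF fconst_emb[OF c']] by blast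
qed

section \<open>Exponents of the Laurent polynomials attached to a seed\<close>

lemma hat_at_upd:
  assumes "j \<noteq> i"
  shows "hat_at F i a (X(j := v)) = v powi a j * lmonom X (UNIV - {i, j}) a * peval (X(j := v)) (F i)"
proof -
  have "lmonom (X(j := v)) (UNIV - {i}) a = v powi a j * lmonom X (UNIV - {i} - {j}) a"
    using assms lmonom_upd[of j "UNIV - {i} - {j}" X v a]
    unfolding lmonom_def by (subst prod.remove[of _ j]) auto
  moreover have "UNIV - {i} - {j} = UNIV - {i, j}" by auto
  ultimately show ?thesis by (simp add: hat_at_def)
qed

lemma peval_in_laurent_subst:
  assumes "\<And>k. X k \<noteq> 0" "\<And>k. Y k \<in> laurent_ring X"
  shows "peval Y p \<in> laurent_ring X"
proof (rule mpoly_induct[of p UNIV])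
  show "peval Y (mconst c) \<in> laurent_ring X" for c
    using peval_in_laurent[of X "mconst c"] by simp
next
  show "peval Y (p + q) \<in> laurent_ring X"
    if "peval Y p \<in> laurent_ring X" "peval Y q \<in> laurent_ring X" for p q
    using laurent_ring_add[OF assms(1) that] by simp
next
  show "peval Y (mvar i * p) \<in> laurent_ring X" if "peval Y p \<in> laurent_ring X" for p i
    using laurent_ring_mult[OF assms(1) assms(2) that] by simp
qed simp

text \<open>Modulo \<open>F j\<close> the substitution of \<open>F j / X j\<close> for
  \<open>X j\<close> amounts to setting \<open>X j\<close> to 0. If the exponent were negative,
  clearing it would make \<open>F j\<close> divide \<open>F i\<close> at
  \<open>X j = 0\<close>.\<close>

lemma hat_exponent_0:
  assumes X: "alg_ind X" and hat: "is_hat_exponent (X, F) i a" and ji: "j \<noteq> i"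
    and nd: "\<not> dvd_in (laurent_ring X) (peval X (F j)) (peval (X(j := 0)) (F i))"
    and Fj: "F j \<noteq> 0"
  shows "a j = 0"
proof (rule ccontr)
  assume a: "a j \<noteq> 0"
  have nz: "\<And>k. X k \<noteq> 0" using alg_ind_nonzero[OF X] .
  define f where "f = peval X (F j)"
  have f0: "f \<noteq> 0" using Fj X by (simp add: f_def alg_ind_eq_0_iff)
  define Y where "Y = X(j := f / X j)"
  have h: "a j \<le> 0" "hat_at F i a Y \<in> laurent_ring X"
    using hat ji by (auto simp: is_hat_exponent_def Let_def Y_def f_def)
  have "a j = - int (Suc (nat (- a j) - 1))" using h(1) a by simp
  then obtain k where k: "a j = - int (Suc k)" by blast
  obtain p0 p1 where p: "F i = p0 + mvar j * p1" "mvars p0 \<subseteq> mvars (F i) - {j}"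
    using split_off_var by blast
  have j: "j \<notin> mvars p0" using p(2) by auto
  have 0: "peval (X(j := 0)) (F i) = peval X p0" by (simp add: p(1) peval_upd_free[OF j])
  have Yl: "Y k \<in> laurent_ring X" for k
  proof (cases "k = j")
    case True
    have "f / X j = f * lmonom X {j} (\<lambda>_. -1)" by (simp add: lmonom_def divide_inverse power_int_minus)
    then have "f / X j \<in> laurent_ring X"
      using laurent_ring_mult[of X f "lmonom X {j} (\<lambda>_. -1)"] nz by (simp add: f_def)
    then show ?thesis using True by (simp add: Y_def)
  next
    case False
    then show ?thesis using peval_in_laurent[of X "mvar k"] by (simp add: Y_def)
  qed
  define m where "m = lmonom X (UNIV - {i, j}) a"
  have m0: "m \<noteq> 0" unfolding m_def using nz by (intro lmonom_neq_0)
  have E: "hat_at F i a Y = (f / X j) powi a j * m * peval Y (F i)"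
    unfolding Y_def m_def by (rule hat_at_upd[OF ji])
  have Yi: "peval Y (F i) = peval X p0 + (f / X j) * peval Y p1"
    unfolding Y_def by (simp add: p(1) peval_upd_free[OF j])
  have im: "inverse m = lmonom X (UNIV - {i, j}) (\<lambda>k. - a k)" by (simp add: m_def lmonom_uminus)
  have "(f / X j) powi a j = inverse ((f / X j) ^ Suc k)"
    unfolding k power_int_minus power_int_of_nat ..
  then have "peval Y (F i) = hat_at F i a Y * inverse m * (f / X j) ^ Suc k"
    using E m0 f0 nz by simp
  then have "peval X p0 = (f / X j) * (hat_at F i a Y * inverse m * (f / X j) ^ k - peval Y p1)"
    using Yi by (simp add: algebra_simps)
  also have "\<dots> = f * (inverse (X j) * (hat_at F i a Y * inverse m * Y j ^ k + - 1 * peval Y p1))"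
    by (simp add: Y_def divide_inverse mult_ac)
  finally have "peval X p0 = \<dots>" .
  moreover have "inverse (X j) * (hat_at F i a Y * inverse m * Y j ^ k + - 1 * peval Y p1) \<in> laurent_ring X"
  proof -
    have 1: "inverse (X j) = lmonom X {j} (\<lambda>_. -1)" by (simp add: lmonom_def power_int_minus)
    have 2: "- 1 \<in> laurent_ring X"
      using peval_in_laurent[of X "- 1"] by (simp del: peval_in_laurent)
    show ?thesis unfolding 1 im
      by (intro laurent_ring_mult laurent_ring_add laurent_ring_power nz h(2) Yl
          peval_in_laurent_subst 2 lmonom_in_laurent)
  qed
  ultimately show False using nd unfolding 0 dvd_in_def f_def by blast
qed

text \<open>As \<open>f\<close> omits \<open>X j\<close>, the substitution of \<open>f / X j\<close>
  for \<open>X j\<close> is an involution, and Laurent identities may be specialized along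
  it.\<close>

lemma theta_flip:
  fixes X :: "'n::{finite,linorder} \<Rightarrow> ('n, 'r::idom) ratfun"
  assumes X: "alg_ind X" and f: "j \<notin> mvars f" "f \<noteq> 0"
    and S: "lfun UNIV S" and T: "lfun UNIV T"
    and eq: "S X = T (X(j := peval X f / X j))"
  shows "S (X(j := peval X f / X j)) = T X"
proof -
  define \<Theta> where "\<Theta> Y = Y(j := peval Y f / Y j)" for Y :: "'n \<Rightarrow> ('n, 'r) ratfun"
  have nz: "\<And>k. X k \<noteq> 0" using alg_ind_nonzero[OF X] .
  have f0: "peval X f \<noteq> 0" using f X by (simp add: alg_ind_eq_0_iff)
  have \<Theta>0: "\<Theta> X k \<noteq> 0" for k using nz f0 by (simp add: \<Theta>_def)
  have \<Theta>2: "\<Theta> (\<Theta> X) = X"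
    using nz[of j] f0 by (auto simp: \<Theta>_def peval_upd_free[OF f(1)])
  obtain c m p where p: "c \<noteq> 0"
    "\<And>Y. (\<forall>k\<in>UNIV. Y k \<noteq> 0) \<Longrightarrow> emb c * peval Y (pmon m) * T Y = peval Y p"
    using lfun_rep[OF T] by metis
  have \<Theta>l: "lfun UNIV (\<lambda>Y. \<Theta> Y k)" for k
    by (cases "k = j") (auto simp: \<Theta>_def intro!: lfun_divide lfun_peval lfun_var)
  have l1: "lfun UNIV (\<lambda>Y. emb c * peval (\<Theta> Y) (pmon m) * S Y)"
    by (intro lfun_mult lfun_emb lfun_peval \<Theta>l S)
  have l2: "lfun UNIV (\<lambda>Y. peval (\<Theta> Y) p)" by (intro lfun_peval \<Theta>l)
  have "emb c * peval (\<Theta> X) (pmon m) * S X = peval (\<Theta> X) p"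
    using p(2)[of "\<Theta> X"] \<Theta>0 eq by (simp add: \<Theta>_def)
  from lfun_identity[OF X l1 l2 this, of "\<Theta> X"]
  have "emb c * peval (\<Theta> (\<Theta> X)) (pmon m) * S (\<Theta> X) = peval (\<Theta> (\<Theta> X)) p"
    using \<Theta>0 by blast
  then have "emb c * peval X (pmon m) * S (\<Theta> X) = emb c * peval X (pmon m) * T X"
    using p(2)[of X] nz by (simp add: \<Theta>2)
  then have "S (\<Theta> X) = T X" using p(1) peval_pmon_neq_0[of m X] nz by simp
  then show ?thesis by (simp add: \<Theta>_def)
qed

text \<open>\<open>v\<close> and \<open>Z\<close> differ by a unit of the Laurent ring in the other
  variables. The reverse inclusion is the same statement with the inverse unit.\<close>

lemma laurent_ring_upd_unit_monomial:
  fixes X :: "'n::{finite,linorder} \<Rightarrow> ('n, 'r::idom) ratfun"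
  assumes nz: "\<And>k. X k \<noteq> 0" and Z: "Z = emb u * lmonom X (UNIV - {j}) c * v" "v \<noteq> 0" "u dvd 1"
    and f: "f \<in> laurent_ring (X(j := v))"
  shows "f \<in> laurent_ring (X(j := Z))"
proof -
  obtain u' where u': "1 = u * u'" using Z(3) by (elim dvdE)
  then have uu: "emb u * emb u' = (1 :: ('n, 'r) ratfun)" by (metis emb_1 emb_mult)
  have u0: "emb u \<noteq> 0" "emb u' \<noteq> 0" using uu by auto
  let ?X = "X(j := Z)"
  have m0: "lmonom X (UNIV - {j}) c \<noteq> 0" using nz by (intro lmonom_neq_0)
  have Z0: "Z \<noteq> 0" using Z u0 m0 by simp
  have nz': "\<And>k. ?X k \<noteq> 0" using nz Z0 by simp
  have v: "v = emb u' * lmonom ?X (UNIV - {j}) (\<lambda>k. - c k) * Z"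
    using m0 uu by (simp add: Z(1) lmonom_upd lmonom_uminus mult_ac)
  have vin: "v \<in> laurent_ring ?X"
    unfolding v using peval_in_laurent[of ?X "mconst u'"] peval_in_laurent[of ?X "mvar j"]
    by (intro laurent_ring_mult nz' lmonom_in_laurent) (auto simp del: peval_in_laurent)
  have iv: "inverse v = emb u * lmonom ?X (UNIV - {j}) c * lmonom ?X {j} (\<lambda>_. -1)"
    unfolding Z(1) using Z(2) m0 u0
    by (simp add: lmonom_upd lmonom_def[of _ "{j}"] power_int_minus field_simps)
  have ivin: "inverse v \<in> laurent_ring ?X"
    unfolding iv using peval_in_laurent[of ?X "mconst u"]
    by (intro laurent_ring_mult nz' lmonom_in_laurent) (auto simp del: peval_in_laurent)
  obtain a p where ap: "f = lmonom (X(j := v)) UNIV a * peval (X(j := v)) p"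
    using f by (auto simp: laurent_ring_def)
  have "v powi n \<in> laurent_ring ?X" for n
    using laurent_ring_power[OF nz' vin] laurent_ring_power[OF nz' ivin] by (simp add: power_int_def)
  moreover have "lmonom (X(j := v)) UNIV a = v powi a j * lmonom ?X (UNIV - {j}) a"
    by (simp add: lmonom_UNIV_remove[of _ _ j] lmonom_upd)
  moreover have "(X(j := v)) k \<in> laurent_ring ?X" for k
    using vin peval_in_laurent[of ?X "mvar k"] by auto
  ultimately show ?thesis unfolding ap
    by (simp only:) (intro laurent_ring_mult nz' lmonom_in_laurent peval_in_laurent_subst)
qed

text \<open>The exponent of \<open>X j\<close> read off in the cluster \<open>Xs\<close> adjacent to \<open>X\<close> at \<open>j\<close>: the
  substitution \<open>X j \<mapsto> F j / X j\<close> is an involution that turns the conditions on the exponent into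
  conditions on the expansion in \<open>Xs\<close>.\<close>

lemma hat_exponent_square:
  fixes X :: "'n::{finite,linorder} \<Rightarrow> ('n, 'r::{factorial_semiring,idom}) ratfun"
  assumes X: "alg_ind X" and hat: "is_hat_exponent (X, F) i a" and ji: "j \<noteq> i"
    and Fj: "irreducible (F j)" "j \<notin> mvars (F j)" "\<And>k. \<not> mvar k dvd F j" "mvars (F j) \<noteq> {}"
    and Xs: "Xs = X(j := Z)" "alg_ind Xs"
      "Z = emb u * lmonom X (UNIV - {j}) c * (peval X (F j) / X j)" "u dvd 1"
    and C: "\<not> F j dvd C" and \<kappa>: "fconst \<kappa>"
    and Fi: "peval X (F i) = \<kappa> * lmonom X UNIV b * (lmonom Xs UNIV b' * peval Xs C)"
  shows "a j = - b j"
proof -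
  have nz: "\<And>k. X k \<noteq> 0" using alg_ind_nonzero[OF X] .
  have nzs: "\<And>k. Xs k \<noteq> 0" using alg_ind_nonzero[OF Xs(2)] .
  have pF: "prime_elem (F j)" using Fj(1) by (rule mpoly_irreducible_imp_prime_elem)
  note dvd_iff = dvd_in_laurent_iff[OF Xs(2) pF Fj(3)]
  define f where "f = peval X (F j)"
  have f0: "f \<noteq> 0" using Fj(1) X by (auto simp: f_def alg_ind_eq_0_iff)
  have fs: "peval Xs (F j) = f" by (simp add: Xs(1) f_def peval_upd_free[OF Fj(2)])
  define Xo where "Xo = X(j := f / X j)"
  have fo: "peval Xo (F j) = f" by (simp add: Xo_def f_def peval_upd_free[OF Fj(2)])
  have Fj0: "F j \<noteq> 0" using Fj(1) by auto
  let ?T = "hat_at F i a"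
  have Tl: "lfun UNIV ?T" unfolding hat_at_def by (intro lfun_mult lfun_lmonom lfun_peval lfun_var) auto
  have E: "?T Xo \<in> laurent_ring X" "\<not> dvd_in (laurent_ring X) f (?T Xo)"
    using hat ji by (auto simp: is_hat_exponent_def Let_def Xo_def f_def)
  have sub: "laurent_ring Xo \<subseteq> laurent_ring Xs"
    using laurent_ring_upd_unit_monomial[OF nz Xs(3) _ Xs(4)] f0 nz
    unfolding Xs(1) Xo_def f_def by auto
  have sub': "laurent_ring Xs \<subseteq> laurent_ring Xo"
  proof -
    obtain u' where u': "1 = u * u'" using Xs(4) by (elim dvdE)
    then have uu: "emb u * emb u' = (1 :: ('n, 'r) ratfun)" by (metis emb_1 emb_mult)
    have "u' dvd 1" using u' by (metis dvd_triv_right)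
    have m0: "lmonom X (UNIV - {j}) c \<noteq> 0" using nz by (intro lmonom_neq_0)
    have "f / X j = emb u' * lmonom X (UNIV - {j}) (\<lambda>k. - c k) * Z"
      using m0 uu unfolding Xs(3) f_def[symmetric] lmonom_uminus
      by (simp add: mult_ac)
    moreover have "Z \<noteq> 0" using nzs[of j] by (simp add: Xs(1))
    ultimately have "g \<in> laurent_ring (X(j := f / X j))" if "g \<in> laurent_ring (X(j := Z))" for g
      by (intro laurent_ring_upd_unit_monomial[OF nz _ _ \<open>u' dvd 1\<close> that])
    then show ?thesis unfolding Xs(1) Xo_def by (rule subsetI)
  qed
  have T1: "?T X \<in> laurent_ring Xs"
  proof -
    obtain e p where "?T Xo = lmonom X UNIV e * peval X p" using E(1) by (auto simp: laurent_ring_def)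
    moreover have "lfun UNIV (\<lambda>Y. lmonom Y UNIV e * peval Y p)"
      by (intro lfun_mult lfun_lmonom lfun_peval lfun_var) auto
    ultimately have "lmonom Xo UNIV e * peval Xo p = ?T X"
      using theta_flip[OF X Fj(2) Fj0 _ Tl, of "\<lambda>Y. lmonom Y UNIV e * peval Y p"]
      by (simp add: Xo_def f_def)
    then have "?T X = lmonom Xo UNIV e * peval Xo p" by simp
    then have "?T X \<in> laurent_ring Xo" unfolding laurent_ring_def by blast
    then show ?thesis using sub by blast
  qed
  have T2: "\<not> dvd_in (laurent_ring Xs) f (?T X)"
  proof
    assume "dvd_in (laurent_ring Xs) f (?T X)"
    then obtain s where s: "s \<in> laurent_ring Xo" "?T X = f * s" using sub' by (auto simp: dvd_in_def)
    then obtain e p where ep: "s = lmonom Xo UNIV e * peval Xo p" by (auto simp: laurent_ring_def)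
    have "lfun UNIV (\<lambda>Y. peval Y (F j) * (lmonom Y UNIV e * peval Y p))"
      by (intro lfun_mult lfun_lmonom lfun_peval lfun_var) auto
    from theta_flip[OF X Fj(2) Fj0 Tl this] have "?T Xo = f * (lmonom X UNIV e * peval X p)"
      using s(2) ep fo by (simp add: Xo_def f_def)
    then show False using E(2) unfolding dvd_in_def
      using laurent_ring_mult[of X, OF nz lmonom_in_laurent peval_in_laurent] by blast
  qed
  obtain k1 k2 where k: "k1 \<noteq> 0" "k2 \<noteq> 0" "\<kappa> = emb k1 / emb k2" using \<kappa> by (auto simp: fconst_def)
  \<comment> \<open>The exponent of \<open>f\<close> in the expansion of the hat polynomial over
    \<open>Xs\<close>. Non-divisibility by \<open>f\<close> excludes a positive value, membership in
    the Laurent ring a negative one.\<close>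
  define d where "d = a j + b j"
  define b1 where "b1 k = (if k = i then b k else a k + b k)" for k
  have ij: "UNIV - {i} - {j} = UNIV - {i, j}" by auto
  \<comment> \<open>The unit of the Laurent ring in \<open>Xs\<close> that is left over when
    \<open>X j\<close> is rewritten through \<open>Z\<close> and \<open>f\<close>.\<close>
  define mm where "mm = emb u powi d * lmonom Xs (UNIV - {j}) (\<lambda>k. c k * d + b1 k) * Z powi (- d) * lmonom Xs UNIV b'"
  have Zl: "Z powi n \<in> laurent_ring Xs" for n
  proof -
    have "Z powi n = lmonom Xs {j} (\<lambda>_. n)" by (simp add: lmonom_def Xs(1))
    then show ?thesis by simp
  qed
  obtain u' where u': "1 = u * u'" using Xs(4) by (elim dvdE)
  then have uu: "emb u * emb u' = (1 :: ('n, 'r) ratfun)" by (metis emb_1 emb_mult)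
  have iu: "inverse (emb u) = (emb u' :: ('n, 'r) ratfun)" using uu by (rule inverse_unique)
  have ul: "emb u powi n \<in> laurent_ring Xs" for n
    using laurent_ring_power[OF nzs, of "emb u"] laurent_ring_power[OF nzs, of "emb u'"]
      peval_in_laurent[of Xs "mconst u"] peval_in_laurent[of Xs "mconst u'"]
    by (simp add: power_int_def iu)
  have mml: "mm \<in> laurent_ring Xs" unfolding mm_def
    by (intro laurent_ring_mult nzs ul Zl lmonom_in_laurent)
  have Xj: "X j = emb u * lmonom X (UNIV - {j}) c * f / Z"
  proof -
    have "Z \<noteq> 0" using nzs[of j] by (simp add: Xs(1))
    moreover have "Z * X j = emb u * lmonom X (UNIV - {j}) c * f"
      using nz[of j] by (simp add: Xs(3) f_def)
    ultimately show ?thesis by (simp add: eq_divide_eq mult.commute)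
  qed
  have HT: "?T X = \<kappa> * f powi d * (mm * peval Xs C)"
  proof -
    have "lmonom X (UNIV - {i}) a * lmonom X UNIV b = X j powi d * lmonom X (UNIV - {j}) b1"
    proof -
      have 1: "lmonom X (UNIV - {i}) a = lmonom X UNIV (\<lambda>k. if k \<in> UNIV - {i} then a k else 0)"
        by (rule lmonom_extend)
      have "lmonom X (UNIV - {i}) a * lmonom X UNIV b =
        lmonom X UNIV (\<lambda>k. (if k \<in> UNIV - {i} then a k else 0) + b k)"
        unfolding 1 by (rule lmonom_add[symmetric]) (rule nz)
      also have "(\<lambda>k. (if k \<in> UNIV - {i} then a k else 0) + b k) = b1" by (auto simp: b1_def)
      also have "lmonom X UNIV b1 = X j powi d * lmonom X (UNIV - {j}) b1"
        using ji by (simp add: lmonom_UNIV_remove[of _ _ j] b1_def[of j] d_def)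
      finally show ?thesis .
    qed
    moreover have "X j powi d = emb u powi d * lmonom X (UNIV - {j}) (\<lambda>k. c k * d) * f powi d * Z powi (- d)"
    proof -
      have "(lmonom X (UNIV - {j}) c) powi d = lmonom X (UNIV - {j}) (\<lambda>k. c k * d)"
        by (rule lmonom_powi)
      then show ?thesis unfolding Xj
        by (simp add: power_int_mult_distrib power_int_divide_distrib power_int_minus divide_inverse
            power_int_inverse)
    qed
    moreover have "lmonom X (UNIV - {j}) (\<lambda>k. c k * d) * lmonom X (UNIV - {j}) b1 =
        lmonom Xs (UNIV - {j}) (\<lambda>k. c k * d + b1 k)"
      using nz by (subst lmonom_add[symmetric]) (auto simp: Xs(1) lmonom_upd)
    ultimately show ?thesis unfolding hat_at_def Fi mm_def by (simp add: mult_ac)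
  qed
  have eq: "emb k2 * ?T X = f powi d * (emb k1 * mm * peval Xs C)"
    using HT k by simp
  have el: "emb k \<in> laurent_ring Xs" for k using peval_in_laurent[of Xs "mconst k"] by simp
  have nk: "\<not> dvd_in (laurent_ring Xs) f (emb k)" if "k \<noteq> 0" for k
    using dvd_iff[of "mconst k"] prime_not_dvd_const[OF Fj(4) that] fs by simp
  have "d = 0"
  proof (rule ccontr)
    assume "d \<noteq> 0"
    then consider n where "d = int (Suc n)" | n where "d = - int (Suc n)"
      by (metis int_cases3 gr0_conv_Suc)
    then show False
    proof cases
      case (1 n)
      then have "emb k2 * ?T X = f * (f ^ n * (emb k1 * mm * peval Xs C))"
        using eq by (simp add: mult_ac del: of_nat_Suc)
      moreover have "f ^ n * (emb k1 * mm * peval Xs C) \<in> laurent_ring Xs"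
        using fs peval_in_laurent[of Xs "F j"]
        by (intro laurent_ring_mult laurent_ring_power nzs el mml peval_in_laurent) auto
      ultimately have "dvd_in (laurent_ring Xs) f (emb k2 * ?T X)" unfolding dvd_in_def by blast
      then show False
        using prime_dvd_laurent_mult[OF Xs(2) pF Fj(3) el T1] fs nk[OF k(2)] T2 by auto
    next
      case (2 n)
      have "f powi d = inverse (f ^ Suc n)" unfolding 2 power_int_minus power_int_of_nat ..
      then have "emb k1 * mm * peval Xs C = f ^ Suc n * (emb k2 * ?T X)"
        using eq f0 by (simp add: field_simps)
      then have "emb k1 * mm * peval Xs C = f * (f ^ n * (emb k2 * ?T X))" by (simp add: mult_ac)
      moreover have "f ^ n * (emb k2 * ?T X) \<in> laurent_ring Xs"
        using fs peval_in_laurent[of Xs "F j"]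
        by (intro laurent_ring_mult laurent_ring_power nzs el T1) auto
      ultimately have d1: "dvd_in (laurent_ring Xs) f (emb k1 * mm * peval Xs C)"
        unfolding dvd_in_def by blast
      have "\<not> dvd_in (laurent_ring Xs) f mm"
      proof
        assume a: "dvd_in (laurent_ring Xs) f mm"
        define mi where "mi = emb u powi (- d) * lmonom Xs (UNIV - {j}) (\<lambda>k. - (c k * d + b1 k)) * Z powi d * lmonom Xs UNIV (\<lambda>k. - b' k)"
        have mil: "mi \<in> laurent_ring Xs" unfolding mi_def
          by (intro laurent_ring_mult nzs ul Zl lmonom_in_laurent)
        have ne: "emb u \<noteq> (0 :: ('n, 'r) ratfun)" "Z \<noteq> 0" "lmonom Xs (UNIV - {j}) (\<lambda>k. c k * d + b1 k) \<noteq> 0" "lmonom Xs UNIV b' \<noteq> 0"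
        proof -
          show "emb u \<noteq> (0 :: ('n, 'r) ratfun)" using uu by auto
          show "Z \<noteq> 0" using nzs[of j] by (simp add: Xs(1))
        qed (rule lmonom_neq_0, rule nzs)+
        have "mm * mi = 1"
          unfolding mm_def mi_def lmonom_uminus using ne by (simp add: power_int_minus field_simps)
        then have "dvd_in (laurent_ring Xs) f (emb 1)"
          using dvd_in_trans_mult[OF nzs a mil] by simp
        then show False using nk[of 1] by simp
      qed
      then have "dvd_in (laurent_ring Xs) f (peval Xs C)"
        using d1 prime_dvd_laurent_mult[OF Xs(2) pF Fj(3) laurent_ring_mult[OF nzs el mml] peval_in_laurent]
          prime_dvd_laurent_mult[OF Xs(2) pF Fj(3) el mml] fs nk[OF k(1)] by metis
      then show False using dvd_iff fs C by blast
    qed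
  qed
  then show ?thesis by (simp add: d_def)
qed

section \<open>Relabelling and rescaling a cluster\<close>

text \<open>Polynomials in \<open>X\<close> and in \<open>Z\<close> have the same values in the
  field. Transfer is stated by existence of a polynomial with the given value, which independence
  makes unique.\<close>

locale rescaled =
  fixes X Z :: "'n::{finite,linorder} \<Rightarrow> ('n, 'r::idom) ratfun" and \<iota> :: "'n \<Rightarrow> 'n" and u v :: "'n \<Rightarrow> 'r"
  assumes bij: "bij \<iota>" and Z: "\<And>k. Z k = emb (u k) * X (\<iota> k)" and uv: "\<And>k. u k * v k = 1"
    and X_ind: "alg_ind X"
begin

lemma emb_uv: "emb (u k) * emb (v k) = (1 :: ('n, 'r) ratfun)"
  using uv[of k] by (metis emb_1 emb_mult)

lemma X_Z: "X (\<iota> k) = emb (v k) * Z k"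
  unfolding Z using emb_uv[of k] by (simp add: mult.assoc[symmetric] mult.commute[of "emb (v k)"])

lemma alg_ind: "alg_ind Z"
  unfolding alg_ind_def
proof (intro allI impI)
  fix p assume p: "peval Z p = 0"
  define Y where "Y k = emb (v (inv \<iota> k)) * X (inv \<iota> k)" for k
  have inv: "inv \<iota> (\<iota> k) = k" for k using bij by (simp add: bij_is_inj)
  have l: "lfun {} (\<lambda>Y. peval (\<lambda>k. emb (u k) * Y (\<iota> k)) p)"
    by (intro lfun_peval lfun_mult lfun_emb lfun_var)
  have "(\<lambda>k. emb (u k) * X (\<iota> k)) = Z" using Z by auto
  then have "peval (\<lambda>k. emb (u k) * X (\<iota> k)) p = 0" using p by simp
  from lfun_identity[OF X_ind l lfun_0 this, of Y]
  have "peval (\<lambda>k. emb (u k) * Y (\<iota> k)) p = 0" by simp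
  moreover have "(\<lambda>k. emb (u k) * Y (\<iota> k)) = X"
    using emb_uv by (auto simp: Y_def inv mult.assoc[symmetric])
  ultimately show "p = 0" using X_ind by (simp add: alg_ind_eq_0_iff)
qed

lemma transfer_ex:
  assumes "mvars p \<subseteq> \<iota> ` K"
  shows "\<exists>q. peval Z q = peval X p \<and> mvars q \<subseteq> K"
proof (rule mpoly_induct[OF assms])
  show "\<exists>q. peval Z q = peval X (mconst c) \<and> mvars q \<subseteq> K" for c
    by (rule exI[of _ "mconst c"]) simp
next
  fix p1 p2
  assume "\<exists>q. peval Z q = peval X p1 \<and> mvars q \<subseteq> K" "\<exists>q. peval Z q = peval X p2 \<and> mvars q \<subseteq> K"
  then obtain q1 q2 where "peval Z q1 = peval X p1" "mvars q1 \<subseteq> K" "peval Z q2 = peval X p2" "mvars q2 \<subseteq> K"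
    by blast
  then show "\<exists>q. peval Z q = peval X (p1 + p2) \<and> mvars q \<subseteq> K"
    by (intro exI[of _ "q1 + q2"]) (simp add: mvars_subsetI)
next
  fix p i
  assume i: "i \<in> \<iota> ` K" and "\<exists>q. peval Z q = peval X p \<and> mvars q \<subseteq> K"
  then obtain q k where q: "peval Z q = peval X p" "mvars q \<subseteq> K" and k: "i = \<iota> k" "k \<in> K" by blast
  have "peval Z (mconst (v k) * mvar k * q) = peval X (mvar i * p)"
    using q k by (simp add: X_Z)
  moreover have "mvars (mconst (v k) * mvar k * q) \<subseteq> K"
    using q k by (intro mvars_subsetI(3)) auto
  ultimately show "\<exists>q. peval Z q = peval X (mvar i * p) \<and> mvars q \<subseteq> K" by blast
qed

lemma transfer_ex': "\<exists>q. peval Z q = peval X p"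
  using transfer_ex[of p UNIV] bij by (auto simp: bij_is_surj)

lemma transfer_back: "\<exists>p. peval Z q = peval X p"
proof (rule mpoly_induct[of q UNIV])
  show "\<exists>p. peval Z (mconst c) = peval X p" for c
    by (rule exI[of _ "mconst c"]) simp
next
  show "\<exists>p. peval Z (q1 + q2) = peval X p"
    if "\<exists>p. peval Z q1 = peval X p" "\<exists>p. peval Z q2 = peval X p" for q1 q2
    using that by (metis peval_simps(5))
next
  fix q k assume "\<exists>p. peval Z q = peval X p"
  then obtain p where "peval Z q = peval X p" by blast
  then have "peval Z (mvar k * q) = peval X (mconst (u k) * mvar (\<iota> k) * p)" by (simp add: Z)
  then show "\<exists>p. peval Z (mvar k * q) = peval X p" by blast
qed simp

lemma poly_ring_eq: "poly_ring Z UNIV = poly_ring X UNIV"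
  unfolding poly_ring_def using transfer_ex' transfer_back by (auto; metis)

lemma transfer_mvar:
  assumes "peval Z q = peval X p" "mvar k dvd q"
  shows "mvar (\<iota> k) dvd p"
proof -
  obtain r where r: "q = mvar k * r" using assms(2) by (elim dvdE)
  obtain s where s: "peval Z r = peval X s" using transfer_back by blast
  have "peval X p = peval X (mvar (\<iota> k) * (mconst (u k) * s))"
    using assms(1) r s by (simp add: Z mult_ac)
  then have "p = mvar (\<iota> k) * (mconst (u k) * s)" using X_ind alg_ind_eq_iff by blast
  then show ?thesis by simp
qed

lemma transfer_mvars:
  assumes "peval Z q = peval X p" "\<iota> k \<notin> mvars p"
  shows "k \<notin> mvars q"
proof -
  have "mvars p \<subseteq> \<iota> ` (UNIV - {k})"
  proof
    fix i assume "i \<in> mvars p"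
    then have "i \<noteq> \<iota> k" using assms(2) by auto
    moreover obtain k' where "i = \<iota> k'" using bij by (metis bij_is_surj surjD)
    ultimately show "i \<in> \<iota> ` (UNIV - {k})" by auto
  qed
  then obtain q' where q': "peval Z q' = peval X p" "mvars q' \<subseteq> UNIV - {k}" using transfer_ex by blast
  then have "peval Z q' = peval Z q" using assms(1) by simp
  then have "q' = q" using alg_ind_eq_iff[OF alg_ind] by blast
  with q' show ?thesis by auto
qed

lemma transfer_unit:
  assumes "peval Z q = peval X p"
  shows "q dvd 1 \<longleftrightarrow> p dvd 1"
proof
  assume "q dvd 1"
  then obtain w where w: "q = mconst w" "w dvd 1" by (elim is_unit_mpolyE)
  then have "peval X p = peval X (mconst w)" using assms by simp
  then have "p = mconst w" using alg_ind_eq_iff[OF X_ind] by blast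
  with w show "p dvd 1" by simp
next
  assume "p dvd 1"
  then obtain w where w: "p = mconst w" "w dvd 1" by (elim is_unit_mpolyE)
  then have "peval Z q = peval Z (mconst w)" using assms by simp
  then have "q = mconst w" using alg_ind_eq_iff[OF alg_ind] by blast
  with w show "q dvd 1" by simp
qed

lemma transfer_irreducible:
  assumes eq: "peval Z q = peval X p" and p: "irreducible p"
  shows "irreducible q"
proof (rule irreducibleI)
  have "p \<noteq> 0" using p by auto
  then show "q \<noteq> 0" using eq alg_ind_eq_0_iff[OF X_ind, of p] by auto
  show "\<not> q dvd 1" using transfer_unit[OF eq] p irreducible_not_unit by blast
  fix a b assume ab: "q = a * b"
  obtain a' b' where ab': "peval Z a = peval X a'" "peval Z b = peval X b'" using transfer_back by metis
  then have "peval X p = peval X (a' * b')" using eq ab by simp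
  then have "p = a' * b'" using alg_ind_eq_iff[OF X_ind] by blast
  with p have "a' dvd 1 \<or> b' dvd 1" by (rule irreducibleD)
  then show "a dvd 1 \<or> b dvd 1" using transfer_unit ab' by blast
qed

lemma transfer_primitive:
  assumes eq: "peval Z q = peval X p" and q: "primitive q"
  shows "primitive p"
  unfolding primitive_def
proof (intro allI impI)
  fix c assume "mconst c dvd p"
  then obtain r where r: "p = mconst c * r" by (elim dvdE)
  obtain s where "peval Z s = peval X r" using transfer_ex' by blast
  then have "peval Z q = peval Z (mconst c * s)" using eq r by simp
  then have "q = mconst c * s" using alg_ind_eq_iff[OF alg_ind] by blast
  then show "c dvd 1" using q unfolding primitive_def by (metis dvd_triv_left)
qed

end

section \<open>Mutation preserves the Gauss valuation\<close>

lemma gauss_units_pmon: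
  fixes x :: "'n::{finite,linorder} \<Rightarrow> ('n, 'r::{factorial_semiring,idom}) ratfun"
  assumes "\<And>p. primitive p \<Longrightarrow> peval X p \<in> gauss_units x"
  shows "lmonom X K a \<in> gauss_units x"
proof -
  have 1: "1 \<in> gauss_units x" using gauss_units_peval[of 1 x] by simp
  have X: "X k \<in> gauss_units x" for k using assms[OF primitive_mvar, of k] by simp
  have pw: "f ^ n \<in> gauss_units x" if "f \<in> gauss_units x" for f n
    using that 1 by (induction n) (auto intro: gauss_units_mult)
  have "X k powi n \<in> gauss_units x" for k n
    by (auto simp: power_int_def intro: pw X gauss_units_inverse)
  then have "(\<Prod>k\<in>S. X k powi a k) \<in> gauss_units x" for S
    by (induction S rule: infinite_finite_induct) (auto intro: 1 gauss_units_mult)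
  then show ?thesis by (simp add: lmonom_def)
qed

text \<open>Mutation of the cluster is an involution \<open>\<Omega>\<close>. Write \<open>p\<close>
  at \<open>\<Omega> X\<close> as \<open>q\<close> over a monomial. A prime of \<open>R\<close>
  dividing \<open>q\<close> would, after applying \<open>\<Omega>\<close> again, divide a product of
  \<open>p\<close>, a power of \<open>f\<close> and monomials, all of which are primitive.\<close>

lemma gauss_units_mutation:
  fixes x X :: "'n::{finite,linorder} \<Rightarrow> ('n, 'r::{factorial_semiring,idom}) ratfun"
  assumes X: "alg_ind X" and Q: "\<And>p. primitive p \<Longrightarrow> peval X p \<in> gauss_units x"
    and f: "primitive f" "i \<notin> mvars f"
    and p: "primitive p"
  shows "peval (X(i := lmonom X (UNIV - {i}) a * peval X f / X i)) p \<in> gauss_units x"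
proof -
  define \<Omega> where "\<Omega> Y = Y(i := lmonom Y (UNIV - {i}) a * peval Y f / Y i)"
    for Y :: "'n \<Rightarrow> ('n, 'r) ratfun"
  have nz: "\<And>k. X k \<noteq> 0" using alg_ind_nonzero[OF X] .
  have f0: "peval X f \<noteq> 0" using primitive_neq_0[OF f(1)] X by (simp add: alg_ind_eq_0_iff)
  have \<Omega>0: "\<Omega> X k \<noteq> 0" for k
    using nz f0 lmonom_neq_0[of "UNIV - {i}" X a] by (simp add: \<Omega>_def)
  have \<Omega>2: "\<Omega> (\<Omega> X) = X"
    using nz[of i] f0 lmonom_neq_0[of "UNIV - {i}" X a] nz
    by (auto simp: \<Omega>_def peval_upd_free[OF f(2)] lmonom_upd)
  have \<Omega>l: "lfun UNIV (\<lambda>Y. \<Omega> Y k)" for k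
    by (cases "k = i") (auto simp: \<Omega>_def intro!: lfun_divide lfun_mult lfun_lmonom lfun_peval lfun_var)
  have ev: "\<exists>m q. peval (\<Omega> X) g * peval X (pmon m) = peval X q" for g
  proof -
    have "\<Omega> X k \<in> laurent_ring X" for k
    proof (cases "k = i")
      case True
      have "\<Omega> X i = lmonom X (UNIV - {i}) a * peval X f * lmonom X {i} (\<lambda>_. - 1)"
        by (simp add: \<Omega>_def lmonom_def[of _ "{i}"] power_int_minus divide_inverse)
      then show ?thesis using True by (simp add: laurent_ring_mult nz)
    next
      case False
      then show ?thesis using peval_in_laurent[of X "mvar k"] by (simp add: \<Omega>_def)
    qed
    then have "peval (\<Omega> X) g \<in> laurent_ring X" using nz by (intro peval_in_laurent_subst)
    then show ?thesis using laurent_ring_iff nz by blast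
  qed
  obtain m q where q: "peval (\<Omega> X) p * peval X (pmon m) = peval X q" using ev by blast
  have m0: "peval X (pmon m) \<noteq> 0" by (rule peval_pmon_neq_0) (rule nz)
  have flip: "peval X p * peval (\<Omega> X) (pmon m) = peval (\<Omega> X) q"
  proof -
    have l1: "lfun UNIV (\<lambda>Y. peval (\<Omega> Y) p * peval Y (pmon m))"
      by (intro lfun_mult lfun_peval \<Omega>l lfun_var)
    have l2: "lfun UNIV (\<lambda>Y. peval Y q)" by (intro lfun_peval lfun_var)
    from lfun_identity[OF X l1 l2 q, of "\<Omega> X"]
    have "peval (\<Omega> (\<Omega> X)) p * peval (\<Omega> X) (pmon m) = peval (\<Omega> X) q" using \<Omega>0 by blast
    then show ?thesis by (simp add: \<Omega>2)
  qed
  have "primitive q"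
  proof (rule ccontr)
    assume nq: "\<not> primitive q"
    have "p \<noteq> 0" using p by (rule primitive_neq_0)
    then have "peval X p * peval (\<Omega> X) (pmon m) \<noteq> 0"
      using X peval_pmon_neq_0[of m "\<Omega> X"] \<Omega>0 by (simp add: alg_ind_eq_0_iff)
    then have "q \<noteq> 0" using flip by auto
    with nq obtain \<pi> where \<pi>: "\<not> \<pi> dvd 1" "prime_elem (mconst \<pi> :: ('n, 'r) mpoly)" "mconst \<pi> dvd q"
      by (elim not_primitiveE)
    then obtain g where g: "q = mconst \<pi> * g" by (elim dvdE)
    obtain n s where s: "peval (\<Omega> X) g * peval X (pmon n) = peval X s" using ev by blast
    define m' where "m' = m(i := 0)"
    have \<Omega>m: "peval (\<Omega> X) (pmon m) * peval X (mvar i ^ m i) * lmonom X UNIV (\<lambda>k. if k = i then 0 else - a k * int (m i)) =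
      peval X (pmon m' * f ^ m i)"
    proof -
      have "peval (\<Omega> X) (pmon m) = (\<Omega> X i) ^ m i * (\<Prod>k\<in>UNIV - {i}. X k ^ m k)"
        by (simp add: peval_pmon prod.remove[of UNIV i] \<Omega>_def)
      moreover have "(\<Prod>k\<in>UNIV - {i}. X k ^ m k) = peval X (pmon m')"
        by (simp add: peval_pmon prod.remove[of UNIV i] m'_def)
      moreover have "lmonom X UNIV (\<lambda>k. if k = i then 0 else - a k * int (m i)) =
          inverse (lmonom X (UNIV - {i}) a ^ m i)"
      proof -
        have "lmonom X UNIV (\<lambda>k. if k = i then 0 else - a k * int (m i)) =
          lmonom X (UNIV - {i}) (\<lambda>k. - (a k * int (m i)))"
          unfolding lmonom_UNIV_remove[of _ _ i] by (simp add: lmonom_def)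
        then show ?thesis unfolding lmonom_uminus
          by (simp add: lmonom_def power_int_mult prod_power_distrib)
      qed
      moreover have "\<Omega> X i * X i = lmonom X (UNIV - {i}) a * peval X f" using nz by (simp add: \<Omega>_def)
      then have "\<Omega> X i ^ m i * X i ^ m i = lmonom X (UNIV - {i}) a ^ m i * peval X f ^ m i"
        by (metis power_mult_distrib)
      moreover have "lmonom X (UNIV - {i}) a ^ m i \<noteq> 0" using nz by (simp add: lmonom_neq_0)
      ultimately show ?thesis by (simp add: field_simps)
    qed
    define e where "e k = (if k = i then 0 else - a k * int (m i))" for k
    define e1 where "e1 k = nat (e k)" for k
    define e2 where "e2 k = nat (- e k)" for k
    have ee: "lmonom X UNIV e * peval X (pmon e2) = peval X (pmon e1)"
    proof -
      have "(\<lambda>k. e k + int (e2 k)) = (\<lambda>k. int (e1 k))" by (auto simp: e1_def e2_def)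
      then show ?thesis using lmonom_add[of UNIV X e "\<lambda>k. int (e2 k)"] nz by (simp add: lmonom_pmon)
    qed
    have "peval X (p * (pmon m' * f ^ m i) * pmon n * pmon e2) =
      (peval X p * peval (\<Omega> X) (pmon m)) * peval X (pmon n) * peval X (mvar i ^ m i) *
      (lmonom X UNIV e * peval X (pmon e2))"
      unfolding peval_simps(6)[of X _ "pmon e2"] peval_simps(6)[of X _ "pmon n"]
        peval_simps(6)[of X p] \<Omega>m[symmetric] e_def by (simp add: mult_ac)
    also have "\<dots> = emb \<pi> * (peval (\<Omega> X) g * peval X (pmon n)) * peval X (mvar i ^ m i) * peval X (pmon e1)"
      unfolding flip g ee by (simp add: mult_ac)
    also have "\<dots> = peval X (mconst \<pi> * (s * mvar i ^ m i * pmon e1))"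
      unfolding s by (simp add: mult_ac)
    finally have "p * (pmon m' * f ^ m i) * pmon n * pmon e2 = mconst \<pi> * (s * mvar i ^ m i * pmon e1)"
      using alg_ind_eq_iff[OF X] by blast
    then have "mconst \<pi> dvd p * (pmon m' * f ^ m i) * pmon n * pmon e2" by simp
    moreover have "primitive (f ^ l)" for l
      using f(1) by (induction l) (auto intro: primitive_mult)
    then have "primitive (p * (pmon m' * f ^ m i) * pmon n * pmon e2)"
      by (intro primitive_mult p primitive_pmon)
    ultimately show False using \<pi>(1) unfolding primitive_def by blast
  qed
  then have "peval X q / peval X (pmon m) \<in> gauss_units x"
    by (intro gauss_units_divide Q primitive_pmon)
  moreover have "peval (\<Omega> X) p = peval X q / peval X (pmon m)"
    using q m0 by (simp add: field_simps)
  ultimately show ?thesis by (simp add: \<Omega>_def)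
qed

section \<open>Seeds attached to activation sequences\<close>

text \<open>The Laurent polynomial ring over \<open>Frac R\<close>, in which the constants of
  \<open>fconst\<close> are units.\<close>

definition flaurent :: "('n::{finite,linorder} \<Rightarrow> ('n, 'r::idom) ratfun) \<Rightarrow> ('n, 'r) ratfun set" where
  "flaurent X = {f. \<exists>c. c \<noteq> 0 \<and> emb c * f \<in> laurent_ring X}"

lemma flaurent_laurent: "f \<in> laurent_ring X \<Longrightarrow> f \<in> flaurent X"
  unfolding flaurent_def by (intro CollectI exI[of _ 1]) simp

context
  fixes X :: "'n::{finite,linorder} \<Rightarrow> ('n, 'r::idom) ratfun"
  assumes nz: "\<And>k. X k \<noteq> 0"
begin

lemma emb_in_laurent: "emb c \<in> laurent_ring X"
  using peval_in_laurent[of X "mconst c"] by simp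

lemma flaurent_mult: "f \<in> flaurent X \<Longrightarrow> g \<in> flaurent X \<Longrightarrow> f * g \<in> flaurent X"
proof -
  assume "f \<in> flaurent X" "g \<in> flaurent X"
  then obtain c d where cd: "c \<noteq> 0" "d \<noteq> 0" "emb c * f \<in> laurent_ring X" "emb d * g \<in> laurent_ring X"
    by (auto simp: flaurent_def)
  have "(emb c * f) * (emb d * g) \<in> laurent_ring X" by (rule laurent_ring_mult[OF nz cd(3,4)])
  then show ?thesis unfolding flaurent_def using cd(1,2)
    by (intro CollectI exI[of _ "c * d"]) (simp add: emb_mult mult_ac)
qed

lemma flaurent_add: "f \<in> flaurent X \<Longrightarrow> g \<in> flaurent X \<Longrightarrow> f + g \<in> flaurent X"
proof -
  assume "f \<in> flaurent X" "g \<in> flaurent X"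
  then obtain c d where cd: "c \<noteq> 0" "d \<noteq> 0" "emb c * f \<in> laurent_ring X" "emb d * g \<in> laurent_ring X"
    by (auto simp: flaurent_def)
  have "emb d * (emb c * f) + emb c * (emb d * g) \<in> laurent_ring X"
    by (rule laurent_ring_add[OF nz laurent_ring_mult[OF nz emb_in_laurent cd(3)]
          laurent_ring_mult[OF nz emb_in_laurent cd(4)]])
  then show ?thesis unfolding flaurent_def using cd(1,2)
    by (intro CollectI exI[of _ "c * d"]) (simp add: emb_mult algebra_simps)
qed

lemma flaurent_fconst: "fconst \<kappa> \<Longrightarrow> \<kappa> \<in> flaurent X"
  unfolding flaurent_def fconst_def
  by (elim exE conjE, rule CollectI, rule_tac x = b in exI) (simp add: emb_in_laurent)

lemma flaurent_emb: "emb c \<in> flaurent X"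
  by (intro flaurent_laurent emb_in_laurent)

lemma flaurent_lmonom: "lmonom X K a \<in> flaurent X"
  by (intro flaurent_laurent lmonom_in_laurent)

lemma flaurent_var: "X k \<in> flaurent X"
  using flaurent_laurent[OF peval_in_laurent[of X "mvar k"]] by simp

lemma flaurent_inverse_var: "inverse (X k) \<in> flaurent X"
  using flaurent_lmonom[of "{k}" "\<lambda>_. -1"] by (simp add: lmonom_def power_int_minus)

lemma flaurent_1: "1 \<in> flaurent X"
  using flaurent_fconst[OF fconst_1] .

lemma flaurent_0: "0 \<in> flaurent X"
  using flaurent_emb[of 0] by simp

lemma flaurent_power: "f \<in> flaurent X \<Longrightarrow> f ^ n \<in> flaurent X"
  by (induction n) (auto intro: flaurent_1 flaurent_mult)

lemma flaurent_uminus: "f \<in> flaurent X \<Longrightarrow> - f \<in> flaurent X"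
proof -
  have "emb (- 1) = (- 1 :: ('n, 'r) ratfun)"
  proof -
    have "emb (- 1) + emb 1 = (emb (- 1 + 1) :: ('n, 'r) ratfun)" by (simp only: emb_add)
    then show ?thesis by (simp add: eq_neg_iff_add_eq_0)
  qed
  moreover assume "f \<in> flaurent X"
  then have "emb (- 1) * f \<in> flaurent X" by (intro flaurent_mult flaurent_emb)
  ultimately show ?thesis by simp
qed

lemma flaurent_prod: "(\<And>a. a \<in> S \<Longrightarrow> f a \<in> flaurent X) \<Longrightarrow> (\<Prod>a\<in>S. f a) \<in> flaurent X"
  by (induction S rule: infinite_finite_induct) (auto intro: flaurent_1 flaurent_mult)

lemma flaurent_lfun: "lfun Z T \<Longrightarrow> T X \<in> flaurent X"
  using lfun_in_laurent[of Z T X] nz unfolding flaurent_def by blast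

text \<open>Used in \<open>activation\<close>: if a sum of a multiple of \<open>D\<close> and a
  multiple of \<open>P\<close> is given and \<open>D\<close> divides \<open>P ^ m\<close>, then
  \<open>D\<close> divides the \<open>m\<close>-th power of the sum.\<close>

lemma flaurent_power_add:
  assumes "a \<in> flaurent X" "b \<in> flaurent X"
  shows "\<exists>t\<in>flaurent X. (a + b) ^ n = a * t + b ^ n"
proof (induction n)
  case 0
  show ?case by (intro bexI[of _ 0] flaurent_0) simp
next
  case (Suc n)
  then obtain t where t: "t \<in> flaurent X" "(a + b) ^ n = a * t + b ^ n" by blast
  show ?case
  proof (rule bexI[of _ "(a + b) * t + b ^ n"])
    show "(a + b) ^ Suc n = a * ((a + b) * t + b ^ n) + b ^ Suc n"
      unfolding power_Suc t(2) by (simp add: algebra_simps)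
  qed (intro flaurent_add flaurent_mult flaurent_power t assms)
qed

end

text \<open>The cluster is prescribed up to constants and the exchange polynomials up to a constant
  and a Laurent monomial. \<open>U\<close> will be the Gauss units of the initial cluster; this
  condition later turns the constants into units of \<open>R\<close>. The data \<open>x\<close> and
  \<open>B\<close> vary so that relabelled seeds can keep their list.\<close>

definition has_type ::
  "('n::{finite,linorder}, 'r::idom) ratfun set \<Rightarrow> ('n \<Rightarrow> ('n, 'r) ratfun) \<Rightarrow> ('n \<Rightarrow> 'r) \<Rightarrow> 'n list \<Rightarrow>
    ('n, 'r) labelled_seed \<Rightarrow> bool" where
  "has_type U x B ps t \<longleftrightarrow> (case t of (X, F) \<Rightarrow> is_seed (X, F) \<and>
     (\<forall>p. primitive p \<longrightarrow> peval X p \<in> U) \<and>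
     (\<forall>q. fconst (Vh (emb \<circ> B) x ps q / X q)) \<and>
     (\<forall>q. \<exists>\<kappa> b. fconst \<kappa> \<and>
        peval X (F q) = \<kappa> * lmonom X UNIV b * (Vh (emb \<circ> B) x ps q * Wh (emb \<circ> B) x ps q)))"

lemma is_seed_alg_ind: "is_seed (X, F) \<Longrightarrow> alg_ind X"
  by (auto simp: is_seed_def transcendence_basis_def alg_ind_def)

lemma monomial_multiple_dvd:
  fixes p q :: "('n::{finite,linorder}, 'r::{factorial_semiring,idom}) mpoly"
  assumes X: "alg_ind X" and p: "irreducible p" "\<And>k. \<not> mvar k dvd p" "mvars p \<noteq> {}"
    and eq: "peval X p = \<kappa> * lmonom X UNIV b * peval X q" "fconst \<kappa>"
  shows "p dvd q"
proof -
  have nz: "\<And>k. X k \<noteq> 0" using alg_ind_nonzero[OF X] .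
  have pp: "prime_elem p" using p(1) by (rule mpoly_irreducible_imp_prime_elem)
  obtain c d where cd: "c \<noteq> 0" "d \<noteq> 0" "\<kappa> = emb c / emb d" using eq(2) by (auto simp: fconst_def)
  define b1 where "b1 k = nat (b k)" for k
  define b2 where "b2 k = nat (- b k)" for k
  have "lmonom X UNIV b * peval X (pmon b2) = peval X (pmon b1)"
  proof -
    have "(\<lambda>k. b k + int (b2 k)) = (\<lambda>k. int (b1 k))" by (auto simp: b1_def b2_def)
    then show ?thesis using lmonom_add[of UNIV X b "\<lambda>k. int (b2 k)"] nz by (simp add: lmonom_pmon)
  qed
  then have "peval X (mconst c * pmon b1 * q) = emb c * (lmonom X UNIV b * peval X (pmon b2)) * peval X q"
    by simp
  also have "\<dots> = peval X (p * (mconst d * pmon b2))" using eq(1) cd by simp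
  finally have "mconst c * pmon b1 * q = p * (mconst d * pmon b2)" using alg_ind_eq_iff[OF X] by blast
  then have "p dvd mconst c * pmon b1 * q" by simp
  then have "p dvd mconst c \<or> p dvd pmon b1 \<or> p dvd q" using prime_elem_dvd_multD[OF pp] by blast
  then show ?thesis using prime_not_dvd_const[OF p(3) cd(1)] prime_not_dvd_pmon[OF pp p(2)] by blast
qed

lemma transcendence_basis_cong:
  assumes "transcendence_basis X" "alg_ind Z" "poly_ring Z UNIV = poly_ring X UNIV"
  shows "transcendence_basis Z"
  using assms unfolding transcendence_basis_def alg_ind_def by simp

text \<open>Seeds are compared on a common cluster by relabelling and rescaling by units of \<open>R\<close>.\<close>

lemma has_type_rescaled:
  fixes x :: "'n::{finite,linorder} \<Rightarrow> ('n, 'r::{factorial_semiring,idom}) ratfun"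
  assumes t: "has_type U x B (map \<iota> ps) (X, F)" and \<iota>: "bij \<iota>"
    and Z: "\<And>q. Z q = emb (u q) * X (\<iota> q)" and u: "\<And>q. u q dvd 1"
  shows "\<exists>F'. has_type U (x \<circ> \<iota>) (B \<circ> \<iota>) ps (Z, F') \<and> (\<forall>q. peval Z (F' q) = peval X (F (\<iota> q)))"
proof -
  have seed: "is_seed (X, F)" using t by (simp add: has_type_def)
  then have X: "alg_ind X" by (rule is_seed_alg_ind)
  obtain v where v: "\<And>q. u q * v q = 1" using u unfolding dvd_def by metis
  interpret rescaled X Z \<iota> u v by unfold_locales (use \<iota> Z v X in auto)
  have "\<forall>q. \<exists>g. peval Z g = peval X (F (\<iota> q))" using transfer_ex' by blast
  then obtain F' where F': "\<And>q. peval Z (F' q) = peval X (F (\<iota> q))" by metis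
  have tb: "transcendence_basis Z"
    using transcendence_basis_cong[OF _ alg_ind poly_ring_eq] seed by (auto simp: is_seed_def)
  have "is_seed (Z, F')"
    using seed transfer_irreducible[OF F'] transfer_mvar[OF F'] transfer_mvars[OF F'] tb
    by (auto simp: is_seed_def)
  moreover have "peval Z p \<in> U" if "primitive p" for p
  proof -
    obtain p' where "peval Z p = peval X p'" using transfer_back by blast
    then show ?thesis using transfer_primitive[of p p'] that t by (simp add: has_type_def)
  qed
  moreover have e: "emb \<circ> (B \<circ> \<iota>) = (emb \<circ> B) \<circ> \<iota>" by auto
  have "fconst (Vh (emb \<circ> (B \<circ> \<iota>)) (x \<circ> \<iota>) ps q / Z q)" for q
  proof -
    have "fconst (Vh (emb \<circ> B) x (map \<iota> ps) (\<iota> q) / X (\<iota> q))" using t by (simp add: has_type_def)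
    moreover have "u q \<noteq> 0" using v[of q] by auto
    then have "fconst (emb (u q) :: ('n, 'r) ratfun)" by (rule fconst_emb)
    ultimately have "fconst (Vh (emb \<circ> B) x (map \<iota> ps) (\<iota> q) / X (\<iota> q) / emb (u q))"
      by (rule fconst_divide)
    then show ?thesis by (simp add: e Vh_reindex[OF \<iota>] Z mult.commute)
  qed
  moreover have "\<exists>\<kappa> b. fconst \<kappa> \<and> peval Z (F' q) = \<kappa> * lmonom Z UNIV b *
      (Vh (emb \<circ> (B \<circ> \<iota>)) (x \<circ> \<iota>) ps q * Wh (emb \<circ> (B \<circ> \<iota>)) (x \<circ> \<iota>) ps q)" for q
  proof -
    have "\<exists>\<kappa> b. fconst \<kappa> \<and> peval X (F (\<iota> q)) = \<kappa> * lmonom X UNIV b *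
      (Vh (emb \<circ> B) x (map \<iota> ps) (\<iota> q) * Wh (emb \<circ> B) x (map \<iota> ps) (\<iota> q))"
      using t unfolding has_type_def by (simp only: prod.case)
    then obtain \<kappa> b where b: "fconst \<kappa>" "peval X (F (\<iota> q)) = \<kappa> * lmonom X UNIV b *
      (Vh (emb \<circ> B) x (map \<iota> ps) (\<iota> q) * Wh (emb \<circ> B) x (map \<iota> ps) (\<iota> q))" by blast
    have "lmonom X UNIV b = (\<Prod>k\<in>UNIV. X (\<iota> k) powi b (\<iota> k))"
      unfolding lmonom_def by (rule prod.reindex_bij_betw[symmetric]) (use \<iota> in \<open>simp add: bij_is_inj\<close>)
    also have "\<dots> = (\<Prod>k\<in>UNIV. emb (v k) powi b (\<iota> k)) * lmonom Z UNIV (b \<circ> \<iota>)"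
      unfolding lmonom_def prod.distrib[symmetric] X_Z by (simp add: power_int_mult_distrib)
    finally have l: "lmonom X UNIV b = (\<Prod>k\<in>UNIV. emb (v k) powi b (\<iota> k)) * lmonom Z UNIV (b \<circ> \<iota>)" .
    have "v k \<noteq> 0" for k using v[of k] by auto
    then have "fconst (\<kappa> * (\<Prod>k\<in>UNIV. emb (v k) powi b (\<iota> k)))"
      by (intro fconst_mult fconst_prod fconst_powi fconst_emb b(1))
    then show ?thesis unfolding F' b(2) l e Vh_reindex[OF \<iota>] Wh_reindex[OF \<iota>]
      by (intro exI[of _ "\<kappa> * (\<Prod>k\<in>UNIV. emb (v k) powi b (\<iota> k))"] exI[of _ "b \<circ> \<iota>"]) (simp add: mult_ac)
  qed
  ultimately show ?thesis using F' unfolding has_type_def by blast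
qed

text \<open>With at least two indices every exchange polynomial involves some variable
  (\<open>F_nonconst\<close>), so it is primitive and divides no nonzero constant.\<close>

locale typed = chain "emb \<circ> B" x ps
  for B :: "'n::{finite,linorder} \<Rightarrow> 'r::{factorial_semiring,idom}"
    and x :: "'n \<Rightarrow> ('n, 'r) ratfun" and ps :: "'n list" +
  fixes x0 X :: "'n \<Rightarrow> ('n, 'r) ratfun" and F :: "'n \<Rightarrow> ('n, 'r) mpoly"
  assumes x0_ind: "alg_ind x0" and n2: "CARD('n) \<ge> 2"
    and ht: "has_type (gauss_units x0) x B ps (X, F)"
begin

lemma seed: "is_seed (X, F)"
  using ht by (simp add: has_type_def)

lemma X_ind: "alg_ind X"
  using seed by (rule is_seed_alg_ind)

lemma X0: "X k \<noteq> 0"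
  using alg_ind_nonzero[OF X_ind] .

lemma F_irr: "irreducible (F q)" and F_nd: "\<not> mvar k dvd F q" and F_free: "q \<notin> mvars (F q)"
  using seed by (auto simp: is_seed_def)

lemma F_prime: "prime_elem (F q)"
  by (rule mpoly_irreducible_imp_prime_elem[OF F_irr])

lemma F0: "F q \<noteq> 0"
  using F_irr[of q] by auto

lemma gauss: "primitive p \<Longrightarrow> peval X p \<in> gauss_units x0"
  using ht by (simp add: has_type_def)

definition "w q = V q / X q"

lemma w_fconst: "fconst (w q)"
  using ht by (simp add: has_type_def w_def)

lemma w0: "w q \<noteq> 0"
  using fconst_neq_0[OF w_fconst] .

lemma V_w: "V q = w q * X q"
  using X0 by (simp add: w_def)

text \<open>The scaling that takes \<open>X\<close> to \<open>V\<close>: polynomials are evaluated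
  on the scale of \<open>X\<close>, exchange functions on that of \<open>V\<close>.\<close>

definition "hw Y = (\<lambda>q. w q * Y q)"

lemma hw_X [simp]: "hw X = V"
  by (auto simp: hw_def V_w)

lemma hw_upd: "hw (X(z := v)) = V(z := w z * v)"
  by (auto simp: hw_def V_w)

section \<open>Exchange polynomials as Laurent functions of the cluster\<close>

lemma lfun_hw: "lfun Z (\<lambda>Y. hw Y q)"
  unfolding hw_def by (intro lfun_mult lfun_fconst lfun_var w_fconst)

lemma lfun_inv_hw: "q \<in> Z \<Longrightarrow> lfun Z (\<lambda>Y. inverse (hw Y q))"
  unfolding hw_def by (simp, intro lfun_mult lfun_fconst lfun_inv_var fconst_inverse w_fconst)

lemma lfun_yh: "lfun Z (\<lambda>Y. y (hw Y) l)"
  by (cases l) (auto simp: yh_def intro: lfun_1 lfun_hw)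

lemma fconst_A: "fconst (A l)"
  unfolding Ah_def using \<beta>0 by (intro fconst_prod) (auto intro: fconst_emb)

lemma fconst_\<beta>: "fconst ((emb \<circ> B) q)"
  using \<beta>0[of q] by (auto intro: fconst_emb)

lemma lfun_Mh: "l \<le> r \<Longrightarrow> lfun {ps ! m | m. l \<le> m \<and> m < r} (\<lambda>Y. M (hw Y) l)"
proof (induction rule: Mh_induct)
  case length
  show ?case unfolding Mh_length by (intro lfun_prod lfun_hw)
next
  case (step l)
  let ?Z = "{ps ! m | m. l \<le> m \<and> m < r}"
  have "{ps ! m | m. Suc l \<le> m \<and> m < r} \<subseteq> ?Z" by fastforce
  then have 1: "lfun ?Z (\<lambda>Y. M (hw Y) (Suc l))" using step(2) lfun_mono by blast
  have "ps ! l \<in> ?Z" using step(1) by auto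
  then have "lfun ?Z (\<lambda>Y. inverse (hw Y (ps ! l)))" by (rule lfun_inv_hw)
  then show ?case unfolding Mh_rec[OF step(1)] yh_Suc divide_inverse
    by (intro lfun_mult lfun_add lfun_fconst fconst_\<beta> fconst_A lfun_yh 1)
qed

lemma lfun_T: "lfun (Zset ps q) (\<lambda>Y. T q (hw Y))"
proof (cases "q \<in> set ps")
  case False
  then show ?thesis unfolding Tfun_inactive[OF False]
    by (intro lfun_mult lfun_add lfun_fconst fconst_\<beta> fconst_A lfun_yh lfun_prod lfun_hw)
next
  case True
  then obtain l where l: "q = ps ! l" "l < r" by (auto simp: in_set_conv_nth)
  show ?thesis
  proof (cases "Suc l = r")
    case True
    show ?thesis unfolding l(1) Tfun_last[OF dist True]
      by (intro lfun_mult lfun_add lfun_fconst fconst_\<beta> fconst_A lfun_yh lfun_prod lfun_hw)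
  next
    case False
    with l have l': "Suc l < r" by simp
    have "lfun (Zset ps q) (\<lambda>Y. M (hw Y) (l + 2))"
      using lfun_Mh[of "l + 2"] l l' by (simp add: Zset_nth dist)
    then show ?thesis unfolding l(1) Tfun_mid[OF dist l']
      by (intro lfun_mult lfun_add lfun_fconst fconst_power fconst_A lfun_yh lfun_power)
  qed
qed

text \<open>At \<open>X\<close> this is the type. An exponent outside \<open>Zset ps q\<close> must
  vanish: if positive, the variable would divide \<open>F q\<close>; if negative, \<open>T q\<close>
  would vanish when the variable is set to 0. The identity then specializes to all \<open>Y\<close>
  without zeros in \<open>Zset ps q\<close>.\<close>

lemma exch_ex: "\<exists>\<kappa> b. fconst \<kappa> \<and> (\<forall>k. k \<notin> Zset ps q \<longrightarrow> b k = 0) \<and>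
  (\<forall>Y. (\<forall>k\<in>Zset ps q. Y k \<noteq> 0) \<longrightarrow> peval Y (F q) = \<kappa> * lmonom Y UNIV b * T q (hw Y))"
proof -
  obtain \<kappa> b where \<kappa>: "fconst \<kappa>" and b: "peval X (F q) = \<kappa> * lmonom X UNIV b * T q V"
  proof -
    have "\<exists>\<kappa> b. fconst \<kappa> \<and> peval X (F q) = \<kappa> * lmonom X UNIV b * (V q * W q)"
      using ht unfolding has_type_def by simp
    then show ?thesis using that unfolding T_V by blast
  qed
  have b0: "b z = 0" if z: "z \<notin> Zset ps q" for z
  proof (rule ccontr)
    assume "b z \<noteq> 0"
    then consider "b z > 0" | "b z < 0" by linarith
    then show False
    proof cases
      case 1
      let ?Z = "Zset ps q \<union> {k. b k < 0}"
      have l: "lfun ?Z (\<lambda>Y. \<kappa> * lmonom Y UNIV b * T q (hw Y))"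
        by (intro lfun_mult lfun_fconst \<kappa> lfun_lmonom lfun_mono[OF lfun_T]) auto
      have l2: "lfun ?Z (\<lambda>Y. peval Y (F q))" by (intro lfun_peval lfun_var)
      have "peval (X(z := 0)) (F q) = \<kappa> * lmonom (X(z := 0)) UNIV b * T q (hw (X(z := 0)))"
        by (rule lfun_identity[OF X_ind l2 l]) (use b z 1 X0 in auto)
      also have "lmonom (X(z := 0)) UNIV b = 0"
        using 1 by (simp add: lmonom_UNIV_remove[of _ _ z])
      finally have "peval (X(z := 0)) (F q) = 0" by (simp only: mult_zero_left mult_zero_right)
      then show False using mvar_dvd_iff_peval[OF X_ind] F_nd by blast
    next
      case 2
      define b' where "b' = b(z := 0)"
      let ?Z = "Zset ps q \<union> {k. b' k < 0}"
      have l: "lfun ?Z (\<lambda>Y. \<kappa> * lmonom Y UNIV b' * T q (hw Y))"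
        by (intro lfun_mult lfun_fconst \<kappa> lfun_lmonom lfun_mono[OF lfun_T]) auto
      have l2: "lfun ?Z (\<lambda>Y. peval Y (F q) * Y z powi (- b z))"
        using 2 by (intro lfun_mult lfun_peval lfun_var lfun_powi_nonneg) simp
      have lb: "lmonom X UNIV b = X z powi b z * lmonom X UNIV b'"
      proof -
        have "lmonom X (UNIV - {z}) b = lmonom X (UNIV - {z}) b'"
          unfolding lmonom_def by (rule prod.cong) (auto simp: b'_def)
        then show ?thesis by (simp add: lmonom_UNIV_remove[of _ _ z] b'_def)
      qed
      have "peval (X(z := 0)) (F q) * (X(z := 0)) z powi (- b z) =
          \<kappa> * lmonom (X(z := 0)) UNIV b' * T q (hw (X(z := 0)))"
      proof (rule lfun_identity[OF X_ind l2 l])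
        show "peval X (F q) * X z powi (- b z) = \<kappa> * lmonom X UNIV b' * T q (hw X)"
          using X0 by (simp add: b lb power_int_minus)
      qed (use z X0 in \<open>auto simp: b'_def\<close>)
      moreover have "(X(z := 0)) z powi (- b z) = 0" using 2 by simp
      moreover have "lmonom (X(z := 0)) UNIV b' \<noteq> 0"
      proof -
        have "lmonom (X(z := 0)) UNIV b' = lmonom X (UNIV - {z}) b'"
          by (simp add: lmonom_UNIV_remove[of _ _ z] b'_def lmonom_upd)
        then show ?thesis using X0 by (simp add: lmonom_neq_0)
      qed
      moreover have "T q (hw (X(z := 0))) \<noteq> 0" using T_upd_0_neq_0[OF z] by (simp add: hw_upd)
      ultimately show False using fconst_neq_0[OF \<kappa>] by simp
    qed
  qed
  have l: "lfun (Zset ps q) (\<lambda>Y. \<kappa> * lmonom Y UNIV b * T q (hw Y))"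
    by (intro lfun_mult lfun_fconst \<kappa> lfun_lmonom lfun_T) (use b0 in fastforce)
  have l2: "lfun (Zset ps q) (\<lambda>Y. peval Y (F q))" by (intro lfun_peval lfun_var)
  have "peval Y (F q) = \<kappa> * lmonom Y UNIV b * T q (hw Y)" if "\<forall>k\<in>Zset ps q. Y k \<noteq> 0" for Y
    by (rule lfun_identity[OF X_ind l2 l]) (use b that in auto)
  then show ?thesis using \<kappa> b0 by blast
qed

definition "kb q = (SOME kb. fconst (fst kb) \<and> (\<forall>k. k \<notin> Zset ps q \<longrightarrow> snd kb k = 0) \<and>
  (\<forall>Y. (\<forall>k\<in>Zset ps q. Y k \<noteq> 0) \<longrightarrow> peval Y (F q) = fst kb * lmonom Y UNIV (snd kb) * T q (hw Y)))"
definition "\<kappa> q = fst (kb q)"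
definition "b q = snd (kb q)"

lemma kb: "fconst (\<kappa> q)" "k \<notin> Zset ps q \<Longrightarrow> b q k = 0"
  "(\<And>k. k \<in> Zset ps q \<Longrightarrow> Y k \<noteq> 0) \<Longrightarrow> peval Y (F q) = \<kappa> q * lmonom Y UNIV (b q) * T q (hw Y)"
proof -
  have "\<exists>kb. fconst (fst kb) \<and> (\<forall>k. k \<notin> Zset ps q \<longrightarrow> snd kb k = 0) \<and>
    (\<forall>Y. (\<forall>k\<in>Zset ps q. Y k \<noteq> 0) \<longrightarrow> peval Y (F q) = fst kb * lmonom Y UNIV (snd kb) * T q (hw Y))"
    using exch_ex[of q] by auto
  from someI_ex[OF this] show "fconst (\<kappa> q)" "k \<notin> Zset ps q \<Longrightarrow> b q k = 0"
    "(\<And>k. k \<in> Zset ps q \<Longrightarrow> Y k \<noteq> 0) \<Longrightarrow> peval Y (F q) = \<kappa> q * lmonom Y UNIV (b q) * T q (hw Y)"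
    unfolding \<kappa>_def b_def kb_def by blast+
qed

lemma F_X: "peval X (F q) = \<kappa> q * lmonom X UNIV (b q) * (V q * W q)"
  using kb(3)[of q X] X0 by (simp add: T_V)

lemma q_notin_Zset: "q \<notin> Zset ps q"
  by (cases "q \<in> set ps") (auto simp: Zset_def idx_nth dist)

lemma lmonom_upd_0: "a z = 0 \<Longrightarrow> lmonom (Y(z := v)) UNIV a = lmonom Y UNIV a"
  by (simp add: lmonom_UNIV_remove[of _ _ z] lmonom_upd)

lemma F_upd: "z \<notin> Zset ps q \<Longrightarrow>
    peval (X(z := v)) (F q) = \<kappa> q * lmonom X UNIV (b q) * T q (V(z := w z * v))"
proof -
  assume z: "z \<notin> Zset ps q"
  have "peval (X(z := v)) (F q) = \<kappa> q * lmonom (X(z := v)) UNIV (b q) * T q (hw (X(z := v)))"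
    by (rule kb(3)) (use z X0 in auto)
  then show ?thesis using kb(2)[OF z] by (simp add: hw_upd lmonom_upd_0)
qed

lemma \<kappa>b0: "\<kappa> q * lmonom X UNIV (b q) \<noteq> 0"
  using fconst_neq_0[OF kb(1)] X0 by (simp add: lmonom_neq_0)

section \<open>Variables occurring in the exchange polynomials\<close>

lemma involves:
  assumes z: "z \<notin> Zset ps q" and v: "T q (V(z := v)) \<noteq> T q V"
  shows "z \<in> mvars (F q)"
proof (rule ccontr)
  assume "z \<notin> mvars (F q)"
  then have "peval (X(z := v / w z)) (F q) = peval X (F q)" by (rule peval_upd_free)
  then have "T q (V(z := v)) = T q V"
    using \<kappa>b0[of q] w0[of z] by (simp add: F_upd[OF z] F_X T_V)
  with v show False by simp
qed

lemma involves_inactive: "z \<notin> set ps \<Longrightarrow> q \<noteq> z \<Longrightarrow> z \<in> mvars (F q)"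
proof -
  assume *: "z \<notin> set ps" "q \<noteq> z"
  then have "z \<notin> Zset ps q" by (auto simp: Zset_def)
  then show ?thesis using involves T_involves_inactive * by blast
qed

lemma involves_last: "q \<notin> set ps \<Longrightarrow> Suc l = r \<Longrightarrow> ps ! l \<in> mvars (F q)"
  using involves[of "ps ! l" q 0] T_involves_last by (auto simp: Zset_def)

lemma involves_prev: "Suc l < r \<Longrightarrow> ps ! l \<in> mvars (F (ps ! Suc l))"
  using involves[of "ps ! l" "ps ! Suc l" 0] T_involves_prev by (simp add: nth_in_Zset_iff dist)

lemma X_neq_1: "X k \<noteq> 1"
proof
  assume "X k = 1"
  then have "peval X (mvar k) = peval X 1" by simp
  then have "(mvar k :: ('n, 'r) mpoly) = 1" using alg_ind_eq_iff[OF X_ind] by blast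
  then show False using irreducible_mvar[of k] by (metis not_irreducible_one)
qed

lemma involves_next: "Suc l < r \<Longrightarrow> ps ! Suc l \<in> mvars (F (ps ! l))"
proof -
  assume l: "Suc l < r"
  obtain v where v: "T (ps ! l) (V(ps ! Suc l := v)) \<noteq> T (ps ! l) (V(ps ! Suc l := 0))"
    using T_involves_next[OF X0 X_neq_1 l] by blast
  have "ps ! Suc l \<notin> Zset ps (ps ! l)" using l by (simp add: nth_in_Zset_iff dist)
  then show ?thesis using involves v by metis
qed

lemma ex_other: "\<exists>z. z \<noteq> (q :: 'n)"
proof (rule ccontr)
  assume "\<not> ?thesis"
  then have "UNIV = {q}" by auto
  then have "CARD('n) = 1" by (metis card.empty card.insert empty_iff finite.emptyI One_nat_def)
  with n2 show False by simp
qed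

lemma F_nonconst: "mvars (F q) \<noteq> {}"
proof (cases "q \<in> set ps")
  case False
  show ?thesis
  proof (cases "ps = []")
    case True
    then show ?thesis using ex_other[of q] involves_inactive[of _ q] by fastforce
  next
    case F: False
    then have "Suc (r - 1) = r" by simp
    then show ?thesis using involves_last[OF False] by blast
  qed
next
  case True
  then obtain l where l: "q = ps ! l" "l < r" by (auto simp: in_set_conv_nth)
  consider "Suc l < r" | "Suc l = r" "l = 0" | n where "Suc l = r" "l = Suc n"
  proof -
    have "Suc l < r \<or> Suc l = r" using l by linarith
    then show ?thesis using that by (cases l) auto
  qed
  then show ?thesis
  proof cases
    case 1
    then show ?thesis using involves_next l by blast
  next
    case 2
    then have "ps = [q]" using l by (cases ps) auto
    then show ?thesis using ex_other[of q] involves_inactive[of _ q] by fastforce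
  next
    case 3
    then show ?thesis using involves_prev[of n] l by auto
  qed
qed

lemma F_primitive: "primitive (F q)"
  using primitive_irreducible[OF F_irr F_nonconst] .

text \<open>Between irreducible polynomials divisibility means proportionality by a unit, which
  would make the two exchange functions proportional in the variable at
  \<open>Suc l\<close>.\<close>

lemma F_not_dvd:
  assumes lm: "l + 2 \<le> m" "m < r"
  shows "\<not> F (ps ! l) dvd F (ps ! m)"
proof
  let ?z = "ps ! Suc l"
  assume "F (ps ! l) dvd F (ps ! m)"
  then obtain g where g: "F (ps ! m) = F (ps ! l) * g" by (elim dvdE)
  then have "F (ps ! l) dvd 1 \<or> g dvd 1" using irreducibleD[OF F_irr] by blast
  then have "g dvd 1" using F_irr irreducible_not_unit by blast
  then obtain u where u: "g = mconst u" by (elim is_unit_mpolyE)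
  have z: "?z \<notin> Zset ps (ps ! l)" "?z \<notin> Zset ps (ps ! m)" using lm by (simp_all add: nth_in_Zset_iff dist)
  define c1 where "c1 = \<kappa> (ps ! m) * lmonom X UNIV (b (ps ! m))"
  define c2 where "c2 = \<kappa> (ps ! l) * lmonom X UNIV (b (ps ! l))"
  have c: "c1 \<noteq> 0" "c2 \<noteq> 0" "emb u \<noteq> (0 :: ('n, 'r) ratfun)"
    using \<kappa>b0 F0[of "ps ! m"] g u by (auto simp: c1_def c2_def)
  have eq: "T (ps ! l) (V(?z := v)) = (c1 / (c2 * emb u)) * T (ps ! m) (V(?z := v))" for v
  proof -
    have "peval (X(?z := v / w ?z)) (F (ps ! m)) = emb u * peval (X(?z := v / w ?z)) (F (ps ! l))"
      by (simp add: g u)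
    then have "c1 * T (ps ! m) (V(?z := v)) = emb u * (c2 * T (ps ! l) (V(?z := v)))"
      using w0[of ?z] by (simp add: F_upd[OF z(1)] F_upd[OF z(2)] c1_def c2_def)
    then show ?thesis using c by (simp add: field_simps)
  qed
  show False using T_not_proportional[OF X0 X_neq_1 lm] eq by blast
qed

text \<open>The new cluster variable of a mutation whose exponents cancel the monomial of \<open>F i\<close>.\<close>

context
  fixes i :: 'n and a :: "'n \<Rightarrow> int"
  assumes a: "\<And>j. j \<noteq> i \<Longrightarrow> a j = - b i j"
begin

lemma hat_eq: "(\<And>k. k \<in> Zset ps i \<Longrightarrow> Y k \<noteq> 0) \<Longrightarrow> hat_at F i a Y = \<kappa> i * T i (hw Y)"
proof -
  assume Y: "\<And>k. k \<in> Zset ps i \<Longrightarrow> Y k \<noteq> 0"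
  have "lmonom Y UNIV (b i) = lmonom Y (UNIV - {i}) (b i)"
    using kb(2)[OF q_notin_Zset] by (simp add: lmonom_UNIV_remove[of _ _ i])
  moreover have "lmonom Y (UNIV - {i}) a * lmonom Y (UNIV - {i}) (b i) = 1"
    unfolding lmonom_def prod.distrib[symmetric]
  proof (rule prod.neutral, rule ballI)
    fix j assume "j \<in> UNIV - {i}"
    then have j: "a j = - b i j" using a by simp
    show "Y j powi a j * Y j powi b i j = 1"
    proof (cases "j \<in> Zset ps i")
      case True
      then show ?thesis using Y[OF True] by (simp add: j power_int_minus)
    next
      case False
      then show ?thesis by (simp add: j kb(2))
    qed
  qed
  moreover have "peval Y (F i) = \<kappa> i * lmonom Y UNIV (b i) * T i (hw Y)" by (rule kb(3)) (rule Y)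
  ultimately show ?thesis unfolding hat_at_def by (simp add: mult_ac)
qed

definition "X' = X(i := hat_at F i a X / X i)"

lemma X'_i: "X' i = \<kappa> i * w i * W i"
  using hat_eq[of X] X0 V_w[of i] by (simp add: X'_def T_V)

lemma X'_other: "q \<noteq> i \<Longrightarrow> X' q = X q"
  by (simp add: X'_def)

lemma fconst_X': "fconst ((V(i := W i)) q / X' q)"
proof (cases "q = i")
  case True
  have "W i / X' i = inverse (\<kappa> i * w i)" using W0[of i] by (simp add: X'_i divide_inverse)
  then show ?thesis using True by (simp add: fconst_inverse fconst_mult kb(1) w_fconst)
next
  case False
  then show ?thesis using w_fconst[of q] by (simp add: X'_other w_def)
qed

lemma gauss_X': "primitive p \<Longrightarrow> peval X' p \<in> gauss_units x0"
proof -
  have "X' = X(i := lmonom X (UNIV - {i}) a * peval X (F i) / X i)" by (simp add: X'_def hat_at_def)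
  then show "primitive p \<Longrightarrow> peval X' p \<in> gauss_units x0"
    using gauss_units_mutation[OF X_ind gauss F_primitive F_free, of p i a] by simp
qed

text \<open>With \<open>P\<close> as in the definition of mutation, evaluating at \<open>X(i := P / X' i)\<close> is evaluating the
  functions \<open>T\<close> at the family on the right.\<close>

lemma hw_subst: "hw (X(i := \<kappa> i * T i h / X' i)) = V(i := T i h / W i)"
  using w0[of i] fconst_neq_0[OF kb(1)] by (simp add: hw_upd X'_i)

lemma F'_i: "peval X' (F i) = \<kappa> i * lmonom X' UNIV (b i) * (W i * V i)"
proof -
  have "peval X' (F i) = peval X (F i)" unfolding X'_def by (rule peval_upd_free[OF F_free])
  moreover have "lmonom X' UNIV (b i) = lmonom X UNIV (b i)"
    unfolding X'_def by (rule lmonom_upd_0) (rule kb(2)[OF q_notin_Zset])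
  ultimately show ?thesis by (simp add: F_X mult.commute)
qed

end

text \<open>\<open>F i\<close> at \<open>X j = 0\<close> is nonzero and omits \<open>X i\<close>,
  whereas \<open>F j\<close> contains \<open>X i\<close>; so \<open>F j\<close> does not divide
  it.\<close>

lemma hat_exponent_neg:
  assumes "is_hat_exponent (X, F) i a" "j \<noteq> i" "i \<in> mvars (F j)"
  shows "a j = 0"
proof (rule hat_exponent_0[OF X_ind assms(1,2) _ F0])
  show "\<not> dvd_in (laurent_ring X) (peval X (F j)) (peval (X(j := 0)) (F i))"
  proof
    assume d: "dvd_in (laurent_ring X) (peval X (F j)) (peval (X(j := 0)) (F i))"
    obtain p0 p1 where p: "F i = p0 + mvar j * p1" "mvars p0 \<subseteq> mvars (F i) - {j}"
      using split_off_var by blast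
    have j: "j \<notin> mvars p0" using p(2) by auto
    have e: "peval (X(j := 0)) (F i) = peval X p0" by (simp add: p(1) peval_upd_free[OF j])
    then have "F j dvd p0" using d dvd_in_laurent_iff[OF X_ind F_prime F_nd] by simp
    moreover have "p0 \<noteq> 0"
    proof
      assume "p0 = 0"
      then have "mvar j dvd F i" using p(1) by simp
      then show False using F_nd by blast
    qed
    ultimately have "i \<in> mvars p0" using mvars_dvd assms(3) by blast
    then show False using p(2) F_free by blast
  qed
qed

lemma mutation_cases:
  assumes "is_mutation i (X, F) t'"
  obtains a F' where "t' = (X(i := hat_at F i a X / X i), F')" "is_hat_exponent (X, F) i a"
    "is_seed t'"
    "\<And>j. i \<notin> mvars (F j) \<Longrightarrow> F' j = F j"
    "\<And>j. i \<in> mvars (F j) \<Longrightarrow> \<exists>H b. common_factors_removed (X(i := hat_at F i a X / X i)) i j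
      (hat_at F i a (X(j := 0)))
      (peval (X(i := hat_at F i a (X(j := 0)) / (hat_at F i a X / X i))) (F j)) H \<and>
      peval (X(i := hat_at F i a X / X i)) (F' j) = lmonom (X(i := hat_at F i a X / X i)) (UNIV - {j}) b * H"
proof -
  obtain X1 F' where t': "t' = (X1, F')" by (cases t')
  from assms obtain a where a: "is_hat_exponent (X, F) i a" "X1 = X(i := hat_at F i a X / X i)"
    "is_seed (X1, F')"
    "\<And>j. if i \<notin> mvars (F j) then F' j = F j
             else (let P = hat_at F i a (X(j := 0));
                       G = peval (X(i := P / X1 i)) (F j)
                   in \<exists>H b. common_factors_removed X1 i j P G H \<and>
                        peval X1 (F' j) = lmonom X1 (UNIV - {j}) b * H \<and>
                        (\<forall>k. \<not> mvar k dvd F' j))"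
    unfolding is_mutation_def t' by auto
  show ?thesis
  proof (rule that[OF _ a(1)])
    show "t' = (X(i := hat_at F i a X / X i), F')" using t' a(2) by simp
    show "is_seed t'" using a(3) t' by simp
    show "F' j = F j" if "i \<notin> mvars (F j)" for j using a(4)[of j] that by simp
    show "\<exists>H b. common_factors_removed (X(i := hat_at F i a X / X i)) i j
      (hat_at F i a (X(j := 0)))
      (peval (X(i := hat_at F i a (X(j := 0)) / (hat_at F i a X / X i))) (F j)) H \<and>
      peval (X(i := hat_at F i a X / X i)) (F' j) = lmonom (X(i := hat_at F i a X / X i)) (UNIV - {j}) b * H"
      if "i \<in> mvars (F j)" for j
      using a(4)[of j] that unfolding a(2) by (auto simp: Let_def)
  qed
qed

subsection \<open>Activation\<close>

text \<open>Every inactive variable occurs in all other exchange polynomials, so all exponents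
  vanish. If \<open>j\<close> is inactive or the last active index, \<open>P\<close> is a monomial
  in the new cluster. For earlier active \<open>j\<close> it contains the old variable
  \<open>V k\<close>, and the argument needs \<open>G\<close> as well.\<close>

lemma activation:
  assumes mut: "is_mutation k (X, F) t'" and k: "k \<notin> set ps"
  shows "has_type (gauss_units x0) x B (ps @ [k]) t'"
proof -
  obtain a F' where t': "t' = (X(k := hat_at F k a X / X k), F')" and hat: "is_hat_exponent (X, F) k a"
    and seed': "is_seed t'"
    and F'1: "\<And>j. k \<notin> mvars (F j) \<Longrightarrow> F' j = F j"
    and F'2: "\<And>j. k \<in> mvars (F j) \<Longrightarrow> \<exists>H b. common_factors_removed (X(k := hat_at F k a X / X k)) k j
      (hat_at F k a (X(j := 0)))
      (peval (X(k := hat_at F k a (X(j := 0)) / (hat_at F k a X / X k))) (F j)) H \<and>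
      peval (X(k := hat_at F k a X / X k)) (F' j) = lmonom (X(k := hat_at F k a X / X k)) (UNIV - {j}) b * H"
    using mutation_cases[OF mut] by blast
  have Zk: "Zset ps k = {}" by (rule Zset_inactive[OF k])
  have a: "a j = - b k j" if "j \<noteq> k" for j
    using hat_exponent_neg[OF hat that involves_inactive[OF k that]] kb(2)[of j k] Zk by simp
  define Xn where "Xn = X' k a"
  have Xn: "X(k := hat_at F k a X / X k) = Xn" by (simp add: Xn_def X'_def[OF a])
  have Xnk: "hat_at F k a X / X k = Xn k" by (simp add: Xn[symmetric])
  have hat_eq': "hat_at F k a Y = \<kappa> k * T k (hw Y)" for Y using hat_eq[OF a] Zk by simp
  have Xn_ind: "alg_ind Xn" using seed' is_seed_alg_ind unfolding t' Xn by blast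
  have Xn0: "Xn q \<noteq> 0" for q using alg_ind_nonzero[OF Xn_ind] .
  interpret c': chain "emb \<circ> B" x "ps @ [k]" by (rule chain_snoc[OF k])
  let ?V' = "Vh (emb \<circ> B) x (ps @ [k])"
  let ?W' = "Wh (emb \<circ> B) x (ps @ [k])"
  have V': "?V' = V(k := W k)" by (rule V_snoc[OF k])
  have fV': "fconst (?V' q / Xn q)" for q unfolding V' Xn_def by (rule fconst_X'[OF a])
  have Vw': "?V' q = (?V' q / Xn q) * Xn q" for q using Xn0 by simp
  note FL = flaurent_mult[of Xn, OF Xn0] flaurent_add[of Xn, OF Xn0] flaurent_fconst[of Xn, OF Xn0]
    flaurent_var[of Xn, OF Xn0] flaurent_inverse_var[of Xn, OF Xn0] flaurent_power[of Xn, OF Xn0]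
    flaurent_prod[of Xn, OF Xn0] flaurent_1[of Xn, OF Xn0] flaurent_lmonom[of Xn, OF Xn0]
    flaurent_uminus[of Xn, OF Xn0]
  have FV': "?V' q \<in> flaurent Xn" "inverse (?V' q) \<in> flaurent Xn" for q
  proof -
    have iv: "inverse (?V' q) = inverse (?V' q / Xn q) * inverse (Xn q)"
      using Xn0[of q] by (simp add: field_simps)
    show "?V' q \<in> flaurent Xn" by (subst Vw') (intro FL fV')
    show "inverse (?V' q) \<in> flaurent Xn" unfolding iv by (intro FL fconst_inverse fV')
  qed
  have FV: "V q \<in> flaurent Xn" "inverse (V q) \<in> flaurent Xn" if "q \<noteq> k" for q
    using FV'[of q] that by (simp_all add: V')
  have yFL: "y V l \<in> flaurent Xn" "inverse (y V l) \<in> flaurent Xn" if "l \<le> r" for l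
  proof -
    have "ps ! (l - 1) \<noteq> k" if "l \<noteq> 0" using that \<open>l \<le> r\<close> k by (metis One_nat_def Suc_le_eq Suc_pred nth_mem
          neq0_conv)
    then show "y V l \<in> flaurent Xn" "inverse (y V l) \<in> flaurent Xn"
      by (auto simp: yh_def intro: FV FL)
  qed
  \<comment> \<open>Units of the Laurent polynomial ring over \<open>Frac R\<close> in the new
    cluster.\<close>
  define mon where "mon f \<longleftrightarrow> (\<exists>\<kappa> e. fconst \<kappa> \<and> f = \<kappa> * lmonom Xn UNIV e)" for f
  have mon_fconst: "mon \<kappa>" if "fconst \<kappa>" for \<kappa>
    unfolding mon_def using that by (intro exI[of _ \<kappa>] exI[of _ "\<lambda>_. 0"]) simp
  have mon_mult: "mon (f * g)" if "mon f" "mon g" for f g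
  proof -
    obtain \<kappa>1 e1 \<kappa>2 e2 where "fconst \<kappa>1" "f = \<kappa>1 * lmonom Xn UNIV e1" "fconst \<kappa>2" "g = \<kappa>2 * lmonom Xn UNIV e2"
      using \<open>mon f\<close> \<open>mon g\<close> unfolding mon_def by blast
    then show ?thesis unfolding mon_def
      by (intro exI[of _ "\<kappa>1 * \<kappa>2"] exI[of _ "\<lambda>k. e1 k + e2 k"])
        (simp add: lmonom_add[OF Xn0] fconst_mult)
  qed
  have mon_inverse: "mon (inverse f)" if f: "mon f" for f
  proof -
    obtain \<kappa>1 e1 where "fconst \<kappa>1" "f = \<kappa>1 * lmonom Xn UNIV e1" using f unfolding mon_def by blast
    then show ?thesis unfolding mon_def
      by (intro exI[of _ "inverse \<kappa>1"] exI[of _ "\<lambda>k. - e1 k"]) (simp add: lmonom_uminus fconst_inverse)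
  qed
  have mon_1: "mon 1" using mon_fconst fconst_1 by blast
  have mon_var: "mon (Xn q)" for q
  proof -
    have "Xn q = lmonom Xn UNIV (\<lambda>k. if k \<in> {q} then 1 else 0)"
      unfolding lmonom_extend[symmetric] by (simp add: lmonom_def)
    then show ?thesis unfolding mon_def by (intro exI[of _ 1]) auto
  qed
  have mon_V': "mon (?V' q)" for q by (subst Vw') (intro mon_mult mon_fconst fV' mon_var)
  have mon_V: "mon (V q)" if "q \<noteq> k" for q using mon_V'[of q] that by (simp add: V')
  have mon_y: "mon (y V l)" if "l \<le> r" for l
  proof -
    have "ps ! (l - 1) \<noteq> k" if "l \<noteq> 0" using that \<open>l \<le> r\<close> k by (metis One_nat_def Suc_le_eq Suc_pred nth_mem
          neq0_conv)
    then show ?thesis by (auto simp: yh_def intro: mon_V mon_1)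
  qed
  have mon_W: "mon (W k)" using mon_V'[of k] by (simp add: V')
  have mon_prod: "mon (\<Prod>a\<in>S. f a)" if "\<And>a. a \<in> S \<Longrightarrow> mon (f a)" for S and f :: "'n \<Rightarrow> _"
    using that by (induction S rule: infinite_finite_induct) (auto intro: mon_1 mon_mult)
  have mon_power: "mon (f ^ n)" if "mon f" for f n
    using that by (induction n) (auto intro: mon_1 mon_mult)
  have mon_lmonom: "mon (lmonom Xn UNIV e)" for e unfolding mon_def by (intro exI[of _ 1] exI[of _ e]) simp
  have mon_FL: "f \<in> flaurent Xn" if "mon f" for f
    using that unfolding mon_def by (auto intro: FL)
  have mon_nz: "f \<noteq> 0" if "mon f" for f
    using that Xn0 unfolding mon_def by (auto simp: lmonom_neq_0 dest: fconst_neq_0)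
  \<comment> \<open>Reduces each index to one claim: whatever divides both \<open>G\<close> and a
    power of \<open>P\<close> over \<open>Frac R\<close> divides a unit monomial.\<close>
  have conclude: "\<exists>\<kappa> b. fconst \<kappa> \<and> peval Xn (F' j) = \<kappa> * lmonom Xn UNIV b * (?V' j * ?W' j)"
    if cfr: "common_factors_removed Xn k j P G H" and F'j: "peval Xn (F' j) = lmonom Xn (UNIV - {j}) b * H"
      and G: "G = N * (?V' j * ?W' j)" "mon N"
      and D: "\<And>D m s1 s2. s1 \<in> flaurent Xn \<Longrightarrow> P ^ m = D * s1 \<Longrightarrow> s2 \<in> flaurent Xn \<Longrightarrow> G = D * s2 \<Longrightarrow>
        \<exists>N s. mon N \<and> s \<in> flaurent Xn \<and> N = D * s"
    for j P G H b N
  proof -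
    have G0: "G \<noteq> 0" unfolding G(1) using mon_nz[OF G(2)] c'.V0 c'.W0 by simp
    have "\<exists>\<kappa> e. fconst \<kappa> \<and> peval Xn (F' j) = \<kappa> * lmonom Xn UNIV e * G"
    proof (rule mutated_exchange_poly_monomial[OF Xn_ind cfr G0 _ F'j])
      fix D m
      assume "dvd_in (laurent_ring Xn) D (P ^ m)" "dvd_in (laurent_ring Xn) D G"
      then obtain s1 s2 where "s1 \<in> laurent_ring Xn" "P ^ m = D * s1" "s2 \<in> laurent_ring Xn" "G = D * s2"
        by (auto simp: dvd_in_def)
      then obtain N s where N: "mon N" "s \<in> flaurent Xn" "N = D * s" using D flaurent_laurent by metis
      then obtain \<kappa>1 e where e: "fconst \<kappa>1" "N = \<kappa>1 * lmonom Xn UNIV e" unfolding mon_def by blast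
      then obtain c1 c2 where c: "c1 \<noteq> 0" "c2 \<noteq> 0" "\<kappa>1 = emb c1 / emb c2" by (auto simp: fconst_def)
      obtain c3 where c3: "c3 \<noteq> 0" "emb c3 * s \<in> laurent_ring Xn" using N(2) by (auto simp: flaurent_def)
      have "emb (c3 * c1) * lmonom Xn UNIV e = D * (emb c2 * (emb c3 * s))"
        using N(3) e(2) c by (simp add: emb_mult field_simps)
      moreover have "emb c2 * (emb c3 * s) \<in> laurent_ring Xn"
        by (intro laurent_ring_mult Xn0 emb_in_laurent c3)
      ultimately have "dvd_in (laurent_ring Xn) D (emb (c3 * c1) * lmonom Xn UNIV e)"
        unfolding dvd_in_def by blast
      moreover have "c3 * c1 \<noteq> 0" using c c3 by simp
      ultimately show "\<exists>c e. c \<noteq> 0 \<and> dvd_in (laurent_ring Xn) D (emb c * lmonom Xn UNIV e)" by blast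
    qed
    then obtain \<kappa>1 e where e: "fconst \<kappa>1" "peval Xn (F' j) = \<kappa>1 * lmonom Xn UNIV e * G" by blast
    have "mon (\<kappa>1 * lmonom Xn UNIV e * N)"
      by (intro mon_mult mon_fconst mon_lmonom G(2) e(1))
    then obtain \<kappa>2 e2 where e2: "fconst \<kappa>2" "\<kappa>1 * lmonom Xn UNIV e * N = \<kappa>2 * lmonom Xn UNIV e2"
      unfolding mon_def by blast
    have "peval Xn (F' j) = (\<kappa>1 * lmonom Xn UNIV e * N) * (?V' j * ?W' j)"
      unfolding e(2) G(1) by (simp only: mult.assoc)
    then show ?thesis using e2 by auto
  qed
  have F': "\<exists>\<kappa> b. fconst \<kappa> \<and> peval Xn (F' j) = \<kappa> * lmonom Xn UNIV b * (?V' j * ?W' j)" for j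
  proof (cases "j = k")
    case True
    have "F' k = F k" using F'1 F_free by blast
    moreover have "?V' k = W k" "?W' k = V k" using V' W_snoc_new[OF k] by simp_all
    ultimately show ?thesis using F'_i[OF a] kb(1) True unfolding Xn_def by metis
  next
    case jk: False
    have kin: "k \<in> mvars (F j)" using involves_inactive k jk by blast
    define P where "P = hat_at F k a (X(j := 0))"
    define G where "G = peval (X(k := P / Xn k)) (F j)"
    obtain H bb where H: "common_factors_removed Xn k j P G H"
      "peval Xn (F' j) = lmonom Xn (UNIV - {j}) bb * H"
      using F'2[OF kin, unfolded Xn, unfolded Xnk, folded P_def, folded G_def] by blast
    have P: "P = \<kappa> k * T k (V(j := 0))" by (simp add: P_def hat_eq' hw_upd)
    have hG: "hw (X(k := P / Xn k)) = V(k := T k (V(j := 0)) / W k)"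
      using hw_subst[OF a, of "V(j := 0)"] unfolding P Xn_def .
    have kZ: "k \<notin> Zset ps j" using k by (auto simp: Zset_def)
    have G: "G = \<kappa> j * lmonom X UNIV (b j) * T j (V(k := T k (V(j := 0)) / W k))"
    proof -
      have "G = \<kappa> j * lmonom (X(k := P / Xn k)) UNIV (b j) * T j (hw (X(k := P / Xn k)))"
        unfolding G_def by (rule kb(3)) (use X0 kZ in auto)
      then show ?thesis using kb(2)[OF kZ] by (simp add: hG lmonom_upd_0)
    qed
    have lX: "lmonom X UNIV (b j) = lmonom Xn UNIV (b j)"
      unfolding Xn[symmetric] by (rule lmonom_upd_0[symmetric]) (rule kb(2)[OF kZ])
    have mon\<kappa>: "mon (\<kappa> j * lmonom X UNIV (b j))" unfolding lX
      by (intro mon_mult mon_fconst mon_lmonom kb(1))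
    have D_easy: "\<exists>N s. mon N \<and> s \<in> flaurent Xn \<and> N = D * s"
      if "mon P" "s1 \<in> flaurent Xn" "P ^ m = D * s1" for D m s1
      using that mon_power by blast
    show ?thesis
    proof (cases "j \<in> set ps")
      case False
      have "T j (V(k := T k (V(j := 0)) / W k)) = (y V r / W k) * (?V' j * ?W' j)"
        using T_snoc_inactive[OF k False jk W0[of k], of V] c'.T_V[of j] unfolding V' by simp
      then have G': "G = (\<kappa> j * lmonom X UNIV (b j) * (y V r * inverse (W k))) * (?V' j * ?W' j)"
        unfolding G by (simp add: divide_inverse mult_ac)
      have "mon (\<kappa> j * lmonom X UNIV (b j) * (y V r * inverse (W k)))"
        by (intro mon_mult mon\<kappa> mon_y mon_inverse mon_W) simp
      moreover have "T k (V(j := 0)) = (emb \<circ> B) k * y V r"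
      proof -
        have "(\<Prod>p\<in>- insert k (set ps). (V(j := 0)) p) = 0"
          by (rule prod_upd_0) (use False jk in auto)
        then show ?thesis using k False by (simp del: fun_upd_apply add: Tfun_inactive yh_upd_inactive)
      qed
      then have "mon P" unfolding P by (simp only:) (intro mon_mult mon_fconst kb(1) fconst_\<beta> mon_y, simp)
      ultimately show ?thesis using conclude[OF H G'] D_easy by blast
    next
      case True
      then obtain l where l: "j = ps ! l" "l < r" by (auto simp: in_set_conv_nth)
      show ?thesis
      proof (cases "Suc l = r")
        case last: True
        have "T j (V(k := T k (V(j := 0)) / W k)) = ((emb \<circ> B) j / W k) * (?V' j * ?W' j)"
          using T_snoc_last[OF k last W0[of k], of V] c'.T_V[of j] l unfolding V' by simp
        then have G': "G = (\<kappa> j * lmonom X UNIV (b j) * ((emb \<circ> B) j * inverse (W k))) * (?V' j * ?W' j)"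
          unfolding G by (simp add: divide_inverse mult_ac)
        have "mon (\<kappa> j * lmonom X UNIV (b j) * ((emb \<circ> B) j * inverse (W k)))"
          by (intro mon_mult mon\<kappa> mon_fconst fconst_\<beta> mon_inverse mon_W)
        moreover have "T k (V(j := 0)) = A r * (\<Prod>p\<in>- insert k (set ps). V p)"
        proof -
          have "(\<Prod>p\<in>- insert k (set ps). (V(j := 0)) p) = (\<Prod>p\<in>- insert k (set ps). V p)"
            by (rule prod_upd_active[OF True]) auto
          then show ?thesis using k l last
            by (simp del: fun_upd_apply add: Tfun_inactive yh_upd_nth dist)
        qed
        then have "mon P" unfolding P by (simp only:)
          (intro mon_mult mon_fconst kb(1) fconst_A mon_prod mon_V, auto)
        ultimately show ?thesis using conclude[OF H G'] D_easy by blast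
      next
        case False
        with l have l': "Suc l < r" by simp
        \<comment> \<open>The exchange function at \<open>k\<close> sees only the longest initial
          segment, and \<open>j\<close> carries a shorter one. So the substitution changes nothing,
          and \<open>P\<close> keeps the factor \<open>V k\<close>, which need not be a monomial in
          the new cluster.\<close>
        have TkV: "T k (V(j := 0)) = T k V"
        proof -
          have "(\<Prod>p\<in>- insert k (set ps). (V(j := 0)) p) = (\<Prod>p\<in>- insert k (set ps). V p)"
            by (rule prod_upd_active[OF True]) auto
          then show ?thesis using k l l'
            by (simp del: fun_upd_apply add: Tfun_inactive yh_upd_nth dist)
        qed
        then have P': "P = \<kappa> k * (V k * W k)" unfolding P by (simp add: T_V)
        have "T k (V(j := 0)) / W k = V k" unfolding TkV T_V using W0 by simp
        then have G1: "G = \<kappa> j * lmonom X UNIV (b j) * T j V" unfolding G by simp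
        have VW: "?V' j * ?W' j = T j V"
          using W_snoc_mid[OF k l'] jk l by (simp add: T_V V')
        then have G': "G = (\<kappa> j * lmonom X UNIV (b j)) * (?V' j * ?W' j)" using G1 by simp
        have VkFL: "V k \<in> flaurent Xn"
        proof -
          have "V k = T k V * inverse (W k)" using W0 by (simp add: T_V)
          moreover have "(\<Prod>p\<in>- insert k (set ps). V p) \<in> flaurent Xn" by (intro FL FV) auto
          then have "T k V \<in> flaurent Xn" unfolding Tfun_inactive[OF k]
            by (intro FL(1,2) FL(3)[OF fconst_\<beta>] FL(3)[OF fconst_A] yFL) auto
          ultimately show ?thesis using mon_FL[OF mon_inverse[OF mon_W]] FL(1) by simp
        qed
        \<comment> \<open>\<open>V k\<close> is a factor of the product of inactive variables, and
          the recursion for \<open>M\<close> preserves it. This makes the square in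
          \<open>T j\<close> a multiple of \<open>P\<close>.\<close>
        have MV: "\<exists>\<mu>\<in>flaurent Xn. M V l = V k * \<mu>" if "l \<le> r" for l
          using that
        proof (induction rule: Mh_induct)
          case length
          have "- set ps = insert k (- insert k (set ps))" using k by auto
          then have "M V r = V k * (\<Prod>p\<in>- insert k (set ps). V p)"
            unfolding Mh_length by simp
          moreover have "(\<Prod>p\<in>- insert k (set ps). V p) \<in> flaurent Xn" by (intro FL FV) auto
          ultimately show ?case by blast
        next
          case (step l)
          then obtain \<mu> where \<mu>: "\<mu> \<in> flaurent Xn" "M V (Suc l) = V k * \<mu>" by blast
          have "M V l = V k * (\<mu> * ((emb \<circ> B) (ps ! l) * y V l + A l * (V k * \<mu>)) * inverse (y V (Suc l)))"
            unfolding Mh_rec[OF step(1)] \<mu>(2) by (simp add: divide_inverse mult_ac)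
          moreover have "\<mu> * ((emb \<circ> B) (ps ! l) * y V l + A l * (V k * \<mu>)) * inverse (y V (Suc l)) \<in> flaurent Xn"
            using step(1) by (intro FL \<mu> fconst_\<beta> fconst_A yFL VkFL) auto
          ultimately show ?case by blast
        qed
        obtain \<mu> where \<mu>: "\<mu> \<in> flaurent Xn" "M V (l + 2) = V k * \<mu>" using MV[of "l + 2"] l' by auto
        show ?thesis
        proof (rule conclude[OF H G' mon\<kappa>])
          fix D m s1 s2
          assume s1: "s1 \<in> flaurent Xn" "P ^ m = D * s1" and s2: "s2 \<in> flaurent Xn" "G = D * s2"
          \<comment> \<open>Modulo \<open>P\<close> the function \<open>T j\<close> is the unit
            monomial \<open>N0\<close>, so a common divisor of \<open>G\<close> and
            \<open>P ^ m\<close> divides \<open>N0 ^ m\<close>.\<close>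
          define N0 where "N0 = y V l * y V (l + 2)"
          have "mon N0" unfolding N0_def using l' by (intro mon_mult mon_y) auto
          define g where "g = - ((A l)\<^sup>2 * \<mu>\<^sup>2 * V k * inverse (\<kappa> k) * inverse (W k))"
          have gFL: "g \<in> flaurent Xn" unfolding g_def
            by (intro FL fconst_A \<mu> VkFL fconst_inverse kb(1) mon_FL[OF mon_inverse[OF mon_W]])
          define q where "q = \<kappa> j * lmonom X UNIV (b j)"
          have q0: "q \<noteq> 0" unfolding q_def by (rule mon_nz[OF mon\<kappa>])
          have "G = q * T j V" by (simp add: G1 q_def)
          then have TG: "T j V = G * inverse q" using q0 by simp
          have "T j V = N0 + (A l)\<^sup>2 * (V k * \<mu>)\<^sup>2"
            using l' l(1) by (simp add: Tfun_mid dist N0_def \<mu>(2)[simplified])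
          moreover have "P * g = - ((A l)\<^sup>2 * (V k * \<mu>)\<^sup>2)"
            unfolding P' g_def using fconst_neq_0[OF kb(1)] W0[of k]
            by (simp add: power2_eq_square field_simps)
          ultimately have N0: "N0 = D * (s2 * inverse q) + P * g"
            using TG s2(2) by (simp add: mult_ac)
          have TjFL: "D * (s2 * inverse q) \<in> flaurent Xn"
          proof -
            have "P \<in> flaurent Xn" unfolding P' by (intro FL kb(1) VkFL mon_FL[OF mon_W])
            then have "N0 + - (P * g) \<in> flaurent Xn"
              by (intro FL(2) FL(10) FL(1) gFL mon_FL[OF \<open>mon N0\<close>])
            then show ?thesis by (simp add: N0)
          qed
          have PgFL: "P * g \<in> flaurent Xn" unfolding P' by (intro FL kb(1) VkFL mon_FL[OF mon_W] gFL)
          obtain t where t: "t \<in> flaurent Xn"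
            "(D * (s2 * inverse q) + P * g) ^ m = D * (s2 * inverse q) * t + (P * g) ^ m"
            using flaurent_power_add[OF Xn0 TjFL PgFL] by blast
          have "N0 ^ m = D * (s2 * inverse q * t + s1 * g ^ m)"
            unfolding N0 t(2) power_mult_distrib s1(2) by (simp add: algebra_simps)
          moreover have "s2 * inverse q * t + s1 * g ^ m \<in> flaurent Xn"
            unfolding q_def by (intro FL s1 s2 t gFL mon_FL[OF mon_inverse[OF mon\<kappa>]])
          ultimately show "\<exists>N s. mon N \<and> s \<in> flaurent Xn \<and> N = D * s"
            using mon_power[OF \<open>mon N0\<close>] by blast
        qed
      qed
    qed
  qed
  show ?thesis unfolding t' Xn has_type_def
    using seed' fV' F' gauss_X'[OF a] unfolding t' Xn by (simp add: Xn_def)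
qed

end

lemma gauss_units_unit:
  fixes x0 :: "'n::{finite,linorder} \<Rightarrow> ('n, 'r::{factorial_semiring,idom}) ratfun"
  assumes "alg_ind x0" "f \<in> gauss_units x0" "g \<in> gauss_units x0" "fconst (f / g)" "g \<noteq> 0"
  obtains u where "u dvd 1" "f = emb u * g"
proof -
  obtain u where "u dvd 1" "f / g = emb u"
    using gauss_units_fconst[OF assms(1) gauss_units_divide[OF assms(2,3)] assms(4)] by blast
  then show ?thesis using that assms(5) by (simp add: field_simps)
qed

text \<open>Two clusters of the same type that consist of Gauss units differ by units of
  \<open>R\<close>; hence the seed can be moved onto the prescribed cluster.\<close>

lemma has_type_adopt:
  fixes x0 :: "'n::{finite,linorder} \<Rightarrow> ('n, 'r::{factorial_semiring,idom}) ratfun"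
  assumes x0: "alg_ind x0" and t: "has_type (gauss_units x0) x B ps (X, F)"
    and V: "\<And>q. Vh (emb \<circ> B) x ps q \<noteq> 0"
    and Y: "\<And>q. fconst (Vh (emb \<circ> B) x ps q / Y q)" "\<And>q. Y q \<in> gauss_units x0"
  shows "\<exists>F'. has_type (gauss_units x0) x B ps (Y, F')"
proof -
  have X: "X q \<in> gauss_units x0" for q
    using t primitive_mvar[of q] by (auto simp: has_type_def dest: spec[of _ "mvar q"])
  have X0: "X q \<noteq> 0" for q
    using t alg_ind_nonzero[OF is_seed_alg_ind, of X F] by (simp add: has_type_def)
  have "\<exists>u. u dvd 1 \<and> Y q = emb u * X q" for q
  proof -
    have "fconst (Vh (emb \<circ> B) x ps q / X q)" using t by (simp add: has_type_def)
    from fconst_divide[OF this Y(1)[of q]] have "fconst (Y q / X q)" using V[of q] by simp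
    then show ?thesis using gauss_units_unit[OF x0 Y(2) X _ X0] by metis
  qed
  then obtain u where u: "\<And>q. u q dvd 1" "\<And>q. Y q = emb (u q) * X (id q)" unfolding id_apply by metis
  have "has_type (gauss_units x0) x B (map id ps) (X, F)" using t by simp
  from has_type_rescaled[of _ _ _ id _ _ _ Y u, OF this bij_id u(2) u(1)]
  obtain F' where "has_type (gauss_units x0) (x \<circ> id) (B \<circ> id) ps (Y, F')" by blast
  then show ?thesis by auto
qed

section \<open>Variables that do not occur, and vanishing exponents\<close>

context typed
begin

lemma typed_cong:
  assumes "chain (emb \<circ> B') x' ps'" "has_type (gauss_units x0) x' B' ps' (Y, F')"
  shows "typed B' x' ps' x0 Y F'"
  using assms x0_ind n2 by (simp add: typed_def typed_axioms_def)

lemma not_involves: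
  assumes z: "z \<notin> Zset ps q" and eq: "T q (V(z := 0)) = T q V"
  shows "z \<notin> mvars (F q)"
proof -
  obtain p0 p1 where p: "F q = p0 + mvar z * p1" "mvars p0 \<subseteq> mvars (F q) - {z}"
    using split_off_var by blast
  have "z \<notin> mvars p0" using p(2) by blast
  then have 1: "peval (X(z := 0)) (F q) = peval X p0" by (simp add: p(1) peval_upd_free)
  have "peval (X(z := 0)) (F q) = peval X (F q)"
    using eq by (simp add: F_upd[OF z] F_X T_V)
  then have "X z * peval X p1 = 0" using 1 by (simp add: p(1))
  then have "p1 = 0" using X0 X_ind by (simp add: alg_ind_eq_0_iff)
  then show ?thesis using p by auto
qed

lemma T_indep_early:
  assumes "m + 2 \<le> l" "l < r"
  shows "T (ps ! l) (V(ps ! m := 0)) = T (ps ! l) V"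
proof (cases "Suc l = r")
  case True
  have "(\<Prod>p\<in>- set ps. (V(ps ! m := 0)) p) = (\<Prod>p\<in>- set ps. V p)"
    by (rule prod_upd_active) (use assms in auto)
  then show ?thesis using assms by (simp del: fun_upd_apply add: Tfun_last[OF dist True] yh_upd_nth dist)
next
  case False
  with assms have l': "Suc l < r" by simp
  have "M (V(ps ! m := 0)) (l + 2) = M V (l + 2)"
    using assms l' by (simp add: Mh_upd_early dist)
  then show ?thesis using assms l'
    by (simp del: fun_upd_apply add: Tfun_mid[OF dist l'] yh_upd_nth dist)
qed

lemma T_indep_inactive:
  assumes "q \<notin> set ps" "Suc m < r"
  shows "T q (V(ps ! m := 0)) = T q V"
proof -
  have "(\<Prod>p\<in>- insert q (set ps). (V(ps ! m := 0)) p) = (\<Prod>p\<in>- insert q (set ps). V p)"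
    by (rule prod_upd_active) (use assms in auto)
  then show ?thesis using assms by (simp del: fun_upd_apply add: Tfun_inactive yh_upd_nth dist)
qed

lemma free_early: "m + 2 \<le> l \<Longrightarrow> l < r \<Longrightarrow> ps ! m \<notin> mvars (F (ps ! l))"
  by (rule not_involves) (simp_all add: nth_in_Zset_iff dist T_indep_early)

lemma free_inactive: "q \<notin> set ps \<Longrightarrow> Suc m < r \<Longrightarrow> ps ! m \<notin> mvars (F q)"
  by (rule not_involves) (simp_all add: Zset_inactive T_indep_inactive)

lemma F_dvd_sym: "irreducible g \<Longrightarrow> F q dvd g \<Longrightarrow> g dvd F q"
  using irreducible_dvd_cases[of g "F q"] F_irr[of q] irreducible_not_unit by blast

lemma hat_exponent_free:
  assumes hat: "is_hat_exponent (X, F) i a" and "j \<noteq> i" and "j \<notin> mvars (F i)" "\<not> F j dvd F i"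
  shows "a j = 0"
  using hat_exponent_0[OF X_ind hat assms(2) _ F0]
    dvd_in_laurent_iff[OF X_ind F_prime F_nd, of j "F i"] assms(3,4)
  by (simp add: peval_upd_free)

text \<open>Here \<open>F j\<close> does not contain the mutated variable. Instead, setting the
  inactive \<open>X j\<close> to 0 leaves only \<open>y l * y (l + 2)\<close> in the exchange
  function, a monomial that \<open>F j\<close> cannot divide.\<close>

lemma hat_exponent_inactive:
  assumes hat: "is_hat_exponent (X, F) (ps ! l) a" and l: "Suc l < r" and j: "j \<notin> set ps"
  shows "a j = 0"
proof (rule hat_exponent_0[OF X_ind hat _ _ F0])
  let ?i = "ps ! l"
  show "j \<noteq> ?i" using j l by auto
  have jZ: "j \<notin> Zset ps ?i" using j by (auto simp: Zset_def)
  have M: "M (V(j := 0)) (l + 2) = 0" by (rule Mh_inactive_0[of j]) (use j l in auto)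
  have T0: "T ?i (V(j := 0)) = y V l * y V (l + 2)"
    using l j M by (simp del: fun_upd_apply add: Tfun_mid dist yh_upd_inactive)
  show "\<not> dvd_in (laurent_ring X) (peval X (F j)) (peval (X(j := 0)) (F ?i))"
  proof
    assume d: "dvd_in (laurent_ring X) (peval X (F j)) (peval (X(j := 0)) (F ?i))"
    have "\<exists>\<mu> e. fconst \<mu> \<and> y V m = \<mu> * lmonom X UNIV e" for m
    proof (cases m)
      case 0
      then show ?thesis by (intro exI[of _ 1] exI[of _ "\<lambda>_. 0"]) (simp add: yh_def)
    next
      case (Suc n)
      have "lmonom X UNIV (\<lambda>k. if k \<in> {ps ! n} then 1 else 0) = X (ps ! n)"
        unfolding lmonom_extend[symmetric] by (simp add: lmonom_def)
      then have "y V m = w (ps ! n) * lmonom X UNIV (\<lambda>k. if k \<in> {ps ! n} then 1 else 0)"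
        by (simp add: Suc yh_Suc V_w)
      then show ?thesis using w_fconst by blast
    qed
    then obtain \<mu>1 e1 \<mu>2 e2 where e: "fconst \<mu>1" "y V l = \<mu>1 * lmonom X UNIV e1"
      "fconst \<mu>2" "y V (l + 2) = \<mu>2 * lmonom X UNIV e2" by metis
    define \<mu> where "\<mu> = \<kappa> ?i * (\<mu>1 * \<mu>2)"
    define ee where "ee = (\<lambda>k. b ?i k + (e1 k + e2 k))"
    have "peval (X(j := 0)) (F ?i) = \<mu> * lmonom X UNIV ee"
      unfolding \<mu>_def ee_def using X0
      by (simp add: F_upd[OF jZ] T0 e(2) e(4)[simplified] lmonom_add mult_ac)
    moreover have "fconst \<mu>" unfolding \<mu>_def by (intro fconst_mult kb(1) e)
    then obtain c d where cd: "c \<noteq> 0" "d \<noteq> 0" "\<mu> = emb c / emb d" by (auto simp: fconst_def)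
    ultimately have "emb c * lmonom X UNIV ee = peval (X(j := 0)) (F ?i) * emb d" by simp
    moreover have "dvd_in (laurent_ring X) (peval X (F j)) (peval (X(j := 0)) (F ?i) * emb d)"
      using dvd_in_trans_mult[OF X0 d emb_in_laurent[OF X0]] .
    ultimately have "\<exists>c' m. F j = mconst c' * pmon m"
      using laurent_ring_const_dvd[OF X_ind cd(1)] by metis
    then obtain c' m where cm: "F j = mconst c' * pmon m" by blast
    have "F j dvd mconst c' * pmon m" unfolding cm[symmetric] by (rule dvd_refl)
    then have "F j dvd mconst c' \<or> F j dvd pmon m" using prime_elem_dvd_multD[OF F_prime] by blast
    moreover have "c' \<noteq> 0" using cm F0[of j] by auto
    ultimately show False
      using prime_not_dvd_pmon[OF F_prime F_nd] prime_not_dvd_const[OF F_nonconst] by blast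
  qed
qed

end

subsection \<open>The other mutations\<close>

text \<open>The cluster \<open>Xn\<close> of a mutation at \<open>i\<close>, together with the exchange polynomials \<open>G\<close> of a seed of
  the expected type on the same cluster.\<close>

locale typed_step = typed B x ps x0 X F
  for B :: "'n::{finite,linorder} \<Rightarrow> 'r::{factorial_semiring,idom}" and x ps x0 X F +
  fixes i :: 'n and a :: "'n \<Rightarrow> int" and Xn F' B' x' ps' G
  assumes a: "\<And>j. j \<noteq> i \<Longrightarrow> a j = - b i j"
    and Xn: "Xn = X(i := hat_at F i a X / X i)"
    and seed': "is_seed (Xn, F')"
    and F'1: "\<And>j. i \<notin> mvars (F j) \<Longrightarrow> F' j = F j"
    and F'2: "\<And>j. i \<in> mvars (F j) \<Longrightarrow> \<exists>H b. common_factors_removed Xn i j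
      (hat_at F i a (X(j := 0))) (peval (X(i := hat_at F i a (X(j := 0)) / Xn i)) (F j)) H \<and>
      peval Xn (F' j) = lmonom Xn (UNIV - {j}) b * H"
    and V': "Vh (emb \<circ> B') x' ps' = V(i := W i)" and W'i: "Wh (emb \<circ> B') x' ps' i = V i"
    and c': "chain (emb \<circ> B') x' ps'"
    and G: "has_type (gauss_units x0) x' B' ps' (Xn, G)"
begin

sublocale n: typed B' x' ps' x0 Xn G
  by (rule typed_cong[OF c' G])

lemma Xn_X': "Xn = X' i a"
  by (simp add: Xn X'_def[OF a])

lemma Xn_other: "q \<noteq> i \<Longrightarrow> Xn q = X q"
  by (simp add: Xn)

lemma F'_irr: "irreducible (F' j)"
  using seed' by (simp add: is_seed_def)

lemma peval_Xn_free: "i \<notin> mvars p \<Longrightarrow> peval Xn p = peval X p"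
  unfolding Xn by (rule peval_upd_free)

lemma lmonom_Xn: "i \<notin> K \<Longrightarrow> lmonom Xn K e = lmonom X K e"
  unfolding Xn by (rule lmonom_upd)

lemma lmonom_Xn_0: "e i = 0 \<Longrightarrow> lmonom Xn UNIV e = lmonom X UNIV e"
  unfolding Xn by (rule lmonom_upd_0)

lemma assoc_of_dvd: "G j dvd g \<Longrightarrow> irreducible g \<Longrightarrow> \<exists>u. u dvd 1 \<and> g = mconst u * G j"
proof -
  assume "G j dvd g" and g: "irreducible g"
  then obtain q where q: "g = G j * q" by (elim dvdE)
  with g have "G j dvd 1 \<or> q dvd 1" by (rule irreducibleD)
  then have "q dvd 1" using n.F_irr irreducible_not_unit by blast
  then obtain u where "q = mconst u" "u dvd 1" by (elim is_unit_mpolyE)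
  then show ?thesis using q by (auto simp: mult.commute)
qed

lemma VW'_of_G: "\<exists>\<mu> e. fconst \<mu> \<and> Vh (emb \<circ> B') x' ps' j * Wh (emb \<circ> B') x' ps' j = \<mu> * lmonom Xn UNIV e * peval Xn (G j)"
proof -
  have "Vh (emb \<circ> B') x' ps' j * Wh (emb \<circ> B') x' ps' j =
    inverse (n.\<kappa> j) * lmonom Xn UNIV (\<lambda>k. - n.b j k) * peval Xn (G j)"
    unfolding n.F_X lmonom_uminus using n.\<kappa>b0[of j] by (simp add: field_simps)
  then show ?thesis using fconst_inverse[OF n.kb(1)] by blast
qed

lemma F_i_dvd: "F i dvd G i"
proof -
  obtain \<mu> e where e: "fconst \<mu>"
    "Vh (emb \<circ> B') x' ps' i * Wh (emb \<circ> B') x' ps' i = \<mu> * lmonom Xn UNIV e * peval Xn (G i)"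
    using VW'_of_G by blast
  have "peval Xn (F i) = \<kappa> i * lmonom Xn UNIV (b i) * (W i * V i)"
    using F'_i[OF a] unfolding Xn_X' .
  also have "W i * V i = \<mu> * lmonom Xn UNIV e * peval Xn (G i)" using e(2) by (simp add: V' W'i)
  finally have "peval Xn (F i) = (\<kappa> i * \<mu>) * lmonom Xn UNIV (\<lambda>k. b i k + e k) * peval Xn (G i)"
    by (simp add: lmonom_add n.X0 mult_ac)
  then show ?thesis
    by (rule monomial_multiple_dvd[OF n.X_ind F_irr F_nd F_nonconst]) (intro fconst_mult kb(1) e)
qed

lemma G_dvd_F: "F j dvd G j \<Longrightarrow> G j dvd F j"
  by (rule F_dvd_sym[OF n.F_irr])

text \<open>Mutation leaves \<open>F j\<close> alone. It and \<open>G j\<close> are both, up to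
  monomials and constants, the product of the same two opposite variables, hence associated.\<close>

lemma step_free:
  assumes "i \<notin> mvars (F j)" "i \<notin> Zset ps j" "j \<noteq> i" "Wh (emb \<circ> B') x' ps' j = W j"
  shows "\<exists>u. u dvd 1 \<and> F' j = mconst u * G j"
proof -
  obtain \<mu> e where e: "fconst \<mu>"
    "Vh (emb \<circ> B') x' ps' j * Wh (emb \<circ> B') x' ps' j = \<mu> * lmonom Xn UNIV e * peval Xn (G j)"
    using VW'_of_G by blast
  have "peval Xn (F j) = \<kappa> j * lmonom Xn UNIV (b j) * (V j * W j)"
    using assms(1,2) by (simp add: peval_Xn_free F_X lmonom_Xn_0 kb(2))
  also have "V j * W j = \<mu> * lmonom Xn UNIV e * peval Xn (G j)" using e(2) assms(3,4) by (simp add: V')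
  finally have "peval Xn (F j) = (\<kappa> j * \<mu>) * lmonom Xn UNIV (\<lambda>k. b j k + e k) * peval Xn (G j)"
    by (simp add: lmonom_add n.X0 mult_ac)
  then have "F j dvd G j"
    by (rule monomial_multiple_dvd[OF n.X_ind F_irr F_nd F_nonconst]) (intro fconst_mult kb(1) e)
  then have "G j dvd F j" by (rule G_dvd_F)
  then show ?thesis using assoc_of_dvd[OF _ F_irr] F'1[OF assms(1)] by simp
qed

text \<open>For the indices that interact with \<open>i\<close>: the explicit computation of the
  substituted exchange function shows that \<open>G j\<close> divides it over
  \<open>Frac R\<close>.\<close>

lemma step_near:
  assumes ji: "j \<noteq> i" and i: "i \<in> mvars (F j)" "i \<in> mvars (G j)" and Z: "j \<notin> Zset ps i" "i \<notin> Zset ps j"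
    and T: "T j (V(i := T i (V(j := 0)) / W i)) = N * Tfun (emb \<circ> B') ps' j (V(i := W i))"
    and N: "N \<in> flaurent Xn"
  shows "\<exists>u. u dvd 1 \<and> F' j = mconst u * G j"
proof -
  define P where "P = hat_at F i a (X(j := 0))"
  define E where "E = peval (X(i := P / Xn i)) (F j)"
  obtain H bb where H: "common_factors_removed Xn i j P E H"
    "peval Xn (F' j) = lmonom Xn (UNIV - {j}) bb * H"
    using F'2[OF i(1), folded P_def, folded E_def] by blast
  have aj: "a j = 0" using a[OF ji] kb(2)[OF Z(1)] by simp
  have P: "P = \<kappa> i * T i (V(j := 0))"
  proof -
    have "P = \<kappa> i * T i (hw (X(j := 0)))" unfolding P_def
      by (rule hat_eq[OF a]) (use Z X0 in auto)
    then show ?thesis by (simp add: hw_upd)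
  qed
  have hE: "hw (X(i := P / Xn i)) = V(i := T i (V(j := 0)) / W i)"
    using hw_subst[OF a, of "V(j := 0)"] unfolding P Xn_X' .
  obtain \<mu> e where e: "fconst \<mu>"
    "Vh (emb \<circ> B') x' ps' j * Wh (emb \<circ> B') x' ps' j = \<mu> * lmonom Xn UNIV e * peval Xn (G j)"
    using VW'_of_G by blast
  have "E = \<kappa> j * lmonom (X(i := P / Xn i)) UNIV (b j) * T j (hw (X(i := P / Xn i)))"
    unfolding E_def by (rule kb(3)) (use X0 Z in auto)
  also have "lmonom (X(i := P / Xn i)) UNIV (b j) = lmonom Xn UNIV (b j)"
    using kb(2)[OF Z(2)] by (simp add: lmonom_upd_0 lmonom_Xn_0)
  also have "T j (hw (X(i := P / Xn i))) = N * (\<mu> * lmonom Xn UNIV e * peval Xn (G j))"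
    unfolding hE T V'[symmetric] n.T_V e(2) ..
  finally have E: "E = (\<kappa> j * lmonom Xn UNIV (b j) * N * (\<mu> * lmonom Xn UNIV e)) * peval Xn (G j)"
    by (simp only: mult_ac)
  have "\<kappa> j * lmonom Xn UNIV (b j) * N * (\<mu> * lmonom Xn UNIV e) \<in> flaurent Xn"
    by (intro flaurent_mult n.X0 flaurent_lmonom N flaurent_fconst[OF n.X0 kb(1)] flaurent_fconst[OF n.X0 e(1)])
  then obtain c where c: "c \<noteq> 0"
    "emb c * (\<kappa> j * lmonom Xn UNIV (b j) * N * (\<mu> * lmonom Xn UNIV e)) \<in> laurent_ring Xn"
    by (auto simp: flaurent_def)
  have cE: "emb c * E = (emb c * (\<kappa> j * lmonom Xn UNIV (b j) * N * (\<mu> * lmonom Xn UNIV e))) * peval Xn (G j)"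
    by (simp only: E mult.assoc)
  obtain p0 p1 where p: "F i = p0 + mvar j * p1" "mvars p0 \<subseteq> mvars (F i) - {j}"
    using split_off_var by blast
  have j0: "j \<notin> mvars p0" and i0: "i \<notin> mvars p0" using p(2) F_free[of i] by auto
  have p00: "p0 \<noteq> 0"
  proof
    assume "p0 = 0"
    then have "mvar j dvd F i" using p(1) by simp
    then show False using F_nd by blast
  qed
  have P0: "P = lmonom Xn (UNIV - {i}) a * peval Xn p0"
  proof -
    have "lmonom (X(j := 0)) (UNIV - {i}) a = lmonom X (UNIV - {i}) a"
      unfolding lmonom_def by (rule prod.cong) (auto simp: aj)
    moreover have "peval (X(j := 0)) (F i) = peval Xn p0"
      by (simp add: p(1) peval_upd_free[OF j0] peval_Xn_free[OF i0])
    ultimately show ?thesis by (simp add: P_def hat_at_def lmonom_Xn)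
  qed
  have PL: "P \<in> laurent_ring Xn" unfolding P0
    by (intro laurent_ring_mult n.X0 lmonom_in_laurent peval_in_laurent)
  \<comment> \<open>\<open>P\<close> is free of the variable \<open>i\<close>, which
    \<open>G j\<close> contains.\<close>
  have nd: "\<not> dvd_in (laurent_ring Xn) (peval Xn (G j)) P"
  proof
    assume d: "dvd_in (laurent_ring Xn) (peval Xn (G j)) P"
    have "peval Xn p0 = P * lmonom Xn (UNIV - {i}) (\<lambda>k. - a k)"
      unfolding P0 lmonom_uminus using n.X0 by (simp add: lmonom_neq_0)
    then have "dvd_in (laurent_ring Xn) (peval Xn (G j)) (peval Xn p0)"
      using dvd_in_trans_mult[OF n.X0 d lmonom_in_laurent] by metis
    then have "G j dvd p0" using dvd_in_laurent_iff[OF n.X_ind n.F_prime n.F_nd] by blast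
    then show False using mvars_dvd p00 i(2) i0 by blast
  qed
  show ?thesis
    by (rule mutated_exchange_poly_unique[OF n.X_ind n.F_irr n.F_nd n.F_nonconst c(1) cE c(2) PL nd H F'_irr])
qed

text \<open>If \<open>F i\<close> omits \<open>X j\<close>, the prescribed substitution gives back
  the old cluster, so the expression to be reduced is \<open>F j\<close> itself. Expanded in the new
  cluster it is a power of \<open>F i\<close> times a monomial times \<open>G j\<close>, up to a
  constant.\<close>

lemma step_far:
  assumes ji: "j \<noteq> i" and j: "j \<notin> mvars (F i)" "j \<notin> Zset ps i" and W': "Wh (emb \<circ> B') x' ps' j = W j"
    and nd: "\<not> G j dvd F i"
  shows "\<exists>u. u dvd 1 \<and> F' j = mconst u * G j"
proof -
  have aj: "a j = 0" using a[OF ji] kb(2)[OF j(2)] by simp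
  define f where "f = peval Xn (F i)"
  have fX: "f = peval X (F i)" unfolding f_def by (rule peval_Xn_free[OF F_free])
  have f0: "f \<noteq> 0" unfolding fX using X_ind F0 by (simp add: alg_ind_eq_0_iff)
  define h where "h = lmonom Xn (UNIV - {i}) a"
  have h0: "h \<noteq> 0" unfolding h_def by (intro lmonom_neq_0 n.X0)
  have Xi: "X i = h * f / Xn i"
  proof -
    have "Xn i = h * f / X i" by (simp add: Xn hat_at_def h_def fX lmonom_upd)
    then show ?thesis using X0[of i] n.X0[of i] by (simp add: field_simps)
  qed
  obtain \<mu> e where e: "fconst \<mu>"
    "Vh (emb \<circ> B') x' ps' j * Wh (emb \<circ> B') x' ps' j = \<mu> * lmonom Xn UNIV e * peval Xn (G j)"
    using VW'_of_G by blast
  \<comment> \<open>The exponent of \<open>X i\<close> in the monomial of \<open>F j\<close>;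
    through \<open>X i = h * f / Xn i\<close> it becomes the exponent of \<open>f\<close>.\<close>
  define n where "n = b j i"
  have "peval X (F j) = \<kappa> j * lmonom X UNIV (b j) * (\<mu> * lmonom Xn UNIV e * peval Xn (G j))"
    using e(2) W' ji by (simp add: F_X V')
  also have "lmonom X UNIV (b j) = f powi n * (h powi n * Xn i powi (- n) * lmonom Xn (UNIV - {i}) (b j))"
    unfolding lmonom_UNIV_remove[of X _ i] n_def[symmetric] Xi
    by (simp add: lmonom_Xn power_int_mult_distrib power_int_divide_distrib power_int_minus divide_inverse
        power_int_inverse mult_ac)
  finally have eq: "peval X (F j) = f powi n * ((\<kappa> j * \<mu>) *
      (h powi n * Xn i powi (- n) * lmonom Xn (UNIV - {i}) (b j) * lmonom Xn UNIV e) * peval Xn (G j))"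
    by (simp add: mult_ac)
  define m where "m = h powi n * Xn i powi (- n) * lmonom Xn (UNIV - {i}) (b j) * lmonom Xn UNIV e"
  have hp: "h powi k = lmonom Xn (UNIV - {i}) (\<lambda>q. a q * k)" for k unfolding h_def by (rule lmonom_powi)
  have xp: "Xn i powi k = lmonom Xn {i} (\<lambda>_. k)" for k by (simp add: lmonom_def)
  have mL: "m \<in> laurent_ring Xn" unfolding m_def hp xp
    by (intro laurent_ring_mult n.X0 lmonom_in_laurent)
  have miL: "inverse m \<in> laurent_ring Xn"
    unfolding m_def hp xp inverse_mult_distrib lmonom_uminus[symmetric]
    by (intro laurent_ring_mult n.X0 lmonom_in_laurent)
  have m0: "m \<noteq> 0" unfolding m_def hp xp by (simp add: lmonom_neq_0 n.X0)
  have "fconst (\<kappa> j * \<mu>)" by (intro fconst_mult kb(1) e)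
  then obtain k1 k2 where k: "k1 \<noteq> 0" "k2 \<noteq> 0" "\<kappa> j * \<mu> = emb k1 / emb k2" by (auto simp: fconst_def)
  have eq': "emb k2 * peval X (F j) = f powi n * (emb k1 * m * peval Xn (G j))"
    unfolding eq m_def[symmetric] k(3) using k(2) by simp
  have fG: "\<not> F i dvd G j"
    using nd F_dvd_sym[OF n.F_irr] by blast
  have fL: "f \<in> laurent_ring Xn" by (simp add: f_def)
  \<comment> \<open>\<open>F j\<close> at \<open>X\<close> is a Laurent polynomial in
    \<open>Xn\<close>, so a negative exponent would make \<open>F i\<close> divide
    \<open>G j\<close>.\<close>
  have n0: "n \<ge> 0"
  proof (rule ccontr)
    assume "\<not> n \<ge> 0"
    then have "n = - int (Suc (nat (- n) - 1))" by simp
    then obtain l where l: "n = - int (Suc l)" by blast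
    have "f powi n = inverse (f ^ Suc l)" unfolding l power_int_minus power_int_of_nat ..
    then have "emb k1 * m * peval Xn (G j) = f ^ Suc l * (emb k2 * peval X (F j))"
      using eq' f0 by (simp add: field_simps)
    then have "emb k1 * peval Xn (G j) = f * (f ^ l * (emb k2 * peval X (F j)) * inverse m)"
      using m0 by (simp add: field_simps)
    moreover have XL: "X q \<in> laurent_ring Xn" for q
    proof (cases "q = i")
      case True
      have "X i = h * f * lmonom Xn {i} (\<lambda>_. - 1)"
        unfolding Xi by (simp add: lmonom_def power_int_minus divide_inverse)
      then show ?thesis using True unfolding h_def
        by (simp add: laurent_ring_mult n.X0 fL)
    next
      case False
      then show ?thesis using peval_in_laurent[of Xn "mvar q"] by (simp add: Xn_other)
    qed
    have "f ^ l * (emb k2 * peval X (F j)) * inverse m \<in> laurent_ring Xn"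
      by (intro laurent_ring_mult laurent_ring_power n.X0 emb_in_laurent miL fL peval_in_laurent_subst XL)
    ultimately have "dvd_in (laurent_ring Xn) (peval Xn (F i)) (peval Xn (mconst k1 * G j))"
      unfolding dvd_in_def f_def by auto
    then have "F i dvd mconst k1 * G j" using dvd_in_laurent_iff[OF n.X_ind F_prime F_nd] by blast
    then show False using prime_elem_dvd_multD[OF F_prime] prime_not_dvd_const[OF F_nonconst k(1)] fG by blast
  qed
  have NL: "f powi n * (emb k1 * m) \<in> laurent_ring Xn"
    using n0 by (auto simp: power_int_def intro!: laurent_ring_mult laurent_ring_power n.X0 fL emb_in_laurent mL)
  have GE: "emb k2 * peval X (F j) = (f powi n * (emb k1 * m)) * peval Xn (G j)"
    using eq' by (simp only: mult_ac)
  show ?thesis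
  proof (cases "i \<in> mvars (F j)")
    case True
    define P where "P = hat_at F i a (X(j := 0))"
    have P: "P = h * f"
    proof -
      have "lmonom (X(j := 0)) (UNIV - {i}) a = lmonom X (UNIV - {i}) a"
        unfolding lmonom_def by (rule prod.cong) (auto simp: aj)
      then show ?thesis by (simp add: P_def hat_at_def h_def fX lmonom_Xn peval_upd_free[OF j(1)])
    qed
    \<comment> \<open>Setting \<open>X j\<close> to 0 has no effect on the hat polynomial of
      \<open>F i\<close>, so the old variable is recovered.\<close>
    then have "P / Xn i = X i" using Xi by simp
    then have "X(i := P / Xn i) = X" by simp
    then obtain H bb where H: "common_factors_removed Xn i j P (peval X (F j)) H"
      "peval Xn (F' j) = lmonom Xn (UNIV - {j}) bb * H"
      using F'2[OF True, folded P_def] by auto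
    have PL: "P \<in> laurent_ring Xn" unfolding P h_def
      by (intro laurent_ring_mult n.X0 lmonom_in_laurent fL)
    have "\<not> dvd_in (laurent_ring Xn) (peval Xn (G j)) P"
    proof
      assume d: "dvd_in (laurent_ring Xn) (peval Xn (G j)) P"
      have "peval Xn (F i) = P * lmonom Xn (UNIV - {i}) (\<lambda>k. - a k)"
        unfolding P f_def[symmetric] lmonom_uminus h_def[symmetric] using h0 by simp
      then have "dvd_in (laurent_ring Xn) (peval Xn (G j)) (peval Xn (F i))"
        using dvd_in_trans_mult[OF n.X0 d lmonom_in_laurent] by metis
      then show False using nd dvd_in_laurent_iff[OF n.X_ind n.F_prime n.F_nd] by blast
    qed
    from mutated_exchange_poly_unique[OF n.X_ind n.F_irr n.F_nd n.F_nonconst k(2) GE NL PL this H F'_irr]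
    show ?thesis .
  next
    case False
    have "peval Xn (mconst k2 * F j) = peval Xn (G j) * (f powi n * (emb k1 * m))"
      using GE by (simp add: peval_Xn_free[OF False] mult_ac)
    then have "dvd_in (laurent_ring Xn) (peval Xn (G j)) (peval Xn (mconst k2 * F j))"
      unfolding dvd_in_def using NL by blast
    then have "G j dvd mconst k2 * F j" using dvd_in_laurent_iff[OF n.X_ind n.F_prime n.F_nd] by blast
    then have "G j dvd F j"
      using prime_elem_dvd_multD[OF n.F_prime] prime_not_dvd_const[OF n.F_nonconst k(2)] by blast
    then show ?thesis using assoc_of_dvd[OF _ F_irr] F'1[OF False] by simp
  qed
qed

lemma step_conclude:
  assumes "\<And>j. j \<noteq> i \<Longrightarrow> \<exists>u. u dvd 1 \<and> F' j = mconst u * G j"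
  shows "has_type (gauss_units x0) x' B' ps' (Xn, F')"
proof -
  have "\<exists>\<kappa> b. fconst \<kappa> \<and> peval Xn (F' j) = \<kappa> * lmonom Xn UNIV b *
      (Vh (emb \<circ> B') x' ps' j * Wh (emb \<circ> B') x' ps' j)" for j
  proof (cases "j = i")
    case True
    have "F' i = F i" using F'1 F_free by blast
    moreover have "peval Xn (F i) = \<kappa> i * lmonom Xn UNIV (b i) * (W i * V i)"
      using F'_i[OF a] unfolding Xn_X' .
    ultimately show ?thesis using True kb(1) V' W'i by auto
  next
    case False
    then obtain u where u: "u dvd 1" "F' j = mconst u * G j" using assms by blast
    have "u \<noteq> 0" using u F'_irr[of j] by auto
    then have "fconst (emb u * n.\<kappa> j)" by (intro fconst_mult fconst_emb n.kb(1))
    moreover have "peval Xn (F' j) = (emb u * n.\<kappa> j) * lmonom Xn UNIV (n.b j) *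
      (Vh (emb \<circ> B') x' ps' j * Wh (emb \<circ> B') x' ps' j)" by (simp add: u(2) n.F_X mult_ac)
    ultimately show ?thesis by blast
  qed
  then show ?thesis using G seed' unfolding has_type_def by simp
qed

end

text \<open>The reference seeds, one for each sequence and each relabelling of the data. They come
  from activations alone (\<open>ex_seed_of\<close>), so the argument is not circular.\<close>

locale typed_ex = typed +
  assumes ex: "\<And>\<tau> qs. bij \<tau> \<Longrightarrow> distinct qs \<Longrightarrow>
    \<exists>t. has_type (gauss_units x0) (x \<circ> \<tau>) (B \<circ> \<tau>) qs t"
begin

lemma gauss_X: "X q \<in> gauss_units x0"
  using gauss[OF primitive_mvar[of q]] by simp

lemma ex_on_cluster:
  assumes \<tau>: "bij \<tau>" and qs: "distinct qs" and c: "chain (emb \<circ> (B \<circ> \<tau>)) (x \<circ> \<tau>) qs"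
    and Y: "\<And>q. fconst (Vh (emb \<circ> (B \<circ> \<tau>)) (x \<circ> \<tau>) qs q / Y q)" "\<And>q. Y q \<in> gauss_units x0"
  shows "\<exists>G. has_type (gauss_units x0) (x \<circ> \<tau>) (B \<circ> \<tau>) qs (Y, G)"
proof -
  obtain X1 F1 where "has_type (gauss_units x0) (x \<circ> \<tau>) (B \<circ> \<tau>) qs (X1, F1)"
    using ex[OF \<tau> qs] by (metis surj_pair)
  from has_type_adopt[OF x0_ind this chain.V0[OF c] Y] show ?thesis .
qed

lemma step_intro:
  assumes mut: "is_mutation i (X, F) t'"
    and ha: "\<And>a j. is_hat_exponent (X, F) i a \<Longrightarrow> j \<noteq> i \<Longrightarrow> a j = - b i j"
    and \<tau>: "bij \<tau>" and c: "chain (emb \<circ> (B \<circ> \<tau>)) (x \<circ> \<tau>) qs"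
    and V': "Vh (emb \<circ> (B \<circ> \<tau>)) (x \<circ> \<tau>) qs = V(i := W i)" "Wh (emb \<circ> (B \<circ> \<tau>)) (x \<circ> \<tau>) qs i = V i"
  obtains a Xn F' G where "t' = (Xn, F')"
    "typed_step B x ps x0 X F i a Xn F' (B \<circ> \<tau>) (x \<circ> \<tau>) qs G"
proof -
  obtain a F' where t': "t' = (X(i := hat_at F i a X / X i), F')" and hat: "is_hat_exponent (X, F) i a"
    and seed': "is_seed t'"
    and F'1: "\<And>j. i \<notin> mvars (F j) \<Longrightarrow> F' j = F j"
    and F'2: "\<And>j. i \<in> mvars (F j) \<Longrightarrow> \<exists>H b. common_factors_removed (X(i := hat_at F i a X / X i)) i j
      (hat_at F i a (X(j := 0)))
      (peval (X(i := hat_at F i a (X(j := 0)) / (hat_at F i a X / X i))) (F j)) H \<and>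
      peval (X(i := hat_at F i a X / X i)) (F' j) = lmonom (X(i := hat_at F i a X / X i)) (UNIV - {j}) b * H"
    using mutation_cases[OF mut] by blast
  have a: "\<And>j. j \<noteq> i \<Longrightarrow> a j = - b i j" using ha[OF hat] .
  define Xn where "Xn = X(i := hat_at F i a X / X i)"
  have Xni: "hat_at F i a X / X i = Xn i" by (simp add: Xn_def)
  have XX: "Xn = X' i a" by (simp add: Xn_def X'_def[OF a])
  have d: "distinct qs" using c by (simp add: chain_def)
  have "Xn q \<in> gauss_units x0" for q
    using gauss_X'[OF a primitive_mvar[of q]] by (simp add: XX)
  moreover have "fconst (Vh (emb \<circ> (B \<circ> \<tau>)) (x \<circ> \<tau>) qs q / Xn q)" for q
    unfolding V' XX by (rule fconst_X'[OF a])
  ultimately obtain G where G: "has_type (gauss_units x0) (x \<circ> \<tau>) (B \<circ> \<tau>) qs (Xn, G)"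
    using ex_on_cluster[OF \<tau> d c] by blast
  have "typed_step B x ps x0 X F i a Xn F' (B \<circ> \<tau>) (x \<circ> \<tau>) qs G"
  proof (intro typed_step.intro typed_step_axioms.intro)
    show "typed B x ps x0 X F" by (rule typed_axioms)
    show "Xn = X(i := hat_at F i a X / X i)" by (rule Xn_def)
    show "is_seed (Xn, F')" using seed' unfolding t' Xn_def .
    show "\<exists>H b. common_factors_removed Xn i j
      (hat_at F i a (X(j := 0))) (peval (X(i := hat_at F i a (X(j := 0)) / Xn i)) (F j)) H \<and>
      peval Xn (F' j) = lmonom Xn (UNIV - {j}) b * H" if "i \<in> mvars (F j)" for j
      using F'2[OF that, folded Xn_def, unfolded Xni] .
  qed (use a F'1 V' c G in auto)
  then show ?thesis using that t' Xn_def by blast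
qed

text \<open>The exchange function of the last active index has no denominator, so all exponents must
  vanish. Inactive indices and the predecessor are handled by \<open>step_near\<close>; earlier ones
  by \<open>step_far\<close>, because their new exchange polynomials contain \<open>i\<close> and
  \<open>F i\<close> does not.\<close>

lemma deactivation:
  assumes mut: "is_mutation i (X, F) t'" and ps: "ps = qs @ [i]"
  shows "has_type (gauss_units x0) x B qs t'"
proof -
  let ?s = "length qs"
  have r: "Suc ?s = r" and i: "i = ps ! ?s" and d: "distinct qs" "i \<notin> set qs" using dist ps by auto
  interpret c0: chain "emb \<circ> B" x qs
    by unfold_locales (use d \<beta>0 x0 Yh0 in auto)
  have VV: "V = c0.V(i := c0.W i)" unfolding ps by (rule c0.V_snoc[OF d(2)])
  have Wi: "W i = x i" using Wh_last[OF dist r] i by metis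
  have V': "c0.V = V(i := W i)" using c0.V_inactive[OF d(2)] by (auto simp: VV Wi)
  have W'i: "c0.W i = V i" by (simp add: VV)
  have Zi: "Zset ps i = {}" using r unfolding i by (simp add: Zset_nth dist)
  have bi: "b i j = 0" for j using kb(2)[of j i] Zi by simp
  have nth: "qs ! l = ps ! l" if "l < ?s" for l using that by (simp add: ps nth_append)
  have js: "j \<notin> set ps \<or> (\<exists>l. j = ps ! l \<and> Suc l < r)" if "j \<noteq> i" for j
  proof -
    have "j \<in> set ps \<Longrightarrow> j \<in> set qs" using that ps by auto
    then show ?thesis using nth r by (metis Suc_less_eq in_set_conv_nth)
  qed
  have hats: "a j = - b i j" if hat: "is_hat_exponent (X, F) i a" and j: "j \<noteq> i" for a j
  proof -
    from js[OF j] consider "j \<notin> set ps" | l where "j = ps ! l" "Suc l = ?s" | l where "j = ps ! l" "Suc l < ?s"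
      using r by (metis Suc_less_eq less_antisym Suc_lessI)
    then have "a j = 0"
    proof cases
      case 1
      then show ?thesis using hat_exponent_neg[OF hat j] involves_last[OF 1 r] i by simp
    next
      case 2
      then have "i \<in> mvars (F j)" using involves_next[of l] r i by simp
      then show ?thesis using hat_exponent_neg[OF hat j] by simp
    next
      case 3
      then have "j \<notin> mvars (F i)" "\<not> F j dvd F i"
        using free_early[of l ?s] F_not_dvd[of l ?s] r i by auto
      then show ?thesis using hat_exponent_free[OF hat j] by simp
    qed
    then show ?thesis by (simp add: bi)
  qed
  have c: "chain (emb \<circ> (B \<circ> id)) (x \<circ> id) qs" using c0.chain_axioms by simp
  obtain a Xn F' G where t': "t' = (Xn, F')"
    and st: "typed_step B x ps x0 X F i a Xn F' (B \<circ> id) (x \<circ> id) qs G"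
  proof (rule step_intro[where \<tau> = id and qs = qs, OF mut _ bij_id c])
    show "\<And>a j. is_hat_exponent (X, F) i a \<Longrightarrow> j \<noteq> i \<Longrightarrow> a j = - b i j" by (rule hats)
  qed (use V' W'i in auto)
  interpret st: typed_step B x ps x0 X F i a Xn F' B x qs G using st by simp
  have FLW: "inverse (W i) \<in> flaurent Xn"
  proof -
    have e: "inverse (W i) = inverse (c0.V i / Xn i) * inverse (Xn i)"
      unfolding V' using st.n.X0[of i] W0 by (simp add: field_simps)
    show ?thesis unfolding e
      using st.n.w_fconst[of i] unfolding st.n.w_def
      by (intro flaurent_mult flaurent_inverse_var flaurent_fconst fconst_inverse st.n.X0)
  qed
  have "\<exists>u. u dvd 1 \<and> F' j = mconst u * G j" if j: "j \<noteq> i" for j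
  proof -
    from js[OF j] consider "j \<notin> set ps" | l where "j = ps ! l" "Suc l = ?s" | l where "j = ps ! l" "Suc l < ?s"
      using r by (metis Suc_less_eq less_antisym Suc_lessI)
    then show ?thesis
    proof cases
      case 1
      show ?thesis
      proof (rule st.step_near[OF j])
        show "i \<in> mvars (F j)" using involves_last[OF 1 r] i by simp
        show "i \<in> mvars (G j)" using st.n.involves_inactive d(2) j by blast
        show "j \<notin> Zset ps i" "i \<notin> Zset ps j" using Zi Zset_inactive[OF 1] by simp_all
        show "T j (V(i := T i (V(j := 0)) / W i)) = ((emb \<circ> B) i / W i) * c0.T j (V(i := W i))"
          by (rule T_butlast_inactive[OF ps 1 W0])
        show "(emb \<circ> B) i / W i \<in> flaurent Xn" unfolding divide_inverse
          by (intro flaurent_mult flaurent_fconst[OF st.n.X0 fconst_\<beta>] st.n.X0 FLW)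
      qed
    next
      case (2 l)
      have jl: "j = qs ! l" using 2 nth[of l] by simp
      show ?thesis
      proof (rule st.step_near[OF j])
        show "i \<in> mvars (F j)" using involves_next[of l] 2 r i by simp
        show "i \<in> mvars (G j)" using st.n.involves_inactive d(2) j by blast
        show "j \<notin> Zset ps i" using Zi by simp
        show "i \<notin> Zset ps j" using 2 r i by (simp add: nth_in_Zset_iff dist)
        show "T j (V(i := T i (V(j := 0)) / W i)) = (A l * (\<Prod>p\<in>- set ps. V p) / W i) * c0.T j (V(i := W i))"
          unfolding jl by (rule T_butlast_last[OF ps 2(2) W0])
        have "V p \<in> flaurent Xn" if "p \<in> - set ps" for p
        proof -
          have "p \<noteq> i" using that ps by auto
          then have "V p = w p * Xn p" by (simp add: V_w st.Xn_other)
          then show ?thesis by (simp add: flaurent_mult flaurent_var flaurent_fconst st.n.X0 w_fconst)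
        qed
        then show "A l * (\<Prod>p\<in>- set ps. V p) / W i \<in> flaurent Xn" unfolding divide_inverse
          by (intro flaurent_mult flaurent_fconst[OF st.n.X0 fconst_A] flaurent_prod st.n.X0 FLW)
      qed
    next
      case (3 l)
      show ?thesis
      proof (rule st.step_far[OF j])
        show f: "j \<notin> mvars (F i)" using free_early[of l ?s] 3 r i by auto
        show "j \<notin> Zset ps i" using Zi by simp
        show "c0.W j = W j" using c0.W_snoc_mid[OF d(2) 3(2)] 3 nth[of l] ps by simp
        show "\<not> G j dvd F i"
        proof
          assume "G j dvd F i"
          then have "mvars (G j) \<subseteq> mvars (F i)" using mvars_dvd F0 by blast
          moreover have "i \<in> mvars (G j)" using st.n.involves_inactive d(2) j by blast
          ultimately show False using F_free by blast
        qed
      qed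
    qed
  qed
  then show ?thesis unfolding t' by (rule st.step_conclude)
qed

text \<open>The adjacent seed at a position at least two behind \<open>l\<close> has the same variable opposite to
  \<open>ps ! l\<close>.\<close>

lemma square:
  assumes hat: "is_hat_exponent (X, F) (ps ! l) a" and lm: "l + 2 \<le> m" "m < r"
  shows "a (ps ! m) = - b (ps ! l) (ps ! m)"
proof -
  let ?i = "ps ! l" and ?j = "ps ! m"
  have ij: "?i \<noteq> ?j" using lm dist by (simp add: nth_eq_iff_index_eq)
  \<comment> \<open>The sequence adjacent at \<open>?j\<close>: drop \<open>?j\<close> if it is
    last, otherwise interchange it with its successor.\<close>
  obtain \<tau> qs where \<tau>: "bij \<tau>" and c: "chain (emb \<circ> (B \<circ> \<tau>)) (x \<circ> \<tau>) qs"
    and V': "Vh (emb \<circ> (B \<circ> \<tau>)) (x \<circ> \<tau>) qs = V(?j := W ?j)"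
    and W': "Wh (emb \<circ> (B \<circ> \<tau>)) (x \<circ> \<tau>) qs ?i = W ?i" "Wh (emb \<circ> (B \<circ> \<tau>)) (x \<circ> \<tau>) qs ?j = V ?j"
    and qs: "qs = ps \<or> (?j \<notin> set qs)"
  proof (cases "Suc m = r")
    case True
    define qs where "qs = butlast ps"
    have ps: "ps = qs @ [?j]"
      unfolding qs_def using True lm by (cases ps rule: rev_cases) (auto simp: nth_append)
    have d: "distinct qs" "?j \<notin> set qs" using dist ps by (metis distinct_append, metis distinct_append
        disjoint_insert(2) list.set(2) distinct.simps(2) distinct_butlast not_distinct_conv_prefix qs_def)
    interpret c0: chain "emb \<circ> B" x qs
      by unfold_locales (use d \<beta>0 x0 Yh0 in auto)
    have VV: "V = c0.V(?j := c0.W ?j)" using c0.V_snoc[OF d(2)] ps by simp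
    have Wj: "W ?j = x ?j" by (rule Wh_last[OF dist True])
    have lq: "l < length qs" "Suc l < length qs" using True lm by (auto simp: qs_def)
    show ?thesis
    proof (rule that[of id qs])
      show "chain (emb \<circ> (B \<circ> id)) (x \<circ> id) qs" using c0.chain_axioms by simp
      show "Vh (emb \<circ> (B \<circ> id)) (x \<circ> id) qs = V(?j := W ?j)"
        using c0.V_inactive[OF d(2)] by (auto simp: VV Wj)
      have "qs ! l = ?i" using lq(1) ps by (metis nth_append)
      then show "Wh (emb \<circ> (B \<circ> id)) (x \<circ> id) qs ?i = W ?i"
        using c0.W_snoc_mid[OF d(2) lq(2)] ps by simp
      show "Wh (emb \<circ> (B \<circ> id)) (x \<circ> id) qs ?j = V ?j" by (simp add: VV)
    qed (use d in auto)
  next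
    case False
    with lm have m: "Suc m < r" by simp
    interpret cs: chain_swap "emb \<circ> B" x ps m by unfold_locales (rule m)
    define \<tau> where "\<tau> = Transposition.transpose (ps ! m) (ps ! Suc m)"
    have e: "emb \<circ> (B \<circ> \<tau>) = cs.\<beta>'" "x \<circ> \<tau> = cs.x'"
      by (auto simp: cs.\<beta>'_def cs.x'_def \<tau>_def)
    show ?thesis
    proof (rule that[of \<tau> ps])
      show "bij \<tau>" by (simp add: \<tau>_def)
      show "chain (emb \<circ> (B \<circ> \<tau>)) (x \<circ> \<tau>) ps" unfolding e by (rule cs.chain')
      show "Vh (emb \<circ> (B \<circ> \<tau>)) (x \<circ> \<tau>) ps = V(?j := W ?j)" unfolding e by (rule cs.V_swap)
      show "Wh (emb \<circ> (B \<circ> \<tau>)) (x \<circ> \<tau>) ps ?i = W ?i" unfolding e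
        by (rule cs.W_swap_far) (use lm in auto)
      show "Wh (emb \<circ> (B \<circ> \<tau>)) (x \<circ> \<tau>) ps ?j = V ?j" unfolding e by (rule cs.W_swap_i)
    qed simp
  qed
  have dq: "distinct qs" using c by (simp add: chain_def)
  obtain X1 F1 where t1: "has_type (gauss_units x0) (x \<circ> \<tau>) (B \<circ> \<tau>) qs (X1, F1)"
    using ex[OF \<tau> dq] by (metis surj_pair)
  interpret t1: typed "B \<circ> \<tau>" "x \<circ> \<tau>" qs x0 X1 F1 by (rule typed_cong[OF c t1])
  \<comment> \<open>A reference seed is moved onto the cluster that agrees with \<open>X\<close>
    except at \<open>?j\<close>. The given seed is not mutated at \<open>?j\<close>, so no exponents
    for that mutation have to be known.\<close>
  define Xs where "Xs = X(?j := X1 ?j)"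
  have "fconst (Vh (emb \<circ> (B \<circ> \<tau>)) (x \<circ> \<tau>) qs q / Xs q)" for q
    using t1.w_fconst[of ?j] w_fconst[of q] unfolding t1.w_def w_def V' Xs_def by (cases "q = ?j") auto
  moreover have X1U: "X1 q \<in> gauss_units x0" for q
    using t1.gauss[OF primitive_mvar[of q]] by simp
  then have "Xs q \<in> gauss_units x0" for q using gauss_X by (simp add: Xs_def)
  ultimately obtain G where G: "has_type (gauss_units x0) (x \<circ> \<tau>) (B \<circ> \<tau>) qs (Xs, G)"
    using ex_on_cluster[OF \<tau> dq c] by blast
  interpret n: typed "B \<circ> \<tau>" "x \<circ> \<tau>" qs x0 Xs G by (rule typed_cong[OF c G])
  have bj: "b ?j ?j = 0" by (rule kb(2)[OF q_notin_Zset])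
  define c1 where "c1 = (\<lambda>k. - b ?j k)"
  \<comment> \<open>The factor between \<open>X1 ?j\<close> and the variable that the exponents
    \<open>c1\<close> would give. It is a constant and a Gauss unit, hence a unit of
    \<open>R\<close>.\<close>
  define z where "z = X1 ?j / (lmonom X (UNIV - {?j}) c1 * (peval X (F ?j) / X ?j))"
  have FX0: "peval X (F ?j) \<noteq> 0" using X_ind F0 by (simp add: alg_ind_eq_0_iff)
  have l0: "lmonom X (UNIV - {?j}) c1 \<noteq> 0" by (intro lmonom_neq_0 X0)
  have lj: "lmonom X UNIV (b ?j) = inverse (lmonom X (UNIV - {?j}) c1)"
    unfolding c1_def lmonom_uminus using bj by (simp add: lmonom_UNIV_remove[of _ _ ?j])
  have z: "X1 ?j = z * lmonom X (UNIV - {?j}) c1 * (peval X (F ?j) / X ?j)"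
    using FX0 l0 X0[of ?j] by (simp add: z_def)
  have "z = inverse (t1.w ?j) * inverse (\<kappa> ?j * w ?j)"
  proof -
    have "t1.w ?j * X1 ?j = W ?j" using t1.V_w[of ?j] by (simp add: V')
    moreover have "peval X (F ?j) / X ?j = \<kappa> ?j * lmonom X UNIV (b ?j) * (w ?j * W ?j)"
      unfolding F_X using V_w[of ?j] X0[of ?j] by simp
    then have "lmonom X (UNIV - {?j}) c1 * (peval X (F ?j) / X ?j) = \<kappa> ?j * (w ?j * W ?j)"
      unfolding lj using l0 by simp
    ultimately show ?thesis unfolding z_def
      using t1.w0[of ?j] w0[of ?j] fconst_neq_0[OF kb(1)[of ?j]] W0[of ?j]
      by (simp add: field_simps)
  qed
  then have zf: "fconst z" by (simp add: fconst_mult fconst_inverse t1.w_fconst kb(1) w_fconst)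
  have zU: "z \<in> gauss_units x0" unfolding z_def
    by (intro gauss_units_divide gauss_units_mult X1U gauss_units_pmon gauss gauss_X F_primitive) 
  obtain u where u: "u dvd 1" "z = emb u" using gauss_units_fconst[OF x0_ind zU zf] .
  have assoc: "F ?j dvd G ?j"
  proof -
    have "peval Xs (F ?j) = peval X (F ?j)" unfolding Xs_def by (rule peval_upd_free[OF F_free])
    moreover have "lmonom Xs UNIV (b ?j) = lmonom X UNIV (b ?j)" unfolding Xs_def by (rule lmonom_upd_0) (rule bj)
    moreover have "peval Xs (G ?j) = n.\<kappa> ?j * lmonom Xs UNIV (n.b ?j) * (W ?j * V ?j)"
      using n.F_X[of ?j] by (simp add: V' W')
    then have "V ?j * W ?j = inverse (n.\<kappa> ?j) * lmonom Xs UNIV (\<lambda>k. - n.b ?j k) * peval Xs (G ?j)"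
      unfolding lmonom_uminus using n.\<kappa>b0[of ?j] by (simp add: field_simps)
    ultimately have "peval Xs (F ?j) = \<kappa> ?j * lmonom Xs UNIV (b ?j) *
        (inverse (n.\<kappa> ?j) * lmonom Xs UNIV (\<lambda>k. - n.b ?j k) * peval Xs (G ?j))" by (simp only: F_X)
    also have "\<dots> = (\<kappa> ?j * inverse (n.\<kappa> ?j)) * lmonom Xs UNIV (\<lambda>k. b ?j k + - n.b ?j k) * peval Xs (G ?j)"
      by (subst lmonom_add) (simp_all add: n.X0 mult_ac)
    finally show ?thesis
      by (rule monomial_multiple_dvd[OF n.X_ind F_irr F_nd F_nonconst])
        (intro fconst_mult fconst_inverse kb(1) n.kb(1))
  qed
  \<comment> \<open>After a swap, \<open>F ?j\<close> is associated with \<open>G ?j\<close>, and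
    \<open>F_not_dvd\<close> applies to the reference seed. After a removal, \<open>G ?i\<close>
    contains \<open>?j\<close> and \<open>F ?j\<close> does not.\<close>
  have nd: "\<not> F ?j dvd G ?i"
  proof
    assume d: "F ?j dvd G ?i"
    then have d': "G ?i dvd F ?j" using F_dvd_sym n.F_irr by blast
    from qs show False
    proof
      assume "qs = ps"
      then show False using n.F_not_dvd[of l m] lm dvd_trans[OF d' assoc] by simp
    next
      assume j: "?j \<notin> set qs"
      have "?j \<in> mvars (G ?i)" using n.involves_inactive[OF j ij] .
      then show False using mvars_dvd[OF d' F0] F_free by blast
    qed
  qed
  have Fi: "peval X (F ?i) = (\<kappa> ?i * inverse (n.\<kappa> ?i)) * lmonom X UNIV (b ?i) *
    (lmonom Xs UNIV (\<lambda>k. - n.b ?i k) * peval Xs (G ?i))"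
  proof -
    have "peval Xs (G ?i) = n.\<kappa> ?i * lmonom Xs UNIV (n.b ?i) * (V ?i * W ?i)"
      using n.F_X[of ?i] ij by (simp add: V' W')
    then have "V ?i * W ?i = inverse (n.\<kappa> ?i) * lmonom Xs UNIV (\<lambda>k. - n.b ?i k) * peval Xs (G ?i)"
      unfolding lmonom_uminus using n.\<kappa>b0[of ?i] by (simp add: field_simps)
    then show ?thesis unfolding F_X by (simp only: mult_ac)
  qed
  show ?thesis
    by (rule hat_exponent_square[where F = F and Z = "X1 ?j" and c = c1, OF X_ind hat ij[symmetric]
          F_irr F_free F_nd F_nonconst Xs_def n.X_ind z[unfolded u(2)] u(1) nd
          fconst_mult[OF kb(1) fconst_inverse[OF n.kb(1)]] Fi])
qed

text \<open>The two neighbours in the sequence are handled by \<open>step_near\<close>, earlier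
  indices by \<open>step_far\<close>, inactive and later ones by \<open>step_free\<close>. The later
  indices are the ones whose exponents may be nonzero and are supplied by
  \<open>square\<close>.\<close>

lemma transposition:
  assumes mut: "is_mutation (ps ! l) (X, F) t'" and l: "Suc l < r"
  shows "has_type (gauss_units x0) (x \<circ> Transposition.transpose (ps ! l) (ps ! Suc l))
    (B \<circ> Transposition.transpose (ps ! l) (ps ! Suc l)) ps t'"
proof -
  let ?i = "ps ! l"
  define \<tau> where "\<tau> = Transposition.transpose (ps ! l) (ps ! Suc l)"
  interpret cs: chain_swap "emb \<circ> B" x ps l by unfold_locales (rule l)
  have e: "emb \<circ> (B \<circ> \<tau>) = cs.\<beta>'" "x \<circ> \<tau> = cs.x'"
    by (auto simp: cs.\<beta>'_def cs.x'_def \<tau>_def)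
  have \<tau>: "bij \<tau>" by (simp add: \<tau>_def)
  have js: "j \<notin> set ps \<or> (\<exists>m<r. j = ps ! m \<and> (m = Suc l \<or> Suc m = l \<or> m + 2 \<le> l \<or> l + 2 \<le> m))"
    if "j \<noteq> ?i" for j
  proof (cases "j \<in> set ps")
    case True
    then obtain m where m: "m < r" "j = ps ! m" by (auto simp: in_set_conv_nth)
    with that have "m \<noteq> l" by auto
    then show ?thesis using m by (intro disjI2 exI[of _ m]) auto
  qed simp
  have hats: "a j = - b ?i j" if hat: "is_hat_exponent (X, F) ?i a" and j: "j \<noteq> ?i" for a j
  proof -
    from js[OF j] consider "j \<notin> set ps" | "j = ps ! Suc l" | m where "j = ps ! m" "Suc m = l"
      | m where "j = ps ! m" "m + 2 \<le> l" | m where "j = ps ! m" "l + 2 \<le> m" "m < r" by blast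
    then show ?thesis
    proof cases
      case 1
      have "b ?i j = 0" using 1 by (intro kb(2)) (auto simp: Zset_def)
      then show ?thesis using hat_exponent_inactive[OF hat l 1] by simp
    next
      case 2
      have "b ?i j = 0" using 2 l by (intro kb(2)) (simp add: nth_in_Zset_iff dist)
      then show ?thesis using hat_exponent_neg[OF hat j] involves_prev[OF l] 2 by simp
    next
      case (3 m)
      have "b ?i j = 0" using 3 l by (intro kb(2)) (simp add: nth_in_Zset_iff dist)
      then show ?thesis using hat_exponent_neg[OF hat j] involves_next[of m] 3 l by auto
    next
      case (4 m)
      have "b ?i j = 0" using 4 l by (intro kb(2)) (simp add: nth_in_Zset_iff dist)
      then show ?thesis
        using hat_exponent_free[OF hat j] free_early[of m l] F_not_dvd[of m l] 4 l by auto
    next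
      case (5 m)
      then show ?thesis using square[OF hat] by simp
    qed
  qed
  have c: "chain (emb \<circ> (B \<circ> \<tau>)) (x \<circ> \<tau>) ps" unfolding e by (rule cs.chain')
  have V': "Vh (emb \<circ> (B \<circ> \<tau>)) (x \<circ> \<tau>) ps = V(?i := W ?i)" unfolding e by (rule cs.V_swap)
  have W'i: "Wh (emb \<circ> (B \<circ> \<tau>)) (x \<circ> \<tau>) ps ?i = V ?i" unfolding e by (rule cs.W_swap_i)
  obtain a Xn F' G where t': "t' = (Xn, F')"
    and st: "typed_step B x ps x0 X F ?i a Xn F' (B \<circ> \<tau>) (x \<circ> \<tau>) ps G"
  proof (rule step_intro[where \<tau> = \<tau> and qs = ps, OF mut _ \<tau> c V' W'i])
    show "\<And>a j. is_hat_exponent (X, F) ?i a \<Longrightarrow> j \<noteq> ?i \<Longrightarrow> a j = - b ?i j" by (rule hats)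
  qed
  interpret st: typed_step B x ps x0 X F ?i a Xn F' "B \<circ> \<tau>" "x \<circ> \<tau>" ps G by (rule st)
  have hwn: "st.n.hw Xn = V(?i := W ?i)" using V' by simp
  have VFL: "(V(?i := W ?i)) p \<in> flaurent Xn" "inverse ((V(?i := W ?i)) p) \<in> flaurent Xn" for p
    using flaurent_lfun[of Xn UNIV "\<lambda>Y. st.n.hw Y p", OF st.n.X0 st.n.lfun_hw]
      flaurent_lfun[of Xn UNIV "\<lambda>Y. inverse (st.n.hw Y p)", OF st.n.X0 st.n.lfun_inv_hw[OF UNIV_I]]
    unfolding hwn by simp_all
  have WFL: "inverse (W ?i) \<in> flaurent Xn" using VFL(2)[of ?i] by simp
  have MFL: "M V m \<in> flaurent Xn" if m: "l + 2 \<le> m" "m \<le> r" for m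
  proof -
    have "Mh (emb \<circ> (B \<circ> \<tau>)) ps (V(?i := W ?i)) m \<in> flaurent Xn"
      using flaurent_lfun[of Xn _ "\<lambda>Y. Mh (emb \<circ> (B \<circ> \<tau>)) ps (st.n.hw Y) m", OF st.n.X0 st.n.lfun_Mh[OF m(2)]] unfolding hwn .
    then show ?thesis unfolding e cs.M_swap_late[OF m] cs.M_upd_late[OF m] .
  qed
  have AFL: "A n \<in> flaurent Xn" for n by (rule flaurent_fconst[OF st.n.X0 fconst_A])
  note FL = flaurent_mult[of Xn, OF st.n.X0] flaurent_power[of Xn, OF st.n.X0]
    flaurent_prod[of Xn, OF st.n.X0]
  have "\<exists>u. u dvd 1 \<and> F' j = mconst u * G j" if j: "j \<noteq> ?i" for j
  proof -
    from js[OF j] consider "j \<notin> set ps" | "j = ps ! Suc l" | m where "j = ps ! m" "Suc m = l"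
      | m where "j = ps ! m" "m + 2 \<le> l" | m where "j = ps ! m" "l + 2 \<le> m" "m < r" by blast
    then show ?thesis
    proof cases
      case 1
      show ?thesis
        by (rule st.step_free) (use j 1 free_inactive[OF 1 l] Zset_inactive[OF 1] cs.W_swap_inactive[OF 1] in \<open>simp_all add: e\<close>)
    next
      case 2
      have T': "Tfun (emb \<circ> (B \<circ> \<tau>)) ps = Tfun cs.\<beta>' ps" by (simp only: e)
      have near: "\<exists>u. u dvd 1 \<and> F' j = mconst u * G j"
        if "T j (V(?i := T ?i (V(j := 0)) / W ?i)) = N * Tfun cs.\<beta>' ps j (V(?i := W ?i))" "N \<in> flaurent Xn" for N
      proof (rule st.step_near[OF j])
        show "?i \<in> mvars (F j)" using involves_prev[OF l] 2 by simp
        show "?i \<in> mvars (G j)" using st.n.involves_prev[OF l] 2 by simp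
        show "j \<notin> Zset ps ?i" "?i \<notin> Zset ps j" using 2 l by (simp_all add: nth_in_Zset_iff dist)
      qed (use that T' in simp_all)
      show ?thesis
      proof (cases "Suc (Suc l) = r")
        case True
        show ?thesis
        proof (rule near)
          show "T j (V(?i := T ?i (V(j := 0)) / W ?i)) =
              (A l * (\<Prod>p\<in>- set ps. V p) / W ?i) * Tfun cs.\<beta>' ps j (V(?i := W ?i))"
            unfolding 2 by (rule cs.T_swap_next_last[OF W0 True])
          have "V p \<in> flaurent Xn" if "p \<in> - set ps" for p
          proof -
            have "p \<noteq> ?i" using that l by auto
            then show ?thesis using VFL(1)[of p] by simp
          qed
          then show "A l * (\<Prod>p\<in>- set ps. V p) / W ?i \<in> flaurent Xn"
            unfolding divide_inverse by (intro FL AFL WFL)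
        qed
      next
        case False
        with l have l2: "l + 2 < r" by simp
        have z: "ps ! (l + 2) \<noteq> ?i" using l2 dist by (simp add: nth_eq_iff_index_eq)
        show ?thesis
        proof (rule near)
          show "T j (V(?i := T ?i (V(j := 0)) / W ?i)) =
              ((A (Suc l))\<^sup>2 * (M V (l + 3))\<^sup>2 / (V (ps ! (l + 2)) * W ?i)) * Tfun cs.\<beta>' ps j (V(?i := W ?i))"
            unfolding 2 by (rule cs.T_swap_next[OF W0 l2 V0])
          have "inverse (V (ps ! (l + 2))) \<in> flaurent Xn" using VFL(2)[of "ps ! (l + 2)"] z by simp
          then show "(A (Suc l))\<^sup>2 * (M V (l + 3))\<^sup>2 / (V (ps ! (l + 2)) * W ?i) \<in> flaurent Xn"
            unfolding divide_inverse inverse_mult_distrib using l2 by (intro FL AFL WFL MFL) auto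
        qed
      qed
    next
      case (3 m)
      have T': "Tfun (emb \<circ> (B \<circ> \<tau>)) ps = Tfun cs.\<beta>' ps" by (simp only: e)
      have m: "Suc m < r" "?i = ps ! Suc m" using 3 l by auto
      show ?thesis
      proof (rule st.step_near[OF j])
        show "?i \<in> mvars (F j)" unfolding m(2) 3(1) by (rule involves_next[OF m(1)])
        show "?i \<in> mvars (G j)" unfolding m(2) 3(1) by (rule st.n.involves_next[OF m(1)])
        show "j \<notin> Zset ps ?i" "?i \<notin> Zset ps j" using 3 l by (auto simp: nth_in_Zset_iff dist)
        show "T j (V(?i := T ?i (V(j := 0)) / W ?i)) =
            (A l * M V (l + 2) / W ?i)\<^sup>2 * Tfun (emb \<circ> (B \<circ> \<tau>)) ps j (V(?i := W ?i))"
          unfolding T' 3(1) by (rule cs.T_swap_prev[OF W0 3(2)[symmetric]])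
        show "(A l * M V (l + 2) / W ?i)\<^sup>2 \<in> flaurent Xn"
          unfolding divide_inverse using l by (intro FL AFL WFL MFL) auto
      qed
    next
      case (4 m)
      show ?thesis
      proof (rule st.step_far[OF j])
        show "j \<notin> mvars (F ?i)" using free_early[of m l] 4 l by simp
        show "j \<notin> Zset ps ?i" using 4 l by (simp add: nth_in_Zset_iff dist)
        show "Wh (emb \<circ> (B \<circ> \<tau>)) (x \<circ> \<tau>) ps j = W j" unfolding e 4(1)
          by (rule cs.W_swap_far) (use 4 l in auto)
        show "\<not> G j dvd F ?i"
          using st.n.F_not_dvd[of m l] 4 l dvd_trans[OF _ st.F_i_dvd] by auto
      qed
    next
      case (5 m)
      show ?thesis
      proof (rule st.step_free)
        show "?i \<notin> mvars (F j)" using free_early[of l m] 5 by simp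
        show "?i \<notin> Zset ps j" using 5 l by (simp add: nth_in_Zset_iff dist)
        show "Wh (emb \<circ> (B \<circ> \<tau>)) (x \<circ> \<tau>) ps j = W j" unfolding e 5(1)
          by (rule cs.W_swap_far) (use 5 in auto)
      qed (rule j)
    qed
  qed
  then show ?thesis unfolding t' \<tau>_def[symmetric] by (rule st.step_conclude)
qed

end

section \<open>Enumeration of the seeds\<close>

lemma adjacent_swaps_induct [consumes 2, case_names swap]:
  assumes "P zs" "mset zs = mset zs'"
    and swap: "\<And>us a b vs. P (us @ a # b # vs) \<Longrightarrow> P (us @ b # a # vs)"
  shows "P zs'"
proof -
  \<comment> \<open>Adjacent swaps carry one entry to the front; the target list is then assembled
    head by head.\<close>
  have front: "P (p @ a # us @ vs)" if "P (p @ us @ a # vs)" for p us a vs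
    using that
  proof (induction us arbitrary: vs rule: rev_induct)
    case (snoc b us)
    then show ?case using swap[of "p @ us" b a vs] by simp
  qed simp
  have "P (p @ zs')" if "P (p @ zs)" "mset zs = mset zs'" for p zs
    using that
  proof (induction zs' arbitrary: p zs)
    case (Cons a w)
    then have "a \<in> set zs" by (metis list.set_intros(1) set_mset_mset)
    then obtain us vs where zs: "zs = us @ a # vs" by (meson split_list)
    have "P ((p @ [a]) @ us @ vs)" using front[of p us a vs] Cons.prems(1) by (simp add: zs)
    moreover have "mset (us @ vs) = mset w" using Cons.prems(2) by (simp add: zs)
    ultimately show ?case using Cons.IH[of "p @ [a]"] by simp
  qed simp
  from this[of "[]"] show ?thesis using assms(1,2) by simp
qed

lemma card_distinct_lists:
  "card {xs :: 'a::finite list. distinct xs} = (\<Sum>k = 0..CARD('a). fact CARD('a) div fact k)"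
proof -
  let ?n = "CARD('a)"
  have "{xs :: 'a list. distinct xs} = (\<Union>k\<in>{0..?n}. {xs. length xs = k \<and> distinct xs \<and> set xs \<subseteq> UNIV})"
    by (auto simp: distinct_card[symmetric] card_mono)
  also have "card \<dots> = (\<Sum>k = 0..?n. card {xs :: 'a list. length xs = k \<and> distinct xs \<and> set xs \<subseteq> UNIV})"
  proof (rule card_UN_disjoint)
    show "\<forall>k\<in>{0..?n}. finite {xs :: 'a list. length xs = k \<and> distinct xs \<and> set xs \<subseteq> UNIV}"
      using finite_lists_length_eq[of "UNIV :: 'a set"] by (auto intro: finite_subset[rotated])
  qed auto
  also have "\<dots> = (\<Sum>k = 0..?n. fact ?n div fact (?n - k))"
  proof (rule sum.cong[OF refl])
    fix k assume "k \<in> {0..?n}"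
    then show "card {xs :: 'a list. length xs = k \<and> distinct xs \<and> set xs \<subseteq> UNIV} = fact ?n div fact (?n - k)"
      using card_lists_distinct_length_eq[of "UNIV :: 'a set" k] fact_div_fact[of "?n - k" ?n] by simp
  qed
  also have "\<dots> = (\<Sum>k = 0..?n. fact ?n div fact k)"
    by (rule sum.reindex_bij_witness[of _ "\<lambda>k. ?n - k" "\<lambda>k. ?n - k"]) auto
  finally show ?thesis .
qed

text \<open>The initial segments of a distinct list have different sizes, so equal families match
  size by size, and consecutive segments differ by one entry.\<close>

lemma list_determined_by_prefix_sets:
  assumes "distinct xs" "distinct ys"
    and eq: "{set (take (Suc l) xs) | l. l < length xs} = {set (take (Suc l) ys) | l. l < length ys}"
  shows "xs = ys"
proof -
  have card_take: "card (set (take (Suc l) zs)) = Suc l" if "distinct zs" "l < length zs" for l and zs :: "'a list"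
    using that by (simp add: distinct_card)
  have sub: "length xs \<le> length ys \<and> (\<forall>l<length xs. set (take (Suc l) xs) = set (take (Suc l) ys))"
    if "distinct xs" "distinct ys"
      "{set (take (Suc l) xs) | l. l < length xs} \<subseteq> {set (take (Suc l) ys) | l. l < length ys}"
    for xs ys :: "'a list"
  proof -
    have m: "l < length ys \<and> set (take (Suc l) xs) = set (take (Suc l) ys)" if l: "l < length xs" for l
    proof -
      obtain m where m: "m < length ys" "set (take (Suc l) xs) = set (take (Suc m) ys)"
        using \<open>_ \<subseteq> _\<close> l by blast
      moreover have "l = m" using card_take[of xs l] card_take[of ys m] m l that
          \<open>distinct xs\<close> \<open>distinct ys\<close> by simp
      ultimately show ?thesis by simp
    qed
    then show ?thesis by (metis not_le_imp_less less_irrefl)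
  qed
  have len: "length xs = length ys"
    using conjunct1[OF sub[OF assms(1,2) eq_refl[OF eq]]] conjunct1[OF sub[OF assms(2,1) eq_refl[OF eq[symmetric]]]]
    by (rule le_antisym)
  have pre: "set (take (Suc l) xs) = set (take (Suc l) ys)" if "l < length xs" for l
    using conjunct2[OF sub[OF assms(1,2) eq_refl[OF eq]]] that by blast
  show ?thesis
  proof (rule nth_equalityI[OF len])
    fix l assume l: "l < length xs"
    have tk: "set (take l xs) = set (take l ys)"
      using pre[of "l - 1"] l by (cases l) auto
    have last: "set (take (Suc l) zs) - set (take l zs) = {zs ! l}"
      if "distinct zs" "l < length zs" for zs :: "'a list"
    proof -
      have "zs ! l \<notin> set (take l zs)" using that distinct_take[of zs "Suc l"]
        by (simp add: take_Suc_conv_app_nth)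
      then show ?thesis using that by (auto simp: take_Suc_conv_app_nth)
    qed
    show "xs ! l = ys ! l"
      using last[of xs] last[of ys] pre[OF l] tk l len assms by simp
  qed
qed

text \<open>The numerator of \<open>Yh\<close>, a polynomial in \<open>x\<close>, so that initial
  variables may be set to 0.\<close>

definition Nh :: "('n \<Rightarrow> 'a) \<Rightarrow> ('n::finite \<Rightarrow> 'a::field) \<Rightarrow> 'n set \<Rightarrow> 'a" where
  "Nh \<beta> x S = (\<Prod>i\<in>S. \<beta> i) + (\<Sum>i\<in>S. (\<Prod>j\<in>S - {i}. \<beta> j) * (\<Prod>j\<in>UNIV - {i}. x j))"

lemma Yh_Nh: "(\<And>k. x k \<noteq> 0) \<Longrightarrow> Nh \<beta> x S = Yh \<beta> x S * (\<Prod>i\<in>S. x i)"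
  by (simp add: Yh_def Nh_def)

text \<open>All summands but the \<open>i\<close>-th contain \<open>x i\<close>. For
  \<open>i \<in> S\<close> a constant times the initial exchange polynomial at \<open>i\<close> is
  left.\<close>

lemma Nh_upd_0: "Nh \<beta> (x(i := 0)) S =
    (if i \<in> S then (\<Prod>j\<in>S - {i}. \<beta> j) * (\<beta> i + (\<Prod>j\<in>UNIV - {i}. x j)) else (\<Prod>j\<in>S. \<beta> j))"
proof -
  let ?x = "x(i := 0)"
  have z: "(\<Prod>j\<in>UNIV - {k}. ?x j) = 0" if "k \<noteq> i" for k
    using that by (auto simp: prod_zero_iff)
  have i: "(\<Prod>j\<in>UNIV - {i}. ?x j) = (\<Prod>j\<in>UNIV - {i}. x j)"
    by (rule prod.cong) auto
  have "(\<Sum>k\<in>S. (\<Prod>j\<in>S - {k}. \<beta> j) * (\<Prod>j\<in>UNIV - {k}. ?x j)) =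
      (\<Sum>k\<in>S. if k = i then (\<Prod>j\<in>S - {i}. \<beta> j) * (\<Prod>j\<in>UNIV - {i}. x j) else 0)"
    by (rule sum.cong) (auto simp: z i simp del: fun_upd_apply)
  also have "\<dots> = (if i \<in> S then (\<Prod>j\<in>S - {i}. \<beta> j) * (\<Prod>j\<in>UNIV - {i}. x j) else 0)"
    by simp
  finally show ?thesis
    by (auto simp: Nh_def prod.remove[of S i] algebra_simps simp del: fun_upd_apply)
qed

text \<open>Keys name the cluster variables up to constants: \<open>Inl i\<close> for an initial
  variable, \<open>Inr S\<close> for the Laurent polynomial of \<open>S\<close>.\<close>

fun kv :: "('n \<Rightarrow> 'a) \<Rightarrow> ('n::finite \<Rightarrow> 'a::field) \<Rightarrow> 'n + 'n set \<Rightarrow> 'a" where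
  "kv \<beta> x (Inl i) = x i"
| "kv \<beta> x (Inr S) = Yh \<beta> x S"

definition key :: "'n list \<Rightarrow> 'n \<Rightarrow> 'n + 'n set" where
  "key \<sigma> q = (if q \<in> set \<sigma> then Inr (set (take (Suc (idx \<sigma> q)) \<sigma>)) else Inl q)"

lemma Vh_key: "Vh \<beta> x \<sigma> q = kv \<beta> x (key \<sigma> q)"
  by (simp add: Vh_def key_def)

lemma key_nth: "distinct \<sigma> \<Longrightarrow> l < length \<sigma> \<Longrightarrow> key \<sigma> (\<sigma> ! l) = Inr (set (take (Suc l) \<sigma>))"
  by (simp add: key_def idx_nth)

lemma key_eq_Inl_iff: "key \<sigma> q = Inl i \<longleftrightarrow> q = i \<and> q \<notin> set \<sigma>"
  by (auto simp: key_def)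

lemma key_eq_InrE:
  assumes "key \<sigma> q = Inr S" "distinct \<sigma>"
  obtains l where "l < length \<sigma>" "q = \<sigma> ! l" "S = set (take (Suc l) \<sigma>)"
proof -
  have q: "q \<in> set \<sigma>" using assms by (auto simp: key_def split: if_splits)
  then obtain l where "l < length \<sigma>" "q = \<sigma> ! l" by (metis in_set_conv_nth)
  then show ?thesis using that[of l] key_nth[of \<sigma> l] assms by simp
qed

lemma inj_key:
  assumes "distinct \<sigma>"
  shows "inj (key \<sigma>)"
proof (rule injI)
  fix p q assume eq: "key \<sigma> p = key \<sigma> q"
  show "p = q"
  proof (cases "key \<sigma> p")
    case (Inl i)
    then show ?thesis using eq by (metis key_eq_Inl_iff)
  next
    case (Inr S)
    obtain l where l: "l < length \<sigma>" "p = \<sigma> ! l" "S = set (take (Suc l) \<sigma>)"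
      using key_eq_InrE[OF Inr assms] .
    obtain m where m: "m < length \<sigma>" "q = \<sigma> ! m" "S = set (take (Suc m) \<sigma>)"
      using key_eq_InrE[OF Inr[unfolded eq] assms] .
    have "card (set (take (Suc l) \<sigma>)) = Suc l" "card (set (take (Suc m) \<sigma>)) = Suc m"
      using l(1) m(1) assms by (simp_all add: distinct_card)
    then have "l = m" using l(3) m(3) by (metis nat.inject)
    then show ?thesis using l m by simp
  qed
qed

lemma range_key_inject:
  assumes "distinct \<sigma>" "distinct \<sigma>'" "range (key \<sigma>) = range (key \<sigma>')"
  shows "\<sigma> = \<sigma>'"
proof (rule list_determined_by_prefix_sets[OF assms(1,2)])
  have "{set (take (Suc l) \<sigma>) | l. l < length \<sigma>} = {S. Inr S \<in> range (key \<sigma>)}"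
    if "distinct \<sigma>" for \<sigma> :: "'a list"
  proof (intro equalityI subsetI; clarify)
    fix l assume "l < length \<sigma>"
    then show "Inr (set (take (Suc l) \<sigma>)) \<in> range (key \<sigma>)"
      using key_nth[OF that] by (metis rangeI)
  next
    fix S q assume "Inr S = key \<sigma> q"
    then show "\<exists>l. S = set (take (Suc l) \<sigma>) \<and> l < length \<sigma>" using key_eq_InrE[OF _ that] by metis
  qed
  from this[OF assms(1)] this[OF assms(2)]
  show "{set (take (Suc l) \<sigma>) | l. l < length \<sigma>} = {set (take (Suc l) \<sigma>') | l. l < length \<sigma>'}"
    by (simp add: assms(3))
qed

text \<open>The empty set is left out because its \<open>Yh\<close> is 1.\<close>

definition keys_all :: "('n + 'n set) set" where
  "keys_all = range Inl \<union> Inr ` (UNIV - {{}})"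

lemma key_in: "key \<sigma> q \<in> keys_all"
proof -
  have "set (take (Suc l) \<sigma>) \<noteq> {}" if "q \<in> set \<sigma>" for l using that by (cases \<sigma>) auto
  then show ?thesis by (simp add: key_def keys_all_def)
qed

lemma card_keys_all: "card (keys_all :: ('n::finite + 'n set) set) = 2 ^ CARD('n) + CARD('n) - 1"
proof -
  have "card (keys_all :: ('n + 'n set) set) =
      card (range Inl :: ('n + 'n set) set) + card (Inr ` (UNIV - {{}}) :: ('n + 'n set) set)"
    unfolding keys_all_def by (rule card_Un_disjoint) auto
  also have "\<dots> = CARD('n) + (2 ^ CARD('n) - 1)"
    by (simp add: card_image card_Diff_subset card_UNIV_set)
  finally show ?thesis by simp
qed

section \<open>The initial seed and the Laurent polynomials attached to it\<close>

locale tau_seed =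
  fixes A :: "'n::{finite,linorder} \<Rightarrow> 'r::{factorial_semiring,idom}"
    and X :: "'n \<Rightarrow> ('n, 'r) ratfun"
  assumes seed: "is_seed (X, tau_poly A)" and n2: "CARD('n) \<ge> 2"
begin

abbreviation "\<beta> \<equiv> emb \<circ> A"
abbreviation "U \<equiv> gauss_units X"

lemma X_ind: "alg_ind X"
  using seed by (rule is_seed_alg_ind)

lemma X0: "X k \<noteq> 0"
  using alg_ind_nonzero[OF X_ind] .

lemma peval_tau: "peval Y (tau_poly A i) = \<beta> i + (\<Prod>j\<in>UNIV - {i}. Y j)"
  by (simp add: tau_poly_def)

lemma tau_neq_0: "\<beta> i + (\<Prod>j\<in>UNIV - {i}. X j) \<noteq> 0"
proof -
  have "tau_poly A i \<noteq> 0" using seed by (auto simp: is_seed_def irreducible_def)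
  then show ?thesis unfolding peval_tau[symmetric] using alg_ind_eq_0_iff[OF X_ind] by blast
qed

text \<open>Otherwise the exchange polynomial would be the product of the other variables. There is
  at least one of them, and it would divide the polynomial.\<close>

lemma A0: "A i \<noteq> 0"
proof
  assume A: "A i = 0"
  have "UNIV \<noteq> {i}"
  proof
    assume "UNIV = {i}"
    then have "CARD('n) = card {i}" by (rule arg_cong)
    then show False using n2 by simp
  qed
  then obtain j where j: "j \<noteq> i" by blast
  have "(\<Prod>k\<in>UNIV - {i}. (X(j := 0)) k) = 0" using j by (auto simp: prod_zero_iff)
  then have "peval (X(j := 0)) (tau_poly A i) = 0"
    using A unfolding peval_tau by simp
  then have "mvar j dvd tau_poly A i" using mvar_dvd_iff_peval[OF X_ind] by blast
  then show False using seed by (auto simp: is_seed_def)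
qed

lemma Nh_upd_neq_0: "Nh \<beta> (X(i := 0)) S \<noteq> 0"
  using tau_neq_0[of i] A0 by (simp add: Nh_upd_0)

lemma lfun_Nh: "lfun Z (\<lambda>Y. Nh \<beta> Y S)"
  unfolding Nh_def by (intro lfun_add lfun_mult lfun_sum lfun_prod lfun_var) (simp_all add: lfun_emb)

lemma Nh_neq_0: "Nh \<beta> X S \<noteq> 0"
proof
  fix i :: 'n
  assume "Nh \<beta> X S = 0"
  then have "Nh \<beta> (X(i := 0)) S = 0"
    using lfun_identity[where S = "\<lambda>Y. Nh \<beta> Y S" and T = "\<lambda>Y. 0" and Z = "{}", OF X_ind lfun_Nh lfun_0]
    by simp
  then show False using Nh_upd_neq_0 by blast
qed

lemma Yh_neq_0: "Yh \<beta> X S \<noteq> 0"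
  using Nh_neq_0[of S] Yh_Nh[of X \<beta> S] X0 by auto

lemma chain:
  fixes \<iota> :: "'n \<Rightarrow> 'n"
  assumes \<iota>: "bij \<iota>" and ps: "distinct ps"
  shows "chain (emb \<circ> (A \<circ> \<iota>)) (X \<circ> \<iota>) ps"
proof -
  have e: "emb \<circ> (A \<circ> \<iota>) = \<beta> \<circ> \<iota>" by auto
  show ?thesis unfolding e
    by unfold_locales (use ps A0 X0 Yh_neq_0 in \<open>simp_all add: Yh_reindex[OF \<iota>]\<close>)
qed

text \<open>Clear denominators and set an initial variable \<open>X i\<close> to 0: the numerators
  stay nonzero, while the denominator of \<open>Yh \<beta> X S\<close> vanishes exactly for
  \<open>i \<in> S\<close>. So a proportionality identifies \<open>S\<close>.\<close>

lemma keys_not_proportional: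
  assumes k: "k \<in> keys_all" "k' \<in> keys_all" and \<kappa>: "fconst (kv \<beta> X k / kv \<beta> X k')"
  shows "k = k'"
proof -
  have ident: "f (X(i := 0)) = g (X(i := 0))" if "lfun {} f" "lfun {} g" "f X = g X" for f g i
    by (rule lfun_identity[OF X_ind that]) simp
  have pX: "(\<Prod>j\<in>S. (X(i := 0)) j) \<noteq> 0" if "i \<notin> S" for S i
    using that X0 by (auto simp: prod_zero_iff)
  have p0: "(\<Prod>j\<in>S. (X(i := 0)) j) = 0" if "i \<in> S" for S i
    using that by (auto simp: prod_zero_iff)
  have RR: "S \<subseteq> S'" if \<kappa>: "fconst \<kappa>" and eq: "Yh \<beta> X S = \<kappa> * Yh \<beta> X S'" for S S' and \<kappa> :: "('n, 'r) ratfun"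
  proof
    fix i assume i: "i \<in> S"
    show "i \<in> S'"
    proof (rule ccontr)
      assume i': "i \<notin> S'"
      have "Nh \<beta> X S * (\<Prod>j\<in>S'. X j) = \<kappa> * Nh \<beta> X S' * (\<Prod>j\<in>S. X j)"
        using eq X0 by (simp add: Yh_Nh)
      then have "Nh \<beta> (X(i := 0)) S * (\<Prod>j\<in>S'. (X(i := 0)) j) =
          \<kappa> * Nh \<beta> (X(i := 0)) S' * (\<Prod>j\<in>S. (X(i := 0)) j)"
        by (intro ident[of "\<lambda>Y. Nh \<beta> Y S * (\<Prod>j\<in>S'. Y j)" "\<lambda>Y. \<kappa> * Nh \<beta> Y S' * (\<Prod>j\<in>S. Y j)"]
            lfun_mult lfun_Nh lfun_prod lfun_var lfun_fconst \<kappa>)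
      then show False using Nh_upd_neq_0[of i S] pX[OF i'] unfolding p0[OF i] by (metis mult_eq_0_iff)
    qed
  qed
  have LR: False if \<kappa>: "fconst \<kappa>" and eq: "X i = \<kappa> * Yh \<beta> X S" and S: "S \<noteq> {}"
    for S i and \<kappa> :: "('n, 'r) ratfun"
  proof -
    obtain j where j: "j \<in> S" using S by blast
    have "X i * (\<Prod>j\<in>S. X j) = \<kappa> * Nh \<beta> X S"
      using eq X0 by (simp add: Yh_Nh)
    then have "(X(j := 0)) i * (\<Prod>k\<in>S. (X(j := 0)) k) = \<kappa> * Nh \<beta> (X(j := 0)) S"
      by (intro ident[of "\<lambda>Y. Y i * (\<Prod>k\<in>S. Y k)" "\<lambda>Y. \<kappa> * Nh \<beta> Y S"]
          lfun_mult lfun_Nh lfun_prod lfun_var lfun_fconst \<kappa>)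
    then show False using Nh_upd_neq_0[of j S] fconst_neq_0[OF \<kappa>] unfolding p0[OF j]
      by (metis mult_eq_0_iff)
  qed
  have LL: "i = j" if \<kappa>: "fconst \<kappa>" and eq: "X i = \<kappa> * X j" for i j and \<kappa> :: "('n, 'r) ratfun"
  proof (rule ccontr)
    assume ij: "i \<noteq> j"
    have "(X(i := 0)) i = \<kappa> * (X(i := 0)) j"
      using eq by (intro ident[of "\<lambda>Y. Y i" "\<lambda>Y. \<kappa> * Y j"] lfun_mult lfun_var lfun_fconst \<kappa>)
    then show False using ij X0[of j] fconst_neq_0[OF \<kappa>] by simp
  qed
  define \<kappa> where "\<kappa> = kv \<beta> X k / kv \<beta> X k'"
  have f: "fconst \<kappa>" "fconst (inverse \<kappa>)" using \<kappa> fconst_inverse[OF \<kappa>] by (simp_all only: \<kappa>_def)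
  have nz: "kv \<beta> X k \<noteq> 0" for k using X0 Yh_neq_0 by (cases k) auto
  have eq: "kv \<beta> X k = \<kappa> * kv \<beta> X k'" "kv \<beta> X k' = inverse \<kappa> * kv \<beta> X k"
    using nz by (simp_all add: \<kappa>_def)
  show ?thesis
  proof (cases k; cases k')
    fix i j assume "k = Inl i" "k' = Inl j"
    then show ?thesis using LL[OF f(1)] eq(1) by simp
  next
    fix i S assume kk: "k = Inl i" "k' = Inr S"
    then have "S \<noteq> {}" using k by (auto simp: keys_all_def)
    then show ?thesis using LR[OF f(1)] eq(1) kk by auto
  next
    fix i S assume kk: "k = Inr S" "k' = Inl i"
    then have "S \<noteq> {}" using k by (auto simp: keys_all_def)
    then show ?thesis using LR[OF f(2)] eq(2) kk by auto
  next
    fix S S' assume kk: "k = Inr S" "k' = Inr S'"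
    then show ?thesis using RR[OF f(1), of S S'] RR[OF f(2), of S' S] eq kk by auto
  qed
qed

end

section \<open>Labellings of a seed and its uniqueness up to units\<close>

lemma alg_ind_inj: "alg_ind X \<Longrightarrow> inj X"
  for X :: "'n::{finite,linorder} \<Rightarrow> ('n, 'r::idom) ratfun"
proof (rule injI)
  fix p q assume X: "alg_ind X" and "X p = X q"
  then have "peval X (mvar p) = peval X (mvar q)" by simp
  then have "mvars (mvar p :: ('n, 'r) mpoly) = mvars (mvar q :: ('n, 'r) mpoly)"
    using alg_ind_eq_iff[OF X] by metis
  then show "p = q" by simp
qed

lemma has_type_relabel:
  fixes x :: "'n::{finite,linorder} \<Rightarrow> ('n, 'r::{factorial_semiring,idom}) ratfun"
  assumes t: "has_type U x B (map \<iota> ps) t" and \<iota>: "bij \<iota>"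
  shows "\<exists>t'. has_type U (x \<circ> \<iota>) (B \<circ> \<iota>) ps t' \<and> unlabel t' = unlabel t"
proof -
  obtain X F where [simp]: "t = (X, F)" by (cases t)
  obtain F' where F': "has_type U (x \<circ> \<iota>) (B \<circ> \<iota>) ps (X \<circ> \<iota>, F')"
    "\<And>q. peval (X \<circ> \<iota>) (F' q) = peval X (F (\<iota> q))"
    using has_type_rescaled[of U x B \<iota> ps X F "X \<circ> \<iota>" "\<lambda>_. 1"] t \<iota> by auto
  have "unlabel (X \<circ> \<iota>, F') = (\<lambda>q. (X q, peval X (F q))) ` range \<iota>"
    unfolding unlabel_def by (auto simp: F'(2))
  then have "unlabel (X \<circ> \<iota>, F') = unlabel t"
    unfolding bij_is_surj[OF \<iota>] unlabel_def by auto
  then show ?thesis using F'(1) by blast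
qed

lemma has_type_relabel_back:
  fixes x :: "'n::{finite,linorder} \<Rightarrow> ('n, 'r::{factorial_semiring,idom}) ratfun"
  assumes t: "has_type U (x \<circ> \<iota>) (B \<circ> \<iota>) ps t" and \<iota>: "bij \<iota>"
  shows "\<exists>t'. has_type U x B (map \<iota> ps) t' \<and> unlabel t' = unlabel t"
proof -
  have i: "\<iota> \<circ> inv \<iota> = id" "inv \<iota> \<circ> \<iota> = id"
    using \<iota> by (simp_all add: bij_is_inj bij_is_surj surj_iff[symmetric] inj_iff[symmetric])
  have "map (inv \<iota>) (map \<iota> ps) = ps" by (simp add: i)
  then have "\<exists>t'. has_type U ((x \<circ> \<iota>) \<circ> inv \<iota>) ((B \<circ> \<iota>) \<circ> inv \<iota>) (map \<iota> ps) t' \<and> unlabel t' = unlabel t"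
    using t bij_imp_bij_inv[OF \<iota>] by (intro has_type_relabel) simp_all
  then show ?thesis by (simp add: comp_assoc i)
qed

lemma unlabel_eq_imp_relabelled:
  assumes s: "is_seed (X1, F1)" and e: "unlabel (X1, F1) = unlabel (X0, F0)"
  obtains \<pi> where "bij \<pi>" "X1 = X0 \<circ> \<pi>" "\<And>q. peval X1 (F1 q) = peval X0 (F0 (\<pi> q))"
proof -
  have "\<exists>p. X1 q = X0 p \<and> peval X1 (F1 q) = peval X0 (F0 p)" for q
  proof -
    have "(X1 q, peval X1 (F1 q)) \<in> unlabel (X0, F0)" unfolding e[symmetric] by (auto simp: unlabel_def)
    then show ?thesis by (auto simp: unlabel_def)
  qed
  then obtain \<pi> where \<pi>: "\<And>q. X1 q = X0 (\<pi> q)" "\<And>q. peval X1 (F1 q) = peval X0 (F0 (\<pi> q))" by metis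
  have "inj \<pi>" using alg_ind_inj[OF is_seed_alg_ind[OF s]] by (simp add: inj_def \<pi>(1))
  then have "bij \<pi>" by (simp add: bij_def finite_UNIV_inj_surj)
  moreover have "X1 = X0 \<circ> \<pi>" using \<pi>(1) by auto
  ultimately show ?thesis using that \<pi>(2) by blast
qed

text \<open>\<open>mutates_to\<close> may choose any labelling of a seed; each one has a type over
  permuted initial data.\<close>

lemma has_type_labelling:
  fixes x :: "'n::{finite,linorder} \<Rightarrow> ('n, 'r::{factorial_semiring,idom}) ratfun"
  assumes t: "has_type U x B \<sigma> t" and t1: "is_seed t1" "unlabel t1 = unlabel t"
  obtains \<pi> ps where "bij \<pi>" "\<sigma> = map \<pi> ps" "has_type U (x \<circ> \<pi>) (B \<circ> \<pi>) ps t1"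
proof -
  obtain X0 F0 X1 F1 where [simp]: "t = (X0, F0)" "t1 = (X1, F1)" by (metis surj_pair)
  obtain \<pi> where \<pi>: "bij \<pi>" "X1 = X0 \<circ> \<pi>" "\<And>q. peval X1 (F1 q) = peval X0 (F0 (\<pi> q))"
    using unlabel_eq_imp_relabelled[of X1 F1 X0 F0] t1 by auto
  define ps where "ps = map (inv \<pi>) \<sigma>"
  have \<sigma>: "\<sigma> = map \<pi> ps" using \<pi>(1) by (simp add: ps_def bij_is_surj surj_iff[THEN iffD1])
  obtain F' where F': "has_type U (x \<circ> \<pi>) (B \<circ> \<pi>) ps (X1, F')" "\<And>q. peval X1 (F' q) = peval X0 (F0 (\<pi> q))"
    using has_type_rescaled[of U x B \<pi> ps X0 F0 X1 "\<lambda>_. 1"] t \<pi>(1,2) \<sigma> by auto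
  have "F' = F1"
  proof
    fix q
    have "peval X1 (F' q) = peval X1 (F1 q)" using F'(2) \<pi>(3) by simp
    then show "F' q = F1 q" using alg_ind_eq_iff[OF is_seed_alg_ind[of X1 F1]] t1(1) by simp
  qed
  then show ?thesis using that \<pi>(1) \<sigma> F'(1) by simp
qed

text \<open>Corresponding variables differ by constants that are Gauss units, hence by units. On a
  common cluster the exchange polynomials are irreducible and agree up to a monomial and a constant,
  so they too differ by units.\<close>

lemma has_type_unique:
  fixes x0 :: "'n::{finite,linorder} \<Rightarrow> ('n, 'r::{factorial_semiring,idom}) ratfun"
  assumes t: "typed B x ps x0 X1 F1" "typed B x ps x0 X2 F2"
  shows "seed_equiv (unlabel (X1, F1)) (unlabel (X2, F2))"
proof -
  interpret t1: typed B x ps x0 X1 F1 by (rule t(1))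
  interpret t2: typed B x ps x0 X2 F2 by (rule t(2))
  let ?V = "Vh (emb \<circ> B) x ps"
  have g: "X1 q \<in> gauss_units x0" "X2 q \<in> gauss_units x0" for q
    using t1.gauss[OF primitive_mvar] t2.gauss[OF primitive_mvar] by simp_all
  have fc: "fconst (X2 q / X1 q)" for q
  proof -
    have "fconst ((?V q / X1 q) / (?V q / X2 q))"
      using fconst_divide[of "?V q / X1 q" "?V q / X2 q"] t1.ht t2.ht by (simp add: has_type_def)
    then show ?thesis using t1.V0[of q] by simp
  qed
  have "\<exists>u. u dvd 1 \<and> X2 q = emb u * X1 q" for q
    using gauss_units_unit[OF t1.x0_ind g(2,1) fc t1.X0] by metis
  then obtain u where u: "\<And>q. u q dvd 1" "\<And>q. X2 q = emb (u q) * X1 q" by metis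
  then obtain v where v: "\<And>q. u q * v q = 1" unfolding dvd_def by metis
  obtain F' where F': "has_type (gauss_units x0) x B ps (X2, F')" "\<And>q. peval X2 (F' q) = peval X1 (F1 q)"
    using has_type_rescaled[of "gauss_units x0" x B id ps X1 F1 X2 u] t1.ht u by auto
  interpret t3: typed B x ps x0 X2 F' using t1.typed_cong[OF t1.chain_axioms F'(1)] .
  have unit: "\<exists>w. w dvd 1 \<and> F' q = mconst w * F2 q" for q
  proof -
    obtain \<kappa> b where k: "fconst \<kappa>" "peval X2 (F' q) = \<kappa> * lmonom X2 UNIV b * (?V q * Wh (emb \<circ> B) x ps q)"
      using F'(1) unfolding has_type_def prod.case by blast
    obtain \<mu> e where m: "fconst \<mu>" "peval X2 (F2 q) = \<mu> * lmonom X2 UNIV e * (?V q * Wh (emb \<circ> B) x ps q)"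
      using t2.ht unfolding has_type_def prod.case by blast
    have l: "lmonom X2 UNIV (\<lambda>k. e k - b k) * lmonom X2 UNIV b = lmonom X2 UNIV e"
      using t2.X0 by (simp add: lmonom_add[symmetric])
    have "peval X2 (F2 q) = (\<mu> / \<kappa>) * lmonom X2 UNIV (\<lambda>k. e k - b k) * peval X2 (F' q)"
      unfolding k(2) m(2) l[symmetric] using fconst_neq_0[OF k(1)] by simp
    then have "F2 q dvd F' q"
      by (rule monomial_multiple_dvd[OF t2.X_ind t2.F_irr t2.F_nd t2.F_nonconst]) (intro fconst_divide m k)
    then obtain p where p: "F' q = F2 q * p" by (elim dvdE)
    have "p dvd 1" using irreducibleD[OF t3.F_irr p] t2.F_irr irreducible_not_unit by blast
    then obtain w where "p = mconst w" "w dvd 1" by (elim is_unit_mpolyE)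
    then show ?thesis using p by (auto simp: mult.commute)
  qed
  have u1: "unit_multiple (X1 q) (X2 q)" for q
    unfolding unit_multiple_def
  proof (intro exI conjI)
    show "v q dvd 1" using v[of q] by (metis dvd_triv_right)
    have "emb (v q) * X2 q = emb (u q * v q) * X1 q" by (simp add: u(2) emb_mult)
    then have "X1 q = emb (v q) * X2 q" by (simp add: v)
    then show "X1 q / X2 q = emb (v q)" using t2.X0[of q] by simp
  qed
  have u2: "unit_multiple (peval X1 (F1 q)) (peval X2 (F2 q))" for q
  proof -
    obtain w where w: "w dvd 1" "F' q = mconst w * F2 q" using unit by blast
    have "peval X2 (F2 q) \<noteq> 0" using alg_ind_eq_0_iff[OF t2.X_ind] t2.F0 by blast
    moreover have "peval X1 (F1 q) = emb w * peval X2 (F2 q)" using F'(2)[of q] w(2) by simp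
    ultimately have "peval X1 (F1 q) / peval X2 (F2 q) = emb w" by simp
    then show ?thesis using w(1) unfolding unit_multiple_def by blast
  qed
  define g1 where "g1 q = (X1 q, peval X1 (F1 q))" for q
  define g2 where "g2 q = (X2 q, peval X2 (F2 q))" for q
  have i: "inj g1" "inj g2"
    using alg_ind_inj[OF t1.X_ind] alg_ind_inj[OF t2.X_ind] by (auto simp: inj_def g1_def g2_def)
  have s: "unlabel (X1, F1) = range g1" "unlabel (X2, F2) = range g2"
    by (auto simp: unlabel_def g1_def g2_def)
  show ?thesis unfolding seed_equiv_def s
  proof (intro exI conjI ballI)
    show "bij_betw (g2 \<circ> inv g1) (range g1) (range g2)"
      by (rule bij_betw_trans[of _ _ UNIV]) (use i in \<open>auto simp: bij_betw_def inj_on_inv_into\<close>)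
    fix y assume "y \<in> range g1"
    then obtain q where q: "y = g1 q" by blast
    show "unit_multiple (fst y) (fst ((g2 \<circ> inv g1) y))" "unit_multiple (snd y) (snd ((g2 \<circ> inv g1) y))"
      using u1[of q] u2[of q] unfolding q comp_apply inv_f_f[OF i(1)] by (simp_all add: g1_def g2_def)
  qed
qed

context tau_seed
begin

text \<open>For unlabelled seeds the initial data can be fixed: by \<open>seed_ofI\<close> a
  permutation of them is absorbed into the sequence.\<close>

definition seed_of :: "'n list \<Rightarrow> ('n, 'r) seed \<Rightarrow> bool" where
  "seed_of \<sigma> s \<longleftrightarrow> distinct \<sigma> \<and> (\<exists>t. has_type U X A \<sigma> t \<and> unlabel t = s)"

lemma seed_ofI:
  assumes "has_type U (X \<circ> \<pi>) (A \<circ> \<pi>) ps t" "bij \<pi>" "distinct ps"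
  shows "seed_of (map \<pi> ps) (unlabel t)"
proof -
  have "distinct (map \<pi> ps)"
    using assms(2,3) unfolding distinct_map by (metis bij_is_inj inj_on_subset subset_UNIV)
  then show ?thesis using has_type_relabel_back[OF assms(1,2)] unfolding seed_of_def by blast
qed

lemma typedI:
  assumes "has_type U (X \<circ> \<pi>) (A \<circ> \<pi>) ps (X1, F1)" "bij \<pi>" "distinct ps"
  shows "typed (A \<circ> \<pi>) (X \<circ> \<pi>) ps X X1 F1"
  using assms chain X_ind n2 by (simp add: typed_def typed_axioms_def)

lemma has_type_initial: "has_type U X A [] (X, tau_poly A)"
proof -
  have "X q * Yh \<beta> X {q} = \<beta> q + (\<Prod>j\<in>UNIV - {q}. X j)" for q
    using Yh_insert[of X q "{}" \<beta>] X0 by (simp add: Compl_eq_Diff_UNIV)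
  then have "peval X (tau_poly A q) = 1 * lmonom X UNIV (\<lambda>_. 0) * (Vh \<beta> X [] q * Wh \<beta> X [] q)" for q
    unfolding peval_tau by (simp add: Vh_def Wh_def)
  then have "\<exists>\<kappa> b. fconst \<kappa> \<and> peval X (tau_poly A q) = \<kappa> * lmonom X UNIV b * (Vh \<beta> X [] q * Wh \<beta> X [] q)" for q
    using fconst_1 by metis
  then show ?thesis
    using seed X0 by (simp add: has_type_def gauss_units_peval Vh_def)
qed

lemma seed_of_append:
  assumes t: "has_type U (X \<circ> \<pi>) (A \<circ> \<pi>) ps t" "bij \<pi>" "distinct ps"
    and mut: "is_mutation k t t'" and k: "k \<notin> set ps"
  shows "seed_of (map \<pi> (ps @ [k])) (unlabel t')"
proof -
  obtain X1 F1 where [simp]: "t = (X1, F1)" by (cases t)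
  interpret typed "A \<circ> \<pi>" "X \<circ> \<pi>" ps X X1 F1 using typedI t by simp
  show ?thesis using activation[of k t'] mut k t(2,3) by (intro seed_ofI) simp_all
qed

end

section \<open>The seeds of a normalized algebra\<close>

locale tau_algebra = tau_seed A X
  for A :: "'n::{finite,linorder} \<Rightarrow> 'r::{factorial_semiring,idom}"
    and X :: "'n \<Rightarrow> ('n, 'r) ratfun" +
  fixes \<S> :: "('n, 'r) seed set" and \<A> :: "('n, 'r) ratfun set"
  assumes alg: "normalized_lp_algebra (X, tau_poly A) \<S> \<A>"
begin

lemma initial_in: "unlabel (X, tau_poly A) \<in> \<S>"
  and closed: "is_seed t \<Longrightarrow> unlabel t \<in> \<S> \<Longrightarrow> \<exists>t'. is_mutation i t t' \<and> unlabel t' \<in> \<S>"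
  and reachable: "s \<in> \<S> \<Longrightarrow> (\<lambda>s s'. s' \<in> \<S> \<and> mutates_to s s')\<^sup>*\<^sup>* (unlabel (X, tau_poly A)) s"
  and normalized: "s \<in> \<S> \<Longrightarrow> s' \<in> \<S> \<Longrightarrow> seed_equiv s s' \<Longrightarrow> s = s'"
  using alg unfolding normalized_lp_algebra_def lp_algebra_def by blast+

text \<open>The sequence is activated entry by entry from the initial seed. No reference seeds enter
  here; this lemma supplies them.\<close>

lemma ex_seed_of: "distinct \<sigma> \<Longrightarrow> \<exists>s\<in>\<S>. seed_of \<sigma> s"
proof (induction \<sigma> rule: rev_induct)
  case Nil
  show ?case using initial_in has_type_initial by (auto simp: seed_of_def)
next
  case (snoc k \<sigma>)
  then obtain t where t: "has_type U X A \<sigma> t" "unlabel t \<in> \<S>" by (auto simp: seed_of_def)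
  then have "is_seed t" by (auto simp: has_type_def)
  then obtain t' where t': "is_mutation k t t'" "unlabel t' \<in> \<S>" using closed t(2) by blast
  have "seed_of (map id (\<sigma> @ [k])) (unlabel t')"
    by (rule seed_of_append) (use t t' snoc.prems in auto)
  then show ?case using t'(2) by auto
qed

lemma typed_exI:
  assumes t: "has_type U (X \<circ> \<pi>) (A \<circ> \<pi>) ps (X1, F1)" "bij \<pi>" "distinct ps"
  shows "typed_ex (A \<circ> \<pi>) (X \<circ> \<pi>) ps X X1 F1"
proof -
  have "\<exists>t. has_type U ((X \<circ> \<pi>) \<circ> \<tau>) ((A \<circ> \<pi>) \<circ> \<tau>) qs t" if \<tau>: "bij \<tau>" and qs: "distinct qs" for \<tau> qs
  proof -
    have b: "bij (\<pi> \<circ> \<tau>)" using t(2) \<tau> by (rule bij_comp[rotated])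
    have "distinct (map (\<pi> \<circ> \<tau>) qs)"
      using qs b unfolding distinct_map by (metis bij_is_inj inj_on_subset subset_UNIV)
    then obtain t where "has_type U X A (map (\<pi> \<circ> \<tau>) qs) t" using ex_seed_of unfolding seed_of_def by blast
    from has_type_relabel[OF this b] show ?thesis by (auto simp: comp_assoc)
  qed
  then show ?thesis using typedI[OF t] by (simp add: typed_ex_def typed_ex_axioms_def)
qed

lemma seed_of_butlast:
  assumes t: "has_type U (X \<circ> \<pi>) (A \<circ> \<pi>) (ps @ [k]) t" "bij \<pi>" "distinct (ps @ [k])"
    and mut: "is_mutation k t t'"
  shows "seed_of (map \<pi> ps) (unlabel t')"
proof -
  obtain X1 F1 where [simp]: "t = (X1, F1)" by (cases t)
  interpret typed_ex "A \<circ> \<pi>" "X \<circ> \<pi>" "ps @ [k]" X X1 F1 using typed_exI t by simp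
  show ?thesis using deactivation[of k t' ps] mut t(2,3) by (intro seed_ofI) simp_all
qed

lemma seed_of_swap:
  assumes t: "has_type U (X \<circ> \<pi>) (A \<circ> \<pi>) (us @ a # b # vs) t" "bij \<pi>" "distinct (us @ a # b # vs)"
    and mut: "is_mutation a t t'"
  shows "seed_of (map \<pi> (us @ b # a # vs)) (unlabel t')"
proof -
  let ?T = "Transposition.transpose a b" and ?ps = "us @ a # b # vs"
  obtain X1 F1 where [simp]: "t = (X1, F1)" by (cases t)
  interpret typed_ex "A \<circ> \<pi>" "X \<circ> \<pi>" ?ps X X1 F1 using typed_exI t by simp
  have n: "?ps ! length us = a" "?ps ! Suc (length us) = b" by (simp_all add: nth_append)
  have "has_type U (X \<circ> (\<pi> \<circ> ?T)) (A \<circ> (\<pi> \<circ> ?T)) ?ps t'"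
    using transposition[of "length us" t'] mut unfolding n by (simp add: comp_assoc)
  then have "seed_of (map (\<pi> \<circ> ?T) ?ps) (unlabel t')"
    using t(2,3) by (intro seed_ofI bij_comp) simp_all
  moreover have "map ?T us = us" "map ?T vs = vs"
    using t(3) by (auto intro!: map_idI transpose_apply_other)
  ultimately show ?thesis by (simp flip: map_map)
qed

lemma seed_of_mutation:
  assumes s: "seed_of \<sigma> s" and m: "mutates_to s s'"
  shows "\<exists>\<sigma>'. seed_of \<sigma>' s'"
proof -
  obtain i t1 t' where m: "is_mutation i t1 t'" "s = unlabel t1" "s' = unlabel t'"
    using m by (auto simp: mutates_to_def)
  then have "is_seed t1" by (simp add: is_mutation_def)
  then obtain \<pi> ps where t: "bij \<pi>" "\<sigma> = map \<pi> ps" "has_type U (X \<circ> \<pi>) (A \<circ> \<pi>) ps t1"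
    using s m(2) by (auto simp: seed_of_def elim: has_type_labelling)
  have d: "distinct ps" using s t(2) by (auto simp: seed_of_def distinct_map)
  show ?thesis
  proof (cases "i \<in> set ps")
    case False
    then show ?thesis using seed_of_append[OF t(3,1) d m(1)] m(3) by blast
  next
    case True
    then obtain us ws where ps: "ps = us @ i # ws" by (meson split_list)
    show ?thesis
    proof (cases ws)
      case Nil
      then show ?thesis using seed_of_butlast[of \<pi> us i t1 t'] t d m ps by auto
    next
      case (Cons b vs)
      then show ?thesis using seed_of_swap[of \<pi> us i b vs t1 t'] t d m ps by blast
    qed
  qed
qed

lemma seed_of_all:
  assumes "s \<in> \<S>"
  shows "\<exists>\<sigma>. seed_of \<sigma> s"
  using reachable[OF assms]
proof (induction rule: rtranclp_induct)
  case base
  have "seed_of [] (unlabel (X, tau_poly A))" using has_type_initial by (auto simp: seed_of_def)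
  then show ?case by blast
next
  case (step y z)
  then show ?case using seed_of_mutation by blast
qed

lemma seed_of_unique:
  assumes "seed_of \<sigma> s" "seed_of \<sigma> s'" "s \<in> \<S>" "s' \<in> \<S>"
  shows "s = s'"
proof -
  obtain X1 F1 X2 F2 where t: "has_type U X A \<sigma> (X1, F1)" "has_type U X A \<sigma> (X2, F2)"
    "s = unlabel (X1, F1)" "s' = unlabel (X2, F2)" and d: "distinct \<sigma>"
    using assms(1,2) by (auto simp: seed_of_def)
  show ?thesis
    using has_type_unique[OF typedI[where \<pi> = id] typedI[where \<pi> = id], of \<sigma> X1 F1 X2 F2] t d normalized assms(3,4)
    by simp
qed

lemma fconst_key: "has_type U X A \<sigma> (X1, F1) \<Longrightarrow> fconst (kv \<beta> X (key \<sigma> q) / X1 q)"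
  by (simp add: has_type_def Vh_key)

lemma key_unique:
  assumes "k \<in> keys_all" "k' \<in> keys_all" "fconst (kv \<beta> X k / f)" "fconst (kv \<beta> X k' / f)"
  shows "k = k'"
proof (rule keys_not_proportional[OF assms(1,2)])
  have "f \<noteq> 0" using fconst_neq_0[OF assms(3)] by auto
  then show "fconst (kv \<beta> X k / kv \<beta> X k')" using fconst_divide[OF assms(3,4)] by simp
qed

text \<open>A cluster determines the keys of its variables, and the set of keys determines the
  sequence.\<close>

lemma seed_of_inject:
  assumes "seed_of \<sigma> s" "seed_of \<sigma>' s"
  shows "\<sigma> = \<sigma>'"
proof -
  obtain X1 F1 X2 F2 where t: "has_type U X A \<sigma> (X1, F1)" "has_type U X A \<sigma>' (X2, F2)"
    "unlabel (X2, F2) = unlabel (X1, F1)" and d: "distinct \<sigma>" "distinct \<sigma>'"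
    using assms by (auto simp: seed_of_def)
  have "is_seed (X2, F2)" using t(2) by (simp add: has_type_def)
  then obtain \<pi> where \<pi>: "bij \<pi>" "X2 = X1 \<circ> \<pi>" using unlabel_eq_imp_relabelled[OF _ t(3)] by metis
  have "key \<sigma>' q = key \<sigma> (\<pi> q)" for q
    using key_unique[OF key_in key_in fconst_key[OF t(2)]] fconst_key[OF t(1), of "\<pi> q"] \<pi>(2) by simp
  then have "range (key \<sigma>') = key \<sigma> ` range \<pi>" by (auto simp: image_image)
  then have "range (key \<sigma>) = range (key \<sigma>')" using bij_is_surj[OF \<pi>(1)] by simp
  then show ?thesis by (rule range_key_inject[OF d])
qed

lemma bij_seeds: "\<exists>\<phi>. bij_betw \<phi> (activation_sequences :: 'n list set) \<S>"
proof -
  have "\<exists>\<phi>. \<forall>\<sigma>\<in>activation_sequences. \<phi> \<sigma> \<in> \<S> \<and> seed_of \<sigma> (\<phi> \<sigma>)"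
    using ex_seed_of unfolding activation_sequences_def by (intro bchoice) auto
  then obtain \<phi> where \<phi>: "\<And>\<sigma>. \<sigma> \<in> activation_sequences \<Longrightarrow> \<phi> \<sigma> \<in> \<S> \<and> seed_of \<sigma> (\<phi> \<sigma>)" by blast
  have "bij_betw \<phi> activation_sequences \<S>"
    unfolding bij_betw_def
  proof (intro conjI inj_onI equalityI subsetI)
    fix \<sigma> \<sigma>' assume "\<sigma> \<in> activation_sequences" "\<sigma>' \<in> activation_sequences" "\<phi> \<sigma> = \<phi> \<sigma>'"
    then show "\<sigma> = \<sigma>'" using \<phi> seed_of_inject by metis
  next
    fix s assume s: "s \<in> \<S>"
    then obtain \<sigma> where \<sigma>: "seed_of \<sigma> s" using seed_of_all by blast
    then have "\<sigma> \<in> activation_sequences" by (simp add: seed_of_def activation_sequences_def)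
    then show "s \<in> \<phi> ` activation_sequences" using \<phi> seed_of_unique[OF \<sigma>] s by blast
  qed (use \<phi> in auto)
  then show ?thesis by blast
qed

section \<open>Carrying a cluster variable from seed to seed\<close>

lemma mutate_keeping:
  assumes s: "seed_of \<sigma> s" "s \<in> \<S>" and f: "f \<in> fst ` s" "fconst (kv \<beta> X k / f)"
    and k: "k \<in> keys_all" "key \<sigma> i \<noteq> k"
  obtains t t' where "has_type U (X \<circ> id) (A \<circ> id) \<sigma> t" "is_mutation i t t'" "unlabel t' \<in> \<S>"
    "f \<in> fst ` unlabel t'"
proof -
  obtain X1 F1 where t: "has_type U X A \<sigma> (X1, F1)" "unlabel (X1, F1) = s"
    using s by (auto simp: seed_of_def)
  then have "is_seed (X1, F1)" by (simp add: has_type_def)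
  then obtain X2 F2 where t': "is_mutation i (X1, F1) (X2, F2)" "unlabel (X2, F2) \<in> \<S>"
    using closed[of "(X1, F1)" i] t(2) s(2) by auto
  obtain q where q: "f = X1 q" using f(1) t(2)[symmetric] by (auto simp: unlabel_def)
  have "key \<sigma> q = k" using key_unique[OF key_in k(1) fconst_key[OF t(1)]] f(2) q by simp
  then have "q \<noteq> i" using k(2) by auto
  \<comment> \<open>Mutation leaves the other entries of the cluster untouched, so \<open>f\<close>
    itself survives and not only a unit multiple of it.\<close>
  then have "X2 q = f" using t'(1) q by (auto simp: is_mutation_def)
  then have "f \<in> fst ` unlabel (X2, F2)" by (force simp: unlabel_def)
  then show ?thesis using that[of "(X1, F1)" "(X2, F2)"] t t' by simp
qed

lemma keep_butlast:
  assumes s: "seed_of (\<sigma> @ [i]) s" "s \<in> \<S>" and f: "f \<in> fst ` s" "fconst (kv \<beta> X k / f)"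
    and k: "k \<in> keys_all" "k \<noteq> Inr (set (\<sigma> @ [i]))"
  shows "\<exists>s'\<in>\<S>. seed_of \<sigma> s' \<and> f \<in> fst ` s'"
proof -
  have d: "distinct (\<sigma> @ [i])" using s by (simp add: seed_of_def)
  have "key (\<sigma> @ [i]) i \<noteq> k" using key_nth[OF d, of "length \<sigma>"] k(2) by simp
  then obtain t t' where "has_type U (X \<circ> id) (A \<circ> id) (\<sigma> @ [i]) t" "is_mutation i t t'" "unlabel t' \<in> \<S>"
    "f \<in> fst ` unlabel t'" using mutate_keeping[OF s f k(1)] by blast
  moreover from this have "seed_of (map id \<sigma>) (unlabel t')" by (intro seed_of_butlast[OF _ _ d]) auto
  ultimately show ?thesis by auto
qed

text \<open>The entries behind \<open>\<sigma>\<close> are deactivated from the end. The variables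
  lost belong to initial segments longer than \<open>\<sigma>\<close>, which the last condition
  keeps different from \<open>k\<close>.\<close>

lemma keep_prefix:
  assumes "seed_of (\<sigma> @ \<tau>) s" "s \<in> \<S>" "f \<in> fst ` s" "fconst (kv \<beta> X k / f)" "k \<in> keys_all"
    "\<And>\<rho> i. i \<notin> set \<sigma> \<Longrightarrow> k \<noteq> Inr (set (\<sigma> @ \<rho> @ [i]))"
  shows "\<exists>s'\<in>\<S>. seed_of \<sigma> s' \<and> f \<in> fst ` s'"
  using assms(1-3)
proof (induction \<tau> arbitrary: s rule: rev_induct)
  case (snoc i \<tau>)
  have "i \<notin> set \<sigma>" using snoc.prems(1) by (auto simp: seed_of_def)
  then have "\<exists>s'\<in>\<S>. seed_of (\<sigma> @ \<tau>) s' \<and> f \<in> fst ` s'"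
    using keep_butlast[of "\<sigma> @ \<tau>" i s f k] snoc.prems assms(4,5) assms(6)[of i \<tau>] by simp
  then show ?case using snoc.IH by blast
qed auto

text \<open>Only the variable of the segment ending in \<open>a\<close> is replaced. That segment
  lacks \<open>b \<in> T\<close>, so it is not the variable of \<open>T\<close>.\<close>

lemma keep_swap:
  assumes s: "seed_of (us @ a # b # vs) s" "s \<in> \<S>" and f: "f \<in> fst ` s" "fconst (kv \<beta> X (Inr T) / f)"
    and T: "T = set (us @ a # b # vs)"
  shows "\<exists>s'\<in>\<S>. seed_of (us @ b # a # vs) s' \<and> f \<in> fst ` s'"
proof -
  let ?\<sigma> = "us @ a # b # vs"
  have d: "distinct ?\<sigma>" using s by (simp add: seed_of_def)
  have "key ?\<sigma> a = Inr (insert a (set us))" using key_nth[OF d, of "length us"] by simp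
  moreover have "b \<notin> insert a (set us)" "b \<in> T" using d T by auto
  ultimately have "key ?\<sigma> a \<noteq> Inr T" by auto
  moreover have "Inr T \<in> keys_all" using T by (simp add: keys_all_def)
  ultimately obtain t t' where "has_type U (X \<circ> id) (A \<circ> id) ?\<sigma> t" "is_mutation a t t'" "unlabel t' \<in> \<S>"
    "f \<in> fst ` unlabel t'" using mutate_keeping[OF s f] by blast
  moreover from this have "seed_of (map id (us @ b # a # vs)) (unlabel t')"
    by (intro seed_of_swap[OF _ _ d]) auto
  ultimately show ?thesis by auto
qed

lemma proportional_in_seed:
  assumes s: "seed_of \<sigma> s" and f: "f \<in> fst ` s" "fconst (kv \<beta> X k / f)"
    and g: "g \<in> fst ` s" "fconst (kv \<beta> X k / g)" and k: "k \<in> keys_all"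
  shows "f = g"
proof -
  obtain X1 F1 where t: "has_type U X A \<sigma> (X1, F1)" "unlabel (X1, F1) = s" and d: "distinct \<sigma>"
    using s by (auto simp: seed_of_def)
  obtain p q where pq: "f = X1 p" "g = X1 q" using f(1) g(1) t(2)[symmetric] by (auto simp: unlabel_def)
  have "key \<sigma> p = k" "key \<sigma> q = k"
    using key_unique[OF key_in k fconst_key[OF t(1)]] f(2) g(2) pq by simp_all
  then show ?thesis using injD[OF inj_key[OF d]] pq by metis
qed

text \<open>The variable of \<open>T\<close> sits at the end of an initial segment with entries
  \<open>T\<close>; everything behind that segment is removed.\<close>

lemma keep_support:
  assumes s: "s \<in> \<S>" and f: "f \<in> fst ` s" "fconst (kv \<beta> X (Inr T) / f)" and T: "T \<noteq> {}"
  obtains \<sigma> s' where "s' \<in> \<S>" "seed_of \<sigma> s'" "f \<in> fst ` s'" "set \<sigma> = T"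
proof -
  obtain \<rho> where \<rho>: "seed_of \<rho> s" using seed_of_all[OF s] by blast
  obtain X1 F1 where t: "has_type U X A \<rho> (X1, F1)" "unlabel (X1, F1) = s" and d: "distinct \<rho>"
    using \<rho> by (auto simp: seed_of_def)
  have k: "Inr T \<in> keys_all" using T by (simp add: keys_all_def)
  obtain q where q: "f = X1 q" using f(1) t(2)[symmetric] by (auto simp: unlabel_def)
  have "key \<rho> q = Inr T" using key_unique[OF key_in k fconst_key[OF t(1)]] f(2) q by simp
  then obtain l where l: "T = set (take (Suc l) \<rho>)" using key_eq_InrE[OF _ d] by metis
  have "\<exists>s'\<in>\<S>. seed_of (take (Suc l) \<rho>) s' \<and> f \<in> fst ` s'"
    by (rule keep_prefix[where \<tau> = "drop (Suc l) \<rho>" and k = "Inr T"]) (use \<rho> s f k l in auto)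
  then show ?thesis using that l by blast
qed

text \<open>Normalization identifies seeds, not single variables, so both variables are carried
  unchanged into one seed: the initial one for \<open>Inl\<close>, and for \<open>Inr T\<close> one
  whose sequence has exactly the entries \<open>T\<close>, where adjacent swaps align the two
  orders.\<close>

lemma proportional_cluster_variables:
  assumes s: "s \<in> \<S>" "s' \<in> \<S>" and f: "f \<in> fst ` s" "fconst (kv \<beta> X k / f)"
    and g: "g \<in> fst ` s'" "fconst (kv \<beta> X k / g)" and k: "k \<in> keys_all"
  shows "f = g"
proof (cases k)
  case (Inl i)
  have "\<exists>s0\<in>\<S>. seed_of [] s0 \<and> h \<in> fst ` s0"
    if "s \<in> \<S>" "h \<in> fst ` s" "fconst (kv \<beta> X k / h)" for s h
  proof -
    obtain \<sigma> where "seed_of \<sigma> s" using seed_of_all[OF \<open>s \<in> \<S>\<close>] by blast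
    then show ?thesis using keep_prefix[of "[]" \<sigma> s h k] that k Inl by simp
  qed
  then show ?thesis using proportional_in_seed[of "[]" _ f k g] seed_of_unique[of "[]"] s f g k by metis
next
  case (Inr T)
  then have T: "T \<noteq> {}" using k by (auto simp: keys_all_def)
  obtain \<sigma> s1 where 1: "s1 \<in> \<S>" "seed_of \<sigma> s1" "f \<in> fst ` s1" "set \<sigma> = T"
    using keep_support[OF s(1) f[unfolded Inr] T] .
  obtain \<sigma>' s2 where 2: "s2 \<in> \<S>" "seed_of \<sigma>' s2" "g \<in> fst ` s2" "set \<sigma>' = T"
    using keep_support[OF s(2) g[unfolded Inr] T] .
  have "(\<exists>s\<in>\<S>. seed_of \<sigma>' s \<and> f \<in> fst ` s) \<and> set \<sigma>' = T"
  proof (rule adjacent_swaps_induct[of _ \<sigma>])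
    show "(\<exists>s\<in>\<S>. seed_of \<sigma> s \<and> f \<in> fst ` s) \<and> set \<sigma> = T" using 1 by blast
    show "mset \<sigma> = mset \<sigma>'"
      using 1 2 by (simp add: seed_of_def set_eq_iff_mset_eq_distinct[symmetric])
  next
    fix us a b vs
    assume *: "(\<exists>s\<in>\<S>. seed_of (us @ a # b # vs) s \<and> f \<in> fst ` s) \<and> set (us @ a # b # vs) = T"
    then have "set (us @ b # a # vs) = T" by auto
    moreover have "\<exists>s\<in>\<S>. seed_of (us @ b # a # vs) s \<and> f \<in> fst ` s"
      using * keep_swap[OF _ _ _ f(2)[unfolded Inr]] by blast
    ultimately show "(\<exists>s\<in>\<S>. seed_of (us @ b # a # vs) s \<and> f \<in> fst ` s) \<and> set (us @ b # a # vs) = T"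
      by blast
  qed
  then obtain s3 where 3: "s3 \<in> \<S>" "seed_of \<sigma>' s3" "f \<in> fst ` s3" by blast
  then have "s3 = s2" using seed_of_unique 2 by blast
  then show ?thesis using proportional_in_seed[OF 2(2) _ f(2) 2(3) g(2) k] 3 by blast
qed

lemma card_cluster_variables: "card (cluster_variables \<S>) = 2 ^ CARD('n) + CARD('n) - 1"
proof -
  have "\<exists>k\<in>keys_all. fconst (kv \<beta> X k / f)" if f: "f \<in> cluster_variables \<S>" for f
  proof -
    obtain s where s: "s \<in> \<S>" "f \<in> fst ` s" using f unfolding cluster_variables_def by blast
    then obtain \<sigma> where "seed_of \<sigma> s" using seed_of_all by blast
    then obtain X1 F1 where t: "has_type U X A \<sigma> (X1, F1)" "unlabel (X1, F1) = s"
      by (auto simp: seed_of_def)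
    then obtain q where "f = X1 q" using s(2) t(2)[symmetric] by (auto simp: unlabel_def)
    then have "fconst (kv \<beta> X (key \<sigma> q) / f)" using fconst_key[OF t(1)] by simp
    then show ?thesis by (rule bexI) (rule key_in)
  qed
  then obtain K where K: "\<And>f. f \<in> cluster_variables \<S> \<Longrightarrow> K f \<in> keys_all \<and> fconst (kv \<beta> X (K f) / f)"
    by metis
  have "bij_betw K (cluster_variables \<S>) keys_all"
    unfolding bij_betw_def
  proof (intro conjI inj_onI equalityI subsetI)
    fix f g assume fg: "f \<in> cluster_variables \<S>" "g \<in> cluster_variables \<S>" "K f = K g"
    then show "f = g"
      using K[of f] K[of g] proportional_cluster_variables[of _ _ f "K f" g]
      unfolding cluster_variables_def by (metis UN_E)
  next
    fix k :: "'n + 'n set" assume k: "k \<in> keys_all"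
    \<comment> \<open>Initial variables occur in the initial seed; the variable of \<open>S\<close>
      is the last active one for any ordering of \<open>S\<close>.\<close>
    have "\<exists>\<sigma> q. distinct \<sigma> \<and> key \<sigma> q = k"
    proof (cases k)
      case (Inl i)
      then have "key [] i = k" by (simp add: key_def)
      then show ?thesis by (intro exI[of _ "[]"] exI[of _ i]) simp
    next
      case (Inr S)
      obtain \<sigma> where \<sigma>: "set \<sigma> = S" "distinct \<sigma>" using finite_distinct_list[of S] by auto
      then have "length \<sigma> \<noteq> 0" using k Inr by (auto simp: keys_all_def)
      then have "key \<sigma> (\<sigma> ! (length \<sigma> - 1)) = k" using key_nth[OF \<sigma>(2), of "length \<sigma> - 1"] \<sigma>(1) Inr by simp
      then show ?thesis using \<sigma>(2) by blast
    qed
    then obtain \<sigma> q where \<sigma>: "distinct \<sigma>" "key \<sigma> q = k" by blast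
    then obtain t where "has_type U X A \<sigma> t" "unlabel t \<in> \<S>"
      using ex_seed_of unfolding seed_of_def by blast
    then obtain X1 F1 where t: "has_type U X A \<sigma> (X1, F1)" "unlabel (X1, F1) \<in> \<S>"
      by (metis surj_pair)
    have "X1 q \<in> fst ` unlabel (X1, F1)" unfolding unlabel_def by force
    then have c: "X1 q \<in> cluster_variables \<S>" using t(2) unfolding cluster_variables_def by blast
    have "K (X1 q) = k"
      using key_unique[of "K (X1 q)" k "X1 q"] K[OF c] k fconst_key[OF t(1), of q] \<sigma>(2) by simp
    then show "k \<in> K ` cluster_variables \<S>" using c by blast
  qed (use K in auto)
  then show ?thesis using bij_betw_same_card card_keys_all by metis
qed

end

section \<open>Rank one\<close>

lemma unlabel_rank_1:
  assumes "(UNIV :: 'n set) = {i}"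
  shows "unlabel (X :: 'n::{finite,linorder} \<Rightarrow> ('n, 'r::idom) ratfun, F) = {(X i, peval X (F i))}"
proof -
  have "unlabel (X, F) = (\<lambda>j. (X j, peval X (F j))) ` UNIV" by (auto simp: unlabel_def)
  then show ?thesis by (simp add: assms)
qed

text \<open>The only exchange polynomial cannot contain the only variable, so it is a constant
  \<open>c\<close>. Its hat polynomial carries an empty monomial and equals
  \<open>c\<close>.\<close>

lemma mutation_rank_1:
  fixes t :: "('n::{finite,linorder}, 'r::idom) labelled_seed"
  assumes U: "(UNIV :: 'n set) = {i}" and m: "is_mutation k t t'" and t: "unlabel t = {(f, c)}"
  shows "unlabel t' = {(c / f, c)}"
proof -
  obtain X F X' F' where [simp]: "t = (X, F)" "t' = (X', F')" by (metis surj_pair)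
  have i: "j = i" for j :: 'n using U by blast
  have fc: "X i = f" "peval X (F i) = c" using t by (simp_all add: unlabel_rank_1[OF U])
  have v: "mvars (F i) = {}" using m i by (fastforce simp: is_mutation_def is_seed_def)
  then have F': "F' i = F i" using m by (auto simp: is_mutation_def split: if_splits)
  have "hat_at F i a X = c" for a by (simp add: hat_at_def lmonom_def fc U)
  then have "X' i = c / f" using m fc i[of k] by (auto simp: is_mutation_def)
  moreover have "peval X' (F' i) = c" unfolding F' fc(2)[symmetric] by (rule peval_cong) (simp add: v)
  ultimately show ?thesis by (simp add: unlabel_rank_1[OF U])
qed

lemma rank_1:
  fixes A :: "'n::{finite,linorder} \<Rightarrow> 'r::{factorial_semiring,idom}"
  assumes n: "CARD('n) = 1" and seed: "is_seed (X, tau_poly A)"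
    and alg: "normalized_lp_algebra (X, tau_poly A) \<S> \<A>"
  shows "card \<S> = 2" "card (cluster_variables \<S>) = 2"
proof -
  obtain i :: 'n where U: "UNIV = {i}" using n by (metis card_1_singletonE)
  define c where "c = peval X (tau_poly A i)"
  define g where "g = X i"
  have init: "unlabel (X, tau_poly A) = {(g, c)}"
    unfolding c_def g_def by (rule unlabel_rank_1[OF U])
  have X: "alg_ind X" using seed by (rule is_seed_alg_ind)
  have irr: "irreducible (tau_poly A i)" "\<not> mvar i dvd tau_poly A i" using seed by (auto simp: is_seed_def)
  have g0: "g \<noteq> 0" unfolding g_def by (rule alg_ind_nonzero[OF X])
  have "tau_poly A i \<noteq> 0" using irr(1) by auto
  then have c0: "c \<noteq> 0" unfolding c_def using alg_ind_eq_0_iff[OF X] by blast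
  \<comment> \<open>Equality would make the exchange polynomial the square of the variable, hence
    divisible by it.\<close>
  have ne: "c / g \<noteq> g"
  proof
    assume "c / g = g"
    then have "c = g * g" using g0 by (simp add: field_simps)
    then have "peval X (tau_poly A i) = peval X (mvar i * mvar i)" by (simp add: c_def g_def)
    then have "tau_poly A i = mvar i * mvar i" using alg_ind_eq_iff[OF X] by blast
    then show False using irr(2) by simp
  qed
  have S1: "{(g, c)} \<in> \<S>"
    and closed: "\<And>t i. is_seed t \<Longrightarrow> unlabel t \<in> \<S> \<Longrightarrow> \<exists>t'. is_mutation i t t' \<and> unlabel t' \<in> \<S>"
    and reach: "\<And>s. s \<in> \<S> \<Longrightarrow> (\<lambda>s s'. s' \<in> \<S> \<and> mutates_to s s')\<^sup>*\<^sup>* (unlabel (X, tau_poly A)) s"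
    using alg unfolding normalized_lp_algebra_def lp_algebra_def init by blast+
  obtain t' where "is_mutation i (X, tau_poly A) t'" "unlabel t' \<in> \<S>"
    using closed[OF seed, of i] S1 unfolding init by blast
  then have S2: "{(c / g, c)} \<in> \<S>" using mutation_rank_1[OF U _ init] by metis
  have "s = {(g, c)} \<or> s = {(c / g, c)}" if "s \<in> \<S>" for s
    using reach[OF that]
  proof (induction rule: rtranclp_induct)
    case base
    show ?case using init by simp
  next
    case (step y z)
    obtain k t t' where m: "is_mutation k t t'" "y = unlabel t" "z = unlabel t'"
      using step.hyps by (auto simp: mutates_to_def)
    have "c / (c / g) = g" using c0 g0 by simp
    then show ?case using step.IH mutation_rank_1[OF U m(1)] m(2,3) by metis
  qed
  then have S: "\<S> = {{(g, c)}, {(c / g, c)}}" using S1 S2 by blast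
  show "card \<S> = 2" "card (cluster_variables \<S>) = 2"
    using ne by (auto simp: S cluster_variables_def card_insert_if doubleton_eq_iff)
qed

theorem corollary4p6:
  fixes A :: "'n::{finite,linorder} \<Rightarrow> 'r::{factorial_semiring,idom}"
    and X :: "'n \<Rightarrow> ('n, 'r) ratfun"
    and \<S> :: "('n, 'r) seed set"
    and \<A> :: "('n, 'r) ratfun set"
  assumes "is_seed (X, tau_poly A)"
    and "normalized_lp_algebra (X, tau_poly A) \<S> \<A>"
  shows "(\<exists>\<phi>. bij_betw \<phi> (activation_sequences :: 'n list set) \<S>) \<and>
         card (cluster_variables \<S>) = 2 ^ CARD('n) + CARD('n) - 1 \<and>
         card \<S> = (\<Sum>k = 0..CARD('n). fact CARD('n) div fact k)"
proof -
  have act: "card (activation_sequences :: 'n list set) = (\<Sum>k = 0..CARD('n). fact CARD('n) div fact k)"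
    unfolding activation_sequences_def by (rule card_distinct_lists)
  have fin: "finite (activation_sequences :: 'n list set)"
  proof (rule finite_subset)
    show "activation_sequences \<subseteq> {xs :: 'n list. set xs \<subseteq> UNIV \<and> length xs \<le> CARD('n)}"
      by (auto simp: activation_sequences_def distinct_card[symmetric] card_mono)
  qed (rule finite_lists_length_le, simp)
  show ?thesis
  proof (cases "CARD('n) = 1")
    case True
    note r = rank_1[OF True assms]
    have 2: "(\<Sum>k = 0..CARD('n). fact CARD('n) div fact k :: nat) = 2" by (simp add: True)
    have "finite \<S>" using r(1) by (metis card.infinite zero_neq_numeral)
    then have "\<exists>\<phi>. bij_betw \<phi> (activation_sequences :: 'n list set) \<S>"
      using finite_same_card_bij[OF fin] act r(1) unfolding 2 by simp
    then show ?thesis using r unfolding 2 by (simp add: True)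
  next
    case False
    have "CARD('n) \<noteq> 0" by simp
    then have "CARD('n) \<ge> 2" using False by linarith
    then interpret tau_algebra A X \<S> \<A> using assms by unfold_locales
    show ?thesis using bij_seeds card_cluster_variables bij_betw_same_card[of _ activation_sequences \<S>] act
      by metis
  qed
qed

end
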